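(* Let $s,l,n$ be positive integers. Equip $\bar{\mathsf{A}}_{s,n}\otimes\bar{\mathsf{A}}_{l,n}$ with the braided multiplication determined by the braiding operator $\bar\Theta:\bar{\mathsf{A}}_{l,n}\otimes\bar{\mathsf{A}}_{s,n}\to\bar{\mathsf{A}}_{s,n}\otimes\bar{\mathsf{A}}_{l,n}$ and with the tensor product action of $\mathrm{U}_q(\mathfrak{q}_n)$. Then the $\mathbb{C}(q)$-linear map $$\bar\sigma:\bar{\mathsf{A}}_{s,n}\otimes\bar{\mathsf{A}}_{l,n}\rightarrow\bar{\mathsf{A}}_{s+l,n},\qquad x\otimes y\mapsto\bar\iota_l(x)\bar\iota_0(y),\quad x\in\bar{\mathsf{A}}_{s,n},\ y\in\bar{\mathsf{A}}_{l,n},$$ is an isomorphism of $\mathrm{U}_q(\mathfrak{q}_n)$-supermodule superalgebras. Here $\bar\iota_l:\bar{\mathsf{A}}_{s,n}\to\bar{\mathsf{A}}_{s+l,n}$ is the superalgebra homomorphism with $\bar t_{\alpha a}\mapsto\bar t_{\alpha-l,a}$ ($\alpha=-1,\dots,-s$, $a\in I_{n|n}$) and $\bar\iota_0:\bar{\mathsf{A}}_{l,n}\to\bar{\mathsf{A}}_{s+l,n}$ is the superalgebra homomorphism with $\bar t_{\beta b}\mapsto\bar t_{\beta b}$ ($\beta=-1,\dots,-l$, $b\in I_{n|n}$).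
   Context: **Conventions.** The base field is $\mathbb{C}(q)$. Tensor products of superalgebras use the Koszul sign rule $(x\otimes y)(x'\otimes y')=(-1)^{|y||x'|}xx'\otimes yy'$. For $N\ge1$, $I_{N|N}=\{-N,\dots,-1,1,\dots,N\}$, with $|i|=\bar0$ if $i>0$ and $|i|=\bar1$ if $i<0$. Matrix units $E_{ij}$ (possibly rectangular) have parity $|i|+|j|$. $\delta_{a<b}$ is $1$ if $a<b$ and $0$ otherwise; $\xi=q-q^{-1}$; $\varphi(i,j)=(-1)^{|j|}(\delta_{ij}+\delta_{i,-j})$. $V_q$ is the superspace with basis $v_i$, $i\in I_{n|n}$, $|v_i|=|i|$, and $$S=\sum_{i,j\in I_{n|n}}q^{\varphi(i,j)}E_{ii}\otimes E_{jj}+\xi\sum_{i<j}(-1)^{|i|}(E_{ji}+E_{-j,-i})\otimes E_{ij}\in\mathrm{End}(V_q)^{\otimes2},$$ with inverse $S^{-1}=\sum_{i,j\in I_{n|n}}q^{-\varphi(i,j)}E_{ii}\otimes E_{jj}-\xi\sum_{i<j}(-1)^{|i|}(E_{ji}+E_{-j,-i})\otimes E_{ij}$. Superscripts indicate tensor positions, and a bracketed position is the one occupied by entries in a superalgebra other than a matrix superalgebra. **$\mathrm{U}_q(\mathfrak{q}_n)$** is the unital associative superalgebra generated by $L_{ij}$ of parity $|i|+|j|$, $i,j\in I_{n|n}$, $i\le j$, with relations $L_{ii}L_{-i,-i}=1=L_{-i,-i}L_{ii}$ and $L^{[1]2}L^{[1]3}S^{23}=S^{23}L^{[1]3}L^{[1]2}$,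 where $L=\sum_{i\le j}L_{ij}\otimes E_{ij}$ (put $L_{ij}=0$ for $i>j$). It is a Hopf superalgebra with $\Delta(L)=L\otimes L$, i.e. $\Delta(L_{ij})=\sum_k(-1)^{(|i|+|k|)(|k|+|j|)}L_{ik}\otimes L_{kj}$, $\varepsilon(L)=1$, antipode $L\mapsto L^{-1}$. A $\mathrm{U}_q(\mathfrak{q}_n)$-supermodule superalgebra is a unital associative superalgebra $B$ that is a $\mathrm{U}_q(\mathfrak{q}_n)$-supermodule with $u.(ab)=\sum_{(u)}(-1)^{|u_{(2)}||a|}(u_{(1)}.a)(u_{(2)}.b)$ and $u.1=\varepsilon(u)1$. **Dual quantum coordinate superalgebra $\bar{\mathsf{A}}_{s,n}$.** Unital associative superalgebra generated by $\bar t_{\alpha b}$ of parity $|\alpha|+|b|$, $\alpha\in I_{s|s}$, $b\in I_{n|n}$, with relations $\bar t_{\alpha b}=(-1)^{|\alpha|+|b|}\bar t_{-\alpha,-b}$ and $\bar T^{1[3]}\bar T^{2[3]}S^{12}=S^{12}\bar T^{2[3]}\bar T^{1[3]}$, where $\bar T=\sum(-1)^{|b|(|\alpha|+|b|)}E_{b\alpha}\otimes\bar t_{\alpha b}$ (the left-hand $S$ is the matrix of the same form with indices in $I_{s|s}$). It is equivalently presented by generators $\bar t_{\alpha b}$, $\alpha=-1,\dots,-s$, $b\in I_{n|n}$, with relations $$q^{-\delta_{\alpha\beta}}\bar t_{\alpha a}\bar t_{\beta b}-(-1)^{(|a|+1)(|b|+1)}q^{\varphi(a,b)}\bar t_{\beta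 b}\bar t_{\alpha a}=\xi(\delta_{\alpha<\beta}-\delta_{b<a})\bar t_{\beta a}\bar t_{\alpha b}-(-1)^{|a|}\xi\,\delta_{b<-a}\,\bar t_{\beta,-a}\bar t_{\alpha,-b}.$$ It is a $\mathrm{U}_q(\mathfrak{q}_n)$-supermodule superalgebra with action $\bar\Phi$ determined by $L^{[2]3}\cdot_{\bar\Phi}\bar T^{1[2]}=(S^{-1})^{13}\bar T^{1[2]}$, where for a matrix $M=\sum E_{c\alpha}\otimes m_{c\alpha}$, $L^{[2]3}\cdot M^{1[2]}:=\sum(-1)^{(|a|+|b|)|m_{c\alpha}|}E_{c\alpha}\otimes(L_{ab}.m_{c\alpha})\otimes E_{ab}$. **Braiding operator.** $\bar\Theta:\bar{\mathsf{A}}_{l,n}\otimes\bar{\mathsf{A}}_{s,n}\to\bar{\mathsf{A}}_{s,n}\otimes\bar{\mathsf{A}}_{l,n}$ is the unique homomorphism of $\mathrm{U}_q(\mathfrak{q}_n)$-supermodules with $\bar\Theta(1\otimes\bar x)=\bar x\otimes1$, $\bar\Theta(\bar y\otimes1)=1\otimes\bar y$, $$\bar\Theta(\bar t_{\beta b}\otimes\bar t_{\alpha a})=(-1)^{(|a|+1)(|b|+1)}q^{\varphi(b,a)}\bar t_{\alpha a}\otimes\bar t_{\beta b}-\delta_{a<b}\xi\,\bar t_{\alpha b}\otimes\bar t_{\beta a}-(-1)^{|b|}\delta_{a<-b}\xi\,\bar t_{\alpha,-b}\otimes\bar t_{\beta,-a}$$ ($\alpha=-1,\dots,-s$, $\beta=-1,\dots,-l$,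 $a,b\in I_{n|n}$), satisfying $\bar\Theta\circ(1\otimes\mathrm{mul})=(\mathrm{mul}\otimes1)(1\otimes\bar\Theta)(\bar\Theta\otimes1)$ and $\bar\Theta\circ(\mathrm{mul}\otimes1)=(1\otimes\mathrm{mul})(\bar\Theta\otimes1)(1\otimes\bar\Theta)$, where $\mathrm{mul}$ is multiplication. The braided multiplication on $\bar{\mathsf{A}}_{s,n}\otimes\bar{\mathsf{A}}_{l,n}$ is $(\mathrm{mul}\otimes\mathrm{mul})\circ(1\otimes\bar\Theta\otimes1)$; with it $\bar{\mathsf{A}}_{s,n}\otimes\bar{\mathsf{A}}_{l,n}$ is a $\mathrm{U}_q(\mathfrak{q}_n)$-supermodule superalgebra. *)

theory Defs
  imports
    "HOL-Algebra.Module"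
    "HOL-Algebra.QuotRing"
    "HOL-Library.Poly_Mapping"
    "HOL-Library.FuncSet"
    "HOL-Computational_Algebra.Polynomial"
    "HOL-Computational_Algebra.Fraction_Field"
begin

section \<open>The base field and superspaces\<close>

type_synonym cq = "complex poly fract"

definition qv :: cq where "qv = Fract [:0, 1:] 1"

definition xiv :: cq where "xiv = qv - inverse qv"

text \<open>Parities are the natural numbers 0 and 1; \<open>part V 0\<close> and \<open>part V 1\<close> are the
  even and the odd part of \<open>V\<close>.\<close>

record 'a superalg = "(cq, 'a) module" +
  part :: "nat \<Rightarrow> 'a set"

definition base_field :: "cq superalg" where
  "base_field = \<lparr>carrier = UNIV, monoid.mult = (*), one = 1, zero = 0, add = (+), module.smult = (*),
     part = (\<lambda>p. if p = 0 then UNIV else {0})\<rparr>"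

text \<open>The multiplication fields of \<open>V\<close> are irrelevant here.\<close>

definition superspace :: "'a superalg \<Rightarrow> bool" where
  "superspace V \<longleftrightarrow> Module.module base_field V \<and>
     submodule (part V 0) base_field V \<and> submodule (part V 1) base_field V \<and>
     (\<forall>x\<in>carrier V. \<exists>!yz. yz \<in> part V 0 \<times> part V 1 \<and> x = fst yz \<oplus>\<^bsub>V\<^esub> snd yz)"

definition superalgebra :: "'a superalg \<Rightarrow> bool" where
  "superalgebra A \<longleftrightarrow> superspace A \<and> ring A \<and>
     (\<forall>c. \<forall>x\<in>carrier A. \<forall>y\<in>carrier A.
        (c \<odot>\<^bsub>A\<^esub> x) \<otimes>\<^bsub>A\<^esub> y = c \<odot>\<^bsub>A\<^esub> (x \<otimes>\<^bsub>A\<^esub> y) \<and> x \<otimes>\<^bsub>A\<^esub> (c \<odot>\<^bsub>A\<^esub> y) = c \<odot>\<^bsub>A\<^esub> (x \<otimes>\<^bsub>A\<^esub> y)) \<and>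
     \<one>\<^bsub>A\<^esub> \<in> part A 0 \<and>
     (\<forall>p\<in>{0, 1}. \<forall>r\<in>{0, 1}. \<forall>x\<in>part A p. \<forall>y\<in>part A r. x \<otimes>\<^bsub>A\<^esub> y \<in> part A ((p + r) mod 2))"

definition even_linear :: "'a superalg \<Rightarrow> 'b superalg \<Rightarrow> ('a \<Rightarrow> 'b) \<Rightarrow> bool" where
  "even_linear V W f \<longleftrightarrow> f \<in> carrier V \<rightarrow> carrier W \<and>
     (\<forall>x\<in>carrier V. \<forall>y\<in>carrier V. f (x \<oplus>\<^bsub>V\<^esub> y) = f x \<oplus>\<^bsub>W\<^esub> f y) \<and>
     (\<forall>c. \<forall>x\<in>carrier V. f (c \<odot>\<^bsub>V\<^esub> x) = c \<odot>\<^bsub>W\<^esub> f x) \<and>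
     (\<forall>p\<in>{0, 1}. f ` part V p \<subseteq> part W p)"

definition superalg_hom :: "'a superalg \<Rightarrow> 'b superalg \<Rightarrow> ('a \<Rightarrow> 'b) \<Rightarrow> bool" where
  "superalg_hom A B f \<longleftrightarrow> even_linear A B f \<and> f \<in> ring_hom A B"

text \<open>The superalgebra homomorphism sending the generator \<open>g x\<close> of \<open>A\<close> to \<open>h x\<close> for \<open>x \<in> X\<close>.\<close>

definition gen_hom ::
  "'a superalg \<Rightarrow> 'b superalg \<Rightarrow> 'x set \<Rightarrow> ('x \<Rightarrow> 'a) \<Rightarrow> ('x \<Rightarrow> 'b) \<Rightarrow> 'a \<Rightarrow> 'b" where
  "gen_hom A B X g h =
     (THE f. f \<in> extensional (carrier A) \<and> superalg_hom A B f \<and> (\<forall>x\<in>X. f (g x) = h x))"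

text \<open>The homogeneous component of parity \<open>p\<close>.\<close>

definition hcomp :: "'a superalg \<Rightarrow> nat \<Rightarrow> 'a \<Rightarrow> 'a" where
  "hcomp V p x = (THE y. y \<in> part V p \<and> (\<exists>z\<in>part V (1 - p). x = y \<oplus>\<^bsub>V\<^esub> z))"

text \<open>Formulas of the shape \<open>(-1)^(|x||y|) g(x,y)\<close> are extended from homogeneous to arbitrary
  \<open>x\<close>, \<open>y\<close> by summing over the homogeneous components of \<open>x\<close> and \<open>y\<close>.\<close>

definition koszul_sum :: "'c superalg \<Rightarrow> (nat \<Rightarrow> nat \<Rightarrow> 'c) \<Rightarrow> 'c" where
  "koszul_sum C g = (\<Oplus>\<^bsub>C\<^esub>p\<in>{0, 1}. \<Oplus>\<^bsub>C\<^esub>r\<in>{0, 1}. ((-1) ^ (p * r)) \<odot>\<^bsub>C\<^esub> g p r)"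

section \<open>Quotients and tensor products\<close>

text \<open>Quotient by an ideal or (forgetting the multiplication) by a subspace.  Adding \<open>I\<close> in
  the scalar multiplication is only relevant for the scalar 0.\<close>

definition squot :: "'a superalg \<Rightarrow> 'a set \<Rightarrow> 'a set superalg" where
  "squot F I = \<lparr>carrier = carrier (F Quot I), monoid.mult = monoid.mult (F Quot I), one = one (F Quot I),
     zero = zero (F Quot I), add = add (F Quot I),
     module.smult = (\<lambda>c X. I <+>\<^bsub>F\<^esub> ((\<lambda>x. c \<odot>\<^bsub>F\<^esub> x) ` X)),
     part = (\<lambda>p. (\<lambda>x. I +>\<^bsub>F\<^esub> x) ` part F p)\<rparr>"

definition subspace_gen :: "'a superalg \<Rightarrow> 'a set \<Rightarrow> 'a set" where
  "subspace_gen V S = \<Inter>{H. submodule H base_field V \<and> S \<subseteq> H}"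

text \<open>The superspace with basis \<open>carrier A \<times> carrier B\<close>.  Its parts need not span it (a basis
  element with a non-homogeneous entry has no parity), but after the bilinear relations are
  divided out they do.\<close>

definition free_pairs :: "'a superalg \<Rightarrow> 'b superalg \<Rightarrow> (('a \<times> 'b) \<Rightarrow>\<^sub>0 cq) superalg" where
  "free_pairs A B = \<lparr>carrier = {f. Poly_Mapping.keys f \<subseteq> carrier A \<times> carrier B},
     monoid.mult = undefined, one = undefined, zero = 0, add = (+),
     module.smult = (\<lambda>c. Poly_Mapping.map ((*) c)),
     part = (\<lambda>p. {f. \<forall>(x, y)\<in>Poly_Mapping.keys f.
        \<exists>i\<in>{0, 1}. \<exists>j\<in>{0, 1}. x \<in> part A i \<and> y \<in> part B j \<and> (i + j) mod 2 = p})\<rparr>"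

definition bilinear_rels :: "'a superalg \<Rightarrow> 'b superalg \<Rightarrow> (('a \<times> 'b) \<Rightarrow>\<^sub>0 cq) set" where
  "bilinear_rels A B = (let e = (\<lambda>x y. Poly_Mapping.single (x, y) 1) in
     {e (x \<oplus>\<^bsub>A\<^esub> x') y - e x y - e x' y | x x' y. x \<in> carrier A \<and> x' \<in> carrier A \<and> y \<in> carrier B} \<union>
     {e x (y \<oplus>\<^bsub>B\<^esub> y') - e x y - e x y' | x y y'. x \<in> carrier A \<and> y \<in> carrier B \<and> y' \<in> carrier B} \<union>
     {e (c \<odot>\<^bsub>A\<^esub> x) y - Poly_Mapping.single (x, y) c | c x y. x \<in> carrier A \<and> y \<in> carrier B} \<union>
     {e x (c \<odot>\<^bsub>B\<^esub> y) - Poly_Mapping.single (x, y) c | c x y. x \<in> carrier A \<and> y \<in> carrier B})"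

definition tens_null :: "'a superalg \<Rightarrow> 'b superalg \<Rightarrow> (('a \<times> 'b) \<Rightarrow>\<^sub>0 cq) set" where
  "tens_null A B = subspace_gen (free_pairs A B) (bilinear_rels A B)"

type_synonym ('a, 'b) tensor = "(('a \<times> 'b) \<Rightarrow>\<^sub>0 cq) set"

definition tens_space :: "'a superalg \<Rightarrow> 'b superalg \<Rightarrow> ('a, 'b) tensor superalg" where
  "tens_space A B = squot (free_pairs A B) (tens_null A B)"

definition tpure :: "'a superalg \<Rightarrow> 'b superalg \<Rightarrow> 'a \<Rightarrow> 'b \<Rightarrow> ('a, 'b) tensor" where
  "tpure A B x y = tens_null A B +>\<^bsub>free_pairs A B\<^esub> Poly_Mapping.single (x, y) 1"

text \<open>The linear map into \<open>C\<close> induced by a bilinear map \<open>\<beta>\<close>: if \<open>Z\<close> is the sum of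
  \<open>x\<^sub>k \<otimes> y\<^sub>k\<close>, the value is the sum of \<open>\<beta> x\<^sub>k y\<^sub>k\<close>.  The choice
  of the representative of \<open>Z\<close> is immaterial for bilinear \<open>\<beta>\<close>.\<close>

definition tlift :: "'c superalg \<Rightarrow> ('a \<Rightarrow> 'b \<Rightarrow> 'c) \<Rightarrow> ('a, 'b) tensor \<Rightarrow> 'c" where
  "tlift C \<beta> Z = (let f = (SOME f. f \<in> Z) in
     \<Oplus>\<^bsub>C\<^esub>z\<in>Poly_Mapping.keys f. Poly_Mapping.lookup f z \<odot>\<^bsub>C\<^esub> \<beta> (fst z) (snd z))"

text \<open>The tensor product of superalgebras, with the Koszul sign rule
  \<open>(x \<otimes> y)(x' \<otimes> y') = (-1)^(|y||x'|) xx' \<otimes> yy'\<close>.\<close>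

definition tens_alg :: "'a superalg \<Rightarrow> 'b superalg \<Rightarrow> ('a, 'b) tensor superalg" where
  "tens_alg A B = (tens_space A B)
     \<lparr>monoid.mult := (\<lambda>Z W. tlift (tens_space A B) (\<lambda>x y. tlift (tens_space A B) (\<lambda>x' y'.
          koszul_sum (tens_space A B) (\<lambda>p r.
            tpure A B (x \<otimes>\<^bsub>A\<^esub> hcomp A r x') (hcomp B p y \<otimes>\<^bsub>B\<^esub> y'))) W) Z),
      one := tpure A B \<one>\<^bsub>A\<^esub> \<one>\<^bsub>B\<^esub>\<rparr>"

section \<open>Supermodules and supermodule superalgebras\<close>

text \<open>Below, \<open>U\<close> is a superalgebra with comultiplication \<open>\<Delta>\<close> and counit \<open>\<epsilon>\<close>.\<close>

definition supermodule :: "'u superalg \<Rightarrow> 'm superalg \<Rightarrow> ('u \<Rightarrow> 'm \<Rightarrow> 'm) \<Rightarrow> bool" where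
  "supermodule U M act \<longleftrightarrow> superspace M \<and>
     (\<forall>u\<in>carrier U. \<forall>m\<in>carrier M. act u m \<in> carrier M) \<and>
     (\<forall>u\<in>carrier U. \<forall>m\<in>carrier M. \<forall>m'\<in>carrier M. act u (m \<oplus>\<^bsub>M\<^esub> m') = act u m \<oplus>\<^bsub>M\<^esub> act u m') \<and>
     (\<forall>u\<in>carrier U. \<forall>u'\<in>carrier U. \<forall>m\<in>carrier M. act (u \<oplus>\<^bsub>U\<^esub> u') m = act u m \<oplus>\<^bsub>M\<^esub> act u' m) \<and>
     (\<forall>c. \<forall>u\<in>carrier U. \<forall>m\<in>carrier M.
        act u (c \<odot>\<^bsub>M\<^esub> m) = c \<odot>\<^bsub>M\<^esub> act u m \<and> act (c \<odot>\<^bsub>U\<^esub> u) m = c \<odot>\<^bsub>M\<^esub> act u m) \<and>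
     (\<forall>u\<in>carrier U. \<forall>u'\<in>carrier U. \<forall>m\<in>carrier M. act (u \<otimes>\<^bsub>U\<^esub> u') m = act u (act u' m)) \<and>
     (\<forall>m\<in>carrier M. act \<one>\<^bsub>U\<^esub> m = m) \<and>
     (\<forall>p\<in>{0, 1}. \<forall>r\<in>{0, 1}. \<forall>u\<in>part U p. \<forall>m\<in>part M r. act u m \<in> part M ((p + r) mod 2))"

definition supermodule_hom ::
  "'u superalg \<Rightarrow> 'm superalg \<Rightarrow> ('u \<Rightarrow> 'm \<Rightarrow> 'm) \<Rightarrow> 'k superalg \<Rightarrow> ('u \<Rightarrow> 'k \<Rightarrow> 'k) \<Rightarrow>
   ('m \<Rightarrow> 'k) \<Rightarrow> bool" where
  "supermodule_hom U M actM N actN f \<longleftrightarrow> even_linear M N f \<and>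
     (\<forall>u\<in>carrier U. \<forall>m\<in>carrier M. f (actM u m) = actN u (f m))"

text \<open>\<open>u.(x \<otimes> y) = \<Sum> (-1)^(|u\<^sub>2||x|) u\<^sub>1.x \<otimes> u\<^sub>2.y\<close>\<close>

definition tens_act ::
  "'u superalg \<Rightarrow> ('u \<Rightarrow> ('u, 'u) tensor) \<Rightarrow> 'a superalg \<Rightarrow> ('u \<Rightarrow> 'a \<Rightarrow> 'a) \<Rightarrow>
   'b superalg \<Rightarrow> ('u \<Rightarrow> 'b \<Rightarrow> 'b) \<Rightarrow> 'u \<Rightarrow> ('a, 'b) tensor \<Rightarrow> ('a, 'b) tensor" where
  "tens_act U \<Delta> A actA B actB u Z =
     tlift (tens_space A B) (\<lambda>x y. tlift (tens_space A B) (\<lambda>u1 u2.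
       koszul_sum (tens_space A B) (\<lambda>p r.
         tpure A B (actA u1 (hcomp A r x)) (actB (hcomp U p u2) y))) (\<Delta> u)) Z"

text \<open>\<open>u.(ab) = \<Sum> (-1)^(|u\<^sub>2||a|) (u\<^sub>1.a)(u\<^sub>2.b)\<close> and \<open>u.1 = \<epsilon>(u)1\<close>\<close>

definition supermodule_superalgebra ::
  "'u superalg \<Rightarrow> ('u \<Rightarrow> ('u, 'u) tensor) \<Rightarrow> ('u \<Rightarrow> cq) \<Rightarrow> 'b superalg \<Rightarrow> ('u \<Rightarrow> 'b \<Rightarrow> 'b) \<Rightarrow> bool" where
  "supermodule_superalgebra U \<Delta> \<epsilon> B act \<longleftrightarrow> superalgebra B \<and> supermodule U B act \<and>
     (\<forall>u\<in>carrier U. \<forall>a\<in>carrier B. \<forall>b\<in>carrier B.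
        act u (a \<otimes>\<^bsub>B\<^esub> b) = tlift B (\<lambda>u1 u2. koszul_sum B (\<lambda>p r.
          act u1 (hcomp B r a) \<otimes>\<^bsub>B\<^esub> act (hcomp U p u2) b)) (\<Delta> u)) \<and>
     (\<forall>u\<in>carrier U. act u \<one>\<^bsub>B\<^esub> = \<epsilon> u \<odot>\<^bsub>B\<^esub> \<one>\<^bsub>B\<^esub>)"

definition supermodule_superalgebra_iso ::
  "'u superalg \<Rightarrow> ('u \<Rightarrow> ('u, 'u) tensor) \<Rightarrow> ('u \<Rightarrow> cq) \<Rightarrow> 'a superalg \<Rightarrow> ('u \<Rightarrow> 'a \<Rightarrow> 'a) \<Rightarrow>
   'b superalg \<Rightarrow> ('u \<Rightarrow> 'b \<Rightarrow> 'b) \<Rightarrow> ('a \<Rightarrow> 'b) \<Rightarrow> bool" where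
  "supermodule_superalgebra_iso U \<Delta> \<epsilon> A actA B actB f \<longleftrightarrow>
     supermodule_superalgebra U \<Delta> \<epsilon> A actA \<and> supermodule_superalgebra U \<Delta> \<epsilon> B actB \<and>
     superalg_hom A B f \<and> supermodule_hom U A actA B actB f \<and> bij_betw f (carrier A) (carrier B)"

section \<open>Free superalgebras and presentations\<close>

text \<open>Words form a monoid under concatenation, so that \<open>'g word \<Rightarrow>\<^sub>0 cq\<close> with its
  convolution product is the free algebra on \<open>'g\<close>.\<close>

datatype 'g word = Word (letters: "'g list")

instantiation word :: (type) monoid_add
begin

definition "0 = Word []"

definition "v + w = Word (letters v @ letters w)"

instance
  by standard (auto simp: zero_word_def plus_word_def)

end

type_synonym 'g falg = "'g word \<Rightarrow>\<^sub>0 cq"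

definition scal :: "cq \<Rightarrow> 'g falg" where "scal c = Poly_Mapping.single 0 c"

definition gen :: "'g \<Rightarrow> 'g falg" where "gen g = Poly_Mapping.single (Word [g]) 1"

definition free_superalg :: "'g set \<Rightarrow> ('g \<Rightarrow> nat) \<Rightarrow> 'g falg superalg" where
  "free_superalg G d = \<lparr>carrier = {f. \<forall>w\<in>Poly_Mapping.keys f. set (letters w) \<subseteq> G},
     monoid.mult = (*), one = 1, zero = 0, add = (+), module.smult = (\<lambda>c f. scal c * f),
     part = (\<lambda>p. {f. \<forall>w\<in>Poly_Mapping.keys f.
        set (letters w) \<subseteq> G \<and> (\<Sum>g\<leftarrow>letters w. d g) mod 2 = p})\<rparr>"

section \<open>Index sets, supermatrices and the matrix \<open>S\<close>\<close>

definition idx :: "nat \<Rightarrow> int set" where "idx N = {- int N..int N} - {0}"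

definition par :: "int \<Rightarrow> nat" where "par i = (if i < 0 then 1 else 0)"

definition phi :: "int \<Rightarrow> int \<Rightarrow> int" where
  "phi i j = (-1) ^ par j * (of_bool (i = j) + of_bool (i = - j))"

text \<open>\<open>munit a b i j\<close> is the \<open>(i,j)\<close> entry of the matrix unit \<open>E\<^sub>a\<^sub>b\<close>.
  \<open>Smat N i j k l\<close> is the coefficient of \<open>E\<^sub>i\<^sub>j \<otimes> E\<^sub>k\<^sub>l\<close> in \<open>S\<close>.\<close>

definition munit :: "int \<Rightarrow> int \<Rightarrow> int \<Rightarrow> int \<Rightarrow> cq" where
  "munit a b i j = of_bool (i = a \<and> j = b)"

definition Smat :: "nat \<Rightarrow> int \<Rightarrow> int \<Rightarrow> int \<Rightarrow> int \<Rightarrow> cq" where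
  "Smat N i j k l =
     (\<Sum>a\<in>idx N. \<Sum>b\<in>idx N. qv powi phi a b * munit a a i j * munit b b k l) +
     xiv * (\<Sum>a\<in>idx N. \<Sum>b\<in>{b\<in>idx N. a < b}.
        (-1) ^ par a * (munit b a i j + munit (- b) (- a) i j) * munit a b k l)"

definition Smat_inv :: "nat \<Rightarrow> int \<Rightarrow> int \<Rightarrow> int \<Rightarrow> int \<Rightarrow> cq" where
  "Smat_inv N i j k l =
     (\<Sum>a\<in>idx N. \<Sum>b\<in>idx N. qv powi (- phi a b) * munit a a i j * munit b b k l) -
     xiv * (\<Sum>a\<in>idx N. \<Sum>b\<in>{b\<in>idx N. a < b}.
        (-1) ^ par a * (munit b a i j + munit (- b) (- a) i j) * munit a b k l)"

text \<open>An even element \<open>\<Sum> E\<^sub>i\<^sub>j \<otimes> E\<^sub>k\<^sub>l \<otimes> X\<^sub>i\<^sub>j\<^sub>k\<^sub>l\<close> (so the parity of \<open>X\<^sub>i\<^sub>j\<^sub>k\<^sub>l\<close> is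
  \<open>|i|+|j|+|k|+|l|\<close>) is represented by the function \<open>X\<close>.  The Koszul sign in
  \<open>(E\<^sub>i\<^sub>j \<otimes> E\<^sub>k\<^sub>l \<otimes> x)(E\<^sub>j\<^sub>m \<otimes> E\<^sub>l\<^sub>p \<otimes> y)\<close> has exponent
  \<open>|E\<^sub>k\<^sub>l||E\<^sub>j\<^sub>m| + |x|(|E\<^sub>j\<^sub>m|+|E\<^sub>l\<^sub>p|)\<close>.  For
  \<open>(x \<otimes> E\<^sub>i\<^sub>j \<otimes> E\<^sub>k\<^sub>l)(y \<otimes> E\<^sub>j\<^sub>m \<otimes> E\<^sub>l\<^sub>p)\<close> it is
  \<open>(|E\<^sub>i\<^sub>j|+|E\<^sub>k\<^sub>l|)|y| + |E\<^sub>k\<^sub>l||E\<^sub>j\<^sub>m|\<close>, which agrees for even elements, so that the same product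
  serves both positions of the algebra.  \<open>J1\<close>, \<open>J2\<close> are the ranges of the summation indices
  \<open>j\<close>, \<open>l\<close>; the matrices may be rectangular.\<close>

type_synonym 'a smat = "int \<Rightarrow> int \<Rightarrow> int \<Rightarrow> int \<Rightarrow> 'a"

definition smul :: "int set \<Rightarrow> int set \<Rightarrow> 'a::ring_1 smat \<Rightarrow> 'a smat \<Rightarrow> 'a smat" where
  "smul J1 J2 X Y i m k p = (\<Sum>j\<in>J1. \<Sum>l\<in>J2.
     (-1) ^ ((par k + par l) * (par j + par m) +
             (par i + par j + par k + par l) * (par j + par m + par l + par p))
     * X i j k l * Y j m l p)"

definition slot1 :: "(int \<Rightarrow> int \<Rightarrow> 'a::zero) \<Rightarrow> 'a smat" where
  "slot1 M i j k l = (if k = l then M i j else 0)"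

definition slot2 :: "(int \<Rightarrow> int \<Rightarrow> 'a::zero) \<Rightarrow> 'a smat" where
  "slot2 M i j k l = (if i = j then M k l else 0)"

definition Sfree :: "nat \<Rightarrow> (int \<times> int) falg smat" where
  "Sfree N i j k l = scal (Smat N i j k l)"

definition gpar :: "int \<times> int \<Rightarrow> nat" where
  "gpar g = par (fst g) + par (snd g)"

type_synonym alg = "(int \<times> int) falg set"

section \<open>The quantum superalgebra of type Q\<close>

definition U_gens :: "nat \<Rightarrow> (int \<times> int) set" where
  "U_gens n = {(i, j). i \<in> idx n \<and> j \<in> idx n \<and> i \<le> j}"

definition Lfree :: "int \<Rightarrow> int \<Rightarrow> (int \<times> int) falg" where
  "Lfree i j = (if i \<le> j then gen (i, j) else 0)"

definition U_rels :: "nat \<Rightarrow> (int \<times> int) falg set" where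
  "U_rels n = {Lfree i i * Lfree (- i) (- i) - 1 | i. i \<in> idx n} \<union>
     {smul (idx n) (idx n) (smul (idx n) (idx n) (slot1 Lfree) (slot2 Lfree)) (Sfree n) i m k p
      - smul (idx n) (idx n) (Sfree n) (smul (idx n) (idx n) (slot2 Lfree) (slot1 Lfree)) i m k p
      | i m k p. i \<in> idx n \<and> m \<in> idx n \<and> k \<in> idx n \<and> p \<in> idx n}"

definition U_free :: "nat \<Rightarrow> (int \<times> int) falg superalg" where
  "U_free n = free_superalg (U_gens n) gpar"

definition U_ideal :: "nat \<Rightarrow> alg" where
  "U_ideal n = Idl\<^bsub>U_free n\<^esub> (U_rels n)"

definition Uq :: "nat \<Rightarrow> alg superalg" where
  "Uq n = squot (U_free n) (U_ideal n)"

definition Lq :: "nat \<Rightarrow> int \<Rightarrow> int \<Rightarrow> alg" where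
  "Lq n i j = U_ideal n +>\<^bsub>U_free n\<^esub> Lfree i j"

definition comult :: "nat \<Rightarrow> alg \<Rightarrow> (alg, alg) tensor" where
  "comult n = gen_hom (Uq n) (tens_alg (Uq n) (Uq n)) (U_gens n) (\<lambda>(i, j). Lq n i j)
     (\<lambda>(i, j). \<Oplus>\<^bsub>tens_alg (Uq n) (Uq n)\<^esub>k\<in>idx n.
        ((-1) ^ ((par i + par k) * (par k + par j)))
          \<odot>\<^bsub>tens_alg (Uq n) (Uq n)\<^esub> tpure (Uq n) (Uq n) (Lq n i k) (Lq n k j))"

definition counit :: "nat \<Rightarrow> alg \<Rightarrow> cq" where
  "counit n = gen_hom (Uq n) base_field (U_gens n) (\<lambda>(i, j). Lq n i j) (\<lambda>(i, j). of_bool (i = j))"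

section \<open>The dual quantum coordinate superalgebra\<close>

definition A_gens :: "nat \<Rightarrow> nat \<Rightarrow> (int \<times> int) set" where
  "A_gens s n = idx s \<times> idx n"

text \<open>\<open>Tfree b \<alpha>\<close> is the coefficient of \<open>E\<^sub>b\<^sub>\<alpha>\<close> in the generator matrix.\<close>

definition Tfree :: "int \<Rightarrow> int \<Rightarrow> (int \<times> int) falg" where
  "Tfree b \<alpha> = (-1) ^ (par b * (par \<alpha> + par b)) * gen (\<alpha>, b)"

definition A_rels :: "nat \<Rightarrow> nat \<Rightarrow> (int \<times> int) falg set" where
  "A_rels s n =
     {gen (\<alpha>, b) - (-1) ^ (par \<alpha> + par b) * gen (- \<alpha>, - b) | \<alpha> b. \<alpha> \<in> idx s \<and> b \<in> idx n} \<union>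
     {smul (idx s) (idx s) (smul (idx s) (idx n) (slot1 Tfree) (slot2 Tfree)) (Sfree s) i m k p
      - smul (idx n) (idx n) (Sfree n) (smul (idx n) (idx s) (slot2 Tfree) (slot1 Tfree)) i m k p
      | i m k p. i \<in> idx n \<and> m \<in> idx s \<and> k \<in> idx n \<and> p \<in> idx s}"

definition A_free :: "nat \<Rightarrow> nat \<Rightarrow> (int \<times> int) falg superalg" where
  "A_free s n = free_superalg (A_gens s n) gpar"

definition A_ideal :: "nat \<Rightarrow> nat \<Rightarrow> alg" where
  "A_ideal s n = Idl\<^bsub>A_free s n\<^esub> (A_rels s n)"

definition Abar :: "nat \<Rightarrow> nat \<Rightarrow> alg superalg" where
  "Abar s n = squot (A_free s n) (A_ideal s n)"

definition tbar :: "nat \<Rightarrow> nat \<Rightarrow> int \<Rightarrow> int \<Rightarrow> alg" where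
  "tbar s n \<alpha> b = A_ideal s n +>\<^bsub>A_free s n\<^esub> gen (\<alpha>, b)"

definition Tbar :: "nat \<Rightarrow> nat \<Rightarrow> int \<Rightarrow> int \<Rightarrow> alg" where
  "Tbar s n b \<alpha> = ((-1) ^ (par b * (par \<alpha> + par b))) \<odot>\<^bsub>Abar s n\<^esub> tbar s n \<alpha> b"

text \<open>The last clause is the \<open>E\<^sub>c\<^sub>\<alpha> \<otimes> _ \<otimes> E\<^sub>a\<^sub>b\<close> component of
  \<open>L\<^sup>[\<^sup>2\<^sup>]\<^sup>3 . T\<^sup>1\<^sup>[\<^sup>2\<^sup>] = (S\<inverse>)\<^sup>1\<^sup>3 T\<^sup>1\<^sup>[\<^sup>2\<^sup>]\<close>.  No sign arises on the right since
  \<open>E\<^sub>a\<^sub>b\<close> is moved past \<open>E\<^sub>j\<^sub>\<alpha>\<close> and an algebra element of the same parity.\<close>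

definition is_Phi :: "nat \<Rightarrow> nat \<Rightarrow> (alg \<Rightarrow> alg \<Rightarrow> alg) \<Rightarrow> bool" where
  "is_Phi s n act \<longleftrightarrow>
     supermodule_superalgebra (Uq n) (comult n) (counit n) (Abar s n) act \<and>
     (\<forall>a\<in>idx n. \<forall>b\<in>idx n. \<forall>c\<in>idx n. \<forall>\<alpha>\<in>idx s.
        ((-1) ^ ((par a + par b) * (par c + par \<alpha>))) \<odot>\<^bsub>Abar s n\<^esub> act (Lq n a b) (Tbar s n c \<alpha>)
        = (\<Oplus>\<^bsub>Abar s n\<^esub>j\<in>idx n. Smat_inv n c j a b \<odot>\<^bsub>Abar s n\<^esub> Tbar s n j \<alpha>))"

section \<open>Braiding and the comparison map\<close>

text \<open>\<open>\<Theta>\<close> maps \<open>Abar l n \<otimes> Abar s n\<close> to \<open>Abar s n \<otimes> Abar l n\<close>.  The clauses before the last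
  one are the hexagon identities \<open>\<Theta>(1 \<otimes> mul) = (mul \<otimes> 1)(1 \<otimes> \<Theta>)(\<Theta> \<otimes> 1)\<close> and
  \<open>\<Theta>(mul \<otimes> 1) = (1 \<otimes> mul)(\<Theta> \<otimes> 1)(1 \<otimes> \<Theta>)\<close>, evaluated on \<open>y \<otimes> x \<otimes> x'\<close> and
  \<open>y \<otimes> y' \<otimes> x\<close>.\<close>

definition is_braiding ::
  "nat \<Rightarrow> nat \<Rightarrow> nat \<Rightarrow> (alg \<Rightarrow> alg \<Rightarrow> alg) \<Rightarrow> (alg \<Rightarrow> alg \<Rightarrow> alg) \<Rightarrow>
   ((alg, alg) tensor \<Rightarrow> (alg, alg) tensor) \<Rightarrow> bool" where
  "is_braiding l s n actl acts \<Theta> \<longleftrightarrow>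
    (let Al = Abar l n; As = Abar s n; U = Uq n; D = comult n;
         V = tens_space Al As; W = tens_space As Al in
     supermodule_hom U V (tens_act U D Al actl As acts) W (tens_act U D As acts Al actl) \<Theta> \<and>
     (\<forall>x\<in>carrier As. \<Theta> (tpure Al As \<one>\<^bsub>Al\<^esub> x) = tpure As Al x \<one>\<^bsub>Al\<^esub>) \<and>
     (\<forall>y\<in>carrier Al. \<Theta> (tpure Al As y \<one>\<^bsub>As\<^esub>) = tpure As Al \<one>\<^bsub>As\<^esub> y) \<and>
     (\<forall>y\<in>carrier Al. \<forall>x\<in>carrier As. \<forall>x'\<in>carrier As.
        \<Theta> (tpure Al As y (x \<otimes>\<^bsub>As\<^esub> x')) =
        tlift W (\<lambda>x1 y1. tlift W (\<lambda>x2 y2. tpure As Al (x1 \<otimes>\<^bsub>As\<^esub> x2) y2) (\<Theta> (tpure Al As y1 x')))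
          (\<Theta> (tpure Al As y x))) \<and>
     (\<forall>y\<in>carrier Al. \<forall>y'\<in>carrier Al. \<forall>x\<in>carrier As.
        \<Theta> (tpure Al As (y \<otimes>\<^bsub>Al\<^esub> y') x) =
        tlift W (\<lambda>x1 y1. tlift W (\<lambda>x2 y2. tpure As Al x2 (y2 \<otimes>\<^bsub>Al\<^esub> y1)) (\<Theta> (tpure Al As y x1)))
          (\<Theta> (tpure Al As y' x))) \<and>
     (\<forall>\<alpha>\<in>{- int s..-1}. \<forall>\<beta>\<in>{- int l..-1}. \<forall>a\<in>idx n. \<forall>b\<in>idx n.
        \<Theta> (tpure Al As (tbar l n \<beta> b) (tbar s n \<alpha> a)) =
          ((-1) ^ ((par a + 1) * (par b + 1)) * qv powi phi b a)
              \<odot>\<^bsub>W\<^esub> tpure As Al (tbar s n \<alpha> a) (tbar l n \<beta> b)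
          \<oplus>\<^bsub>W\<^esub> (- (of_bool (a < b) * xiv))
              \<odot>\<^bsub>W\<^esub> tpure As Al (tbar s n \<alpha> b) (tbar l n \<beta> a)
          \<oplus>\<^bsub>W\<^esub> (- ((-1) ^ par b * of_bool (a < - b) * xiv))
              \<odot>\<^bsub>W\<^esub> tpure As Al (tbar s n \<alpha> (- b)) (tbar l n \<beta> (- a))))"

text \<open>The braided multiplication \<open>(mul \<otimes> mul)(1 \<otimes> \<Theta> \<otimes> 1)\<close>.\<close>

definition braided ::
  "'a superalg \<Rightarrow> 'b superalg \<Rightarrow> (('b, 'a) tensor \<Rightarrow> ('a, 'b) tensor) \<Rightarrow> ('a, 'b) tensor superalg" where
  "braided A B \<Theta> = (tens_space A B)
     \<lparr>monoid.mult := (\<lambda>Z W. tlift (tens_space A B) (\<lambda>x y. tlift (tens_space A B) (\<lambda>x' y'.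
          tlift (tens_space A B) (\<lambda>x'' y''. tpure A B (x \<otimes>\<^bsub>A\<^esub> x'') (y'' \<otimes>\<^bsub>B\<^esub> y'))
            (\<Theta> (tpure B A y x'))) W) Z),
      one := tpure A B \<one>\<^bsub>A\<^esub> \<one>\<^bsub>B\<^esub>\<rparr>"

text \<open>\<open>iota k m s n\<close> is the homomorphism from \<open>Abar s n\<close> to \<open>Abar m n\<close> that shifts the
  negative first index by \<open>-k\<close>.\<close>

definition iota :: "nat \<Rightarrow> nat \<Rightarrow> nat \<Rightarrow> nat \<Rightarrow> alg \<Rightarrow> alg" where
  "iota k m s n = gen_hom (Abar s n) (Abar m n) ({- int s..-1} \<times> idx n)
     (\<lambda>(\<alpha>, a). tbar s n \<alpha> a) (\<lambda>(\<alpha>, a). tbar m n (\<alpha> - int k) a)"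

definition sigma_bar :: "nat \<Rightarrow> nat \<Rightarrow> nat \<Rightarrow> (alg, alg) tensor \<Rightarrow> alg" where
  "sigma_bar s l n = tlift (Abar (s + l) n)
     (\<lambda>x y. iota l (s + l) s n x \<otimes>\<^bsub>Abar (s + l) n\<^esub> iota 0 (s + l) l n y)"

end

(* The generators of the large algebra whose first index lies beyond l generate a copy of the first
   factor and the remaining ones a copy of the second factor, and the relations between the two
   blocks are exactly the formula for the braiding on generators.  Since the braiding is compatible
   with both multiplications (hexagon identities), it computes the product iota_0(y) iota_l(x) for
   all x and y; so sigma is multiplicative, and its image is a left ideal containing 1.

   For injectivity no basis is needed.  The large algebra acts on the tensor product of the two
   small ones: the first block by left multiplication on the first factor, the second block through
   the braiding.  Evaluating this action at 1 (x) 1 inverts sigma.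

   Finally, sigma intertwines the actions because the embeddings are equivariant and the action on
   the large algebra satisfies the product formula, so that all axioms of a supermodule
   superalgebra can be transported along the bijection sigma.  Besides this, one only needs to know
   that the comultiplication is well defined. *)

theory Submission
  imports Defs
begin

section \<open>Vector spaces over the base field\<close>

text \<open>That the block relations are the braiding formula hides a computation. The algebra is
  presented with first indices of both signs, tied in pairs by a sign, and with relations for both
  orders of two columns, whereas \<Theta> is prescribed on negative indices only. So eight families
  of mixed relations have to be traced back to one, through identities in q that rest on xi = q -
  1/q. Relations inside a block act as zero without any computation, because each block acts through
  its small algebra. For the second block this is one hexagon identity (for \<open>y y'\<close>);
  the other one (for \<open>x x'\<close>) says how a second-block element passes a first-block one.
  Evaluation at 1 \<otimes> 1 recovers a tensor because \<Theta>(y \<otimes> 1) = 1 \<otimes> y.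
  Neither associativity of the braided product nor uniqueness of parity components in the tensor
  space is proved by hand: both are pulled back along sigma. The comultiplication is a definite
  description, so a homomorphism with these values has to be exhibited before its values can be used
  as tensors. The point there is that the product of two solutions of the exchange relation is again
  a solution when their entries supercommute.\<close>

lemma base_field_simps [simp]:
  "carrier base_field = UNIV" "x \<otimes>\<^bsub>base_field\<^esub> y = x * y" "x \<oplus>\<^bsub>base_field\<^esub> y = x + y"
  "\<one>\<^bsub>base_field\<^esub> = 1" "\<zero>\<^bsub>base_field\<^esub> = 0"
  by (simp_all add: base_field_def)

lemma cring_base_field: "cring base_field"
proof (rule cringI)
  show "abelian_group base_field"
  proof (rule abelian_groupI)
    fix x show "\<exists>y\<in>carrier base_field. y \<oplus>\<^bsub>base_field\<^esub> x = \<zero>\<^bsub>base_field\<^esub>"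
      by (rule bexI[of _ "- x"]) auto
  qed auto
  show "comm_monoid base_field" by (rule comm_monoidI) auto
qed (auto simp: algebra_simps)

text \<open>The multiplication field of the record stays free: in a tensor space it has no
  meaning.\<close>

locale vspace =
  fixes V :: "'a superalg" (structure)
  assumes module_base: "Module.module base_field V"

sublocale vspace \<subseteq> abelian_group V
  using module_base by (simp add: Module.module_def)

context vspace
begin

lemma smult_cl [simp, intro]: "x \<in> carrier V \<Longrightarrow> c \<odot> x \<in> carrier V"
  using module.smult_closed[OF module_base, of c x] by simp

lemma smult_add_left: "x \<in> carrier V \<Longrightarrow> (c + d) \<odot> x = c \<odot> x \<oplus> d \<odot> x"
  using module.smult_l_distr[OF module_base, of c d x] by simp

lemma smult_add_right:
  "x \<in> carrier V \<Longrightarrow> y \<in> carrier V \<Longrightarrow> c \<odot> (x \<oplus> y) = c \<odot> x \<oplus> c \<odot> y"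
  using module.smult_r_distr[OF module_base, of c x y] by simp

lemma smult_smult [simp]: "x \<in> carrier V \<Longrightarrow> c \<odot> (d \<odot> x) = (c * d) \<odot> x"
  using module.smult_assoc1[OF module_base, of c d x] by simp

lemma one_smult [simp]: "x \<in> carrier V \<Longrightarrow> 1 \<odot> x = x"
  using module.smult_one[OF module_base, of x] by simp

lemma zero_smult [simp]: "x \<in> carrier V \<Longrightarrow> 0 \<odot> x = \<zero>"
  using module.smult_l_null[OF module_base, of x] by simp

lemma smult_zero [simp]: "c \<odot> \<zero> = \<zero>"
  using module.smult_r_null[OF module_base, of c] by simp

lemma minus_one_smult: "x \<in> carrier V \<Longrightarrow> (-1) \<odot> x = \<ominus> x"
  using smult_add_left[of x "-1" 1] by (simp add: minus_equality)

lemma smult_finsum: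
  "g \<in> I \<rightarrow> carrier V \<Longrightarrow> c \<odot> (\<Oplus>i\<in>I. g i) = (\<Oplus>i\<in>I. c \<odot> g i)"
  by (cases "finite I") (simp_all add: module.finsum_smult_ldistr[OF module_base] finsum_infinite)

end

text \<open>Parities are left out on purpose: multiplication by an odd element and the action of an
  odd element of \<open>Uq n\<close> are linear but not even.\<close>

definition lin :: "'a superalg \<Rightarrow> 'b superalg \<Rightarrow> ('a \<Rightarrow> 'b) \<Rightarrow> bool" where
  "lin V W f \<longleftrightarrow> f \<in> carrier V \<rightarrow> carrier W \<and>
     (\<forall>x\<in>carrier V. \<forall>y\<in>carrier V. f (x \<oplus>\<^bsub>V\<^esub> y) = f x \<oplus>\<^bsub>W\<^esub> f y) \<and>
     (\<forall>c. \<forall>x\<in>carrier V. f (c \<odot>\<^bsub>V\<^esub> x) = c \<odot>\<^bsub>W\<^esub> f x)"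

lemma linI [intro?]:
  assumes "\<And>x. x \<in> carrier V \<Longrightarrow> f x \<in> carrier W"
    and "\<And>x y. x \<in> carrier V \<Longrightarrow> y \<in> carrier V \<Longrightarrow> f (x \<oplus>\<^bsub>V\<^esub> y) = f x \<oplus>\<^bsub>W\<^esub> f y"
    and "\<And>c x. x \<in> carrier V \<Longrightarrow> f (c \<odot>\<^bsub>V\<^esub> x) = c \<odot>\<^bsub>W\<^esub> f x"
  shows "lin V W f"
  using assms by (auto simp: lin_def)

lemma lin_closed: "lin V W f \<Longrightarrow> x \<in> carrier V \<Longrightarrow> f x \<in> carrier W"
  by (auto simp: lin_def)

lemma lin_add:
  "lin V W f \<Longrightarrow> x \<in> carrier V \<Longrightarrow> y \<in> carrier V \<Longrightarrow> f (x \<oplus>\<^bsub>V\<^esub> y) = f x \<oplus>\<^bsub>W\<^esub> f y"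
  by (auto simp: lin_def)

lemma lin_smult: "lin V W f \<Longrightarrow> x \<in> carrier V \<Longrightarrow> f (c \<odot>\<^bsub>V\<^esub> x) = c \<odot>\<^bsub>W\<^esub> f x"
  by (auto simp: lin_def)

lemma lin_zero:
  assumes "vspace V" "vspace W" "lin V W f" shows "f \<zero>\<^bsub>V\<^esub> = \<zero>\<^bsub>W\<^esub>"
proof -
  interpret V: vspace V by fact
  interpret W: vspace W by fact
  show ?thesis using lin_smult[OF assms(3), of "\<zero>\<^bsub>V\<^esub>" 0] lin_closed[OF assms(3)] by simp
qed

lemma lin_minus:
  assumes "vspace V" "vspace W" "lin V W f" "x \<in> carrier V" shows "f (\<ominus>\<^bsub>V\<^esub> x) = \<ominus>\<^bsub>W\<^esub> f x"
  using lin_smult[OF assms(3,4), of "-1"] assms lin_closed[OF assms(3,4)]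
  by (simp add: vspace.minus_one_smult)

lemma lin_comp: "lin V W f \<Longrightarrow> lin U V g \<Longrightarrow> lin U W (\<lambda>x. f (g x))"
  by (auto simp: lin_def Pi_iff)

lemma lin_id: "lin V V (\<lambda>x. x)"
  by (auto simp: lin_def)

lemma lin_cong:
  assumes "lin V W g" "vspace V" "\<And>x. x \<in> carrier V \<Longrightarrow> f x = g x" shows "lin V W f"
proof -
  interpret V: vspace V by fact
  show ?thesis using assms(1,3) by (auto simp: lin_def Pi_iff)
qed

lemma lin_const_zero: "vspace W \<Longrightarrow> lin V W (\<lambda>x. \<zero>\<^bsub>W\<^esub>)"
proof -
  assume "vspace W"
  then interpret W: vspace W .
  show ?thesis by (rule linI) auto
qed

lemma lin_plus:
  assumes "vspace W" "lin V W f" "lin V W g" shows "lin V W (\<lambda>x. f x \<oplus>\<^bsub>W\<^esub> g x)"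
proof -
  interpret W: vspace W by fact
  show ?thesis using assms(2,3)
    by (auto simp: lin_def Pi_iff W.smult_add_right W.a_ac)
qed

lemma lin_scale:
  assumes "vspace W" "lin V W f" shows "lin V W (\<lambda>x. c \<odot>\<^bsub>W\<^esub> f x)"
proof -
  interpret W: vspace W by fact
  show ?thesis using assms(2)
    by (auto simp: lin_def Pi_iff W.smult_add_right mult.commute)
qed

lemma lin_finsum_fun:
  assumes W: "vspace W" and V: "vspace V" and f: "\<And>i. i \<in> I \<Longrightarrow> lin V W (f i)"
  shows "lin V W (\<lambda>x. \<Oplus>\<^bsub>W\<^esub>i\<in>I. f i x)"
proof -
  interpret W: vspace W by fact
  interpret V: vspace V by fact
  from f show ?thesis
  proof (induct I rule: infinite_finite_induct)
    case (infinite A)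
    then show ?case by (simp add: W.finsum_infinite lin_const_zero W)
  next
    case empty
    then show ?case by (simp add: W.finsum_empty lin_const_zero W)
  next
    case (insert i I)
    have eq: "(\<Oplus>\<^bsub>W\<^esub>j\<in>insert i I. f j x) = f i x \<oplus>\<^bsub>W\<^esub> (\<Oplus>\<^bsub>W\<^esub>j\<in>I. f j x)" if "x \<in> carrier V" for x
      by (rule W.finsum_insert) (use insert.hyps that in \<open>auto intro: lin_closed[OF insert.prems]\<close>)
    have "lin V W (\<lambda>x. f i x \<oplus>\<^bsub>W\<^esub> (\<Oplus>\<^bsub>W\<^esub>j\<in>I. f j x))"
      by (rule lin_plus[OF W]) (use insert in auto)
    then show ?case by (rule lin_cong[OF _ V]) (rule eq)
  qed
qed

lemma lin_finsum:
  assumes V: "vspace V" and W: "vspace W" and f: "lin V W f" and g: "g \<in> I \<rightarrow> carrier V"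
  shows "f (\<Oplus>\<^bsub>V\<^esub>i\<in>I. g i) = (\<Oplus>\<^bsub>W\<^esub>i\<in>I. f (g i))"
proof -
  interpret V: vspace V by fact
  interpret W: vspace W by fact
  note z = lin_zero[OF V W f]
  from g show ?thesis
  proof (induct I rule: infinite_finite_induct)
    case (infinite A)
    then show ?case by (simp add: V.finsum_infinite W.finsum_infinite z)
  next
    case empty
    then show ?case by (simp add: V.finsum_empty W.finsum_empty z)
  next
    case (insert i I)
    then show ?case using lin_closed[OF f] lin_add[OF f]
      by (auto simp: V.finsum_insert W.finsum_insert Pi_iff)
  qed
qed

lemma finsum_pair:
  assumes "abelian_monoid C" "f \<in> {0, 1} \<rightarrow> carrier C"
  shows "(\<Oplus>\<^bsub>C\<^esub>p\<in>{0, 1 :: nat}. f p) = f 0 \<oplus>\<^bsub>C\<^esub> f 1"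
proof -
  interpret abelian_monoid C by fact
  show ?thesis using assms(2) by (simp add: finsum_insert finsum_empty)
qed

definition bilin ::
  "'a superalg \<Rightarrow> 'b superalg \<Rightarrow> 'c superalg \<Rightarrow> ('a \<Rightarrow> 'b \<Rightarrow> 'c) \<Rightarrow> bool" where
  "bilin A B C \<beta> \<longleftrightarrow>
     (\<forall>x\<in>carrier A. lin B C (\<beta> x)) \<and> (\<forall>y\<in>carrier B. lin A C (\<lambda>x. \<beta> x y))"

lemma bilinI [intro?]:
  assumes "\<And>x. x \<in> carrier A \<Longrightarrow> lin B C (\<beta> x)" "\<And>y. y \<in> carrier B \<Longrightarrow> lin A C (\<lambda>x. \<beta> x y)"
  shows "bilin A B C \<beta>"
  using assms by (auto simp: bilin_def)

lemma bilin_left: "bilin A B C \<beta> \<Longrightarrow> y \<in> carrier B \<Longrightarrow> lin A C (\<lambda>x. \<beta> x y)"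
  by (auto simp: bilin_def)

lemma bilin_right: "bilin A B C \<beta> \<Longrightarrow> x \<in> carrier A \<Longrightarrow> lin B C (\<beta> x)"
  by (auto simp: bilin_def)

lemma bilin_closed: "bilin A B C \<beta> \<Longrightarrow> x \<in> carrier A \<Longrightarrow> y \<in> carrier B \<Longrightarrow> \<beta> x y \<in> carrier C"
  by (auto intro: lin_closed bilin_left)

lemma lin_bilin_comp: "lin C D f \<Longrightarrow> bilin A B C \<beta> \<Longrightarrow> bilin A B D (\<lambda>x y. f (\<beta> x y))"
  by (auto simp: bilin_def intro: lin_comp[of C D f])

section \<open>Linear extension from a basis\<close>

lemma lookup_scale [simp]:
  "Poly_Mapping.lookup (Poly_Mapping.map ((*) (c :: cq)) f) z = c * Poly_Mapping.lookup f z"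
  by (simp add: Poly_Mapping.map.rep_eq when_def)

lemma keys_scale: "Poly_Mapping.keys (Poly_Mapping.map ((*) (c :: cq)) f) \<subseteq> Poly_Mapping.keys f"
  by (auto simp: in_keys_iff)

lemma keys_uminus: "Poly_Mapping.keys (- f) = Poly_Mapping.keys (f :: 'a \<Rightarrow>\<^sub>0 cq)"
  by (auto simp: in_keys_iff)

lemma scale_minus_one: "Poly_Mapping.map ((*) (- 1)) f = - (f :: 'a \<Rightarrow>\<^sub>0 cq)"
  by (rule poly_mapping_eqI) simp

lemma update_eq_single_add:
  "z \<notin> Poly_Mapping.keys f \<Longrightarrow> Poly_Mapping.update z c f = Poly_Mapping.single z c + f"
  by (rule poly_mapping_eqI) (auto simp: lookup_update lookup_add lookup_single in_keys_iff when_def)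

text \<open>A finitely supported function is reached from 0 by adding one term at a time. Both
  \<open>free_pairs\<close> and the free algebra on words consist of such functions, so this is
  expansion in a basis for either of them.\<close>

lemma keys_induct [consumes 1, case_names zero add]:
  fixes f :: "'a \<Rightarrow>\<^sub>0 cq"
  assumes "Poly_Mapping.keys f \<subseteq> D" and "P 0"
    and "\<And>z c f. z \<in> D \<Longrightarrow> Poly_Mapping.keys f \<subseteq> D \<Longrightarrow> P f \<Longrightarrow> P (Poly_Mapping.single z c + f)"
  shows "P f"
  using assms(1)
proof (induct f rule: update_induct)
  case const
  show ?case by (rule assms(2))
next
  case (update f a b)
  then have "a \<in> D" "Poly_Mapping.keys f \<subseteq> D"
    by (auto simp: keys_update)
  then show ?case using update by (simp add: update_eq_single_add assms(3))
qed

text \<open>The linear extension of the family \<open>b\<close> to finitely supported functions.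
  \<open>tlift\<close> evaluates pairs in this way, and a free algebra acts on a space in this
  way.\<close>

definition pev :: "'c superalg \<Rightarrow> ('z \<Rightarrow> 'c) \<Rightarrow> ('z \<Rightarrow>\<^sub>0 cq) \<Rightarrow> 'c" where
  "pev C b f = (\<Oplus>\<^bsub>C\<^esub>z\<in>Poly_Mapping.keys f. Poly_Mapping.lookup f z \<odot>\<^bsub>C\<^esub> b z)"

context vspace
begin

text \<open>The added indices carry coefficient 0. A common index set for two functions makes
  additivity a termwise statement.\<close>

lemma pev_superset:
  assumes "finite K" "Poly_Mapping.keys f \<subseteq> K" "b \<in> K \<rightarrow> carrier V"
  shows "pev V b f = (\<Oplus>z\<in>K. Poly_Mapping.lookup f z \<odot> b z)"
  unfolding pev_def
  by (rule add.finprod_mono_neutral_cong_left) (use assms in \<open>auto simp: in_keys_iff Pi_iff\<close>)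

lemma pev_cong:
  assumes "\<And>z. z \<in> Poly_Mapping.keys f \<Longrightarrow> b z = b' z" "b' \<in> Poly_Mapping.keys f \<rightarrow> carrier V"
  shows "pev V b f = pev V b' f"
  unfolding pev_def by (rule finsum_cong') (use assms in auto)

lemma pev_closed: "b \<in> Poly_Mapping.keys f \<rightarrow> carrier V \<Longrightarrow> pev V b f \<in> carrier V"
  unfolding pev_def by (rule finsum_closed) auto

lemma pev_zero [simp]: "pev V b 0 = \<zero>"
  by (simp add: pev_def finsum_empty)

lemma pev_single: "b z \<in> carrier V \<Longrightarrow> pev V b (Poly_Mapping.single z c) = c \<odot> b z"
  by (subst pev_superset[of "{z}"]) (auto simp: finsum_insert finsum_empty)

lemma pev_add:
  assumes "b \<in> Poly_Mapping.keys f \<rightarrow> carrier V" "b \<in> Poly_Mapping.keys g \<rightarrow> carrier V"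
  shows "pev V b (f + g) = pev V b f \<oplus> pev V b g"
proof -
  let ?K = "Poly_Mapping.keys f \<union> Poly_Mapping.keys g"
  have b: "b \<in> ?K \<rightarrow> carrier V" using assms by auto
  have "pev V b (f + g) = (\<Oplus>z\<in>?K. Poly_Mapping.lookup (f + g) z \<odot> b z)"
    by (rule pev_superset[OF _ keys_add b]) simp
  also have "\<dots> = (\<Oplus>z\<in>?K. Poly_Mapping.lookup f z \<odot> b z \<oplus> Poly_Mapping.lookup g z \<odot> b z)"
    by (rule finsum_cong') (use b in \<open>auto simp: lookup_add smult_add_left Pi_iff\<close>)
  also have "\<dots> = (\<Oplus>z\<in>?K. Poly_Mapping.lookup f z \<odot> b z) \<oplus> (\<Oplus>z\<in>?K. Poly_Mapping.lookup g z \<odot> b z)"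
    by (rule finsum_addf) (use b in auto)
  also have "\<dots> = pev V b f \<oplus> pev V b g"
    using b by (simp add: pev_superset[of ?K])
  finally show ?thesis .
qed

lemma pev_scale:
  assumes b: "b \<in> Poly_Mapping.keys f \<rightarrow> carrier V"
  shows "pev V b (Poly_Mapping.map ((*) c) f) = c \<odot> pev V b f"
  using b keys_scale[of c f]
  by (subst pev_superset[of "Poly_Mapping.keys f"])
     (auto simp: pev_def smult_finsum Pi_iff intro!: finsum_cong')

lemma pev_uminus:
  "b \<in> Poly_Mapping.keys f \<rightarrow> carrier V \<Longrightarrow> pev V b (- f) = \<ominus> pev V b f"
  using pev_scale[of b f "-1"] by (simp add: scale_minus_one minus_one_smult pev_closed)

lemma pev_diff:
  assumes "b \<in> Poly_Mapping.keys f \<rightarrow> carrier V" "b \<in> Poly_Mapping.keys g \<rightarrow> carrier V"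
  shows "pev V b (f - g) = pev V b f \<ominus> pev V b g"
  using pev_add[of b f "- g"] assms by (simp add: keys_uminus pev_uminus a_minus_def)

end

lemma lin_pev:
  assumes V: "vspace V" and W: "vspace W" and f: "lin V W f" and b: "b \<in> Poly_Mapping.keys p \<rightarrow> carrier V"
  shows "f (pev V b p) = pev W (\<lambda>z. f (b z)) p"
proof -
  interpret V: vspace V by fact
  interpret W: vspace W by fact
  show ?thesis using b
    by (auto simp: pev_def lin_finsum[OF V W f] Pi_iff lin_smult[OF f] intro!: W.finsum_cong' lin_closed[OF f])
qed

lemma lin_pev_param:
  assumes V: "vspace V" and W: "vspace W" and b: "\<And>z. z \<in> Poly_Mapping.keys p \<Longrightarrow> lin V W (\<lambda>x. b x z)"
  shows "lin V W (\<lambda>x. pev W (b x) p)"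
  unfolding pev_def by (rule lin_finsum_fun[OF W V]) (rule lin_scale[OF W b])

section \<open>Quotients and tensor products as vector spaces\<close>

section \<open>Quotient spaces\<close>

text \<open>In both kinds of quotient that occur, tensor spaces and presented algebras, the elements
  below are finitely supported functions with the addition of their type. Identifying
  \<open>add F\<close> and \<open>zero F\<close> with the type-class operations lets cosets be
  handled by ordinary arithmetic.\<close>

locale quot = vspace F for F :: "'a::ab_group_add superalg" (structure) +
  fixes I :: "'a set"
  assumes add_F: "add F = (+)" and zero_F: "zero F = 0" and sub: "submodule I base_field F"
begin

lemmas subE = module.submoduleE[OF module_base sub]

lemma minus_F: "x \<in> carrier F \<Longrightarrow> \<ominus> x = - x"
  using l_neg[of x] by (simp add: add_F zero_F eq_neg_iff_add_eq_0)

lemma plus_closed [simp, intro]: "x \<in> carrier F \<Longrightarrow> y \<in> carrier F \<Longrightarrow> x + y \<in> carrier F"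
  using a_closed[of x y] by (simp add: add_F)

lemma uminus_closed [simp, intro]: "x \<in> carrier F \<Longrightarrow> - x \<in> carrier F"
  using a_inv_closed[of x] by (simp add: minus_F)

lemma diff_closed [simp, intro]: "x \<in> carrier F \<Longrightarrow> y \<in> carrier F \<Longrightarrow> x - y \<in> carrier F"
  using plus_closed[of x "- y"] by simp

lemma I_sub: "x \<in> I \<Longrightarrow> x \<in> carrier F"
  using subE(1) by blast

lemma I_zero [simp, intro]: "0 \<in> I"
  using submodule.axioms(1)[OF sub] subgroup.one_closed[of I "add_monoid F"] by (simp add: zero_F)

lemma I_add: "x \<in> I \<Longrightarrow> y \<in> I \<Longrightarrow> x + y \<in> I"
  using subE(5)[of x y] by (simp add: add_F)

lemma I_uminus: "x \<in> I \<Longrightarrow> - x \<in> I"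
  using subE(3)[of x] by (simp add: minus_F I_sub)

lemma I_diff: "x \<in> I \<Longrightarrow> y \<in> I \<Longrightarrow> x - y \<in> I"
  using I_add[of x "- y"] I_uminus by simp

lemma I_smult: "x \<in> I \<Longrightarrow> c \<odot> x \<in> I"
  using subE(4)[of c x] by simp

definition pr :: "'a \<Rightarrow> 'a set" where "pr x = I +> x"

lemma pr_eq: "pr x = {h + x | h. h \<in> I}"
  by (auto simp: pr_def a_r_coset_def' add_F)

lemma mem_pr: "y \<in> pr x \<longleftrightarrow> y - x \<in> I"
  by (auto simp: pr_eq) (metis diff_add_cancel)

lemma pr_eq_iff: "pr x = pr y \<longleftrightarrow> x - y \<in> I"
proof
  assume "pr x = pr y"
  then have "x \<in> pr y" using mem_pr[of x x] by simp
  then show "x - y \<in> I" by (simp add: mem_pr)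
next
  assume *: "x - y \<in> I"
  have "z - x \<in> I \<longleftrightarrow> z - y \<in> I" for z
    using I_add[OF _ *, of "z - x"] I_diff[OF _ *, of "z - y"] by auto
  then show "pr x = pr y" by (auto simp: mem_pr)
qed

lemma zero_squot: "\<zero>\<^bsub>squot F I\<^esub> = pr 0"
  by (auto simp: squot_def FactRing_def pr_eq)

lemma pr_zero_iff: "pr x = \<zero>\<^bsub>squot F I\<^esub> \<longleftrightarrow> x \<in> I"
  using pr_eq_iff[of x 0] by (simp add: zero_squot)

lemma carrier_squot: "carrier (squot F I) = pr ` carrier F"
  by (auto simp: squot_def FactRing_def A_RCOSETS_def' pr_def)

lemma part_squot: "part (squot F I) p = pr ` part F p"
  by (auto simp: squot_def pr_def)

lemma pr_closed [simp, intro]: "x \<in> carrier F \<Longrightarrow> pr x \<in> carrier (squot F I)"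
  by (simp add: carrier_squot)

lemma add_squot: "pr x \<oplus>\<^bsub>squot F I\<^esub> pr y = pr (x + y)"
proof -
  have "pr x \<oplus>\<^bsub>squot F I\<^esub> pr y = {a + b | a b. a \<in> pr x \<and> b \<in> pr y}"
    by (auto simp: squot_def FactRing_def set_add_def' add_F)
  also have "\<dots> = pr (x + y)"
  proof (intro equalityI subsetI)
    fix z assume "z \<in> {a + b | a b. a \<in> pr x \<and> b \<in> pr y}"
    then obtain a b where z: "z = a + b" and ab: "a - x \<in> I" "b - y \<in> I" by (auto simp: mem_pr)
    show "z \<in> pr (x + y)" using I_add[OF ab] z by (simp add: mem_pr algebra_simps)
  next
    fix z assume z: "z \<in> pr (x + y)"
    have "z = (z - y) + y" "z - y \<in> pr x" "y \<in> pr y" using z by (auto simp: mem_pr algebra_simps)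
    then show "z \<in> {a + b | a b. a \<in> pr x \<and> b \<in> pr y}" by blast
  qed
  finally show ?thesis .
qed

lemma smult_squot:
  assumes x: "x \<in> carrier F" shows "c \<odot>\<^bsub>squot F I\<^esub> pr x = pr (c \<odot> x)"
proof -
  have "c \<odot>\<^bsub>squot F I\<^esub> pr x = {h + c \<odot> y | h y. h \<in> I \<and> y \<in> pr x}"
    by (auto simp: squot_def set_add_def' add_F)
  also have "\<dots> = pr (c \<odot> x)"
  proof (intro equalityI subsetI)
    fix z assume "z \<in> {h + c \<odot> y | h y. h \<in> I \<and> y \<in> pr x}"
    then obtain h k where z: "z = h + c \<odot> (k + x)" and hk: "h \<in> I" "k \<in> I" by (auto simp: pr_eq)
    have "z = (h + c \<odot> k) + c \<odot> x"
      using z smult_add_right[of k x c] I_sub[OF hk(2)] x by (simp add: add_F add.assoc)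
    then show "z \<in> pr (c \<odot> x)" using I_add[OF hk(1) I_smult[OF hk(2)]] by (auto simp: pr_eq)
  next
    fix z assume "z \<in> pr (c \<odot> x)"
    then obtain h where "z = h + c \<odot> x" "h \<in> I" by (auto simp: pr_eq)
    moreover have "x \<in> pr x" by (simp add: mem_pr)
    ultimately show "z \<in> {h + c \<odot> y | h y. h \<in> I \<and> y \<in> pr x}" by blast
  qed
  finally show ?thesis .
qed

lemma squot_cases:
  assumes "Z \<in> carrier (squot F I)" obtains f where "f \<in> carrier F" "Z = pr f"
  using assms by (auto simp: carrier_squot)

lemma zero_in_F [simp]: "0 \<in> carrier F"
  using zero_closed by (simp add: zero_F)

lemma vspace_squot: "vspace (squot F I)"
proof (rule vspace.intro, rule moduleI[OF cring_base_field])
  show "abelian_group (squot F I)"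
  proof (rule abelian_groupI)
    fix Z assume "Z \<in> carrier (squot F I)"
    then obtain f where f: "f \<in> carrier F" "Z = pr f" by (rule squot_cases)
    show "\<exists>y\<in>carrier (squot F I). y \<oplus>\<^bsub>squot F I\<^esub> Z = \<zero>\<^bsub>squot F I\<^esub>"
      by (rule bexI[of _ "pr (- f)"]) (use f in \<open>auto simp: add_squot zero_squot\<close>)
  qed (auto simp: add_squot zero_squot ac_simps elim!: squot_cases)
next
  have F: "c \<odot> (x + y) = c \<odot> x + c \<odot> y" "(c + d) \<odot> x = c \<odot> x + d \<odot> x"
    if "x \<in> carrier F" "y \<in> carrier F" for c d x y
    using that smult_add_right[of x y c] smult_add_left[of x c d] by (simp_all add: add_F)
  fix c d Z Y
  assume ZY: "Z \<in> carrier (squot F I)" "Y \<in> carrier (squot F I)"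
  from ZY(1) obtain f where f: "f \<in> carrier F" "Z = pr f" by (rule squot_cases)
  from ZY(2) obtain g where g: "g \<in> carrier F" "Y = pr g" by (rule squot_cases)
  show "c \<odot>\<^bsub>squot F I\<^esub> Z \<in> carrier (squot F I)" using f by (auto simp: smult_squot)
  show "(c \<oplus>\<^bsub>base_field\<^esub> d) \<odot>\<^bsub>squot F I\<^esub> Z = c \<odot>\<^bsub>squot F I\<^esub> Z \<oplus>\<^bsub>squot F I\<^esub> d \<odot>\<^bsub>squot F I\<^esub> Z"
    "c \<odot>\<^bsub>squot F I\<^esub> (Z \<oplus>\<^bsub>squot F I\<^esub> Y) = c \<odot>\<^bsub>squot F I\<^esub> Z \<oplus>\<^bsub>squot F I\<^esub> c \<odot>\<^bsub>squot F I\<^esub> Y"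
    "(c \<otimes>\<^bsub>base_field\<^esub> d) \<odot>\<^bsub>squot F I\<^esub> Z = c \<odot>\<^bsub>squot F I\<^esub> (d \<odot>\<^bsub>squot F I\<^esub> Z)"
    "\<one>\<^bsub>base_field\<^esub> \<odot>\<^bsub>squot F I\<^esub> Z = Z"
    using f g by (simp_all add: smult_squot add_squot F)
qed

lemma mem_squot_carrier: "f \<in> Z \<Longrightarrow> Z \<in> carrier (squot F I) \<Longrightarrow> f \<in> carrier F \<and> Z = pr f"
proof -
  assume f: "f \<in> Z" and Z: "Z \<in> carrier (squot F I)"
  obtain g where g: "g \<in> carrier F" "Z = pr g" using Z by (rule squot_cases)
  then have "f - g \<in> I" using f by (simp add: mem_pr)
  moreover from this have "f \<in> carrier F" using plus_closed[OF I_sub[OF \<open>f - g \<in> I\<close>] g(1)] by simp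
  ultimately show ?thesis using g by (simp add: pr_eq_iff[symmetric])
qed

text \<open>A coset is never empty, so the choice operator in \<open>tlift\<close> and in the
  induced homomorphisms returns a genuine representative.\<close>

lemma some_mem: "Z \<in> carrier (squot F I) \<Longrightarrow> (SOME f. f \<in> Z) \<in> carrier F \<and> Z = pr (SOME f. f \<in> Z)"
proof -
  assume Z: "Z \<in> carrier (squot F I)"
  then obtain g where "Z = pr g" by (rule squot_cases)
  then have "g \<in> Z" by (simp add: mem_pr)
  then have "(SOME f. f \<in> Z) \<in> Z" by (rule someI)
  then show ?thesis using mem_squot_carrier Z by blast
qed

end

lemma submodule_ker:
  assumes V: "vspace V" and C: "vspace C" and \<phi>: "lin V C \<phi>"
  shows "submodule {x \<in> carrier V. \<phi> x = \<zero>\<^bsub>C\<^esub>} base_field V"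
proof -
  interpret V: vspace V by fact
  interpret C: vspace C by fact
  show ?thesis
    by (rule module.submoduleI[OF V.module_base])
       (auto simp: lin_add[OF \<phi>] lin_smult[OF \<phi>] lin_minus[OF V C \<phi>] lin_zero[OF V C \<phi>])
qed

lemma submodule_subspace_gen:
  assumes V: "vspace V" and S: "S \<subseteq> carrier V"
  shows "submodule (subspace_gen V S) base_field V"
proof -
  interpret V: vspace V by fact
  note E = module.submoduleE[OF V.module_base]
  have top: "carrier V \<in> {H. submodule H base_field V \<and> S \<subseteq> H}"
    using S module.carrier_is_submodule[OF V.module_base] by auto
  have z: "\<zero>\<^bsub>V\<^esub> \<in> H" if "submodule H base_field V" for H
    using submodule.axioms(1)[OF that] subgroup.one_closed[of H "add_monoid V"] by simp
  show ?thesis unfolding subspace_gen_def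
  proof (rule module.submoduleI[OF V.module_base])
    show "\<Inter>{H. submodule H base_field V \<and> S \<subseteq> H} \<subseteq> carrier V" using top by (rule Inter_lower)
  qed (simp_all add: z E)
qed

lemma subspace_gen_least:
  "submodule H base_field V \<Longrightarrow> S \<subseteq> H \<Longrightarrow> subspace_gen V S \<subseteq> H"
  by (auto simp: subspace_gen_def)

lemma subspace_gen_incl: "S \<subseteq> subspace_gen V S"
  by (auto simp: subspace_gen_def)

text \<open>Otherwise the parity 1 would be rewritten to \<open>Suc 0\<close>.\<close>

declare One_nat_def [simp del]

section \<open>Tensor products\<close>

lemma free_pairs_simps [simp]:
  "carrier (free_pairs A B) = {f. Poly_Mapping.keys f \<subseteq> carrier A \<times> carrier B}"
  "add (free_pairs A B) = (+)" "zero (free_pairs A B) = 0"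
  "module.smult (free_pairs A B) c f = Poly_Mapping.map ((*) c) f"
  by (simp_all add: free_pairs_def)

lemma vspace_free_pairs: "vspace (free_pairs A B)"
proof (rule vspace.intro, rule moduleI[OF cring_base_field])
  show "abelian_group (free_pairs A B)"
  proof (rule abelian_groupI)
    fix f g :: "('a \<times> 'b) \<Rightarrow>\<^sub>0 cq"
    assume "f \<in> carrier (free_pairs A B)" "g \<in> carrier (free_pairs A B)"
    then show "f \<oplus>\<^bsub>free_pairs A B\<^esub> g \<in> carrier (free_pairs A B)"
      using keys_add[of f g] by auto
  next
    fix f assume f: "f \<in> carrier (free_pairs A B)"
    show "\<exists>g\<in>carrier (free_pairs A B). g \<oplus>\<^bsub>free_pairs A B\<^esub> f = \<zero>\<^bsub>free_pairs A B\<^esub>"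
      by (rule bexI[of _ "- f"]) (use f in \<open>auto simp: keys_uminus\<close>)
  qed (auto simp: ac_simps)
next
  fix c and f :: "('a \<times> 'b) \<Rightarrow>\<^sub>0 cq"
  assume "f \<in> carrier (free_pairs A B)"
  then show "c \<odot>\<^bsub>free_pairs A B\<^esub> f \<in> carrier (free_pairs A B)"
    using keys_scale[of c f] by auto
qed (auto intro!: poly_mapping_eqI simp: lookup_add algebra_simps)

locale tens = A: vspace A + B: vspace B for A :: "'a superalg" and B :: "'b superalg"
begin

lemma bilinear_rels_carrier: "bilinear_rels A B \<subseteq> carrier (free_pairs A B)"
proof -
  have k: "f - g \<in> carrier (free_pairs A B)"
    if "f \<in> carrier (free_pairs A B)" "g \<in> carrier (free_pairs A B)" for f g
    using that keys_add[of f "- g"] by (auto simp: keys_uminus)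
  have s: "Poly_Mapping.single (x, y) c \<in> carrier (free_pairs A B)"
    if "x \<in> carrier A" "y \<in> carrier B" for x y c using that by auto
  show ?thesis unfolding bilinear_rels_def Let_def
    by (intro Un_least subsetI; elim CollectE exE conjE; hypsubst; intro k s; simp)
qed

sublocale Q: quot "free_pairs A B" "tens_null A B"
  by (intro quot.intro quot_axioms.intro vspace_free_pairs)
     (simp_all only: tens_null_def free_pairs_simps submodule_subspace_gen[OF vspace_free_pairs bilinear_rels_carrier])

lemma squot_eq: "squot (free_pairs A B) (tens_null A B) = tens_space A B"
  by (simp add: tens_space_def)

sublocale T: vspace "tens_space A B"
  using Q.vspace_squot by (simp add: squot_eq)

lemmas T_simps = Q.carrier_squot[unfolded squot_eq] Q.zero_squot[unfolded squot_eq]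
  Q.add_squot[unfolded squot_eq] Q.smult_squot[unfolded squot_eq]

lemma tpure_pr: "tpure A B x y = Q.pr (Poly_Mapping.single (x, y) 1)"
  by (simp add: tpure_def Q.pr_def)

lemma rel_null: "r \<in> bilinear_rels A B \<Longrightarrow> r \<in> tens_null A B"
  unfolding tens_null_def by (rule subsetD[OF subspace_gen_incl])

lemma tpure_closed [simp, intro]:
  "x \<in> carrier A \<Longrightarrow> y \<in> carrier B \<Longrightarrow> tpure A B x y \<in> carrier (tens_space A B)"
  by (auto simp: tpure_pr T_simps intro!: imageI)

lemma pr_single:
  assumes "x \<in> carrier A" "y \<in> carrier B"
  shows "Q.pr (Poly_Mapping.single (x, y) c) = c \<odot>\<^bsub>tens_space A B\<^esub> tpure A B x y"
  using assms by (simp add: tpure_pr T_simps)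

lemma tpure_add_left:
  assumes "x \<in> carrier A" "x' \<in> carrier A" "y \<in> carrier B"
  shows "tpure A B (x \<oplus>\<^bsub>A\<^esub> x') y = tpure A B x y \<oplus>\<^bsub>tens_space A B\<^esub> tpure A B x' y"
  unfolding tpure_pr T_simps(3) Q.pr_eq_iff diff_diff_eq[symmetric]
  by (rule rel_null, unfold bilinear_rels_def Let_def, rule UnI1, rule UnI1, rule UnI1, rule CollectI,
      (rule exI)+, rule conjI, rule refl, simp add: assms)

lemma tpure_add_right:
  assumes "x \<in> carrier A" "y \<in> carrier B" "y' \<in> carrier B"
  shows "tpure A B x (y \<oplus>\<^bsub>B\<^esub> y') = tpure A B x y \<oplus>\<^bsub>tens_space A B\<^esub> tpure A B x y'"
  unfolding tpure_pr T_simps(3) Q.pr_eq_iff diff_diff_eq[symmetric]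
  by (rule rel_null, unfold bilinear_rels_def Let_def, rule UnI1, rule UnI1, rule UnI2, rule CollectI,
      (rule exI)+, rule conjI, rule refl, simp add: assms)

lemma tpure_smult_left:
  assumes "x \<in> carrier A" "y \<in> carrier B"
  shows "tpure A B (c \<odot>\<^bsub>A\<^esub> x) y = c \<odot>\<^bsub>tens_space A B\<^esub> tpure A B x y"
  unfolding pr_single[OF assms, symmetric] unfolding tpure_pr Q.pr_eq_iff
  by (rule rel_null, unfold bilinear_rels_def Let_def, rule UnI1, rule UnI2, rule CollectI,
      (rule exI)+, rule conjI, rule refl, simp add: assms)

lemma tpure_smult_right:
  assumes "x \<in> carrier A" "y \<in> carrier B"
  shows "tpure A B x (c \<odot>\<^bsub>B\<^esub> y) = c \<odot>\<^bsub>tens_space A B\<^esub> tpure A B x y"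
  unfolding pr_single[OF assms, symmetric] unfolding tpure_pr Q.pr_eq_iff
  by (rule rel_null, unfold bilinear_rels_def Let_def, rule UnI2, rule CollectI,
      (rule exI)+, rule conjI, rule refl, simp add: assms)

lemma bilin_tpure: "bilin A B (tens_space A B) (tpure A B)"
  by (intro bilinI linI)
     (auto simp: tpure_add_left tpure_add_right tpure_smult_left tpure_smult_right)

text \<open>There is no scalar case, since a scalar multiple of a pure tensor is pure: the scalar
  moves into the left entry.\<close>

lemma tens_induct [consumes 1, case_names tpure add]:
  assumes Z: "Z \<in> carrier (tens_space A B)"
    and pure: "\<And>x y. x \<in> carrier A \<Longrightarrow> y \<in> carrier B \<Longrightarrow> P (tpure A B x y)"
    and add: "\<And>Z W. Z \<in> carrier (tens_space A B) \<Longrightarrow> W \<in> carrier (tens_space A B) \<Longrightarrow> P Z \<Longrightarrow> P W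
      \<Longrightarrow> P (Z \<oplus>\<^bsub>tens_space A B\<^esub> W)"
  shows "P Z"
proof -
  obtain f where f: "Poly_Mapping.keys f \<subseteq> carrier A \<times> carrier B" "Z = Q.pr f"
    using Z by (auto simp: T_simps)
  have P_scale: "P (c \<odot>\<^bsub>tens_space A B\<^esub> tpure A B x y)" if "x \<in> carrier A" "y \<in> carrier B" for c x y
    using pure[of "c \<odot>\<^bsub>A\<^esub> x" y] that by (simp add: tpure_smult_left)
  from f(1) have "P (Q.pr f)"
  proof (induct f rule: keys_induct)
    case zero
    show ?case using P_scale[of "\<zero>\<^bsub>A\<^esub>" "\<zero>\<^bsub>B\<^esub>" 0] by (simp add: T_simps(2))
  next
    case (add z c f)
    then have z: "fst z \<in> carrier A" "snd z \<in> carrier B" by auto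
    have "Q.pr (Poly_Mapping.single z c + f)
        = c \<odot>\<^bsub>tens_space A B\<^esub> tpure A B (fst z) (snd z) \<oplus>\<^bsub>tens_space A B\<^esub> Q.pr f"
      using pr_single[OF z, of c] by (simp add: T_simps(3)[symmetric])
    then show ?case
      using add z by (auto intro!: assms(3) P_scale simp: T_simps(1) imageI)
  qed
  with f(2) show ?thesis by simp
qed

lemma lin_eqI:
  assumes C: "vspace C" and fg: "lin (tens_space A B) C f" "lin (tens_space A B) C g"
    and eq: "\<And>x y. x \<in> carrier A \<Longrightarrow> y \<in> carrier B \<Longrightarrow> f (tpure A B x y) = g (tpure A B x y)"
    and Z: "Z \<in> carrier (tens_space A B)"
  shows "f Z = g Z"
  using Z by (induct Z rule: tens_induct) (auto simp: eq lin_add[OF fg(1)] lin_add[OF fg(2)])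

text \<open>The linear extension of \<beta> to \<open>free_pairs\<close> kills the bilinear
  relations. Its kernel is a subspace, so it contains the generated subspace
  \<open>tens_null\<close>; hence the representative chosen inside \<open>tlift\<close> may be
  replaced by any other one.\<close>

lemma tlift_pr:
  assumes C: "vspace C" and \<beta>: "bilin A B C \<beta>" and f: "f \<in> carrier (free_pairs A B)"
  shows "tlift C \<beta> (Q.pr f) = pev C (\<lambda>z. \<beta> (fst z) (snd z)) f"
proof -
  interpret C: vspace C by fact
  let ?b = "\<lambda>z. \<beta> (fst z) (snd z)"
  note cl = bilin_closed[OF \<beta>]
  have b: "?b \<in> Poly_Mapping.keys g \<rightarrow> carrier C" if "g \<in> carrier (free_pairs A B)" for g
    using that by (force intro!: cl)
  have e: "Poly_Mapping.single (x, y) c \<in> carrier (free_pairs A B)"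
    if "x \<in> carrier A" "y \<in> carrier B" for x y c using that by auto
  have pe: "pev C ?b (Poly_Mapping.single (x, y) c) = c \<odot>\<^bsub>C\<^esub> \<beta> x y"
    if "x \<in> carrier A" "y \<in> carrier B" for x y c
    using that by (subst C.pev_single) (auto intro: cl)
  have pd: "pev C ?b (f - g - h) = pev C ?b f \<ominus>\<^bsub>C\<^esub> pev C ?b g \<ominus>\<^bsub>C\<^esub> pev C ?b h"
    if "f \<in> carrier (free_pairs A B)" "g \<in> carrier (free_pairs A B)" "h \<in> carrier (free_pairs A B)" for f g h
    using that b Q.diff_closed by (simp add: C.pev_diff del: free_pairs_simps(1))
  have lin: "lin (free_pairs A B) C (pev C ?b)"
    by (rule linI) (use b in \<open>auto intro!: C.pev_closed C.pev_add C.pev_scale\<close>)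
  have "bilinear_rels A B \<subseteq> {f \<in> carrier (free_pairs A B). pev C ?b f = \<zero>\<^bsub>C\<^esub>}"
  proof
    fix r assume r: "r \<in> bilinear_rels A B"
    have "pev C ?b r = \<zero>\<^bsub>C\<^esub>"
      using r[unfolded bilinear_rels_def Let_def]
    proof (elim UnE CollectE exE conjE)
      fix x x' y
      assume "r = Poly_Mapping.single (x \<oplus>\<^bsub>A\<^esub> x', y) 1 - Poly_Mapping.single (x, y) 1 - Poly_Mapping.single (x', y) 1"
        and xy: "x \<in> carrier A" "x' \<in> carrier A" "y \<in> carrier B"
      then show ?thesis
        by (simp add: pd[OF e e e] pe cl lin_add[OF bilin_left[OF \<beta>]] a_minus_def C.minus_add C.a_ac C.r_neg)
    next
      fix x y y'
      assume "r = Poly_Mapping.single (x, y \<oplus>\<^bsub>B\<^esub> y') 1 - Poly_Mapping.single (x, y) 1 - Poly_Mapping.single (x, y') 1"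
        and xy: "x \<in> carrier A" "y \<in> carrier B" "y' \<in> carrier B"
      then show ?thesis
        by (simp add: pd[OF e e e] pe cl lin_add[OF bilin_right[OF \<beta>]] a_minus_def C.minus_add C.a_ac C.r_neg)
    next
      fix c x y
      assume "r = Poly_Mapping.single (c \<odot>\<^bsub>A\<^esub> x, y) 1 - Poly_Mapping.single (x, y) c"
        and xy: "x \<in> carrier A" "y \<in> carrier B"
      then show ?thesis
        by (simp add: C.pev_diff[OF b b, OF e e] pe cl lin_smult[OF bilin_left[OF \<beta>]] a_minus_def C.r_neg)
    next
      fix c x y
      assume "r = Poly_Mapping.single (x, c \<odot>\<^bsub>B\<^esub> y) 1 - Poly_Mapping.single (x, y) c"
        and xy: "x \<in> carrier A" "y \<in> carrier B"
      then show ?thesis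
        by (simp add: C.pev_diff[OF b b, OF e e] pe cl lin_smult[OF bilin_right[OF \<beta>]] a_minus_def C.r_neg)
    qed
    with r bilinear_rels_carrier show "r \<in> {f \<in> carrier (free_pairs A B). pev C ?b f = \<zero>\<^bsub>C\<^esub>}" by blast
  qed
  then have null: "tens_null A B \<subseteq> {f \<in> carrier (free_pairs A B). pev C ?b f = \<zero>\<^bsub>C\<^esub>}"
    unfolding tens_null_def
    by (rule subspace_gen_least[OF submodule_ker[OF vspace_free_pairs C lin]])
  define g where "g = (SOME g. g \<in> Q.pr f)"
  have g: "g \<in> carrier (free_pairs A B)" "Q.pr f = Q.pr g"
    using Q.some_mem[of "Q.pr f"] Q.pr_closed[OF f] by (auto simp: g_def)
  have "f - g \<in> tens_null A B" using g(2) by (simp add: Q.pr_eq_iff)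
  then have "pev C ?b (f - g) = \<zero>\<^bsub>C\<^esub>" using null by blast
  then have "pev C ?b f \<oplus>\<^bsub>C\<^esub> \<ominus>\<^bsub>C\<^esub> pev C ?b g = \<zero>\<^bsub>C\<^esub>"
    using f g(1) b by (simp add: C.pev_diff a_minus_def del: free_pairs_simps(1))
  then have "\<ominus>\<^bsub>C\<^esub> (\<ominus>\<^bsub>C\<^esub> pev C ?b g) = pev C ?b f"
    using f g(1) b by (intro C.minus_equality) (auto intro!: C.pev_closed simp del: free_pairs_simps(1))
  then have "pev C ?b f = pev C ?b g"
    using C.pev_closed[OF b[OF g(1)]] by simp
  then show ?thesis by (simp add: tlift_def Let_def g_def pev_def)
qed

lemma tlift_tpure:
  assumes "vspace C" "bilin A B C \<beta>" "x \<in> carrier A" "y \<in> carrier B"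
  shows "tlift C \<beta> (tpure A B x y) = \<beta> x y"
proof -
  interpret C: vspace C by fact
  show ?thesis using assms(3,4) bilin_closed[OF assms(2-4)]
    by (simp add: tpure_pr tlift_pr[OF assms(1,2)] C.pev_single)
qed

lemma lin_tlift:
  assumes C: "vspace C" and \<beta>: "bilin A B C \<beta>"
  shows "lin (tens_space A B) C (tlift C \<beta>)"
proof -
  interpret C: vspace C by fact
  have b: "(\<lambda>z. \<beta> (fst z) (snd z)) \<in> Poly_Mapping.keys g \<rightarrow> carrier C"
    if "g \<in> carrier (free_pairs A B)" for g
    using that by (force intro!: bilin_closed[OF \<beta>])
  have cl: "f + g \<in> carrier (free_pairs A B)" "Poly_Mapping.map ((*) c) f \<in> carrier (free_pairs A B)"
    if "f \<in> carrier (free_pairs A B)" "g \<in> carrier (free_pairs A B)" for f g c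
    using that Q.plus_closed[of f g] Q.smult_cl[of f c] by auto
  show ?thesis
  proof (rule linI)
    fix Z W assume "Z \<in> carrier (tens_space A B)" "W \<in> carrier (tens_space A B)"
    then obtain f g where fg: "f \<in> carrier (free_pairs A B)" "Z = Q.pr f" "g \<in> carrier (free_pairs A B)" "W = Q.pr g"
      unfolding T_simps(1) by blast
    show "tlift C \<beta> Z \<in> carrier C"
      using fg b by (simp add: tlift_pr[OF C \<beta>] C.pev_closed del: free_pairs_simps(1))
    show "tlift C \<beta> (Z \<oplus>\<^bsub>tens_space A B\<^esub> W) = tlift C \<beta> Z \<oplus>\<^bsub>C\<^esub> tlift C \<beta> W"
      using fg b cl by (simp add: T_simps(3) tlift_pr[OF C \<beta>] C.pev_add del: free_pairs_simps(1))
    show "tlift C \<beta> (c \<odot>\<^bsub>tens_space A B\<^esub> Z) = c \<odot>\<^bsub>C\<^esub> tlift C \<beta> Z" for c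
      using fg b cl by (simp add: T_simps(4) tlift_pr[OF C \<beta>] C.pev_scale del: free_pairs_simps(1))
  qed
qed

lemma some_keys:
  assumes "Z \<in> carrier (tens_space A B)" "z \<in> Poly_Mapping.keys (SOME f. f \<in> Z)"
  shows "fst z \<in> carrier A \<and> snd z \<in> carrier B"
  using Q.some_mem[of Z] assms by (fastforce simp: squot_eq)

text \<open>\<open>tlift\<close> evaluates one fixed representative, so it commutes with operations on the map
  even where that map is not bilinear.\<close>

lemma tlift_closed:
  assumes "vspace C" and "\<And>x y. x \<in> carrier A \<Longrightarrow> y \<in> carrier B \<Longrightarrow> \<beta> x y \<in> carrier C"
    and "Z \<in> carrier (tens_space A B)"
  shows "tlift C \<beta> Z \<in> carrier C"
  unfolding tlift_def Let_def pev_def[symmetric]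
  by (rule vspace.pev_closed[OF assms(1)]) (use some_keys[OF assms(3)] assms(2) in blast)

lemma tlift_cong:
  assumes "vspace C" "Z \<in> carrier (tens_space A B)"
    and "\<And>x y. x \<in> carrier A \<Longrightarrow> y \<in> carrier B \<Longrightarrow> \<beta> x y = \<gamma> x y"
    and "\<And>x y. x \<in> carrier A \<Longrightarrow> y \<in> carrier B \<Longrightarrow> \<gamma> x y \<in> carrier C"
  shows "tlift C \<beta> Z = tlift C \<gamma> Z"
  unfolding tlift_def Let_def
  by (fold pev_def[of C "\<lambda>z. \<beta> (fst z) (snd z)"] pev_def[of C "\<lambda>z. \<gamma> (fst z) (snd z)"],
      rule vspace.pev_cong[OF assms(1)]) (use some_keys[OF assms(2)] assms(3,4) in blast)+

lemma lin_comp_tlift: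
  assumes "vspace C" "vspace D" "lin C D g" "Z \<in> carrier (tens_space A B)"
    and "\<And>x y. x \<in> carrier A \<Longrightarrow> y \<in> carrier B \<Longrightarrow> \<beta> x y \<in> carrier C"
  shows "g (tlift C \<beta> Z) = tlift D (\<lambda>x y. g (\<beta> x y)) Z"
  unfolding tlift_def Let_def
  by (fold pev_def[of C "\<lambda>z. \<beta> (fst z) (snd z)"] pev_def[of D "\<lambda>z. g (\<beta> (fst z) (snd z))"],
      rule lin_pev[OF assms(1-3)]) (use some_keys[OF assms(4)] assms(5) in blast)

lemma lin_tlift_param:
  assumes "vspace P" "vspace C" "Z \<in> carrier (tens_space A B)"
    and "\<And>x y. x \<in> carrier A \<Longrightarrow> y \<in> carrier B \<Longrightarrow> lin P C (\<lambda>p. \<beta> p x y)"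
  shows "lin P C (\<lambda>p. tlift C (\<beta> p) Z)"
proof -
  have "lin P C (\<lambda>p. pev C (\<lambda>z. \<beta> p (fst z) (snd z)) (SOME f. f \<in> Z))"
    by (rule lin_pev_param[OF assms(1,2)]) (use some_keys[OF assms(3)] assms(4) in blast)
  then show ?thesis by (simp add: tlift_def Let_def pev_def)
qed

end

section \<open>Gradings, and the tensor product of superalgebras\<close>

section \<open>Parities\<close>

locale superspc = vspace V for V :: "'a superalg" (structure) +
  assumes ss: "superspace V"
begin

lemma submod_part: "p \<in> {0, 1} \<Longrightarrow> submodule (part V p) base_field V"
  using ss by (auto simp: superspace_def)

lemma part_closed: "p \<in> {0, 1} \<Longrightarrow> x \<in> part V p \<Longrightarrow> x \<in> carrier V"
  using module.submoduleE(1)[OF module_base submod_part] by blast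

lemma part_zero [simp]: "p \<in> {0, 1} \<Longrightarrow> \<zero> \<in> part V p"
  using submodule.axioms(1)[OF submod_part] subgroup.one_closed[of "part V p" "add_monoid V"] by force

lemma part_add: "p \<in> {0, 1} \<Longrightarrow> x \<in> part V p \<Longrightarrow> y \<in> part V p \<Longrightarrow> x \<oplus> y \<in> part V p"
  using module.submoduleE(5)[OF module_base submod_part] by blast

lemma part_smult: "p \<in> {0, 1} \<Longrightarrow> x \<in> part V p \<Longrightarrow> c \<odot> x \<in> part V p"
  using module.submoduleE(4)[OF module_base submod_part, of p c x] by simp

lemma part_unique:
  assumes "a \<in> part V 0" "b \<in> part V 1" "a' \<in> part V 0" "b' \<in> part V 1" "a \<oplus> b = a' \<oplus> b'"
  shows "a = a' \<and> b = b'"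
proof -
  have ex: "\<exists>!yz. yz \<in> part V 0 \<times> part V 1 \<and> a \<oplus> b = fst yz \<oplus> snd yz"
  proof -
    have "a \<oplus> b \<in> carrier V" using assms part_closed by auto
    then show ?thesis using ss unfolding superspace_def by blast
  qed
  then obtain u where u: "\<And>yz. yz \<in> part V 0 \<times> part V 1 \<Longrightarrow> a \<oplus> b = fst yz \<oplus> snd yz \<Longrightarrow> yz = u"
    by (elim ex1E) blast
  have "(a, b) = u" "(a', b') = u" by (rule u; use assms in simp)+
  then have "(a, b) = (a', b')" by metis
  then show ?thesis by simp
qed

lemma hcomp_eq:
  assumes "a \<in> part V 0" "b \<in> part V 1" "x = a \<oplus> b"
  shows "hcomp V 0 x = a" "hcomp V 1 x = b"
proof -
  have c: "a \<in> carrier V" "b \<in> carrier V" using assms part_closed by auto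
  show "hcomp V 0 x = a" unfolding hcomp_def
    by (rule the_equality) (use assms part_unique in auto)
  have *: "z \<oplus> y = y \<oplus> z" if "y \<in> part V 0" "z \<in> part V 1" for y z
    using that part_closed[of 0] part_closed[of 1] by (simp add: a_comm)
  show "hcomp V 1 x = b" unfolding hcomp_def
  proof (rule the_equality)
    show "b \<in> part V 1 \<and> (\<exists>z\<in>part V (1 - 1). x = b \<oplus> z)" using assms * by auto
  next
    fix y assume "y \<in> part V 1 \<and> (\<exists>z\<in>part V (1 - 1). x = y \<oplus> z)"
    then obtain z where "y \<in> part V 1" "z \<in> part V 0" "x = z \<oplus> y" using * by auto
    then show "y = b" using part_unique assms by blast
  qed
qed

lemma decomp:
  assumes "x \<in> carrier V" obtains a b where "a \<in> part V 0" "b \<in> part V 1" "x = a \<oplus> b"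
proof -
  have "\<exists>!yz. yz \<in> part V 0 \<times> part V 1 \<and> x = fst yz \<oplus> snd yz"
    using ss assms unfolding superspace_def by blast
  then obtain yz where "yz \<in> part V 0 \<times> part V 1" "x = fst yz \<oplus> snd yz" by (elim ex1E conjE)
  then show thesis using that[of "fst yz" "snd yz"] by (simp add: mem_Times_iff)
qed

lemma hcomp_part: "p \<in> {0, 1} \<Longrightarrow> x \<in> carrier V \<Longrightarrow> hcomp V p x \<in> part V p"
  by (erule decomp) (auto simp: hcomp_eq)

lemma hcomp_closed [simp, intro]: "p \<in> {0, 1} \<Longrightarrow> x \<in> carrier V \<Longrightarrow> hcomp V p x \<in> carrier V"
  using hcomp_part part_closed by blast

lemma hcomp_hom:
  assumes "p \<in> {0, 1}" "r \<in> {0, 1}" "x \<in> part V r" shows "hcomp V p x = (if p = r then x else \<zero>)"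
proof -
  have c: "x \<in> carrier V" using assms part_closed by auto
  have "r = 0 \<or> r = 1" using assms by auto
  then show ?thesis
  proof
    assume "r = 0" then show ?thesis using assms c hcomp_eq[of x "\<zero>" x] by auto
  next
    assume "r = 1" then show ?thesis using assms c hcomp_eq[of "\<zero>" x x] by auto
  qed
qed

lemma lin_hcomp: assumes "p \<in> {0, 1}" shows "lin V V (hcomp V p)"
proof (rule linI)
  fix x assume x: "x \<in> carrier V"
  then show "hcomp V p x \<in> carrier V" using assms by simp
  obtain a b where ab: "a \<in> part V 0" "b \<in> part V 1" "x = a \<oplus> b" using x by (rule decomp)
  then have abc: "a \<in> carrier V" "b \<in> carrier V" using part_closed by auto
  show "hcomp V p (c \<odot> x) = c \<odot> hcomp V p x" for c
    using assms ab abc hcomp_eq[of "c \<odot> a" "c \<odot> b" "c \<odot> x"] hcomp_eq[OF ab]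
    by (auto simp: part_smult smult_add_right)
  fix y assume y: "y \<in> carrier V"
  obtain d e where de: "d \<in> part V 0" "e \<in> part V 1" "y = d \<oplus> e" using y by (rule decomp)
  then have dec: "d \<in> carrier V" "e \<in> carrier V" using part_closed by auto
  have "x \<oplus> y = (a \<oplus> d) \<oplus> (b \<oplus> e)" using ab de abc dec by (simp add: a_ac)
  then show "hcomp V p (x \<oplus> y) = hcomp V p x \<oplus> hcomp V p y"
    using assms ab de hcomp_eq[of "a \<oplus> d" "b \<oplus> e" "x \<oplus> y"] hcomp_eq[OF ab] hcomp_eq[OF de]
    by (auto simp: part_add)
qed

end

lemma superspcI: "superspace V \<Longrightarrow> superspc V"
  by (simp add: superspc_def superspc_axioms_def vspace_def superspace_def)

lemma koszul_sum_eq: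
  assumes C: "vspace C" and g: "\<And>p r. p \<in> {0, 1} \<Longrightarrow> r \<in> {0, 1} \<Longrightarrow> g p r \<in> carrier C"
  shows "koszul_sum C g = (g 0 0 \<oplus>\<^bsub>C\<^esub> g 0 1) \<oplus>\<^bsub>C\<^esub> (g 1 0 \<oplus>\<^bsub>C\<^esub> (-1) \<odot>\<^bsub>C\<^esub> g 1 1)"
proof -
  interpret C: vspace C by fact
  have inner: "(\<Oplus>\<^bsub>C\<^esub>r\<in>{0, 1}. ((-1) ^ (p * r)) \<odot>\<^bsub>C\<^esub> g p r) = g p 0 \<oplus>\<^bsub>C\<^esub> ((-1) ^ p) \<odot>\<^bsub>C\<^esub> g p 1"
    if "p \<in> {0, 1}" for p
    by (subst finsum_pair) (use that in \<open>auto simp: g C.abelian_monoid_axioms\<close>)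
  have "koszul_sum C g = (\<Oplus>\<^bsub>C\<^esub>p\<in>{0, 1}. g p 0 \<oplus>\<^bsub>C\<^esub> ((-1) ^ p) \<odot>\<^bsub>C\<^esub> g p 1)"
    unfolding koszul_sum_def by (rule C.finsum_cong') (use inner g in auto)
  also have "\<dots> = (g 0 0 \<oplus>\<^bsub>C\<^esub> g 0 1) \<oplus>\<^bsub>C\<^esub> (g 1 0 \<oplus>\<^bsub>C\<^esub> (-1) \<odot>\<^bsub>C\<^esub> g 1 1)"
    by (subst finsum_pair) (use g in \<open>auto simp: C.abelian_monoid_axioms\<close>)
  finally show ?thesis .
qed

lemma koszul_sum_closed:
  assumes C: "vspace C" and g: "\<And>p r. p \<in> {0, 1} \<Longrightarrow> r \<in> {0, 1} \<Longrightarrow> g p r \<in> carrier C"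
  shows "koszul_sum C g \<in> carrier C"
proof -
  interpret C: vspace C by fact
  show ?thesis by (subst koszul_sum_eq[OF C g]) (auto simp: g)
qed

lemma lin_koszul_sum:
  assumes C: "vspace C" and D: "vspace D" and f: "lin C D f"
    and g: "\<And>p r. p \<in> {0, 1} \<Longrightarrow> r \<in> {0, 1} \<Longrightarrow> g p r \<in> carrier C"
  shows "f (koszul_sum C g) = koszul_sum D (\<lambda>p r. f (g p r))"
proof -
  interpret C: vspace C by fact
  interpret D: vspace D by fact
  show ?thesis
    by (subst koszul_sum_eq[OF C], erule (1) g, subst koszul_sum_eq[OF D])
       (auto simp: lin_closed[OF f] g lin_add[OF f] lin_smult[OF f])
qed

lemma lin_koszul_sum_param:
  assumes C: "vspace C" and V: "vspace V"
    and g: "\<And>p r. p \<in> {0, 1} \<Longrightarrow> r \<in> {0, 1} \<Longrightarrow> lin V C (\<lambda>x. g x p r)"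
  shows "lin V C (\<lambda>x. koszul_sum C (g x))"
  unfolding koszul_sum_def
  by (intro lin_finsum_fun[OF C V] lin_scale[OF C] g)

text \<open>This is the case of homogeneous arguments: all components but one vanish, and the sum
  turns back into a single Koszul sign.\<close>

lemma koszul_sum_single:
  assumes C: "vspace C" and pr: "p0 \<in> {0, 1}" "r0 \<in> {0, 1}"
    and g: "\<And>p r. p \<in> {0, 1} \<Longrightarrow> r \<in> {0, 1} \<Longrightarrow> g p r \<in> carrier C"
    and z: "\<And>p r. p \<in> {0, 1} \<Longrightarrow> r \<in> {0, 1} \<Longrightarrow> p \<noteq> p0 \<or> r \<noteq> r0 \<Longrightarrow> g p r = \<zero>\<^bsub>C\<^esub>"
  shows "koszul_sum C g = ((-1) ^ (p0 * r0)) \<odot>\<^bsub>C\<^esub> g p0 r0"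
proof -
  interpret C: vspace C by fact
  have eq: "koszul_sum C g = (g 0 0 \<oplus>\<^bsub>C\<^esub> g 0 1) \<oplus>\<^bsub>C\<^esub> (g 1 0 \<oplus>\<^bsub>C\<^esub> (-1) \<odot>\<^bsub>C\<^esub> g 1 1)"
    by (rule koszul_sum_eq[OF C]) (rule g)
  have "p0 = 0 \<or> p0 = 1" "r0 = 0 \<or> r0 = 1" using pr by auto
  then show ?thesis
    by (elim disjE; simp add: eq g z)
qed

lemma koszul_sum_cong:
  "(\<And>p r. p \<in> {0, 1} \<Longrightarrow> r \<in> {0, 1} \<Longrightarrow> g p r = h p r) \<Longrightarrow> vspace C \<Longrightarrow>
   (\<And>p r. p \<in> {0, 1} \<Longrightarrow> r \<in> {0, 1} \<Longrightarrow> h p r \<in> carrier C) \<Longrightarrow> koszul_sum C g = koszul_sum C h"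
  by (subst (1 2) koszul_sum_eq) auto

locale stens = A: superspc A + B: superspc B for A :: "'a superalg" and B :: "'b superalg"

sublocale stens \<subseteq> tens A B ..

context stens
begin

definition homkeys :: "nat \<Rightarrow> ('a \<times> 'b) set" where
  "homkeys p = {z. \<exists>i\<in>{0, 1}. \<exists>j\<in>{0, 1}. fst z \<in> part A i \<and> snd z \<in> part B j \<and> (i + j) mod 2 = p}"

lemma part_free_pairs: "part (free_pairs A B) p = {f. Poly_Mapping.keys f \<subseteq> homkeys p}"
  by (auto simp: free_pairs_def homkeys_def)

lemma part_tens: "part (tens_space A B) p = Q.pr ` {f. Poly_Mapping.keys f \<subseteq> homkeys p}"
  using Q.part_squot by (simp add: squot_eq part_free_pairs)

lemma homkeys_carrier: "homkeys p \<subseteq> carrier A \<times> carrier B"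
proof
  fix z assume "z \<in> homkeys p"
  then obtain i j where "i \<in> {0, 1}" "j \<in> {0, 1}" "fst z \<in> part A i" "snd z \<in> part B j"
    by (auto simp: homkeys_def)
  then show "z \<in> carrier A \<times> carrier B"
    using A.part_closed[of i "fst z"] B.part_closed[of j "snd z"] by (simp add: mem_Times_iff)
qed

lemma part_tens_carrier: "part (tens_space A B) p \<subseteq> carrier (tens_space A B)"
  unfolding part_tens T_simps(1) using homkeys_carrier[of p] by (intro image_mono) auto

lemma tpure_part:
  assumes "i \<in> {0, 1}" "j \<in> {0, 1}" "x \<in> part A i" "y \<in> part B j" "(i + j) mod 2 = p"
  shows "tpure A B x y \<in> part (tens_space A B) p"
  unfolding part_tens tpure_pr by (rule imageI) (use assms in \<open>auto simp: homkeys_def\<close>)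

lemma part_tens_add:
  assumes "Z \<in> part (tens_space A B) p" "W \<in> part (tens_space A B) p"
  shows "Z \<oplus>\<^bsub>tens_space A B\<^esub> W \<in> part (tens_space A B) p"
proof -
  obtain f g where fg: "Z = Q.pr f" "W = Q.pr g"
      "Poly_Mapping.keys f \<subseteq> homkeys p" "Poly_Mapping.keys g \<subseteq> homkeys p"
    using assms unfolding part_tens by blast
  have "Poly_Mapping.keys (f + g) \<subseteq> homkeys p" using fg(3,4) keys_add[of f g] by blast
  then show ?thesis unfolding fg(1,2) T_simps(3) part_tens by blast
qed

lemma part_tens_smult:
  assumes "Z \<in> part (tens_space A B) p"
  shows "c \<odot>\<^bsub>tens_space A B\<^esub> Z \<in> part (tens_space A B) p"
proof -
  obtain f where f: "Z = Q.pr f" "Poly_Mapping.keys f \<subseteq> homkeys p"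
    using assms unfolding part_tens by blast
  have "f \<in> carrier (free_pairs A B)" using f(2) homkeys_carrier by auto
  then have "c \<odot>\<^bsub>tens_space A B\<^esub> Z = Q.pr (Poly_Mapping.map ((*) c) f)"
    unfolding f(1) by (simp only: T_simps(4) free_pairs_simps(4))
  moreover have "Poly_Mapping.keys (Poly_Mapping.map ((*) c) f) \<subseteq> homkeys p"
    using f(2) keys_scale[of c f] by blast
  ultimately show ?thesis unfolding part_tens by blast
qed

lemma part_tens_zero: "\<zero>\<^bsub>tens_space A B\<^esub> \<in> part (tens_space A B) p"
  unfolding part_tens T_simps(2) by auto

lemma submodule_part_tens: "submodule (part (tens_space A B) p) base_field (tens_space A B)"
  by (rule module.submoduleI[OF T.module_base])
     (use part_tens_carrier part_tens_zero part_tens_add part_tens_smult[of _ _ "-1"] part_tens_smult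
      in \<open>auto simp: subset_iff T.minus_one_smult[symmetric]\<close>)

lemma part_tens_finsum:
  assumes "\<And>i. i \<in> I \<Longrightarrow> g i \<in> part (tens_space A B) p"
  shows "(\<Oplus>\<^bsub>tens_space A B\<^esub>i\<in>I. g i) \<in> part (tens_space A B) p"
  using assms
proof (induct I rule: infinite_finite_induct)
  case (insert i I)
  then have "g \<in> I \<rightarrow> carrier (tens_space A B)" "g i \<in> carrier (tens_space A B)"
    using part_tens_carrier by auto
  with insert show ?case by (simp add: T.finsum_insert part_tens_add)
qed (simp_all add: T.finsum_infinite T.finsum_empty part_tens_zero)

text \<open>A scalar can be absorbed into the left entry without leaving its part, so homogeneous
  pure tensors and sums are the only cases.\<close>

lemma part_tens_induct [consumes 1, case_names tpure add]:
  assumes Z: "Z \<in> part (tens_space A B) p"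
    and pure: "\<And>x y i j. i \<in> {0, 1} \<Longrightarrow> j \<in> {0, 1} \<Longrightarrow> x \<in> part A i \<Longrightarrow> y \<in> part B j \<Longrightarrow>
      (i + j) mod 2 = p \<Longrightarrow> P (tpure A B x y)"
    and add: "\<And>Z W. Z \<in> part (tens_space A B) p \<Longrightarrow> W \<in> part (tens_space A B) p \<Longrightarrow> P Z \<Longrightarrow> P W
      \<Longrightarrow> P (Z \<oplus>\<^bsub>tens_space A B\<^esub> W)"
    and p: "p \<in> {0, 1}"
  shows "P Z"
proof -
  have P_scale: "P (c \<odot>\<^bsub>tens_space A B\<^esub> tpure A B x y) \<and>
      c \<odot>\<^bsub>tens_space A B\<^esub> tpure A B x y \<in> part (tens_space A B) p"
    if xy: "(x, y) \<in> homkeys p" for c x y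
  proof -
    obtain i j where ij: "i \<in> {0, 1}" "j \<in> {0, 1}" "x \<in> part A i" "y \<in> part B j" "(i + j) mod 2 = p"
      using xy unfolding homkeys_def mem_Collect_eq fst_conv snd_conv by (elim bexE conjE)
    then have "c \<odot>\<^bsub>A\<^esub> x \<in> part A i" by (intro A.part_smult)
    then show ?thesis
      using pure[of i j "c \<odot>\<^bsub>A\<^esub> x" y] tpure_part[of i j "c \<odot>\<^bsub>A\<^esub> x" y p] ij
        A.part_closed[OF ij(1,3)] B.part_closed[OF ij(2,4)] by (simp add: tpure_smult_left)
  qed
  have P_zero: "P \<zero>\<^bsub>tens_space A B\<^esub>"
  proof -
    have "(\<zero>\<^bsub>A\<^esub>, \<zero>\<^bsub>B\<^esub>) \<in> homkeys p"
    proof -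
      \<comment> \<open>Parity 0 on the left and \<open>p\<close> on the right: zero lies in every
        part, so the zero tensor counts as a homogeneous pure tensor of either parity.\<close>
      have "p = (0 + p) mod 2" using p by auto
      then show ?thesis using p A.part_zero[of 0] B.part_zero[of p] unfolding homkeys_def by fastforce
    qed
    then show ?thesis using P_scale[of "\<zero>\<^bsub>A\<^esub>" "\<zero>\<^bsub>B\<^esub>" 0] by simp
  qed
  obtain f where f: "Poly_Mapping.keys f \<subseteq> homkeys p" "Z = Q.pr f"
    using Z unfolding part_tens by blast
  from f(1) have "P (Q.pr f)"
  proof (induct f rule: keys_induct)
    case zero
    show ?case using P_zero by (simp add: T_simps(2))
  next
    case (add z c f)
    then have z: "fst z \<in> carrier A" "snd z \<in> carrier B"
      using subsetD[OF homkeys_carrier add(1)] by (simp_all add: mem_Times_iff)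
    have eq: "Q.pr (Poly_Mapping.single z c + f)
        = c \<odot>\<^bsub>tens_space A B\<^esub> tpure A B (fst z) (snd z) \<oplus>\<^bsub>tens_space A B\<^esub> Q.pr f"
      using pr_single[OF z, of c] by (simp add: T_simps(3)[symmetric])
    have "Q.pr f \<in> part (tens_space A B) p" using add(2) unfolding part_tens by blast
    then show ?case unfolding eq
      using add P_scale[of "fst z" "snd z" c] by (intro assms(3)) auto
  qed
  with f(2) show ?thesis by simp
qed

text \<open>Each entry of a pure tensor splits into its two components, which makes four homogeneous
  pure tensors.\<close>

lemma tens_hom_induct [consumes 1, case_names tpure add]:
  assumes Z: "Z \<in> carrier (tens_space A B)"
    and pure: "\<And>x y i j. i \<in> {0, 1} \<Longrightarrow> j \<in> {0, 1} \<Longrightarrow> x \<in> part A i \<Longrightarrow> y \<in> part B j \<Longrightarrow>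
      P (tpure A B x y)"
    and add: "\<And>Z W. Z \<in> carrier (tens_space A B) \<Longrightarrow> W \<in> carrier (tens_space A B) \<Longrightarrow> P Z \<Longrightarrow> P W
      \<Longrightarrow> P (Z \<oplus>\<^bsub>tens_space A B\<^esub> W)"
  shows "P Z"
  using Z
proof (induct Z rule: tens_induct)
  case (tpure x y)
  obtain a b where ab: "a \<in> part A 0" "b \<in> part A 1" "x = a \<oplus>\<^bsub>A\<^esub> b" using tpure(1) by (rule A.decomp)
  obtain c d where cd: "c \<in> part B 0" "d \<in> part B 1" "y = c \<oplus>\<^bsub>B\<^esub> d" using tpure(2) by (rule B.decomp)
  have cl: "a \<in> carrier A" "b \<in> carrier A" "c \<in> carrier B" "d \<in> carrier B"
    using ab cd A.part_closed B.part_closed by auto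
  show ?case unfolding ab(3) cd(3)
    using ab cd cl
    by (simp add: tpure_add_left tpure_add_right pure[of 0 0] pure[of 0 1] pure[of 1 0] pure[of 1 1] add)
qed (rule add)

text \<open>Existence only. Uniqueness of the components is inherited later from the large algebra,
  through the bijection sigma.\<close>

lemma tens_decomp:
  assumes "Z \<in> carrier (tens_space A B)"
  shows "\<exists>a\<in>part (tens_space A B) 0. \<exists>b\<in>part (tens_space A B) 1. Z = a \<oplus>\<^bsub>tens_space A B\<^esub> b"
  using assms
proof (induct Z rule: tens_hom_induct)
  case (tpure x y i j)
  let ?z = "tpure A B x y"
  have z: "?z \<in> carrier (tens_space A B)"
    using A.part_closed[OF tpure(1,3)] B.part_closed[OF tpure(2,4)] by (rule tpure_closed)
  consider "(i + j) mod 2 = 0" | "(i + j) mod 2 = 1" by linarith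
  then show ?case
  proof cases
    case 1
    with tpure have "?z \<in> part (tens_space A B) 0" by (intro tpure_part)
    moreover have "?z = ?z \<oplus>\<^bsub>tens_space A B\<^esub> \<zero>\<^bsub>tens_space A B\<^esub>" using z by simp
    ultimately show ?thesis using part_tens_zero by blast
  next
    case 2
    with tpure have "?z \<in> part (tens_space A B) 1" by (intro tpure_part)
    moreover have "?z = \<zero>\<^bsub>tens_space A B\<^esub> \<oplus>\<^bsub>tens_space A B\<^esub> ?z" using z by simp
    ultimately show ?thesis using part_tens_zero by blast
  qed
next
  case (add Z W)
  then obtain a b c d where *: "a \<in> part (tens_space A B) 0" "b \<in> part (tens_space A B) 1"
      "c \<in> part (tens_space A B) 0" "d \<in> part (tens_space A B) 1"
      "Z = a \<oplus>\<^bsub>tens_space A B\<^esub> b" "W = c \<oplus>\<^bsub>tens_space A B\<^esub> d" by blast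
  have "Z \<oplus>\<^bsub>tens_space A B\<^esub> W = (a \<oplus>\<^bsub>tens_space A B\<^esub> c) \<oplus>\<^bsub>tens_space A B\<^esub> (b \<oplus>\<^bsub>tens_space A B\<^esub> d)"
  proof -
    have "a \<in> carrier (tens_space A B)" "b \<in> carrier (tens_space A B)"
      "c \<in> carrier (tens_space A B)" "d \<in> carrier (tens_space A B)"
      using * part_tens_carrier by blast+
    then show ?thesis unfolding *(5,6) by (simp add: T.a_ac)
  qed
  then show ?case using * part_tens_add by blast
qed

end

section \<open>Algebras over the base field\<close>

text \<open>Unital associative algebras without the grading. They are kept apart from
  \<open>salg\<close> so as to cover \<open>tens_alg\<close>, for which only existence of parity
  components has been established.\<close>

locale uralg = vspace V for V :: "'a superalg" (structure) +
  assumes bilin_mult: "bilin V V V (monoid.mult V)"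
    and mult_assoc: "x \<in> carrier V \<Longrightarrow> y \<in> carrier V \<Longrightarrow> z \<in> carrier V \<Longrightarrow> (x \<otimes> y) \<otimes> z = x \<otimes> (y \<otimes> z)"
    and one_cl [simp, intro]: "\<one> \<in> carrier V"
    and one_mult [simp]: "x \<in> carrier V \<Longrightarrow> \<one> \<otimes> x = x"
    and mult_one [simp]: "x \<in> carrier V \<Longrightarrow> x \<otimes> \<one> = x"
begin

lemma mult_cl [simp, intro]: "x \<in> carrier V \<Longrightarrow> y \<in> carrier V \<Longrightarrow> x \<otimes> y \<in> carrier V"
  by (rule bilin_closed[OF bilin_mult])

lemma lin_mult_left: "x \<in> carrier V \<Longrightarrow> lin V V (\<lambda>y. x \<otimes> y)"
  by (rule bilin_right[OF bilin_mult])

lemma lin_mult_right: "y \<in> carrier V \<Longrightarrow> lin V V (\<lambda>x. x \<otimes> y)"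
  by (rule bilin_left[OF bilin_mult])

lemma smult_mult_left: "x \<in> carrier V \<Longrightarrow> y \<in> carrier V \<Longrightarrow> (c \<odot> x) \<otimes> y = c \<odot> (x \<otimes> y)"
  using lin_smult[OF lin_mult_right] by blast

lemma smult_mult_right: "x \<in> carrier V \<Longrightarrow> y \<in> carrier V \<Longrightarrow> x \<otimes> (c \<odot> y) = c \<odot> (x \<otimes> y)"
  using lin_smult[OF lin_mult_left] by blast

lemma add_mult: "x \<in> carrier V \<Longrightarrow> y \<in> carrier V \<Longrightarrow> z \<in> carrier V \<Longrightarrow> (x \<oplus> y) \<otimes> z = x \<otimes> z \<oplus> y \<otimes> z"
  using lin_add[OF lin_mult_right] by blast

lemma mult_add: "x \<in> carrier V \<Longrightarrow> y \<in> carrier V \<Longrightarrow> z \<in> carrier V \<Longrightarrow> x \<otimes> (y \<oplus> z) = x \<otimes> y \<oplus> x \<otimes> z"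
  using lin_add[OF lin_mult_left] by blast

end

locale salg = superspc V for V :: "'a superalg" (structure) +
  assumes sa: "superalgebra V"

lemma salgI: "superalgebra V \<Longrightarrow> salg V"
  by (simp add: salg_def salg_axioms_def superspcI superalgebra_def)

sublocale salg \<subseteq> uralg V
proof -
  interpret R: ring V using sa by (simp add: superalgebra_def)
  have s: "(c \<odot> x) \<otimes> y = c \<odot> (x \<otimes> y) \<and> x \<otimes> (c \<odot> y) = c \<odot> (x \<otimes> y)"
    if "x \<in> carrier V" "y \<in> carrier V" for c x y
    using sa that by (simp add: superalgebra_def)
  show "uralg V"
    by unfold_locales (auto intro!: bilinI linI simp: R.m_assoc R.l_distr R.r_distr s)
qed

context salg
begin

lemma one_part [simp]: "\<one> \<in> part V 0"
  using sa by (simp add: superalgebra_def)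

lemma mult_part:
  "p \<in> {0, 1} \<Longrightarrow> r \<in> {0, 1} \<Longrightarrow> x \<in> part V p \<Longrightarrow> y \<in> part V r \<Longrightarrow> x \<otimes> y \<in> part V ((p + r) mod 2)"
  using sa unfolding superalgebra_def by blast

end

section \<open>Tensor products of superalgebras\<close>

locale tensalg = A: salg A + B: salg B for A :: "'a superalg" and B :: "'b superalg"

sublocale tensalg \<subseteq> stens A B ..

lemma tens_alg_simps [simp]:
  "carrier (tens_alg A B) = carrier (tens_space A B)" "add (tens_alg A B) = add (tens_space A B)"
  "zero (tens_alg A B) = zero (tens_space A B)" "module.smult (tens_alg A B) = module.smult (tens_space A B)"
  "part (tens_alg A B) = part (tens_space A B)" "one (tens_alg A B) = tpure A B \<one>\<^bsub>A\<^esub> \<one>\<^bsub>B\<^esub>"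
  by (simp_all add: tens_alg_def)

text \<open>\<open>tens_alg\<close> and \<open>braided\<close> are the tensor space with new
  multiplication and unit; the vector space structure passes over to them by this.\<close>

lemma vspace_cong:
  fixes V W :: "'a superalg"
  assumes W: "vspace W" and eq: "carrier V = carrier W" "add V = add W" "zero V = zero W"
    "module.smult V = module.smult W"
  shows "vspace V"
proof -
  interpret W: vspace W by fact
  have "abelian_group V"
  proof (rule abelian_groupI)
    fix x assume "x \<in> carrier V"
    then show "\<exists>y\<in>carrier V. y \<oplus>\<^bsub>V\<^esub> x = \<zero>\<^bsub>V\<^esub>"
      by (intro bexI[of _ "\<ominus>\<^bsub>W\<^esub> x"]) (simp_all add: eq W.l_neg)
  qed (simp_all add: eq W.a_ac)
  then show ?thesis
    by (intro vspace.intro moduleI cring_base_field)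
       (auto simp: eq W.smult_add_left W.smult_add_right)
qed

context tensalg
begin

definition mulp :: "'a \<Rightarrow> 'b \<Rightarrow> 'a \<Rightarrow> 'b \<Rightarrow> ('a, 'b) tensor" where
  "mulp x y x' y' = koszul_sum (tens_space A B) (\<lambda>p r.
     tpure A B (x \<otimes>\<^bsub>A\<^esub> hcomp A r x') (hcomp B p y \<otimes>\<^bsub>B\<^esub> y'))"

lemma mult_tens_alg:
  "Z \<otimes>\<^bsub>tens_alg A B\<^esub> W =
     tlift (tens_space A B) (\<lambda>x y. tlift (tens_space A B) (mulp x y) W) Z"
  by (simp add: tens_alg_def mulp_def[abs_def])

lemma lin_mulp1: "y \<in> carrier B \<Longrightarrow> x' \<in> carrier A \<Longrightarrow> y' \<in> carrier B \<Longrightarrow> lin A (tens_space A B) (\<lambda>x. mulp x y x' y')"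
  unfolding mulp_def
  by (rule lin_koszul_sum_param[OF T.vspace_axioms A.vspace_axioms], rule lin_comp[OF bilin_left[OF bilin_tpure] A.lin_mult_right]) auto

lemma lin_mulp2: "x \<in> carrier A \<Longrightarrow> x' \<in> carrier A \<Longrightarrow> y' \<in> carrier B \<Longrightarrow> lin B (tens_space A B) (\<lambda>y. mulp x y x' y')"
  unfolding mulp_def
  by (rule lin_koszul_sum_param[OF T.vspace_axioms B.vspace_axioms], rule lin_comp[OF bilin_right[OF bilin_tpure] lin_comp[OF B.lin_mult_right B.lin_hcomp]]) auto

lemma lin_mulp3: "x \<in> carrier A \<Longrightarrow> y \<in> carrier B \<Longrightarrow> y' \<in> carrier B \<Longrightarrow> lin A (tens_space A B) (\<lambda>x'. mulp x y x' y')"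
  unfolding mulp_def
  by (rule lin_koszul_sum_param[OF T.vspace_axioms A.vspace_axioms], rule lin_comp[OF bilin_left[OF bilin_tpure] lin_comp[OF A.lin_mult_left A.lin_hcomp]]) auto

lemma lin_mulp4: "x \<in> carrier A \<Longrightarrow> y \<in> carrier B \<Longrightarrow> x' \<in> carrier A \<Longrightarrow> lin B (tens_space A B) (\<lambda>y'. mulp x y x' y')"
  unfolding mulp_def
  by (rule lin_koszul_sum_param[OF T.vspace_axioms B.vspace_axioms], rule lin_comp[OF bilin_right[OF bilin_tpure] B.lin_mult_left]) auto

lemma bilin_mulp: "x \<in> carrier A \<Longrightarrow> y \<in> carrier B \<Longrightarrow> bilin A B (tens_space A B) (mulp x y)"
  by (rule bilinI) (auto intro: lin_mulp3 lin_mulp4)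

lemma bilin_tlift_mulp:
  "W \<in> carrier (tens_space A B) \<Longrightarrow>
   bilin A B (tens_space A B) (\<lambda>x y. tlift (tens_space A B) (mulp x y) W)"
  by (intro bilinI lin_tlift_param T.vspace_axioms A.vspace_axioms B.vspace_axioms lin_mulp1 lin_mulp2)

lemma bilin_mult_tens:
  "bilin (tens_space A B) (tens_space A B) (tens_space A B) (monoid.mult (tens_alg A B))"
  unfolding mult_tens_alg[abs_def]
  by (intro bilinI lin_tlift lin_tlift_param T.vspace_axioms bilin_tlift_mulp bilin_mulp)

lemma mult_tpure:
  assumes "p \<in> {0, 1}" "r \<in> {0, 1}" "x \<in> carrier A" "y \<in> part B p" "x' \<in> part A r" "y' \<in> carrier B"
  shows "tpure A B x y \<otimes>\<^bsub>tens_alg A B\<^esub> tpure A B x' y' =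
    ((-1) ^ (p * r)) \<odot>\<^bsub>tens_space A B\<^esub> tpure A B (x \<otimes>\<^bsub>A\<^esub> x') (y \<otimes>\<^bsub>B\<^esub> y')"
proof -
  have c: "y \<in> carrier B" "x' \<in> carrier A" using assms A.part_closed B.part_closed by auto
  have z: "tpure A B u \<zero>\<^bsub>B\<^esub> = \<zero>\<^bsub>tens_space A B\<^esub>" if "u \<in> carrier A" for u
    using lin_zero[OF B.vspace_axioms T.vspace_axioms bilin_right[OF bilin_tpure that]] .
  have z': "tpure A B \<zero>\<^bsub>A\<^esub> u = \<zero>\<^bsub>tens_space A B\<^esub>" if "u \<in> carrier B" for u
    using lin_zero[OF A.vspace_axioms T.vspace_axioms bilin_left[OF bilin_tpure that]] .
  have m: "u \<otimes>\<^bsub>A\<^esub> \<zero>\<^bsub>A\<^esub> = \<zero>\<^bsub>A\<^esub>" if "u \<in> carrier A" for u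
    using lin_zero[OF A.vspace_axioms A.vspace_axioms A.lin_mult_left[OF that]] .
  have m': "\<zero>\<^bsub>B\<^esub> \<otimes>\<^bsub>B\<^esub> u = \<zero>\<^bsub>B\<^esub>" if "u \<in> carrier B" for u
    using lin_zero[OF B.vspace_axioms B.vspace_axioms B.lin_mult_right[OF that]] .
  have "tpure A B x y \<otimes>\<^bsub>tens_alg A B\<^esub> tpure A B x' y' = mulp x y x' y'"
    using assms c by (simp add: mult_tens_alg tlift_tpure[OF T.vspace_axioms bilin_tlift_mulp]
        tlift_tpure[OF T.vspace_axioms bilin_mulp])
  also have "\<dots> = ((-1) ^ (p * r)) \<odot>\<^bsub>tens_space A B\<^esub> tpure A B (x \<otimes>\<^bsub>A\<^esub> hcomp A r x') (hcomp B p y \<otimes>\<^bsub>B\<^esub> y')"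
    unfolding mulp_def
    by (rule koszul_sum_single[OF T.vspace_axioms assms(1,2)])
       (use assms c in \<open>auto simp: A.hcomp_hom[OF _ assms(2,5)] B.hcomp_hom[OF _ assms(1,4)] z z' m m'\<close>)
  also have "\<dots> = ((-1) ^ (p * r)) \<odot>\<^bsub>tens_space A B\<^esub> tpure A B (x \<otimes>\<^bsub>A\<^esub> x') (y \<otimes>\<^bsub>B\<^esub> y')"
    using assms by (simp add: A.hcomp_hom[OF _ assms(2,5)] B.hcomp_hom[OF _ assms(1,4)])
  finally show ?thesis .
qed

lemma vspace_tens_alg: "vspace (tens_alg A B)"
  by (rule vspace_cong[OF T.vspace_axioms]) simp_all

lemma lin_tens_alg [simp]:
  "lin (tens_alg A B) W f \<longleftrightarrow> lin (tens_space A B) W f" "lin W (tens_alg A B) g \<longleftrightarrow> lin W (tens_space A B) g"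
  by (simp_all add: lin_def)

text \<open>On homogeneous pure tensors both bracketings are the same pure tensor up to sign, and
  the signs agree. Linearity then frees the third factor, after it the second and the first.\<close>

lemma tens_mult_assoc:
  assumes "Z \<in> carrier (tens_space A B)" "W \<in> carrier (tens_space A B)" "X \<in> carrier (tens_space A B)"
  shows "(Z \<otimes>\<^bsub>tens_alg A B\<^esub> W) \<otimes>\<^bsub>tens_alg A B\<^esub> X = Z \<otimes>\<^bsub>tens_alg A B\<^esub> (W \<otimes>\<^bsub>tens_alg A B\<^esub> X)"
proof -
  note l = bilin_left[OF bilin_mult_tens] and r = bilin_right[OF bilin_mult_tens]
  note cl = bilin_closed[OF bilin_mult_tens]
  note simps = lin_add[OF l] lin_add[OF r] lin_smult[OF l] lin_smult[OF r] cl
  \<comment> \<open>Both exponents are p r + p r' + p' r' modulo 2.\<close>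
  have sgn: "(-1) ^ (p * r) * (-1) ^ (((p + p') mod 2) * r') = (-1) ^ (p' * r') * ((-1) ^ (p * ((r + r') mod 2)) :: cq)"
    if "p \<in> {0, 1}" "p' \<in> {0, 1}" "r \<in> {0, 1}" "r' \<in> {0, 1}" for p p' r r' :: nat
    using that by auto
  have pure: "(tpure A B x y \<otimes>\<^bsub>tens_alg A B\<^esub> tpure A B x' y') \<otimes>\<^bsub>tens_alg A B\<^esub> tpure A B x'' y'' =
      tpure A B x y \<otimes>\<^bsub>tens_alg A B\<^esub> (tpure A B x' y' \<otimes>\<^bsub>tens_alg A B\<^esub> tpure A B x'' y'')"
    if h: "p \<in> {0, 1}" "p' \<in> {0, 1}" "r \<in> {0, 1}" "r' \<in> {0, 1}" "x \<in> carrier A" "y \<in> part B p"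
      "x' \<in> part A r" "y' \<in> part B p'" "x'' \<in> part A r'" "y'' \<in> carrier B" for p p' r r' x y x' y' x'' y''
  proof -
    have c: "y \<in> carrier B" "x' \<in> carrier A" "y' \<in> carrier B" "x'' \<in> carrier A"
      using h A.part_closed B.part_closed by blast+
    have "(p + p') mod 2 \<in> {0, 1}" "(r + r') mod 2 \<in> {0, 1}" by auto
    moreover have "y \<otimes>\<^bsub>B\<^esub> y' \<in> part B ((p + p') mod 2)" "x' \<otimes>\<^bsub>A\<^esub> x'' \<in> part A ((r + r') mod 2)"
      using h A.mult_part B.mult_part by blast+
    ultimately show ?thesis
      using h c sgn[of p p' r r'] mult_tpure[of p r x y x' y'] mult_tpure[of p' r' x' y' x'' y'']
        mult_tpure[of "(p + p') mod 2" r' "x \<otimes>\<^bsub>A\<^esub> x'" "y \<otimes>\<^bsub>B\<^esub> y'" x'' y'']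
        mult_tpure[of p "(r + r') mod 2" x y "x' \<otimes>\<^bsub>A\<^esub> x''" "y' \<otimes>\<^bsub>B\<^esub> y''"]
      by (simp add: simps A.mult_assoc B.mult_assoc)
  qed
  have cp: "tpure A B x y \<in> carrier (tens_space A B)"
    if "i \<in> {0, 1}" "j \<in> {0, 1}" "x \<in> part A i" "y \<in> part B j" for i j x y
    using that A.part_closed B.part_closed by blast
  have 1: "(tpure A B x y \<otimes>\<^bsub>tens_alg A B\<^esub> tpure A B x' y') \<otimes>\<^bsub>tens_alg A B\<^esub> X =
      tpure A B x y \<otimes>\<^bsub>tens_alg A B\<^esub> (tpure A B x' y' \<otimes>\<^bsub>tens_alg A B\<^esub> X)"
    if h: "i \<in> {0, 1}" "j \<in> {0, 1}" "i' \<in> {0, 1}" "j' \<in> {0, 1}" "x \<in> part A i" "y \<in> part B j"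
      "x' \<in> part A i'" "y' \<in> part B j'" for i j i' j' x y x' y'
    using assms(3)
  proof (induct X rule: tens_hom_induct)
    case (tpure x'' y'' i'' j'')
    then show ?case using pure[of j j' i' i'' x y x' y' x'' y''] h A.part_closed B.part_closed by blast
  next
    case (add Z W)
    then show ?case using h by (simp add: simps cp)
  qed
  have 2: "(tpure A B x y \<otimes>\<^bsub>tens_alg A B\<^esub> W) \<otimes>\<^bsub>tens_alg A B\<^esub> X =
      tpure A B x y \<otimes>\<^bsub>tens_alg A B\<^esub> (W \<otimes>\<^bsub>tens_alg A B\<^esub> X)"
    if h: "i \<in> {0, 1}" "j \<in> {0, 1}" "x \<in> part A i" "y \<in> part B j" for i j x y
    using assms(2)
  proof (induct W rule: tens_hom_induct)
    case (tpure x' y' i' j')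
    then show ?case using h by (intro 1)
  next
    case (add Z W)
    then show ?case using h assms(3) by (simp add: simps cp)
  qed
  show ?thesis
    using assms(1)
  proof (induct Z rule: tens_hom_induct)
    case (tpure x y i j)
    then show ?case by (intro 2)
  next
    case (add Z Z')
    then show ?case using assms(2,3) by (simp add: simps)
  qed
qed

lemma uralg_tens_alg: "uralg (tens_alg A B)"
proof -
  note l = bilin_left[OF bilin_mult_tens] and r = bilin_right[OF bilin_mult_tens]
  interpret V: vspace "tens_alg A B" by (rule vspace_tens_alg)
  have 1: "tpure A B \<one>\<^bsub>A\<^esub> \<one>\<^bsub>B\<^esub> \<otimes>\<^bsub>tens_alg A B\<^esub> Z = Z" if "Z \<in> carrier (tens_space A B)" for Z
    using that
  proof (induct Z rule: tens_hom_induct)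
    case (tpure x y i j)
    then show ?case
      using mult_tpure[of 0 i "\<one>\<^bsub>A\<^esub>" "\<one>\<^bsub>B\<^esub>" x y] A.part_closed[of i x] B.part_closed[of j y] by simp
  next
    case (add Z W)
    then show ?case by (simp add: lin_add[OF r])
  qed
  have 2: "Z \<otimes>\<^bsub>tens_alg A B\<^esub> tpure A B \<one>\<^bsub>A\<^esub> \<one>\<^bsub>B\<^esub> = Z" if "Z \<in> carrier (tens_space A B)" for Z
    using that
  proof (induct Z rule: tens_hom_induct)
    case (tpure x y i j)
    then show ?case
      using mult_tpure[of j 0 x y "\<one>\<^bsub>A\<^esub>" "\<one>\<^bsub>B\<^esub>"] A.part_closed[of i x] B.part_closed[of j y] by simp
  next
    case (add Z W)
    then show ?case by (simp add: lin_add[OF l])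
  qed
  show ?thesis
    by unfold_locales (use l r in \<open>auto simp: tens_mult_assoc 1 2 bilin_def\<close>)
qed

lemma mult_tens_part:
  assumes "p \<in> {0, 1}" "r \<in> {0, 1}" "Z \<in> part (tens_space A B) p" "W \<in> part (tens_space A B) r"
  shows "Z \<otimes>\<^bsub>tens_alg A B\<^esub> W \<in> part (tens_space A B) ((p + r) mod 2)"
proof -
  note l = bilin_left[OF bilin_mult_tens] and rr = bilin_right[OF bilin_mult_tens]
  have cp: "tpure A B x y \<in> carrier (tens_space A B)"
    if "i \<in> {0, 1}" "j \<in> {0, 1}" "x \<in> part A i" "y \<in> part B j" for i j x y
    using that A.part_closed B.part_closed by blast
  have c: "X \<in> carrier (tens_space A B)" if "X \<in> part (tens_space A B) t" for t X
    using that part_tens_carrier by blast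
  have 1: "tpure A B x y \<otimes>\<^bsub>tens_alg A B\<^esub> W \<in> part (tens_space A B) ((p + r) mod 2)"
    if h: "i \<in> {0, 1}" "j \<in> {0, 1}" "x \<in> part A i" "y \<in> part B j" "(i + j) mod 2 = p" for i j x y
    using assms(4)
  proof (induct W rule: part_tens_induct)
    case (tpure x' y' i' j')
    have *: "x \<otimes>\<^bsub>A\<^esub> x' \<in> part A ((i + i') mod 2)" "y \<otimes>\<^bsub>B\<^esub> y' \<in> part B ((j + j') mod 2)"
      using h tpure A.mult_part B.mult_part by blast+
    have "tpure A B (x \<otimes>\<^bsub>A\<^esub> x') (y \<otimes>\<^bsub>B\<^esub> y') \<in> part (tens_space A B) ((p + r) mod 2)"
      by (rule tpure_part[OF _ _ *]) (use h(5) tpure(5) in \<open>auto simp: mod_simps, presburger\<close>)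
    then show ?case
      using mult_tpure[of j i' x y x' y'] h tpure A.part_closed[of i x] B.part_closed[of j' y']
      by (simp add: part_tens_smult)
  next
    case (add Z W)
    then show ?case using h by (simp add: lin_add[OF rr] cp c part_tens_add)
  qed (fact assms(2))
  show ?thesis
    using assms(3)
  proof (induct Z rule: part_tens_induct)
    case (tpure x y i j)
    then show ?case by (intro 1)
  next
    case (add Z Z')
    then show ?case using assms(4) by (simp add: lin_add[OF l] c part_tens_add)
  qed (fact assms(1))
qed

end

section \<open>Free algebras, presentations and induced homomorphisms\<close>

section \<open>Operators indexed by words\<close>

text \<open>Two-sided ideals of the ring type itself, in contrast to ideals of the record
  \<open>free_superalg G d\<close>, whose carrier is only \<open>polys G\<close>. Kernels of actions
  are of this form because every letter of the type acts.\<close>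

definition two_sided :: "'a::ring_1 set \<Rightarrow> bool" where
  "two_sided K \<longleftrightarrow> 0 \<in> K \<and> (\<forall>x\<in>K. \<forall>y\<in>K. x + y \<in> K) \<and> (\<forall>x\<in>K. \<forall>a. a * x \<in> K \<and> x * a \<in> K)"

lemma two_sidedD:
  assumes "two_sided K"
  shows "0 \<in> K" "x \<in> K \<Longrightarrow> y \<in> K \<Longrightarrow> x + y \<in> K" "x \<in> K \<Longrightarrow> a * x \<in> K" "x \<in> K \<Longrightarrow> x * a \<in> K"
  using assms by (auto simp: two_sided_def)

lemma two_sided_uminus: "two_sided K \<Longrightarrow> x \<in> K \<Longrightarrow> - x \<in> K"
  using two_sidedD(3)[of K x "- 1"] by simp

lemma two_sided_diff: "two_sided K \<Longrightarrow> x \<in> K \<Longrightarrow> y \<in> K \<Longrightarrow> x - y \<in> K"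
  using two_sidedD(2)[of K x "- y"] two_sided_uminus[of K y] by simp

lemma two_sided_sum: "two_sided K \<Longrightarrow> (\<And>i. i \<in> A \<Longrightarrow> f i \<in> K) \<Longrightarrow> sum f A \<in> K"
  by (induct A rule: infinite_finite_induct) (auto simp: two_sidedD)

lemma one_falg: "(1 :: 'g falg) = Poly_Mapping.single 0 1"
  by simp

lemma scal_mult: "scal c * f = Poly_Mapping.map ((*) c) f"
  by (simp add: scal_def mult_map_scale_conv_mult)

lemma scal_commute: "scal c * f = f * scal c"
proof -
  have "Poly_Mapping.keys f \<subseteq> UNIV" by simp
  then show ?thesis
    by (induct f rule: keys_induct) (simp_all add: scal_def mult_single distrib_left distrib_right mult.commute)
qed

lemma mult_scal_left: "f * (scal c * g) = scal c * (f * g)"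
  by (metis mult.assoc scal_commute)

lemma scal_one [simp]: "scal 1 = 1" and scal_zero [simp]: "scal 0 = 0"
  and scal_minus [simp]: "scal (- c) = - scal c" and scal_add: "scal (c + d) = scal c + scal d"
  and scal_times: "scal (c * d) = scal c * scal d"
  by (simp_all add: scal_def single_uminus single_add mult_single)

lemma scal_neg_one_power: "scal ((-1) ^ k) = (-1) ^ k"
  by (induct k) (simp_all add: scal_times)

lemma keys_scal: "Poly_Mapping.keys (scal c) \<subseteq> {0}"
  by (simp add: scal_def)

lemma letters_zero [simp]: "letters 0 = []" and letters_plus [simp]: "letters (u + w) = letters u @ letters w"
  by (simp_all add: zero_word_def plus_word_def)

text \<open>Any family of linear operators, one for each letter, makes \<open>V\<close> a module
  over the free algebra; there is nothing to verify. Substitution, evaluation of generators in an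
  algebra and the action that inverts sigma are three instances.\<close>

locale opspace = vspace V for V :: "'a superalg" (structure) +
  fixes op :: "'g \<Rightarrow> 'a \<Rightarrow> 'a"
  assumes lin_op: "lin V V (op g)"
begin

definition wact :: "'g word \<Rightarrow> 'a \<Rightarrow> 'a" where "wact w v = foldr op (letters w) v"

lemma wact_zero [simp]: "wact 0 v = v"
  by (simp add: wact_def)

lemma wact_plus: "wact (u + w) v = wact u (wact w v)"
  by (simp add: wact_def)

lemma lin_foldr: "lin V V (foldr op l)"
  by (induct l) (auto simp: id_def comp_def intro: lin_id lin_comp[OF lin_op])

lemma lin_wact: "lin V V (wact w)"
  using lin_foldr[of "letters w"] by (simp add: wact_def[abs_def])

lemma wact_closed [simp, intro]: "v \<in> carrier V \<Longrightarrow> wact w v \<in> carrier V"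
  by (rule lin_closed[OF lin_wact])

definition act :: "'g falg \<Rightarrow> 'a \<Rightarrow> 'a" where "act f v = pev V (\<lambda>w. wact w v) f"

lemma lin_act: "lin V V (act f)"
  using lin_pev_param[OF vspace_axioms vspace_axioms, of f "\<lambda>v w. wact w v"] lin_wact
  by (simp add: act_def[abs_def])

lemma act_closed [simp, intro]: "v \<in> carrier V \<Longrightarrow> act f v \<in> carrier V"
  by (rule lin_closed[OF lin_act])

lemma act_zero [simp]: "act 0 v = \<zero>"
  by (simp add: act_def)

lemma act_add: "v \<in> carrier V \<Longrightarrow> act (f + g) v = act f v \<oplus> act g v"
  by (simp add: act_def pev_add)

lemma act_diff: "v \<in> carrier V \<Longrightarrow> act (f - g) v = act f v \<ominus> act g v"
  by (simp add: act_def pev_diff)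

lemma act_scal: "v \<in> carrier V \<Longrightarrow> act (scal c * f) v = c \<odot> act f v"
  by (simp add: act_def scal_mult pev_scale)

lemma act_single: "v \<in> carrier V \<Longrightarrow> act (Poly_Mapping.single w c) v = c \<odot> wact w v"
  by (simp add: act_def pev_single)

lemma act_one [simp]: "v \<in> carrier V \<Longrightarrow> act 1 v = v"
  by (simp add: one_falg act_single del: single_one)

lemma act_gen [simp]: "v \<in> carrier V \<Longrightarrow> act (gen g) v = op g v"
  using lin_closed[OF lin_op] by (simp add: gen_def act_single) (simp add: wact_def)

lemma act_mult: "v \<in> carrier V \<Longrightarrow> act (f * g) v = act f (act g v)"
proof -
  assume v: "v \<in> carrier V"
  have 1: "act (Poly_Mapping.single w c * g) v = c \<odot> wact w (act g v)" for w c
  proof -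
    have "Poly_Mapping.keys g \<subseteq> UNIV" by simp
    then show ?thesis
    proof (induct g rule: keys_induct)
      case zero
      then show ?case by (simp add: lin_zero[OF vspace_axioms vspace_axioms lin_wact])
    next
      case (add u d g)
      then show ?case using v
        by (simp add: distrib_left act_add mult_single act_single wact_plus lin_add[OF lin_wact]
            lin_smult[OF lin_wact] smult_add_right)
    qed
  qed
  have "Poly_Mapping.keys f \<subseteq> UNIV" by simp
  then show ?thesis
    by (induct f rule: keys_induct) (use v in \<open>simp_all add: distrib_right act_add 1 act_single\<close>)
qed

lemma act_sum: "v \<in> carrier V \<Longrightarrow> act (sum f A) v = (\<Oplus>i\<in>A. act (f i) v)"
  by (induct A rule: infinite_finite_induct)
     (simp_all add: finsum_infinite finsum_empty act_add finsum_insert Pi_iff)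

text \<open>The annihilator of \<open>V\<close>. Since it is two-sided, it contains the ideal of a
  presentation as soon as it contains the relations.\<close>

definition ker :: "'g falg set" where "ker = {f. \<forall>v\<in>carrier V. act f v = \<zero>}"

lemma two_sided_ker: "two_sided ker"
  by (auto simp: two_sided_def ker_def act_add act_mult lin_zero[OF vspace_axioms vspace_axioms lin_act])

lemma act_cong_ker: "f - g \<in> ker \<Longrightarrow> v \<in> carrier V \<Longrightarrow> act f v = act g v"
  using act_add[of v "f - g" g] by (simp add: ker_def)

end

section \<open>Free superalgebras\<close>

lemma free_superalg_simps [simp]:
  "carrier (free_superalg G d) = {f. \<forall>w\<in>Poly_Mapping.keys f. set (letters w) \<subseteq> G}"
  "monoid.mult (free_superalg G d) = (*)" "one (free_superalg G d) = 1"
  "add (free_superalg G d) = (+)" "zero (free_superalg G d) = 0"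
  "module.smult (free_superalg G d) c f = scal c * f"
  by (simp_all add: free_superalg_def)

text \<open>The carrier of \<open>free_superalg G d\<close>, freed from the parity function
  \<open>d\<close>, which does not influence it.\<close>

definition polys :: "'g set \<Rightarrow> 'g falg set" where
  "polys G = {f. \<forall>w\<in>Poly_Mapping.keys f. set (letters w) \<subseteq> G}"

lemma polys_add: "f \<in> polys G \<Longrightarrow> g \<in> polys G \<Longrightarrow> f + g \<in> polys G"
  using keys_add[of f g] by (fastforce simp: polys_def)

lemma polys_uminus: "f \<in> polys G \<Longrightarrow> - f \<in> polys G"
  by (simp add: polys_def keys_uminus)

lemma polys_diff: "f \<in> polys G \<Longrightarrow> g \<in> polys G \<Longrightarrow> f - g \<in> polys G"
  using polys_add[of f G "- g"] polys_uminus[of g G] by simp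

lemma polys_mult: "f \<in> polys G \<Longrightarrow> g \<in> polys G \<Longrightarrow> f * g \<in> polys G"
  using keys_mult[of f g] by (fastforce simp: polys_def)

lemma polys_zero [simp]: "0 \<in> polys G" and polys_one [simp]: "1 \<in> polys G" and polys_scal [simp]: "scal c \<in> polys G"
  using keys_scal[of c] by (auto simp: polys_def)

lemma polys_gen: "g \<in> G \<Longrightarrow> gen g \<in> polys G"
  by (simp add: polys_def gen_def)

lemma polys_sum: "(\<And>i. i \<in> A \<Longrightarrow> f i \<in> polys G) \<Longrightarrow> sum f A \<in> polys G"
  by (induct A rule: infinite_finite_induct) (auto simp: polys_add)

lemma polys_neg_one_power [simp]: "(-1) ^ k \<in> polys G"
  using polys_scal[of "(-1) ^ k" G] by (simp add: scal_neg_one_power)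

lemma polys_induct [consumes 1, case_names one gen add scal]:
  assumes f: "f \<in> polys G" and one: "C 1"
    and gen: "\<And>g f. g \<in> G \<Longrightarrow> f \<in> polys G \<Longrightarrow> C f \<Longrightarrow> C (gen g * f)"
    and add: "\<And>f g. f \<in> polys G \<Longrightarrow> g \<in> polys G \<Longrightarrow> C f \<Longrightarrow> C g \<Longrightarrow> C (f + g)"
    and scal: "\<And>f c. f \<in> polys G \<Longrightarrow> C f \<Longrightarrow> C (scal c * f)"
  shows "C f"
proof -
  have s: "Poly_Mapping.single (Word l) 1 \<in> polys G" if "set l \<subseteq> G" for l
    using that by (simp add: polys_def)
  have word: "C (Poly_Mapping.single (Word l) 1)" if "set l \<subseteq> G" for l
    using that
  proof (induct l)
    case Nil
    then show ?case using one by (simp add: zero_word_def[symmetric])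
  next
    case (Cons g l)
    have "Poly_Mapping.single (Word (g # l)) (1 :: cq) = gen g * Poly_Mapping.single (Word l) 1"
      by (simp add: gen_def mult_single plus_word_def)
    then show ?case using Cons gen[of g "Poly_Mapping.single (Word l) 1"] s[of l] by simp
  qed
  have "Poly_Mapping.keys f \<subseteq> {w. set (letters w) \<subseteq> G}" using f by (auto simp: polys_def)
  then show ?thesis
  proof (induct f rule: keys_induct)
    case zero
    show ?case using scal[OF _ one, of 0] by (simp add: polys_def)
  next
    case (add w c f)
    obtain l where l: "w = Word l" by (cases w)
    have sl: "set l \<subseteq> G" using add(1) l by simp
    have "Poly_Mapping.single w c = scal c * Poly_Mapping.single (Word l) 1"
      by (simp add: scal_def mult_single l)
    moreover have "f \<in> polys G" using add(2) by (auto simp: polys_def)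
    ultimately show ?case
      using assms(4)[OF polys_mult[OF polys_scal s[OF sl]] _ scal[OF s[OF sl] word[OF sl]] add(3)] by simp
  qed
qed

lemma carrier_free: "carrier (free_superalg G d) = polys G"
  by (simp add: polys_def)

lemma vspace_free: "vspace (free_superalg G d)"
proof (rule vspace.intro, rule moduleI[OF cring_base_field], goal_cases)
  case 1
  show ?case
  proof (rule abelian_groupI, unfold carrier_free)
    fix f assume f: "f \<in> polys G"
    show "\<exists>g\<in>polys G. g \<oplus>\<^bsub>free_superalg G d\<^esub> f = \<zero>\<^bsub>free_superalg G d\<^esub>"
      by (rule bexI[of _ "- f"]) (use f in \<open>auto simp: polys_uminus\<close>)
  qed (auto simp: ac_simps polys_add)
qed (unfold carrier_free, auto simp: polys_mult scal_add scal_times algebra_simps)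

lemma ring_free: "ring (free_superalg G d)"
proof (rule ringI)
  show "abelian_group (free_superalg G d)"
    by (rule Module.module.axioms(2)[OF vspace.module_base[OF vspace_free]])
  show "monoid (free_superalg G d)"
    by (rule monoidI; unfold carrier_free) (simp_all add: polys_mult mult.assoc)
qed (simp_all add: algebra_simps)

text \<open>The substitution homomorphism is obtained from left multiplications on the free algebra.\<close>

definition subst :: "('g \<Rightarrow> 'h falg) \<Rightarrow> 'g falg \<Rightarrow> 'h falg" where
  "subst h f = opspace.act (free_superalg UNIV (\<lambda>_. 0)) (\<lambda>g v. h g * v) f 1"

context
  fixes h :: "'g \<Rightarrow> 'h falg"
begin

interpretation S: opspace "free_superalg UNIV (\<lambda>_. 0) :: 'h falg superalg" "\<lambda>g v. h g * v"
proof -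
  interpret vspace "free_superalg UNIV (\<lambda>_. 0) :: 'h falg superalg" by (rule vspace_free)
  show "opspace (free_superalg UNIV (\<lambda>_. 0) :: 'h falg superalg) (\<lambda>g v. h g * v)"
    by unfold_locales (auto intro!: linI simp: distrib_left mult_scal_left)
qed

lemma subst_act: "S.act f v = subst h f * v"
proof -
  have w: "S.wact w v = S.wact w 1 * v" for w :: "'g word" and v
  proof -
    have "foldr (\<lambda>g v. h g * v) l v = foldr (\<lambda>g v. h g * v) l 1 * v" for l
      by (induct l) (simp_all add: mult.assoc)
    then show ?thesis by (simp add: S.wact_def)
  qed
  have "Poly_Mapping.keys f \<subseteq> UNIV" by simp
  then show ?thesis unfolding subst_def
  proof (induct f rule: keys_induct)
    case (add u c f)
    then show ?case
      using w[of u v] by (simp add: S.act_add S.act_single distrib_right mult.assoc)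
  qed simp
qed

lemma subst_zero [simp]: "subst h 0 = 0" and subst_one [simp]: "subst h 1 = 1"
  and subst_gen [simp]: "subst h (gen g) = h g"
  and subst_add: "subst h (f + f') = subst h f + subst h f'"
  by (simp_all add: subst_def S.act_add)

lemma subst_mult: "subst h (f * f') = subst h f * subst h f'"
proof -
  have "subst h (f * f') = S.act f (subst h f')"
    unfolding subst_def by (rule S.act_mult) simp
  then show ?thesis by (simp add: subst_act)
qed

lemma subst_scal [simp]: "subst h (scal c) = scal c"
  using S.act_scal[of 1 c 1] by (simp add: subst_def)

lemma subst_uminus: "subst h (- f) = - subst h f"
  using subst_add[of f "- f"] by (simp add: eq_neg_iff_add_eq_0 add.commute)

lemma subst_diff: "subst h (f - f') = subst h f - subst h f'"
  using subst_add[of f "- f'"] by (simp add: subst_uminus)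

lemma subst_sum: "subst h (sum F A) = (\<Sum>i\<in>A. subst h (F i))"
  by (induct A rule: infinite_finite_induct) (simp_all add: subst_add)

lemma subst_neg_one_power [simp]: "subst h ((-1) ^ k) = (-1) ^ k"
  using subst_scal[of "(-1) ^ k"] by (simp add: scal_neg_one_power)

lemma subst_polys:
  assumes "\<And>g. g \<in> G \<Longrightarrow> h g \<in> polys H" "f \<in> polys G" shows "subst h f \<in> polys H"
proof -
  have "Poly_Mapping.keys f \<subseteq> {w. set (letters w) \<subseteq> G}" using assms(2) by (auto simp: polys_def)
  then show ?thesis
  proof (induct f rule: keys_induct)
    case (add w c f)
    have "subst h (Poly_Mapping.single w c) \<in> polys H" if "set (letters w) \<subseteq> G" for w
    proof -
      have "set l \<subseteq> G \<Longrightarrow> foldr (\<lambda>g v. h g * v) l 1 \<in> polys H" for l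
        by (induct l) (auto simp: polys_mult assms(1))
      then show ?thesis using that
        by (simp add: subst_def S.act_single) (simp add: S.wact_def polys_mult)
    qed
    then show ?case using add by (auto simp: subst_add polys_add)
  qed simp
qed

end

text \<open>If each letter acts as a polynomial in other operators, then a word acts as the word
  with these polynomials substituted. This is how the comultiplication is computed in a free algebra
  on two copies of the generators.\<close>

lemma (in opspace) act_subst:
  assumes v: "v \<in> carrier V" and P: "opspace V op'" and op': "\<And>g v. v \<in> carrier V \<Longrightarrow> op' g v = act (h g) v"
  shows "opspace.act V op' f v = act (subst h f) v"
proof -
  interpret P: opspace V op' by (rule P)
  have w: "P.wact w v = act (subst h (Poly_Mapping.single w 1)) v" for w
  proof (cases w)
    case (Word l)
    have "foldr op' l v = act (subst h (Poly_Mapping.single (Word l) 1)) v"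
    proof (induct l)
      case Nil
      then show ?case using v by (simp add: zero_word_def[symmetric])
    next
      case (Cons g l)
      have "Poly_Mapping.single (Word (g # l)) (1 :: cq) = gen g * Poly_Mapping.single (Word l) 1"
        by (simp add: gen_def mult_single plus_word_def)
      then show ?case using Cons v by (simp add: subst_mult act_mult op')
    qed
    then show ?thesis by (simp add: P.wact_def Word)
  qed
  have s: "Poly_Mapping.single u c = scal c * Poly_Mapping.single u 1" for u :: "'c word" and c
    by (simp add: scal_def mult_single)
  have "Poly_Mapping.keys f \<subseteq> UNIV" by simp
  then show ?thesis
  proof (induct f rule: keys_induct)
    case (add u c f)
    have "act (subst h (Poly_Mapping.single u c)) v = c \<odot> P.wact u v"
      unfolding w by (subst s) (simp add: subst_mult act_scal v)
    then show ?case using add v by (simp add: P.act_add act_add P.act_single subst_add)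
  qed simp
qed

section \<open>Presented algebras\<close>

locale pres =
  fixes G :: "'g set" and d :: "'g \<Rightarrow> nat" and S :: "'g falg set"
  assumes S_polys: "S \<subseteq> polys G"
begin

abbreviation "F \<equiv> free_superalg G d"
abbreviation "I \<equiv> Idl\<^bsub>F\<^esub> S"
abbreviation "P \<equiv> squot F I"

lemma ideal_I: "ideal I F"
  by (rule ring.genideal_ideal[OF ring_free]) (use S_polys in \<open>simp add: polys_def\<close>)

lemma S_I: "S \<subseteq> I"
  by (rule ring.genideal_self[OF ring_free]) (use S_polys in \<open>simp add: polys_def\<close>)

lemma I_mult: "x \<in> I \<Longrightarrow> f \<in> polys G \<Longrightarrow> f * x \<in> I" "x \<in> I \<Longrightarrow> f \<in> polys G \<Longrightarrow> x * f \<in> I"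
  using ideal.I_l_closed[OF ideal_I, of x f] ideal.I_r_closed[OF ideal_I, of x f]
  by (simp_all add: polys_def)

lemma submodule_I: "submodule I base_field F"
proof -
  interpret I: ideal I F by (rule ideal_I)
  show ?thesis
    by (intro submodule.intro submodule_axioms.intro I.a_subgroup)
       (use I_mult(1)[OF _ polys_scal] in simp)
qed

sublocale Q: quot F I
  by (intro quot.intro quot_axioms.intro vspace_free submodule_I) simp_all

lemma pr_polys [simp, intro]: "f \<in> polys G \<Longrightarrow> Q.pr f \<in> carrier P"
  using Q.pr_closed[of f] by (simp add: polys_def)

lemma pres_cases:
  assumes "Z \<in> carrier P" obtains f where "f \<in> polys G" "Z = Q.pr f"
  using Q.squot_cases[OF assms] unfolding carrier_free by blast

lemma mult_pr: "f \<in> polys G \<Longrightarrow> g \<in> polys G \<Longrightarrow> Q.pr f \<otimes>\<^bsub>P\<^esub> Q.pr g = Q.pr (f * g)"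
  using ideal.rcoset_mult_add[OF ideal_I, of f g]
  by (simp add: squot_def FactRing_def Q.pr_def polys_def)

lemma one_pr: "\<one>\<^bsub>P\<^esub> = Q.pr 1"
  by (simp add: squot_def FactRing_def Q.pr_def)

lemma smult_pr: "f \<in> polys G \<Longrightarrow> c \<odot>\<^bsub>P\<^esub> Q.pr f = Q.pr (scal c * f)"
  using Q.smult_squot[of f c] by (simp add: polys_def)

lemmas pr_simps = Q.add_squot mult_pr one_pr smult_pr

lemma uralg_P: "uralg P"
proof -
  interpret V: vspace P by (rule Q.vspace_squot)
  show ?thesis
  proof
    show "bilin P P P (monoid.mult P)"
    proof (intro bilinI linI; elim pres_cases; hypsubst)
    qed (simp_all add: pr_simps polys_mult polys_add distrib_left distrib_right mult.assoc mult_scal_left)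
  qed (auto elim!: pres_cases simp: pr_simps polys_mult mult.assoc)
qed

text \<open>The polynomials satisfying \<open>C\<close> form an ideal, and \<open>I\<close> is the
  least ideal containing the relations. Closure under negation is multiplication by -1.\<close>

lemma I_induct [consumes 1, case_names rel zero add mult]:
  assumes x: "x \<in> I" and rel: "\<And>r. r \<in> S \<Longrightarrow> C r" and zero: "C 0"
    and add: "\<And>x y. x \<in> polys G \<Longrightarrow> y \<in> polys G \<Longrightarrow> C x \<Longrightarrow> C y \<Longrightarrow> C (x + y)"
    and mult: "\<And>f x. f \<in> polys G \<Longrightarrow> x \<in> polys G \<Longrightarrow> C x \<Longrightarrow> C (f * x) \<and> C (x * f)"
  shows "C x"
proof -
  let ?K = "{x \<in> polys G. C x}"
  have inv: "\<ominus>\<^bsub>F\<^esub> x = - x" if "x \<in> polys G" for x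
    using Q.minus_F[of x] that by (simp add: polys_def)
  have neg: "C (- x)" if "x \<in> polys G" "C x" for x
    using mult[of "- 1" x] that polys_neg_one_power[of 1 G] by simp
  have "submodule ?K base_field F"
    by (rule module.submoduleI[OF Q.module_base])
       (use zero inv neg in \<open>auto simp: polys_def[symmetric] add mult intro: polys_add polys_uminus polys_mult polys_scal\<close>)
  then have sg: "subgroup ?K (add_monoid F)" by (rule submodule.axioms(1))
  have "ideal ?K F"
    by (rule idealI[OF ring_free sg]) (auto simp: polys_def[symmetric] polys_mult mult)
  then have "I \<subseteq> ?K"
    by (rule ring.genideal_minimal[OF ring_free]) (use rel S_polys in auto)
  with x show ?thesis by blast
qed

lemma I_least: assumes K: "two_sided K" "S \<subseteq> K" shows "I \<subseteq> K"
proof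
  fix x assume "x \<in> I"
  then show "x \<in> K" by (induct x rule: I_induct) (use K two_sidedD[OF K(1)] in auto)
qed

lemma pr_gen [simp, intro]: "g \<in> G \<Longrightarrow> Q.pr (gen g) \<in> carrier P"
  by (simp add: polys_gen)

lemma P_induct_word:
  assumes Z: "Z \<in> carrier P"
    and word: "\<And>l. set l \<subseteq> G \<Longrightarrow> C (Q.pr (Poly_Mapping.single (Word l) 1))"
    and add: "\<And>Z W. Z \<in> carrier P \<Longrightarrow> W \<in> carrier P \<Longrightarrow> C Z \<Longrightarrow> C W \<Longrightarrow> C (Z \<oplus>\<^bsub>P\<^esub> W)"
    and smult: "\<And>Z c. Z \<in> carrier P \<Longrightarrow> C Z \<Longrightarrow> C (c \<odot>\<^bsub>P\<^esub> Z)"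
  shows "C Z"
proof -
  obtain f where f: "f \<in> polys G" "Z = Q.pr f" using Z by (rule pres_cases)
  have s: "Poly_Mapping.single (Word l) 1 \<in> polys G" if "set l \<subseteq> G" for l
    using that by (simp add: polys_def)
  have "Poly_Mapping.keys f \<subseteq> {w. set (letters w) \<subseteq> G}" using f(1) by (auto simp: polys_def)
  then have "C (Q.pr f)"
  proof (induct f rule: keys_induct)
    case zero
    have "Q.pr 0 = 0 \<odot>\<^bsub>P\<^esub> Q.pr (Poly_Mapping.single (Word []) 1)"
      using smult_pr[OF s[of "[]"]] by simp
    then show ?case using smult[OF _ word[of "[]"]] s[of "[]"] by simp
  next
    case (add w c f)
    obtain l where l: "w = Word l" by (cases w)
    have sl: "set l \<subseteq> G" using add(1) l by simp
    have "Poly_Mapping.single w c = scal c * Poly_Mapping.single (Word l) 1"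
      by (simp add: scal_def mult_single l)
    then have "Q.pr (Poly_Mapping.single w c + f) = (c \<odot>\<^bsub>P\<^esub> Q.pr (Poly_Mapping.single (Word l) 1)) \<oplus>\<^bsub>P\<^esub> Q.pr f"
      by (simp add: smult_pr s sl Q.add_squot)
    moreover have "f \<in> polys G" using add(2) by (auto simp: polys_def)
    ultimately show ?case
      using assms(3)[OF _ _ smult[OF _ word[OF sl]] add(3)] s[OF sl]
      by (simp add: vspace.smult_cl[OF Q.vspace_squot])
  qed
  with f(2) show ?thesis by simp
qed

lemma P_induct [consumes 1, case_names one gen add smult]:
  assumes Z: "Z \<in> carrier P" and one: "C \<one>\<^bsub>P\<^esub>"
    and gen: "\<And>g Z. g \<in> G \<Longrightarrow> Z \<in> carrier P \<Longrightarrow> C Z \<Longrightarrow> C (Q.pr (gen g) \<otimes>\<^bsub>P\<^esub> Z)"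
    and add: "\<And>Z W. Z \<in> carrier P \<Longrightarrow> W \<in> carrier P \<Longrightarrow> C Z \<Longrightarrow> C W \<Longrightarrow> C (Z \<oplus>\<^bsub>P\<^esub> W)"
    and smult: "\<And>Z c. Z \<in> carrier P \<Longrightarrow> C Z \<Longrightarrow> C (c \<odot>\<^bsub>P\<^esub> Z)"
  shows "C Z"
  using Z
proof (rule P_induct_word)
  fix l assume "set l \<subseteq> G"
  then show "C (Q.pr (Poly_Mapping.single (Word l) 1))"
  proof (induct l)
    case Nil
    then show ?case using one by (simp add: one_pr zero_word_def[symmetric])
  next
    case (Cons g l)
    have "Poly_Mapping.single (Word (g # l)) (1 :: cq) = gen g * Poly_Mapping.single (Word l) 1"
      by (simp add: gen_def mult_single plus_word_def)
    moreover have "Poly_Mapping.single (Word l) 1 \<in> polys G" using Cons by (simp add: polys_def)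
    ultimately show ?case using Cons gen[of g "Q.pr (Poly_Mapping.single (Word l) 1)"]
      by (simp add: mult_pr polys_gen)
  qed
qed (fact add smult)+

text \<open>Peeling off the last letter suits two later arguments: in a product \<open>y t\<close>
  the factor \<open>t\<close> is braided first, and in a product \<open>u L\<close> the factor
  \<open>L\<close> acts first.\<close>

lemma P_induct_right [consumes 1, case_names one gen add smult]:
  assumes Z: "Z \<in> carrier P" and one: "C \<one>\<^bsub>P\<^esub>"
    and gen: "\<And>g Z. g \<in> G \<Longrightarrow> Z \<in> carrier P \<Longrightarrow> C Z \<Longrightarrow> C (Z \<otimes>\<^bsub>P\<^esub> Q.pr (gen g))"
    and add: "\<And>Z W. Z \<in> carrier P \<Longrightarrow> W \<in> carrier P \<Longrightarrow> C Z \<Longrightarrow> C W \<Longrightarrow> C (Z \<oplus>\<^bsub>P\<^esub> W)"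
    and smult: "\<And>Z c. Z \<in> carrier P \<Longrightarrow> C Z \<Longrightarrow> C (c \<odot>\<^bsub>P\<^esub> Z)"
  shows "C Z"
  using Z
proof (rule P_induct_word)
  fix l assume "set l \<subseteq> G"
  then show "C (Q.pr (Poly_Mapping.single (Word l) 1))"
  proof (induct l rule: rev_induct)
    case Nil
    then show ?case using one by (simp add: one_pr zero_word_def[symmetric])
  next
    case (snoc g l)
    have "Poly_Mapping.single (Word (l @ [g])) (1 :: cq) = Poly_Mapping.single (Word l) 1 * gen g"
      by (simp add: gen_def mult_single plus_word_def)
    moreover have "Poly_Mapping.single (Word l) 1 \<in> polys G" using snoc by (simp add: polys_def)
    ultimately show ?case using snoc gen[of g "Q.pr (Poly_Mapping.single (Word l) 1)"]
      by (simp add: mult_pr polys_gen)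
  qed
qed (fact add smult)+

end

section \<open>Homomorphisms out of presented superalgebras\<close>

text \<open>What the target of a homomorphism out of a presentation has to offer for the
  homomorphism to respect parity: multiplicative subspaces indexed by the two parities.\<close>

locale gralg = uralg V for V :: "'a superalg" (structure) +
  assumes gr_sub: "p \<in> {0, 1} \<Longrightarrow> submodule (part V p) base_field V"
    and gr_one: "\<one> \<in> part V 0"
    and gr_mult: "p \<in> {0, 1} \<Longrightarrow> r \<in> {0, 1} \<Longrightarrow> x \<in> part V p \<Longrightarrow> y \<in> part V r
      \<Longrightarrow> x \<otimes> y \<in> part V ((p + r) mod 2)"

lemma (in salg) gralg: "gralg V"
proof (intro gralg.intro gralg_axioms.intro)
  show "uralg V" by (rule uralg_axioms)
  show "p \<in> {0, 1} \<Longrightarrow> submodule (part V p) base_field V" for p by (rule submod_part)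
  show "\<one> \<in> part V 0" by (rule one_part)
  show "p \<in> {0, 1} \<Longrightarrow> r \<in> {0, 1} \<Longrightarrow> x \<in> part V p \<Longrightarrow> y \<in> part V r
      \<Longrightarrow> x \<otimes> y \<in> part V ((p + r) mod 2)" for p r x y by (rule mult_part)
qed

lemma (in tensalg) gralg_tens: "gralg (tens_alg A B)"
proof -
  show ?thesis
  proof (intro gralg.intro gralg_axioms.intro uralg_tens_alg)
    show "submodule (part (tens_alg A B) p) base_field (tens_alg A B)" for p
      using submodule_part_tens[of p] by (simp add: submodule_def submodule_axioms_def)
    show "\<one>\<^bsub>tens_alg A B\<^esub> \<in> part (tens_alg A B) 0"
      unfolding tens_alg_simps by (rule tpure_part[of 0 0]) simp_all
    show "Z \<otimes>\<^bsub>tens_alg A B\<^esub> W \<in> part (tens_alg A B) ((p + r) mod 2)"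
      if "p \<in> {0, 1}" "r \<in> {0, 1}" "Z \<in> part (tens_alg A B) p" "W \<in> part (tens_alg A B) r" for p r Z W
      using mult_tens_part[of p r Z W] that by (simp only: tens_alg_simps)
  qed
qed

text \<open>The reduction modulo 2 in the parity condition is there because \<open>gpar\<close> adds
  two parities and may be 2.\<close>

locale genmap = pres G d S + B: gralg B
  for G :: "'g set" and d :: "'g \<Rightarrow> nat" and S :: "'g falg set" and B :: "'b superalg" +
  fixes h :: "'g \<Rightarrow> 'b"
  assumes h_part: "g \<in> G \<Longrightarrow> h g \<in> part B (d g mod 2)"
begin

lemma B_part_closed: "p \<in> {0, 1} \<Longrightarrow> x \<in> part B p \<Longrightarrow> x \<in> carrier B"
  using module.submoduleE(1)[OF B.module_base B.gr_sub] by blast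

lemma h_closed: "g \<in> G \<Longrightarrow> h g \<in> carrier B"
  by (rule B_part_closed[OF _ h_part]) auto

text \<open>The zero operator is the default outside \<open>G\<close>, so that every letter of the
  type has an operator.\<close>

definition opr :: "'g \<Rightarrow> 'b \<Rightarrow> 'b" where
  "opr g v = (if g \<in> G then h g \<otimes>\<^bsub>B\<^esub> v else \<zero>\<^bsub>B\<^esub>)"

sublocale O: opspace B opr
proof
  show "lin B B (opr g)" for g
    by (cases "g \<in> G") (simp_all add: opr_def[abs_def] B.lin_mult_left h_closed lin_const_zero B.vspace_axioms)
qed

text \<open>The evaluation homomorphism, recovered from the representation by left multiplications
  by applying it to the unit.\<close>

definition ev :: "'g falg \<Rightarrow> 'b" where "ev f = O.act f \<one>\<^bsub>B\<^esub>"

lemma zero_mult: "v \<in> carrier B \<Longrightarrow> \<zero>\<^bsub>B\<^esub> \<otimes>\<^bsub>B\<^esub> v = \<zero>\<^bsub>B\<^esub>"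
  by (rule lin_zero[OF B.vspace_axioms B.vspace_axioms B.lin_mult_right])

lemma act_ev: "v \<in> carrier B \<Longrightarrow> O.act f v = ev f \<otimes>\<^bsub>B\<^esub> v"
proof -
  assume v: "v \<in> carrier B"
  have w: "O.wact w v = O.wact w \<one>\<^bsub>B\<^esub> \<otimes>\<^bsub>B\<^esub> v" for w
  proof -
    have "foldr opr l v = foldr opr l \<one>\<^bsub>B\<^esub> \<otimes>\<^bsub>B\<^esub> v \<and> foldr opr l \<one>\<^bsub>B\<^esub> \<in> carrier B" for l
      by (induct l) (simp_all add: opr_def v B.mult_assoc h_closed zero_mult)
    then show ?thesis by (simp add: O.wact_def)
  qed
  have "Poly_Mapping.keys f \<subseteq> UNIV" by simp
  then show ?thesis unfolding ev_def
  proof (induct f rule: keys_induct)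
    case zero
    then show ?case by (simp add: zero_mult v)
  next
    case (add u c f)
    then show ?case using w[of u] v by (simp add: O.act_add O.act_single B.add_mult B.smult_mult_left)
  qed
qed

lemma ev_closed [simp, intro]: "ev f \<in> carrier B"
  by (simp add: ev_def)

lemma ev_add: "ev (f + g) = ev f \<oplus>\<^bsub>B\<^esub> ev g" and ev_scal: "ev (scal c * f) = c \<odot>\<^bsub>B\<^esub> ev f"
  and ev_one [simp]: "ev 1 = \<one>\<^bsub>B\<^esub>" and ev_zero [simp]: "ev 0 = \<zero>\<^bsub>B\<^esub>"
  and ev_gen: "x \<in> G \<Longrightarrow> ev (gen x) = h x"
  and ev_sum: "ev (sum F' A) = (\<Oplus>\<^bsub>B\<^esub>i\<in>A. ev (F' i))"
  by (simp_all add: ev_def O.act_add O.act_scal O.act_sum opr_def h_closed)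

lemma ev_mult: "ev (f * g) = ev f \<otimes>\<^bsub>B\<^esub> ev g"
  using act_ev[of "ev g" f] by (simp add: ev_def O.act_mult)

lemma ker_iff: "f \<in> O.ker \<longleftrightarrow> ev f = \<zero>\<^bsub>B\<^esub>"
proof
  assume "f \<in> O.ker" then show "ev f = \<zero>\<^bsub>B\<^esub>" by (simp add: O.ker_def ev_def)
next
  assume "ev f = \<zero>\<^bsub>B\<^esub>" then show "f \<in> O.ker"
    by (simp add: O.ker_def act_ev zero_mult)
qed

lemma ev_part:
  assumes "f \<in> part F p" "p \<in> {0, 1}" shows "ev f \<in> part B p"
proof -
  note sub = module.submoduleE[OF B.module_base B.gr_sub]
  have part_zero: "\<zero>\<^bsub>B\<^esub> \<in> part B p" if "p \<in> {0, 1}" for p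
  proof -
    have "\<one>\<^bsub>add_monoid B\<^esub> \<in> part B p"
      by (rule subgroup.one_closed[OF submodule.axioms(1)[OF B.gr_sub[OF that]]])
    then show ?thesis by simp
  qed
  have w: "set l \<subseteq> G \<Longrightarrow> foldr opr l \<one>\<^bsub>B\<^esub> \<in> part B ((\<Sum>g\<leftarrow>l. d g) mod 2)" for l
  proof (induct l)
    case Nil
    then show ?case by (simp add: B.gr_one)
  next
    case (Cons g l)
    then have "h g \<otimes>\<^bsub>B\<^esub> foldr opr l \<one>\<^bsub>B\<^esub> \<in> part B ((d g mod 2 + (\<Sum>g\<leftarrow>l. d g) mod 2) mod 2)"
      by (intro B.gr_mult h_part) auto
    then show ?case using Cons(2) by (simp add: opr_def[of g] mod_simps)
  qed
  have "Poly_Mapping.keys f \<subseteq> {w. set (letters w) \<subseteq> G \<and> (\<Sum>g\<leftarrow>letters w. d g) mod 2 = p}"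
    using assms(1) by (auto simp: free_superalg_def)
  then show ?thesis
  proof (induct f rule: keys_induct)
    case zero
    then show ?case using part_zero[OF assms(2)] by simp
  next
    case (add u c f)
    then have "O.wact u \<one>\<^bsub>B\<^esub> \<in> part B p" using w[of "letters u"] by (auto simp: O.wact_def)
    then show ?case using add sub(4)[OF assms(2), of c] sub(5)[OF assms(2)]
      by (simp add: ev_def O.act_add O.act_single)
  qed
qed

text \<open>Restricted to the carrier because \<open>gen_hom\<close> selects among extensional
  functions.\<close>

definition hom :: "'g falg set \<Rightarrow> 'b" where
  "hom = restrict (\<lambda>Z. ev (SOME f. f \<in> Z)) (carrier P)"

context
  assumes kills: "\<And>r. r \<in> S \<Longrightarrow> ev r = \<zero>\<^bsub>B\<^esub>"
begin

lemma I_ker: "I \<subseteq> O.ker"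
  by (rule I_least[OF O.two_sided_ker]) (auto simp: ker_iff kills)

lemma hom_pr: "f \<in> polys G \<Longrightarrow> hom (Q.pr f) = ev f"
proof -
  assume f: "f \<in> polys G"
  let ?g = "SOME g. g \<in> Q.pr f"
  have "Q.pr f = Q.pr ?g" using Q.some_mem[of "Q.pr f"] pr_polys[OF f] by blast
  then have "f - ?g \<in> O.ker" using I_ker by (auto simp: Q.pr_eq_iff)
  then show ?thesis using pr_polys[OF f] O.act_cong_ker[of f ?g "\<one>\<^bsub>B\<^esub>"] by (simp add: hom_def ev_def)
qed

lemma superalg_hom: "superalg_hom P B hom"
  unfolding superalg_hom_def even_linear_def
proof (intro conjI ballI allI ring_hom_memI)
  show "hom ` part P p \<subseteq> part B p" if p: "p \<in> {0, 1}" for p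
  proof -
    have "f \<in> polys G" if "f \<in> part F p" for f using that by (auto simp: free_superalg_def polys_def)
    then show ?thesis using ev_part p by (auto simp: Q.part_squot hom_pr)
  qed
qed (auto elim!: pres_cases simp: pr_simps hom_pr ev_add ev_mult ev_scal[of _ 1, simplified] B.smult_mult_left
    polys_add polys_mult)

lemma hom_extensional: "hom \<in> extensional (carrier P)"
  by (simp add: hom_def)

end

end

lemma (in pres) superalg_hom_unique:
  assumes B: "uralg B" and f: "superalg_hom P B f" and f': "superalg_hom P B f'"
    and gen: "\<And>g. g \<in> G \<Longrightarrow> f (Q.pr (gen g)) = f' (Q.pr (gen g))" and Z: "Z \<in> carrier P"
  shows "f Z = f' Z"
  using Z
proof (induct Z rule: P_induct)
  case one
  show ?case using f f' by (simp add: superalg_hom_def ring_hom_def)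
next
  case (gen g Z)
  then show ?case using f f' assms(4)[of g] ring_hom_mult[of f P B] ring_hom_mult[of f' P B]
    by (simp add: superalg_hom_def)
qed (use f f' in \<open>simp_all add: superalg_hom_def even_linear_def\<close>)

text \<open>The family \<open>t\<close> may omit generators as long as each generator is a scalar
  multiple of a listed element. For \<open>Abar\<close> the list consists of the generators with
  negative first index, and the others are these up to sign.\<close>

lemma (in pres) gen_hom_eq:
  assumes B: "uralg B" and f: "superalg_hom P B f" "f \<in> extensional (carrier P)"
    and h: "\<And>x. x \<in> X \<Longrightarrow> f (t x) = h x"
    and span: "\<And>g. g \<in> G \<Longrightarrow> \<exists>x\<in>X. \<exists>c. t x \<in> carrier P \<and> Q.pr (gen g) = c \<odot>\<^bsub>P\<^esub> t x"
  shows "gen_hom P B X t h = f"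
  unfolding gen_hom_def
proof (rule the_equality)
  show "f \<in> extensional (carrier P) \<and> superalg_hom P B f \<and> (\<forall>x\<in>X. f (t x) = h x)"
    using assms by auto
next
  fix f' assume f': "f' \<in> extensional (carrier P) \<and> superalg_hom P B f' \<and> (\<forall>x\<in>X. f' (t x) = h x)"
  have "f' (Q.pr (gen g)) = f (Q.pr (gen g))" if g: "g \<in> G" for g
  proof -
    obtain x c where xc: "x \<in> X" "t x \<in> carrier P" "Q.pr (gen g) = c \<odot>\<^bsub>P\<^esub> t x" using span[OF g] by blast
    then show ?thesis using f(1) f' h by (simp add: superalg_hom_def even_linear_def)
  qed
  then show "f' = f"
    using f f' by (intro extensionalityI[of _ "carrier P"]) (auto intro: superalg_hom_unique[OF B])
qed

section \<open>Superalgebras from homogeneous relations\<close>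

section \<open>The parity automorphism\<close>

text \<open>Its eigenspaces for 1 and -1 are the even and the odd part, so that parity statements
  become equations in the free algebra.\<close>

definition paut :: "('g \<Rightarrow> nat) \<Rightarrow> 'g falg \<Rightarrow> 'g falg" where
  "paut d = subst (\<lambda>g. (-1) ^ d g * gen g)"

lemmas paut_simps = subst_add[of "\<lambda>g. (-1) ^ d g * gen g" for d, folded paut_def]
  subst_diff[of "\<lambda>g. (-1) ^ d g * gen g" for d, folded paut_def]
  subst_uminus[of "\<lambda>g. (-1) ^ d g * gen g" for d, folded paut_def]
  subst_mult[of "\<lambda>g. (-1) ^ d g * gen g" for d, folded paut_def]
  subst_sum[of "\<lambda>g. (-1) ^ d g * gen g" for d, folded paut_def]

lemma paut_atoms [simp]:
  "paut d 0 = 0" "paut d 1 = 1" "paut d (scal c) = scal c" "paut d (gen g) = (-1) ^ d g * gen g"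
  "paut d ((-1) ^ k) = (-1) ^ k"
  by (simp_all add: paut_def)

lemma neg_one_power_scal_mult: "(-1) ^ k * (f :: 'g falg) = scal ((-1) ^ k) * f"
  by (simp add: scal_neg_one_power)

lemma lookup_scal_mult [simp]: "Poly_Mapping.lookup (scal c * f) w = c * Poly_Mapping.lookup f w"
  by (simp add: scal_mult)

lemma lookup_paut:
  "Poly_Mapping.lookup (paut d f) w = (-1) ^ (\<Sum>g\<leftarrow>letters w. d g) * Poly_Mapping.lookup f w"
proof -
  have word: "paut d (Poly_Mapping.single (Word l) 1) = scal ((-1) ^ (\<Sum>g\<leftarrow>l. d g)) * Poly_Mapping.single (Word l) 1" for l
  proof (induct l)
    case Nil
    then show ?case by (simp add: zero_word_def[symmetric])
  next
    case (Cons g l)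
    have "Poly_Mapping.single (Word (g # l)) (1 :: cq) = gen g * Poly_Mapping.single (Word l) 1"
      by (simp add: gen_def mult_single plus_word_def)
    then show ?case using Cons
      by (simp add: paut_simps power_add scal_times neg_one_power_scal_mult mult_scal_left[of "gen g"] mult.assoc)
  qed
  have "Poly_Mapping.keys f \<subseteq> UNIV" by simp
  then show ?thesis
  proof (induct f rule: keys_induct)
    case (add u c f)
    obtain l where l: "u = Word l" by (cases u)
    have "Poly_Mapping.single u c = scal c * Poly_Mapping.single (Word l) 1"
      by (simp add: scal_def mult_single l)
    then have "paut d (Poly_Mapping.single u c) = scal c * (scal ((-1) ^ (\<Sum>g\<leftarrow>l. d g)) * Poly_Mapping.single (Word l) 1)"
      by (simp add: paut_simps word)
    then show ?case using add(3) l
      by (auto simp: paut_simps lookup_add distrib_left lookup_single when_def)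
  qed simp
qed

lemma paut_paut [simp]: "paut d (paut d f) = f"
  by (rule poly_mapping_eqI) (simp add: lookup_paut mult.assoc[symmetric] power_add[symmetric])

lemma paut_polys: "f \<in> polys G \<Longrightarrow> paut d f \<in> polys G"
  unfolding paut_def by (rule subst_polys) (auto intro: polys_mult polys_gen)

text \<open>Projecting to an eigenspace of the parity automorphism divides by 2.\<close>

lemma two_cq: "(2 :: cq) \<noteq> 0"
proof -
  have "(2 :: cq) = Fract 1 1 + Fract 1 1" by (simp add: One_fract_def[symmetric])
  also have "\<dots> = Fract (1 + 1) 1" by (subst add_fract) simp_all
  also have "\<dots> \<noteq> Fract 0 1" by (subst eq_fract) simp_all
  finally show ?thesis unfolding Zero_fract_def .
qed

lemma neg_eq_self_cq: "- c = (c :: cq) \<longleftrightarrow> c = 0"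
proof
  assume "- c = c"
  then have "2 * c = 0" by (metis mult_2 add.right_inverse)
  then show "c = 0" using two_cq by simp
qed simp

lemma part_free_superalg:
  assumes "p \<in> {0, 1}"
  shows "f \<in> part (free_superalg G d) p \<longleftrightarrow> f \<in> polys G \<and> paut d f = scal ((-1) ^ p) * f"
proof -
  have "((\<Sum>g\<leftarrow>letters w. d g) mod 2 = p) \<longleftrightarrow>
      (-1) ^ (\<Sum>g\<leftarrow>letters w. d g) * Poly_Mapping.lookup f w = (-1) ^ p * Poly_Mapping.lookup f w"
    if "w \<in> Poly_Mapping.keys f" for w
  proof -
    have l: "Poly_Mapping.lookup f w \<noteq> 0" using that by (simp add: in_keys_iff)
    show ?thesis
      using assms l neg_eq_self_cq[of "Poly_Mapping.lookup f w"] neg_eq_self_cq[of "- Poly_Mapping.lookup f w"]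
      by (cases "even (\<Sum>g\<leftarrow>letters w. d g)") (auto simp: odd_iff_mod_2_eq_one)
  qed
  then show ?thesis
    by (auto simp: free_superalg_def polys_def poly_mapping_eq_iff fun_eq_iff lookup_paut in_keys_iff)
qed

lemma (in uralg) ring: "ring V"
  by (intro ringI abelian_group_axioms monoidI) (auto simp: mult_assoc add_mult mult_add)

text \<open>Homogeneity of a relation is expressed as being an eigenvector of \<open>paut\<close>.
  The sign may vary from one relation to another; in either case the ideal is stable under
  \<open>paut\<close>.\<close>

locale hpres = pres +
  assumes S_hom: "r \<in> S \<Longrightarrow> paut d r = r \<or> paut d r = - r"
begin

lemma paut_I: "x \<in> I \<Longrightarrow> paut d x \<in> I"
proof (induct x rule: I_induct)
  case (rel r)
  then show ?case using S_hom[of r] S_I Q.I_uminus[of r] by auto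
next
  case (add x y)
  then show ?case by (simp add: paut_simps Q.I_add)
next
  case (mult f x)
  then show ?case by (simp add: paut_simps I_mult paut_polys)
qed simp

lemma part_F: "p \<in> {0, 1} \<Longrightarrow> f \<in> part F p \<longleftrightarrow> f \<in> polys G \<and> paut d f = scal ((-1) ^ p) * f"
  by (rule part_free_superalg)

lemma part_F_polys: "p \<in> {0, 1} \<Longrightarrow> f \<in> part F p \<Longrightarrow> f \<in> polys G"
  by (simp add: part_F)

lemma submodule_part_P:
  assumes p: "p \<in> {0, 1}" shows "submodule (part P p) base_field P"
proof -
  interpret V: vspace P by (rule Q.vspace_squot)
  have cl: "0 \<in> part F p" "\<And>x y. x \<in> part F p \<Longrightarrow> y \<in> part F p \<Longrightarrow> x + y \<in> part F p"
    "\<And>x c. x \<in> part F p \<Longrightarrow> scal c * x \<in> part F p"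
    using p by (auto simp: part_F polys_add polys_mult paut_simps distrib_left)
  have sc: "c \<odot>\<^bsub>P\<^esub> x \<in> part P p" if x: "x \<in> part P p" for c x
  proof -
    obtain f where "f \<in> part F p" "x = Q.pr f" using x unfolding Q.part_squot by blast
    then show ?thesis
      using cl(3)[of f c] by (simp add: smult_pr part_F_polys[OF p] Q.part_squot)
  qed
  have sub: "part P p \<subseteq> carrier P" using part_F_polys[OF p] unfolding Q.part_squot by auto
  show ?thesis
  proof (rule module.submoduleI[OF V.module_base])
    show "part P p \<subseteq> carrier P" by (rule sub)
    show "\<zero>\<^bsub>P\<^esub> \<in> part P p" unfolding Q.zero_squot Q.part_squot using cl(1) by blast
    show "a \<oplus>\<^bsub>P\<^esub> b \<in> part P p" if ab: "a \<in> part P p" "b \<in> part P p" for a b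
    proof -
      obtain f g where "f \<in> part F p" "a = Q.pr f" "g \<in> part F p" "b = Q.pr g"
        using ab unfolding Q.part_squot by blast
      then show ?thesis using cl(2)[of f g] by (simp add: Q.add_squot Q.part_squot)
    qed
    show "\<ominus>\<^bsub>P\<^esub> a \<in> part P p" if "a \<in> part P p" for a
      using sc[OF that, of "-1"] that sub by (auto simp: V.minus_one_smult)
  qed (simp add: sc)
qed

text \<open>A representative f splits into half of f + \<open>paut\<close> f and half of f -
  \<open>paut\<close> f. For uniqueness, the difference of two decompositions lies in the ideal; its
  image under \<open>paut\<close> lies there too, and their sum is twice the even component.\<close>

lemma superalgebra_P: "superalgebra P"
proof -
  interpret V: uralg P by (rule uralg_P)
  have half: "scal (1 / 2) * (f + f) = f" for f :: "'g falg"
  proof -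
    have "f + f = scal (1 + 1) * f"
      by (simp only: scal_add scal_one distrib_right mult_1)
    then have "scal (1 / 2) * (f + f) = scal (1 / 2 * (1 + 1)) * f"
      by (simp only: scal_times mult.assoc)
    also have "1 / 2 * (1 + 1) = (1 :: cq)" using two_cq by simp
    finally show ?thesis by simp
  qed
  have ex1: "\<exists>!yz. yz \<in> part P 0 \<times> part P 1 \<and> x = fst yz \<oplus>\<^bsub>P\<^esub> snd yz" if x: "x \<in> carrier P" for x
  proof (rule ex_ex1I)
    obtain f where f: "f \<in> polys G" "x = Q.pr f" using x by (rule pres_cases)
    define a b where "a = scal (1 / 2) * (f + paut d f)" and "b = scal (1 / 2) * (f - paut d f)"
    have "a \<in> part F 0" "b \<in> part F 1"
      using f(1) by (simp_all add: part_F a_def b_def polys_mult polys_add polys_diff paut_polys paut_simps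
          add.commute right_diff_distrib)
    moreover have "a + b = f"
      using half[of f] by (simp add: a_def b_def distrib_left[symmetric])
    ultimately have "(Q.pr a, Q.pr b) \<in> part P 0 \<times> part P 1 \<and> x = Q.pr a \<oplus>\<^bsub>P\<^esub> Q.pr b"
      using f(2) by (auto simp: Q.part_squot Q.add_squot)
    then show "\<exists>yz. yz \<in> part P 0 \<times> part P 1 \<and> x = fst yz \<oplus>\<^bsub>P\<^esub> snd yz"
      by (intro exI[of _ "(Q.pr a, Q.pr b)"]) simp
  next
    fix yz yz'
    assume "yz \<in> part P 0 \<times> part P 1 \<and> x = fst yz \<oplus>\<^bsub>P\<^esub> snd yz"
      "yz' \<in> part P 0 \<times> part P 1 \<and> x = fst yz' \<oplus>\<^bsub>P\<^esub> snd yz'"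
    then obtain a b a' b' where ab: "a \<in> part F 0" "b \<in> part F 1" "a' \<in> part F 0" "b' \<in> part F 1"
      and yz: "yz = (Q.pr a, Q.pr b)" "yz' = (Q.pr a', Q.pr b')"
      and eq: "Q.pr (a + b) = Q.pr (a' + b')"
      unfolding Q.part_squot by (auto simp: Q.add_squot)
    have mem: "(a - a') + (b - b') \<in> I" using eq by (simp add: Q.pr_eq_iff algebra_simps)
    from paut_I[OF this] have mem': "(a - a') - (b - b') \<in> I"
      using ab by (simp add: part_F paut_simps algebra_simps)
    have "scal (1 / 2) * ((a - a') + (a - a')) \<in> I"
    proof -
      have "(a - a') + (a - a') = ((a - a') + (b - b')) + ((a - a') - (b - b'))" by simp
      then show ?thesis using I_mult(1)[OF Q.I_add[OF mem mem'] polys_scal] by (simp only:)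
    qed
    then have 1: "a - a' \<in> I" by (simp only: half)
    with mem have "b - b' \<in> I" using Q.I_diff[OF mem 1] by simp
    with 1 show "yz = yz'" by (simp add: yz Q.pr_eq_iff)
  qed
  have mult: "x \<otimes>\<^bsub>P\<^esub> y \<in> part P ((p + r) mod 2)"
    if pr: "p \<in> {0, 1}" "r \<in> {0, 1}" and xy: "x \<in> part P p" "y \<in> part P r" for p r x y
  proof -
    obtain f g where fg: "f \<in> part F p" "x = Q.pr f" "g \<in> part F r" "y = Q.pr g"
      using xy unfolding Q.part_squot by blast
    have "f * g \<in> part F ((p + r) mod 2)"
      using fg(1,3) pr by (auto simp: part_F polys_mult paut_simps)
    then show ?thesis using fg pr by (simp add: mult_pr part_F_polys[of p] part_F_polys[of r] Q.part_squot)
  qed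
  have one: "\<one>\<^bsub>P\<^esub> \<in> part P 0"
    unfolding one_pr Q.part_squot by (rule imageI) (simp add: part_F)
  have "superspace P"
    unfolding superspace_def by (intro conjI ballI V.module_base submodule_part_P ex1) simp_all
  then show ?thesis
    unfolding superalgebra_def
    by (intro conjI ballI allI) (assumption | rule V.ring one V.smult_mult_left V.smult_mult_right mult)+
qed

end

section \<open>Exchange relations for supermatrices and the comultiplication\<close>

section \<open>Products of supermatrices\<close>

lemma par_cases: "par i = 0 \<or> par i = 1"
  by (simp add: par_def)

lemma par_uminus: "i \<noteq> 0 \<Longrightarrow> par (- i) = 1 - par i"
  by (simp add: par_def)

lemma neg_one_power_cong: "even (a + b) \<Longrightarrow> ((-1) ^ a :: 'a::ring_1) = (-1) ^ b"
  by (cases "even a") (auto simp: even_add)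

lemma neg_one_power_commute: "(-1) ^ k * x = x * ((-1) ^ k :: 'a::ring_1)"
  by (cases "even k") auto

lemma sum_swap4:
  fixes f :: "'a \<Rightarrow> 'b \<Rightarrow> 'c \<Rightarrow> 'd \<Rightarrow> 'e::comm_monoid_add"
  shows "(\<Sum>a\<in>A. \<Sum>b\<in>B. \<Sum>c\<in>C. \<Sum>d\<in>D. f a b c d) = (\<Sum>c\<in>C. \<Sum>d\<in>D. \<Sum>a\<in>A. \<Sum>b\<in>B. f a b c d)"
proof -
  have "(\<Sum>a\<in>A. \<Sum>b\<in>B. \<Sum>c\<in>C. \<Sum>d\<in>D. f a b c d) = (\<Sum>a\<in>A. \<Sum>c\<in>C. \<Sum>d\<in>D. \<Sum>b\<in>B. f a b c d)"
    by (intro sum.cong refl) (subst sum.swap, intro sum.cong refl, rule sum.swap)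
  also have "\<dots> = (\<Sum>c\<in>C. \<Sum>d\<in>D. \<Sum>a\<in>A. \<Sum>b\<in>B. f a b c d)"
    by (subst sum.swap, intro sum.cong refl, rule sum.swap)
  finally show ?thesis .
qed

text \<open>The Koszul exponent satisfies a cocycle identity modulo 2 in the parities of the
  indices. The rest is associativity of the ring, signs being central, and an interchange of
  sums.\<close>

lemma smul_assoc:
  fixes X Y Z :: "'a::ring_1 smat"
  shows "smul K1 K2 (smul J1 J2 X Y) Z = smul J1 J2 X (smul K1 K2 Y Z)"
proof (intro ext)
  fix i m k p
  let ?e = "\<lambda>i j k l m p. (par k + par l) * (par j + par m) +
             (par i + par j + par k + par l) * (par j + par m + par l + par p)"
  let ?s = "\<lambda>i j k l m p. (-1) ^ ?e i j k l m p :: 'a"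
  have sgn: "?s i j k l m p * ?s i j' k l' j l = ?s i j' k l' m p * ?s j' j l' l m p" for j l j' l'
    unfolding power_add[symmetric]
    by (rule neg_one_power_cong) (simp only: even_add even_mult_iff, argo)
  have t: "?s i j k l m p * (?s i j' k l' j l * X i j' k l' * Y j' j l' l) * Z j m l p =
      ?s i j' k l' m p * X i j' k l' * (?s j' j l' l m p * Y j' j l' l * Z j m l p)" for j l j' l'
  proof -
    have "?s i j' k l' m p * X i j' k l' * (?s j' j l' l m p * Y j' j l' l * Z j m l p)
        = (?s i j' k l' m p * ?s j' j l' l m p) * X i j' k l' * Y j' j l' l * Z j m l p"
      using neg_one_power_commute[of "?e j' j l' l m p" "X i j' k l'"] by (simp add: mult.assoc)
    then show ?thesis by (simp add: sgn[symmetric] mult.assoc)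
  qed
  have "smul K1 K2 (smul J1 J2 X Y) Z i m k p =
      (\<Sum>j\<in>K1. \<Sum>l\<in>K2. \<Sum>j'\<in>J1. \<Sum>l'\<in>J2.
        ?s i j k l m p * (?s i j' k l' j l * X i j' k l' * Y j' j l' l) * Z j m l p)"
    by (simp only: smul_def sum_distrib_left sum_distrib_right)
  also have "\<dots> = (\<Sum>j'\<in>J1. \<Sum>l'\<in>J2. \<Sum>j\<in>K1. \<Sum>l\<in>K2.
        ?s i j' k l' m p * X i j' k l' * (?s j' j l' l m p * Y j' j l' l * Z j m l p))"
    unfolding t by (rule sum_swap4)
  also have "\<dots> = smul J1 J2 X (smul K1 K2 Y Z) i m k p"
    by (simp only: smul_def sum_distrib_left sum_distrib_right)
  finally show "smul K1 K2 (smul J1 J2 X Y) Z i m k p = smul J1 J2 X (smul K1 K2 Y Z) i m k p" .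
qed

lemma smul_cong:
  assumes "\<And>j l. j \<in> J1 \<Longrightarrow> l \<in> J2 \<Longrightarrow> X i j k l = X' i j k l" "\<And>j l. j \<in> J1 \<Longrightarrow> l \<in> J2 \<Longrightarrow> Y j m l p = Y' j m l p"
  shows "smul J1 J2 X Y i m k p = smul J1 J2 X' Y' i m k p"
  unfolding smul_def by (intro sum.cong refl) (simp add: assms)

text \<open>Only the entry of \<open>X\<close> has to pass the second matrix unit. It has the parity
  of its own matrix unit, which gives the sign.\<close>

lemma smul_slot1_slot2:
  assumes "finite J1" "finite J2" "m \<in> J1" "k \<in> J2"
  shows "smul J1 J2 (slot1 X) (slot2 Y) i m k p = (-1) ^ ((par i + par m) * (par k + par p)) * X i m * Y k p"
proof -
  have "smul J1 J2 (slot1 X) (slot2 Y) i m k p = (\<Sum>j\<in>J1. \<Sum>l\<in>J2.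
     if l = k then if j = m then (-1) ^ ((par i + par m) * (par k + par p)) * X i m * Y k p else 0 else 0)"
    unfolding smul_def
    by (intro sum.cong refl) (auto simp: slot1_def slot2_def intro!: neg_one_power_cong arg_cong2[where f = "(*)"])
  then show ?thesis using assms by (simp add: sum.delta')
qed

text \<open>No sign survives: the matrix unit belonging to \<open>Y\<close> passes both a matrix
  unit and an entry of \<open>X\<close> of the same parity, so the two signs cancel.\<close>

lemma smul_slot2_slot1:
  assumes "finite J1" "finite J2" "i \<in> J1" "p \<in> J2"
  shows "smul J1 J2 (slot2 X) (slot1 Y) i m k p = X k p * Y i m"
proof -
  have s: "(-1) ^ ((par k + par p) * (par i + par m) +
      (par i + par i + par k + par p) * (par i + par m + par p + par p)) = (1 :: 'a)"
    by (rule trans[OF neg_one_power_cong[of _ 0]]) (simp_all only: even_add even_mult_iff dvd_0_right power_0, argo)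
  have "smul J1 J2 (slot2 X) (slot1 Y) i m k p = (\<Sum>j\<in>J1. \<Sum>l\<in>J2. if l = p then if j = i then X k p * Y i m else 0 else 0)"
    unfolding smul_def
    by (intro sum.cong refl) (auto simp: slot1_def slot2_def s)
  then show ?thesis using assms by (simp add: sum.delta')
qed

text \<open>The product of two even matrices with entries in a superalgebra; the sign is the one in
  the formula for the comultiplication of \<open>L\<close>.\<close>

definition mmul :: "int set \<Rightarrow> (int \<Rightarrow> int \<Rightarrow> 'a::ring_1) \<Rightarrow> (int \<Rightarrow> int \<Rightarrow> 'a) \<Rightarrow> int \<Rightarrow> int \<Rightarrow> 'a" where
  "mmul N X Y i j = (\<Sum>k\<in>N. (-1) ^ ((par i + par k) * (par k + par j)) * X i k * Y k j)"

lemma slot1_mmul: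
  assumes "finite N" "k \<in> N" shows "smul N N (slot1 X) (slot1 Y) i m k p = slot1 (mmul N X Y) i m k p"
proof -
  have "smul N N (slot1 X) (slot1 Y) i m k p = (\<Sum>j\<in>N. \<Sum>l\<in>N. if l = k then
      if k = p then (-1) ^ ((par i + par j) * (par j + par m)) * X i j * Y j m else 0 else 0)"
    unfolding smul_def
    by (intro sum.cong refl) (auto simp: slot1_def intro!: neg_one_power_cong arg_cong2[where f = "(*)"])
  then show ?thesis using assms by (simp add: sum.delta' slot1_def mmul_def)
qed

lemma slot2_mmul:
  assumes "finite N" "i \<in> N" shows "smul N N (slot2 X) (slot2 Y) i m k p = slot2 (mmul N X Y) i m k p"
proof -
  have "smul N N (slot2 X) (slot2 Y) i m k p = (\<Sum>j\<in>N. if j = i then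
      if i = m then \<Sum>l\<in>N. (-1) ^ ((par k + par l) * (par l + par p)) * X k l * Y l p else 0 else 0)"
    unfolding smul_def
    by (intro sum.cong refl)
       (auto simp: slot2_def intro!: sum.cong neg_one_power_cong arg_cong2[where f = "(*)"])
  then show ?thesis using assms by (simp add: sum.delta' slot2_def mmul_def)
qed

definition scong :: "int set \<Rightarrow> 'a::ring_1 set \<Rightarrow> 'a smat \<Rightarrow> 'a smat \<Rightarrow> bool" where
  "scong N K X Y \<longleftrightarrow> (\<forall>i\<in>N. \<forall>m\<in>N. \<forall>k\<in>N. \<forall>p\<in>N. X i m k p - Y i m k p \<in> K)"

lemma scong_refl: "two_sided K \<Longrightarrow> (\<And>i m k p. i \<in> N \<Longrightarrow> m \<in> N \<Longrightarrow> k \<in> N \<Longrightarrow> p \<in> N \<Longrightarrow> X i m k p = Y i m k p) \<Longrightarrow> scong N K X Y"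
  by (simp add: scong_def two_sidedD)

lemma scong_sym: assumes "two_sided K" "scong N K X Y" shows "scong N K Y X"
  unfolding scong_def
proof (intro ballI)
  fix i m k p assume "i \<in> N" "m \<in> N" "k \<in> N" "p \<in> N"
  then have "- (X i m k p - Y i m k p) \<in> K"
    using assms(2) by (intro two_sided_uminus[OF assms(1)]) (simp add: scong_def)
  then show "Y i m k p - X i m k p \<in> K" by simp
qed

lemma scong_trans: assumes "two_sided K" "scong N K X Y" "scong N K Y Z" shows "scong N K X Z"
  unfolding scong_def
proof (intro ballI)
  fix i m k p assume "i \<in> N" "m \<in> N" "k \<in> N" "p \<in> N"
  then have "(X i m k p - Y i m k p) + (Y i m k p - Z i m k p) \<in> K"
    using assms(2,3) by (intro two_sidedD(2)[OF assms(1)]) (simp_all add: scong_def)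
  then show "X i m k p - Z i m k p \<in> K" by simp
qed

lemma scong_smul:
  assumes K: "two_sided K" and X: "scong N K X X'" and Y: "scong N K Y Y'"
  shows "scong N K (smul N N X Y) (smul N N X' Y')"
  unfolding scong_def
proof (intro ballI)
  fix i m k p assume N: "i \<in> N" "m \<in> N" "k \<in> N" "p \<in> N"
  have "s * X i j k l * Y j m l p - s * X' i j k l * Y' j m l p \<in> K" if jl: "j \<in> N" "l \<in> N" for j l s
  proof -
    have "s * (X i j k l - X' i j k l) * Y j m l p + s * X' i j k l * (Y j m l p - Y' j m l p) \<in> K"
      using X Y N jl by (intro two_sidedD(2-4)[OF K]) (simp_all add: scong_def)
    then show ?thesis by (simp add: algebra_simps)
  qed
  then show "smul N N X Y i m k p - smul N N X' Y' i m k p \<in> K"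
    unfolding smul_def sum_subtractf[symmetric] by (intro two_sided_sum[OF K])
qed

text \<open>The exchange relation of the RLL presentation, read modulo the ideal \<open>K\<close>
  and with coefficient matrix \<open>R\<close>.\<close>

definition RLL :: "int set \<Rightarrow> 'a::ring_1 set \<Rightarrow> 'a smat \<Rightarrow> (int \<Rightarrow> int \<Rightarrow> 'a) \<Rightarrow> bool" where
  "RLL N K R X \<longleftrightarrow> scong N K (smul N N (smul N N (slot1 X) (slot2 X)) R) (smul N N R (smul N N (slot2 X) (slot1 X)))"

text \<open>With \<open>Z = XY\<close> this is
  \<open>Z\<^sub>1Z\<^sub>2R = X\<^sub>1X\<^sub>2Y\<^sub>1Y\<^sub>2R = X\<^sub>1X\<^sub>2RY\<^sub>2Y\<^sub>1 = RX\<^sub>2X\<^sub>1Y\<^sub>2Y\<^sub>1 = RZ\<^sub>2Z\<^sub>1\<close>.\<close>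

lemma RLL_mmul:
  assumes N: "finite N" and K: "two_sided K" and X: "RLL N K R X" and Y: "RLL N K R Y"
    and comm: "\<And>a b c d. a \<in> N \<Longrightarrow> b \<in> N \<Longrightarrow> c \<in> N \<Longrightarrow> d \<in> N \<Longrightarrow>
      Y a b * X c d - (-1) ^ ((par a + par b) * (par c + par d)) * X c d * Y a b \<in> K"
  shows "RLL N K R (mmul N X Y)"
proof -
  let ?m = "smul N N"
  note A = smul_assoc[of N N N N]
  note cg = scong_smul[OF K] and rf = scong_refl[OF K refl] and tr = scong_trans[OF K]
  \<comment> \<open>Supercommutation of the entries in matrix form: the sign from the product of
    slot 1 with slot 2 is exactly the Koszul sign in \<open>comm\<close>, so the reversed product
    carries none.\<close>
  have c1: "scong N K (?m (slot1 Y) (slot2 X)) (?m (slot2 X) (slot1 Y))"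
    unfolding scong_def
  proof (intro ballI)
    fix i m k p assume *: "i \<in> N" "m \<in> N" "k \<in> N" "p \<in> N"
    let ?s = "(-1) ^ ((par i + par m) * (par k + par p)) :: 'a"
    have "?s * (Y i m * X k p - ?s * X k p * Y i m) \<in> K"
      by (intro two_sidedD(3)[OF K] comm *)
    then show "?m (slot1 Y) (slot2 X) i m k p - ?m (slot2 X) (slot1 Y) i m k p \<in> K"
      using * by (simp add: smul_slot1_slot2 smul_slot2_slot1 N right_diff_distrib mult.assoc[symmetric]
          power_add[symmetric])
  qed
  have c2: "scong N K (?m (slot1 X) (slot2 Y)) (?m (slot2 Y) (slot1 X))"
    unfolding scong_def
  proof (intro ballI)
    fix i m k p assume *: "i \<in> N" "m \<in> N" "k \<in> N" "p \<in> N"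
    have "- (Y k p * X i m - (-1) ^ ((par k + par p) * (par i + par m)) * X i m * Y k p) \<in> K"
      by (intro two_sided_uminus[OF K] comm *)
    then show "?m (slot1 X) (slot2 Y) i m k p - ?m (slot2 Y) (slot1 X) i m k p \<in> K"
      using * by (simp add: smul_slot1_slot2 smul_slot2_slot1 N mult.commute[of "par k + par p"])
  qed
  have s1: "scong N K (slot1 (mmul N X Y)) (?m (slot1 X) (slot1 Y))"
    and s2: "scong N K (slot2 (mmul N X Y)) (?m (slot2 X) (slot2 Y))"
    by (rule scong_refl[OF K]; simp add: slot1_mmul slot2_mmul N)+
  have rX: "scong N K (?m (?m (slot1 X) (slot2 X)) R) (?m R (?m (slot2 X) (slot1 X)))"
    and rY: "scong N K (?m (?m (slot1 Y) (slot2 Y)) R) (?m R (?m (slot2 Y) (slot1 Y)))"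
    using X Y by (simp_all add: RLL_def)
  have "scong N K (?m (?m (slot1 (mmul N X Y)) (slot2 (mmul N X Y))) R)
      (?m (?m (?m (slot1 X) (slot1 Y)) (?m (slot2 X) (slot2 Y))) R)"
    by (intro cg s1 s2 rf)
  also have "?m (?m (?m (slot1 X) (slot1 Y)) (?m (slot2 X) (slot2 Y))) R
      = ?m (slot1 X) (?m (?m (slot1 Y) (slot2 X)) (?m (slot2 Y) R))"
    by (simp add: A)
  finally have 1: "scong N K (?m (?m (slot1 (mmul N X Y)) (slot2 (mmul N X Y))) R)
      (?m (slot1 X) (?m (?m (slot1 Y) (slot2 X)) (?m (slot2 Y) R)))" .
  have 2: "scong N K (?m (slot1 X) (?m (?m (slot1 Y) (slot2 X)) (?m (slot2 Y) R)))
      (?m (slot1 X) (?m (?m (slot2 X) (slot1 Y)) (?m (slot2 Y) R)))"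
    by (intro cg c1 rf)
  have e2: "?m (slot1 X) (?m (?m (slot2 X) (slot1 Y)) (?m (slot2 Y) R))
      = ?m (?m (slot1 X) (slot2 X)) (?m (?m (slot1 Y) (slot2 Y)) R)" by (simp add: A)
  have 3: "scong N K (?m (?m (slot1 X) (slot2 X)) (?m (?m (slot1 Y) (slot2 Y)) R))
      (?m (?m (slot1 X) (slot2 X)) (?m R (?m (slot2 Y) (slot1 Y))))"
    by (intro cg rY rf)
  have e3: "?m (?m (slot1 X) (slot2 X)) (?m R (?m (slot2 Y) (slot1 Y)))
      = ?m (?m (?m (slot1 X) (slot2 X)) R) (?m (slot2 Y) (slot1 Y))" by (simp add: A)
  have 4: "scong N K (?m (?m (?m (slot1 X) (slot2 X)) R) (?m (slot2 Y) (slot1 Y)))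
      (?m (?m R (?m (slot2 X) (slot1 X))) (?m (slot2 Y) (slot1 Y)))"
    by (intro cg rX rf)
  have e4: "?m (?m R (?m (slot2 X) (slot1 X))) (?m (slot2 Y) (slot1 Y))
      = ?m R (?m (slot2 X) (?m (?m (slot1 X) (slot2 Y)) (slot1 Y)))" by (simp add: A)
  have 5: "scong N K (?m R (?m (slot2 X) (?m (?m (slot1 X) (slot2 Y)) (slot1 Y))))
      (?m R (?m (slot2 X) (?m (?m (slot2 Y) (slot1 X)) (slot1 Y))))"
    by (intro cg c2 rf)
  have e5: "?m R (?m (slot2 X) (?m (?m (slot2 Y) (slot1 X)) (slot1 Y)))
      = ?m R (?m (?m (slot2 X) (slot2 Y)) (?m (slot1 X) (slot1 Y)))" by (simp add: A)
  have 6: "scong N K (?m R (?m (?m (slot2 X) (slot2 Y)) (?m (slot1 X) (slot1 Y))))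
      (?m R (?m (slot2 (mmul N X Y)) (slot1 (mmul N X Y))))"
    by (rule cg[OF rf cg[OF scong_sym[OF K s2] scong_sym[OF K s1]]])
  show ?thesis unfolding RLL_def
    by (rule tr[OF 1 tr[OF 2[unfolded e2] tr[OF 3[unfolded e3] tr[OF 4[unfolded e4] tr[OF 5[unfolded e5] 6]]]]])
qed

lemma subst_smul: "subst h (smul J1 J2 X Y i m k p) =
  smul J1 J2 (\<lambda>i j k l. subst h (X i j k l)) (\<lambda>i j k l. subst h (Y i j k l)) i m k p"
  by (simp add: smul_def subst_sum subst_mult)

lemma smul_polys:
  assumes "\<And>j l. j \<in> J1 \<Longrightarrow> l \<in> J2 \<Longrightarrow> X i j k l \<in> polys G" "\<And>j l. j \<in> J1 \<Longrightarrow> l \<in> J2 \<Longrightarrow> Y j m l p \<in> polys G"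
  shows "smul J1 J2 X Y i m k p \<in> polys G"
  unfolding smul_def by (intro polys_sum polys_mult assms polys_neg_one_power)

text \<open>Evenness of a supermatrix means that the parity of an entry is the sum of the parities
  of its four indices. The parities of the summation indices occur twice and drop out.\<close>

lemma paut_smul:
  assumes X: "\<And>j l. j \<in> J1 \<Longrightarrow> l \<in> J2 \<Longrightarrow> paut d (X i j k l) = (-1) ^ (par i + par j + par k + par l) * X i j k l"
    and Y: "\<And>j l. j \<in> J1 \<Longrightarrow> l \<in> J2 \<Longrightarrow> paut d (Y j m l p) = (-1) ^ (par j + par m + par l + par p) * Y j m l p"
  shows "paut d (smul J1 J2 X Y i m k p) = (-1) ^ (par i + par m + par k + par p) * smul J1 J2 X Y i m k p"
proof -
  have pull: "(-1) ^ e * ((-1) ^ a * x) * ((-1) ^ b * y) = ((-1) ^ a * (-1) ^ b) * ((-1) ^ e * x * y)"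
    for e a b and x y :: "'g falg"
    by (cases "even a"; cases "even b") auto
  have sgn: "((-1) ^ (par i + par j + par k + par l) * (-1) ^ (par j + par m + par l + par p) :: 'g falg)
      = (-1) ^ (par i + par m + par k + par p)" for j l
    unfolding power_add[symmetric] by (rule neg_one_power_cong) (simp only: even_add even_mult_iff, argo)
  have "paut d ((-1) ^ e * X i j k l * Y j m l p) = (-1) ^ (par i + par m + par k + par p) * ((-1) ^ e * X i j k l * Y j m l p)"
    if jl: "j \<in> J1" "l \<in> J2" for j l e
  proof -
    have "paut d ((-1) ^ e * X i j k l * Y j m l p) = (-1) ^ e * paut d (X i j k l) * paut d (Y j m l p)"
      by (simp only: paut_simps paut_atoms)
    also have "\<dots> = (-1) ^ e * ((-1) ^ (par i + par j + par k + par l) * X i j k l) * ((-1) ^ (par j + par m + par l + par p) * Y j m l p)"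
      by (simp only: X[OF jl] Y[OF jl])
    also have "\<dots> = ((-1) ^ (par i + par j + par k + par l) * (-1) ^ (par j + par m + par l + par p)) * ((-1) ^ e * X i j k l * Y j m l p)"
      by (rule pull)
    finally show ?thesis by (simp only: sgn)
  qed
  then show ?thesis
    unfolding smul_def paut_simps sum_distrib_left by (intro sum.cong refl)
qed

section \<open>The matrix S\<close>

lemma finite_idx [simp, intro]: "finite (idx N)"
  by (simp add: idx_def)

lemma idx_uminus [simp]: "- i \<in> idx N \<longleftrightarrow> i \<in> idx N"
  by (auto simp: idx_def)

lemma idx_nz: "i \<in> idx N \<Longrightarrow> i \<noteq> 0"
  by (auto simp: idx_def)

text \<open>\<open>Smat\<close> with its sums over matrix units carried out. It no longer refers to
  the size of the index set, so one formula serves both sizes of \<open>S\<close> in a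
  relation.\<close>

definition sc :: "int \<Rightarrow> int \<Rightarrow> int \<Rightarrow> int \<Rightarrow> cq" where
  "sc i j k l = (if i = j \<and> k = l then qv powi phi i k else 0) +
     (if k < l \<and> i = l \<and> j = k then xiv * (-1) ^ par k else 0) +
     (if k < l \<and> i = - l \<and> j = - k then xiv * (-1) ^ par k else 0)"

lemma Smat_eq:
  assumes "i \<in> idx N" "j \<in> idx N" "k \<in> idx N" "l \<in> idx N"
  shows "Smat N i j k l = sc i j k l"
proof -
  have 1: "(\<Sum>a\<in>idx N. \<Sum>b\<in>idx N. qv powi phi a b * munit a a i j * munit b b k l)
      = (if i = j \<and> k = l then qv powi phi i k else 0)"
  proof -
    have "(\<Sum>a\<in>idx N. \<Sum>b\<in>idx N. qv powi phi a b * munit a a i j * munit b b k l)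
      = (\<Sum>a\<in>idx N. \<Sum>b\<in>idx N. if b = k then if a = i then (if i = j \<and> k = l then qv powi phi i k else 0) else 0 else 0)"
      by (intro sum.cong refl) (auto simp: munit_def)
    then show ?thesis using assms by (simp add: sum.delta')
  qed
  have 2: "(\<Sum>a\<in>idx N. \<Sum>b\<in>{b \<in> idx N. a < b}. (-1) ^ par a * (munit b a i j + munit (- b) (- a) i j) * munit a b k l)
     = (if k < l then (-1) ^ par k * (munit l k i j + munit (- l) (- k) i j) else (0 :: cq))"
  proof -
    have "(\<Sum>a\<in>idx N. \<Sum>b\<in>{b \<in> idx N. a < b}. (-1) ^ par a * (munit b a i j + munit (- b) (- a) i j) * munit a b k l)
      = (\<Sum>a\<in>idx N. \<Sum>b\<in>idx N. if a < b then (-1) ^ par a * (munit b a i j + munit (- b) (- a) i j) * munit a b k l else 0)"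
      by (simp add: sum.inter_filter)
    also have "\<dots> = (\<Sum>a\<in>idx N. \<Sum>b\<in>idx N. if b = l then if a = k then
          (if k < l then (-1) ^ par k * (munit l k i j + munit (- l) (- k) i j) else (0 :: cq)) else 0 else 0)"
      by (intro sum.cong refl) (simp add: munit_def)
    finally have "(\<Sum>a\<in>idx N. \<Sum>b\<in>{b \<in> idx N. a < b}. (-1) ^ par a * (munit b a i j + munit (- b) (- a) i j) * munit a b k l)
      = (\<Sum>a\<in>idx N. \<Sum>b\<in>idx N. if b = l then if a = k then
          (if k < l then (-1) ^ par k * (munit l k i j + munit (- l) (- k) i j) else (0 :: cq)) else 0 else 0)" .
    then show ?thesis using assms by (simp add: sum.delta')
  qed
  show ?thesis unfolding Smat_def 1 2 sc_def
    by (auto simp: munit_def algebra_simps)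
qed

text \<open>In each of the three terms the index parities cancel in pairs; in the last one
  \<open>par (- i) = 1 - par i\<close> is used twice.\<close>

lemma sc_parity:
  assumes "i \<noteq> 0" "j \<noteq> 0" "k \<noteq> 0" "l \<noteq> 0" "odd (par i + par j + par k + par l)" shows "sc i j k l = 0"
  using assms by (auto simp: sc_def par_uminus par_def split: if_splits)

lemma paut_Sfree:
  assumes "i \<in> idx N" "j \<in> idx N" "k \<in> idx N" "l \<in> idx N"
  shows "paut d (Sfree N i j k l) = (-1) ^ (par i + par j + par k + par l) * Sfree N i j k l"
  using assms sc_parity[of i j k l] idx_nz
  by (cases "even (par i + par j + par k + par l)") (auto simp: Sfree_def Smat_eq)

lemma paut_slot1:
  assumes "paut d (M i j) = (-1) ^ (par i + par j) * M i j"
  shows "paut d (slot1 M i j k l) = (-1) ^ (par i + par j + par k + par l) * slot1 M i j k l"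
proof -
  have "((-1) ^ (par i + par j) :: 'a falg) = (-1) ^ (par i + par j + par k + par k)"
    by (rule neg_one_power_cong) (simp only: even_add, argo)
  then show ?thesis using assms by (auto simp: slot1_def)
qed

lemma paut_slot2:
  assumes "paut d (M k l) = (-1) ^ (par k + par l) * M k l"
  shows "paut d (slot2 M i j k l) = (-1) ^ (par i + par j + par k + par l) * slot2 M i j k l"
proof -
  have "((-1) ^ (par k + par l) :: 'a falg) = (-1) ^ (par i + par i + par k + par l)"
    by (rule neg_one_power_cong) (simp only: even_add, argo)
  then show ?thesis using assms by (auto simp: slot2_def)
qed

section \<open>The comultiplication is well defined\<close>

lemma Lfree_polys: "i \<in> idx n \<Longrightarrow> j \<in> idx n \<Longrightarrow> Lfree i j \<in> polys (U_gens n)"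
  by (auto simp: Lfree_def U_gens_def intro!: polys_gen)

lemma slot1_polys: "M i j \<in> polys G \<Longrightarrow> slot1 M i j k l \<in> polys G"
  and slot2_polys: "M k l \<in> polys G \<Longrightarrow> slot2 M i j k l \<in> polys G"
  by (simp_all add: slot1_def slot2_def)

lemma paut_Lfree: "paut gpar (Lfree i j) = (-1) ^ (par i + par j) * Lfree i j"
  by (simp add: Lfree_def gpar_def)

lemma hpres_U: "hpres (U_gens n) gpar (U_rels n)"
proof
  show "U_rels n \<subseteq> polys (U_gens n)"
    unfolding U_rels_def Sfree_def
    by (auto intro!: polys_diff polys_mult Lfree_polys smul_polys slot1_polys slot2_polys)
next
  fix r assume "r \<in> U_rels n"
  then consider i where "i \<in> idx n" "r = Lfree i i * Lfree (- i) (- i) - 1"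
    | i m k p where "i \<in> idx n" "m \<in> idx n" "k \<in> idx n" "p \<in> idx n"
      "r = smul (idx n) (idx n) (smul (idx n) (idx n) (slot1 Lfree) (slot2 Lfree)) (Sfree n) i m k p
        - smul (idx n) (idx n) (Sfree n) (smul (idx n) (idx n) (slot2 Lfree) (slot1 Lfree)) i m k p"
    unfolding U_rels_def by blast
  then show "paut gpar r = r \<or> paut gpar r = - r"
  proof cases
    case 1
    then show ?thesis
      by (simp add: paut_simps paut_Lfree)
  next
    case 2
    have "paut gpar r = (-1) ^ (par i + par m + par k + par p) * r"
      unfolding 2(5) paut_simps right_diff_distrib
      by (intro arg_cong2[where f = "(-)"] paut_smul paut_Sfree paut_slot1 paut_slot2 paut_Lfree) (use 2 in auto)
    then show ?thesis by (cases "even (par i + par m + par k + par p)") auto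
  qed
qed

lemma Uq_eq: "squot (free_superalg (U_gens n) gpar) (Idl\<^bsub>free_superalg (U_gens n) gpar\<^esub> (U_rels n)) = Uq n"
  by (simp add: Uq_def U_ideal_def U_free_def)

text \<open>\<open>X2\<close> and \<open>Y2\<close> are the generator matrices of two formal copies
  of the algebra, the future L \<otimes> 1 and 1 \<otimes> L.\<close>

definition X2 :: "int \<Rightarrow> int \<Rightarrow> ((int \<times> int) + (int \<times> int)) falg" where
  "X2 i j = (if i \<le> j then gen (Inl (i, j)) else 0)"

definition Y2 :: "int \<Rightarrow> int \<Rightarrow> ((int \<times> int) + (int \<times> int)) falg" where
  "Y2 i j = (if i \<le> j then gen (Inr (i, j)) else 0)"

locale uq =
  fixes n :: nat

sublocale uq \<subseteq> U: hpres "U_gens n" gpar "U_rels n"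
  rewrites "squot (free_superalg (U_gens n) gpar) (Idl\<^bsub>free_superalg (U_gens n) gpar\<^esub> (U_rels n)) = Uq n"
  by (rule hpres_U) (rule Uq_eq)

context uq
begin

lemma salg_U: "salg (Uq n)"
  by (rule salgI[OF U.superalgebra_P])

sublocale TT: tensalg "Uq n" "Uq n"
  by (intro tensalg.intro salg_U)

lemma Lq_pr: "Lq n i j = U.Q.pr (Lfree i j)"
  by (simp add: Lq_def U.Q.pr_def U_ideal_def U_free_def)

abbreviation "N \<equiv> idx n"
abbreviation "T \<equiv> tens_alg (Uq n) (Uq n)"
abbreviation "G2 \<equiv> Inl ` U_gens n \<union> Inr ` U_gens n"

definition d2 :: "(int \<times> int) + (int \<times> int) \<Rightarrow> nat" where
  "d2 g = (case g of Inl x \<Rightarrow> gpar x | Inr x \<Rightarrow> gpar x)"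

definition h2 :: "(int \<times> int) + (int \<times> int) \<Rightarrow> (alg, alg) tensor" where
  "h2 g = (case g of Inl x \<Rightarrow> tpure (Uq n) (Uq n) (U.Q.pr (gen x)) \<one>\<^bsub>Uq n\<^esub>
     | Inr x \<Rightarrow> tpure (Uq n) (Uq n) \<one>\<^bsub>Uq n\<^esub> (U.Q.pr (gen x)))"

lemma pr_gen_part: "g \<in> U_gens n \<Longrightarrow> U.Q.pr (gen g) \<in> part (Uq n) (gpar g mod 2)"
proof -
  assume g: "g \<in> U_gens n"
  have "gen g \<in> part U.F (gpar g mod 2)"
    using g by (simp add: free_superalg_def gen_def)
  then show ?thesis using U.Q.part_squot by blast
qed

lemma h2_simps:
  "h2 (Inl x) = tpure (Uq n) (Uq n) (U.Q.pr (gen x)) \<one>\<^bsub>Uq n\<^esub>"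
  "h2 (Inr x) = tpure (Uq n) (Uq n) \<one>\<^bsub>Uq n\<^esub> (U.Q.pr (gen x))"
  by (simp_all add: h2_def)

lemma h2_part:
  assumes "g \<in> G2" shows "h2 g \<in> part T (d2 g mod 2)"
proof (cases g)
  case (Inl x)
  then have x: "x \<in> U_gens n" using assms by auto
  show ?thesis unfolding tens_alg_simps Inl h2_simps
    by (rule TT.tpure_part[of "gpar x mod 2" 0]) (use pr_gen_part[OF x] in \<open>auto simp: d2_def\<close>)
next
  case (Inr x)
  then have x: "x \<in> U_gens n" using assms by auto
  show ?thesis unfolding tens_alg_simps Inr h2_simps
    by (rule TT.tpure_part[of 0 "gpar x mod 2"]) (use pr_gen_part[OF x] in \<open>auto simp: d2_def\<close>)
qed

text \<open>The set of relations is empty: this is plain evaluation of the free algebra on two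
  copies in the tensor square. Whatever holds there is expressed as membership in its kernel, so the
  matrix calculus can take place in a ring type.\<close>

sublocale M2: genmap G2 d2 "{}" T h2
  by (intro genmap.intro genmap_axioms.intro pres.intro TT.gralg_tens h2_part) auto

text \<open>An even entry passes without sign, so the factor it passes may be inhomogeneous.\<close>

lemma mult_tpure_even_left:
  assumes "x \<in> carrier (Uq n)" "y \<in> part (Uq n) 0" "x' \<in> carrier (Uq n)" "y' \<in> carrier (Uq n)"
  shows "tpure (Uq n) (Uq n) x y \<otimes>\<^bsub>T\<^esub> tpure (Uq n) (Uq n) x' y'
    = tpure (Uq n) (Uq n) (x \<otimes>\<^bsub>Uq n\<^esub> x') (y \<otimes>\<^bsub>Uq n\<^esub> y')"
proof -
  obtain a b where ab: "a \<in> part (Uq n) 0" "b \<in> part (Uq n) 1" "x' = a \<oplus>\<^bsub>Uq n\<^esub> b"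
    using assms(3) by (rule TT.A.decomp)
  have y: "y \<in> carrier (Uq n)" and c: "a \<in> carrier (Uq n)" "b \<in> carrier (Uq n)"
    using assms ab TT.A.part_closed by auto
  have "tpure (Uq n) (Uq n) x y \<in> carrier (tens_space (Uq n) (Uq n))" using assms y by simp
  note r = lin_add[OF bilin_right[OF TT.bilin_mult_tens this]]
  show ?thesis
    using assms ab y c TT.mult_tpure[of 0 0 x y a y'] TT.mult_tpure[of 0 1 x y b y']
    by (simp add: TT.tpure_add_left r TT.A.mult_add)
qed

lemma mult_tpure_even_right:
  assumes "x \<in> carrier (Uq n)" "y \<in> carrier (Uq n)" "x' \<in> part (Uq n) 0" "y' \<in> carrier (Uq n)"
  shows "tpure (Uq n) (Uq n) x y \<otimes>\<^bsub>T\<^esub> tpure (Uq n) (Uq n) x' y'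
    = tpure (Uq n) (Uq n) (x \<otimes>\<^bsub>Uq n\<^esub> x') (y \<otimes>\<^bsub>Uq n\<^esub> y')"
proof -
  obtain a b where ab: "a \<in> part (Uq n) 0" "b \<in> part (Uq n) 1" "y = a \<oplus>\<^bsub>Uq n\<^esub> b"
    using assms(2) by (rule TT.A.decomp)
  have x': "x' \<in> carrier (Uq n)" and c: "a \<in> carrier (Uq n)" "b \<in> carrier (Uq n)"
    using assms ab TT.A.part_closed by auto
  have "tpure (Uq n) (Uq n) x' y' \<in> carrier (tens_space (Uq n) (Uq n))" using assms x' by simp
  note l = lin_add[OF bilin_left[OF TT.bilin_mult_tens this]]
  show ?thesis
    using assms ab x' c TT.mult_tpure[of 0 0 x a x' y'] TT.mult_tpure[of 1 0 x b x' y']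
    by (simp add: TT.tpure_add_right l TT.A.add_mult)
qed

lemma ev2_left:
  "f \<in> polys (U_gens n) \<Longrightarrow> M2.ev (subst (\<lambda>g. gen (Inl g)) f) = tpure (Uq n) (Uq n) (U.Q.pr f) \<one>\<^bsub>Uq n\<^esub>"
proof (induct f rule: polys_induct)
  case one
  show ?case by (simp add: U.one_pr)
next
  case (gen g f)
  then show ?case
    by (simp add: subst_mult M2.ev_mult M2.ev_gen h2_simps mult_tpure_even_left U.mult_pr polys_gen)
next
  case (add f g)
  then show ?case
    by (simp add: subst_add M2.ev_add U.Q.add_squot[symmetric] TT.tpure_add_left)
next
  case (scal f c)
  then show ?case
    by (simp add: subst_mult M2.ev_scal U.smult_pr[symmetric] TT.tpure_smult_left)
qed

lemma ev2_right:
  "f \<in> polys (U_gens n) \<Longrightarrow> M2.ev (subst (\<lambda>g. gen (Inr g)) f) = tpure (Uq n) (Uq n) \<one>\<^bsub>Uq n\<^esub> (U.Q.pr f)"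
proof (induct f rule: polys_induct)
  case one
  show ?case by (simp add: U.one_pr)
next
  case (gen g f)
  then show ?case
    by (simp add: subst_mult M2.ev_mult M2.ev_gen h2_simps mult_tpure_even_right U.mult_pr polys_gen)
next
  case (add f g)
  then show ?case
    by (simp add: subst_add M2.ev_add U.Q.add_squot[symmetric] TT.tpure_add_right)
next
  case (scal f c)
  then show ?case
    by (simp add: subst_mult M2.ev_scal U.smult_pr[symmetric] TT.tpure_smult_right)
qed

lemma subst_slot: "(\<lambda>i j k l. subst h (slot1 M i j k l)) = slot1 (\<lambda>i j. subst h (M i j))"
  "(\<lambda>i j k l. subst h (slot2 M i j k l)) = slot2 (\<lambda>i j. subst h (M i j))"
  by (simp_all add: slot1_def slot2_def fun_eq_iff)

lemma subst_rll: "subst h (smul N N (smul N N (slot1 Lfree) (slot2 Lfree)) (Sfree n) i m k p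
      - smul N N (Sfree n) (smul N N (slot2 Lfree) (slot1 Lfree)) i m k p)
   = smul N N (smul N N (slot1 (\<lambda>i j. subst h (Lfree i j))) (slot2 (\<lambda>i j. subst h (Lfree i j))))
       (\<lambda>i j k l. scal (Smat n i j k l)) i m k p
     - smul N N (\<lambda>i j k l. scal (Smat n i j k l))
       (smul N N (slot2 (\<lambda>i j. subst h (Lfree i j))) (slot1 (\<lambda>i j. subst h (Lfree i j)))) i m k p"
  by (simp add: subst_diff subst_smul subst_slot Sfree_def)

lemma rels_ker:
  assumes h: "\<And>f. f \<in> polys (U_gens n) \<Longrightarrow> f \<in> U.I \<Longrightarrow> M2.ev (subst h f) = \<zero>\<^bsub>T\<^esub>"
  shows "RLL N M2.O.ker (\<lambda>i j k l. scal (Smat n i j k l)) (\<lambda>i j. subst h (Lfree i j))"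
    and "i \<in> N \<Longrightarrow> subst h (Lfree i i) * subst h (Lfree (- i) (- i)) - 1 \<in> M2.O.ker"
proof -
  have k: "subst h r \<in> M2.O.ker" if "r \<in> U_rels n" for r
    using h[of r] that U.S_polys U.S_I by (auto simp: M2.ker_iff)
  show "RLL N M2.O.ker (\<lambda>i j k l. scal (Smat n i j k l)) (\<lambda>i j. subst h (Lfree i j))"
    unfolding RLL_def scong_def
  proof (intro ballI)
    fix i m k p assume "i \<in> N" "m \<in> N" "k \<in> N" "p \<in> N"
    then have "smul N N (smul N N (slot1 Lfree) (slot2 Lfree)) (Sfree n) i m k p
      - smul N N (Sfree n) (smul N N (slot2 Lfree) (slot1 Lfree)) i m k p \<in> U_rels n"
      unfolding U_rels_def by blast
    from k[OF this] show "smul N N (smul N N (slot1 (\<lambda>i j. subst h (Lfree i j))) (slot2 (\<lambda>i j. subst h (Lfree i j))))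
       (\<lambda>i j k l. scal (Smat n i j k l)) i m k p
     - smul N N (\<lambda>i j k l. scal (Smat n i j k l))
       (smul N N (slot2 (\<lambda>i j. subst h (Lfree i j))) (slot1 (\<lambda>i j. subst h (Lfree i j)))) i m k p \<in> M2.O.ker"
      by (simp only: subst_rll)
  qed
  assume "i \<in> N"
  then have "Lfree i i * Lfree (- i) (- i) - 1 \<in> U_rels n" unfolding U_rels_def by blast
  from k[OF this] show "subst h (Lfree i i) * subst h (Lfree (- i) (- i)) - 1 \<in> M2.O.ker"
    by (simp add: subst_diff subst_mult)
qed

lemma pr_I: "f \<in> U.I \<Longrightarrow> U.Q.pr f = \<zero>\<^bsub>Uq n\<^esub>"
  by (simp add: U.Q.pr_zero_iff)

lemma tpure_zero [simp]:
  "y \<in> carrier (Uq n) \<Longrightarrow> tpure (Uq n) (Uq n) \<zero>\<^bsub>Uq n\<^esub> y = \<zero>\<^bsub>tens_space (Uq n) (Uq n)\<^esub>"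
  "y \<in> carrier (Uq n) \<Longrightarrow> tpure (Uq n) (Uq n) y \<zero>\<^bsub>Uq n\<^esub> = \<zero>\<^bsub>tens_space (Uq n) (Uq n)\<^esub>"
  using lin_zero[OF TT.A.vspace_axioms TT.T.vspace_axioms bilin_left[OF TT.bilin_tpure]]
    lin_zero[OF TT.A.vspace_axioms TT.T.vspace_axioms bilin_right[OF TT.bilin_tpure]] by auto

lemma X2_eq: "X2 i j = subst (\<lambda>g. gen (Inl g)) (Lfree i j)"
  and Y2_eq: "Y2 i j = subst (\<lambda>g. gen (Inr g)) (Lfree i j)"
  by (auto simp: X2_def Y2_def Lfree_def)

lemma ker_X2: "RLL N M2.O.ker (\<lambda>i j k l. scal (Smat n i j k l)) X2"
    "i \<in> N \<Longrightarrow> X2 i i * X2 (- i) (- i) - 1 \<in> M2.O.ker"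
  and ker_Y2: "RLL N M2.O.ker (\<lambda>i j k l. scal (Smat n i j k l)) Y2"
    "i \<in> N \<Longrightarrow> Y2 i i * Y2 (- i) (- i) - 1 \<in> M2.O.ker"
proof -
  have h: "M2.ev (subst (\<lambda>g. gen (Inl g)) f) = \<zero>\<^bsub>T\<^esub>" "M2.ev (subst (\<lambda>g. gen (Inr g)) f) = \<zero>\<^bsub>T\<^esub>"
    if "f \<in> polys (U_gens n)" "f \<in> U.I" for f
    using that by (simp_all add: ev2_left ev2_right pr_I)
  have X: "X2 = (\<lambda>i j. subst (\<lambda>g. gen (Inl g)) (Lfree i j))" and Y: "Y2 = (\<lambda>i j. subst (\<lambda>g. gen (Inr g)) (Lfree i j))"
    by (simp_all add: fun_eq_iff X2_eq Y2_eq)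
  show "RLL N M2.O.ker (\<lambda>i j k l. scal (Smat n i j k l)) X2" unfolding X by (rule rels_ker[OF h(1)])
  show "RLL N M2.O.ker (\<lambda>i j k l. scal (Smat n i j k l)) Y2" unfolding Y by (rule rels_ker[OF h(2)])
  show "i \<in> N \<Longrightarrow> X2 i i * X2 (- i) (- i) - 1 \<in> M2.O.ker" unfolding X by (rule rels_ker(2)[OF h(1)])
  show "i \<in> N \<Longrightarrow> Y2 i i * Y2 (- i) (- i) - 1 \<in> M2.O.ker" unfolding Y by (rule rels_ker(2)[OF h(2)])
qed

text \<open>This is the Koszul rule for (1 \<otimes> u)(u' \<otimes> 1). If one of the entries lies
  below the diagonal, both products are already 0 in the free algebra.\<close>

lemma ker_comm:
  assumes "a \<in> N" "b \<in> N" "c \<in> N" "d \<in> N"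
  shows "Y2 a b * X2 c d - (-1) ^ ((par a + par b) * (par c + par d)) * X2 c d * Y2 a b \<in> M2.O.ker"
proof (cases "a \<le> b \<and> c \<le> d")
  case True
  then have g: "(a, b) \<in> U_gens n" "(c, d) \<in> U_gens n" using assms by (auto simp: U_gens_def)
  let ?e = "(par a + par b) * (par c + par d)"
  have "M2.ev (gen (Inr (a, b)) * gen (Inl (c, d))) = ((-1) ^ ((gpar (a, b) mod 2) * (gpar (c, d) mod 2)))
      \<odot>\<^bsub>tens_space (Uq n) (Uq n)\<^esub> tpure (Uq n) (Uq n) (U.Q.pr (gen (c, d))) (U.Q.pr (gen (a, b)))"
  proof -
    have m: "k mod 2 \<in> {0, 1}" for k :: nat by auto
    have "tpure (Uq n) (Uq n) \<one>\<^bsub>Uq n\<^esub> (U.Q.pr (gen (a, b))) \<otimes>\<^bsub>T\<^esub> tpure (Uq n) (Uq n) (U.Q.pr (gen (c, d))) \<one>\<^bsub>Uq n\<^esub>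
      = ((-1) ^ ((gpar (a, b) mod 2) * (gpar (c, d) mod 2))) \<odot>\<^bsub>tens_space (Uq n) (Uq n)\<^esub>
        tpure (Uq n) (Uq n) (\<one>\<^bsub>Uq n\<^esub> \<otimes>\<^bsub>Uq n\<^esub> U.Q.pr (gen (c, d))) (U.Q.pr (gen (a, b)) \<otimes>\<^bsub>Uq n\<^esub> \<one>\<^bsub>Uq n\<^esub>)"
      by (rule TT.mult_tpure[OF m m _ pr_gen_part[OF g(1)] pr_gen_part[OF g(2)]]) simp_all
    then show ?thesis using g by (simp add: M2.ev_mult M2.ev_gen h2_simps)
  qed
  also have "((-1) ^ ((gpar (a, b) mod 2) * (gpar (c, d) mod 2)) :: cq) = (-1) ^ ?e"
    by (rule neg_one_power_cong) (simp add: gpar_def even_mult_iff even_add)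
  also have "tpure (Uq n) (Uq n) (U.Q.pr (gen (c, d))) (U.Q.pr (gen (a, b)))
      = M2.ev (gen (Inl (c, d)) * gen (Inr (a, b)))"
    using g by (simp add: M2.ev_mult M2.ev_gen h2_simps mult_tpure_even_left)
  also have "(-1) ^ ?e \<odot>\<^bsub>tens_space (Uq n) (Uq n)\<^esub> M2.ev (gen (Inl (c, d)) * gen (Inr (a, b)))
      = M2.ev ((-1) ^ ?e * gen (Inl (c, d)) * gen (Inr (a, b)))"
    using M2.ev_scal[of "(-1) ^ ?e" "gen (Inl (c, d)) * gen (Inr (a, b))"]
    by (simp add: scal_neg_one_power mult.assoc)
  finally have "M2.ev (gen (Inr (a, b)) * gen (Inl (c, d))) = M2.ev ((-1) ^ ?e * gen (Inl (c, d)) * gen (Inr (a, b)))" .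
  moreover have "M2.ev (f - g) = \<zero>\<^bsub>T\<^esub>" if "M2.ev f = M2.ev g" for f g
    using that M2.O.act_diff[of "\<one>\<^bsub>T\<^esub>" f g] M2.B.r_neg[OF M2.ev_closed[of g]] by (simp only: M2.ev_def[symmetric] a_minus_def M2.B.one_cl)
  ultimately show ?thesis using True by (simp add: M2.ker_iff X2_def Y2_def)
next
  case False
  then show ?thesis using two_sidedD(1)[OF M2.O.two_sided_ker] by (auto simp: X2_def Y2_def)
qed

text \<open>The formal comultiplication: \<open>L\<close> is replaced by the product of its two
  copies.\<close>

definition zf :: "int \<times> int \<Rightarrow> ((int \<times> int) + (int \<times> int)) falg" where
  "zf g = (if g \<in> U_gens n then mmul N X2 Y2 (fst g) (snd g) else 0)"

lemma mmul_X2_Y2_zero: "j < i \<Longrightarrow> mmul N X2 Y2 i j = 0"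
  unfolding mmul_def by (rule sum.neutral) (auto simp: X2_def Y2_def)

lemma mmul_X2_Y2_diag: "i \<in> N \<Longrightarrow> mmul N X2 Y2 i i = X2 i i * Y2 i i"
proof -
  assume i: "i \<in> N"
  have "mmul N X2 Y2 i i = (\<Sum>k\<in>N. if k = i then X2 i i * Y2 i i else 0)"
    unfolding mmul_def by (rule sum.cong) (auto simp: X2_def Y2_def)
  then show ?thesis using i by simp
qed

text \<open>Below the diagonal \<open>Lfree\<close> is 0, and so is the product of two upper
  triangular matrices. Hence the substitution may be performed in matrix equations at all index
  pairs.\<close>

lemma subst_zf: "i \<in> N \<Longrightarrow> j \<in> N \<Longrightarrow> subst zf (Lfree i j) = mmul N X2 Y2 i j"
  by (auto simp: Lfree_def zf_def U_gens_def mmul_X2_Y2_zero)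

definition hz :: "int \<times> int \<Rightarrow> (alg, alg) tensor" where
  "hz = (\<lambda>(i, j). \<Oplus>\<^bsub>T\<^esub>k\<in>N. ((-1) ^ ((par i + par k) * (par k + par j)))
          \<odot>\<^bsub>T\<^esub> tpure (Uq n) (Uq n) (Lq n i k) (Lq n k j))"

lemma Lq_closed: "i \<in> N \<Longrightarrow> j \<in> N \<Longrightarrow> Lq n i j \<in> carrier (Uq n)"
  by (simp add: Lq_pr Lfree_polys)

lemma ev_zf: "g \<in> U_gens n \<Longrightarrow> M2.ev (zf g) = hz g"
proof -
  assume g: "g \<in> U_gens n"
  obtain i j where ij: "g = (i, j)" "i \<in> N" "j \<in> N" using g by (auto simp: U_gens_def)
  have t: "M2.ev (X2 i k * Y2 k j) = tpure (Uq n) (Uq n) (Lq n i k) (Lq n k j)" if "k \<in> N" for k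
    using ev2_left[OF Lfree_polys[OF ij(2) that]] ev2_right[OF Lfree_polys[OF that ij(3)]]
    unfolding X2_eq Y2_eq by (simp add: M2.ev_mult Lq_pr Lfree_polys that ij mult_tpure_even_left)
  have "M2.ev (zf g) = (\<Oplus>\<^bsub>T\<^esub>k\<in>N. M2.ev ((-1) ^ ((par i + par k) * (par k + par j)) * X2 i k * Y2 k j))"
    using g unfolding zf_def mmul_def by (simp add: ij(1) M2.ev_sum)
  also have "\<dots> = (\<Oplus>\<^bsub>T\<^esub>k\<in>N. ((-1) ^ ((par i + par k) * (par k + par j)))
          \<odot>\<^bsub>T\<^esub> tpure (Uq n) (Uq n) (Lq n i k) (Lq n k j))"
  proof (rule M2.B.finsum_cong')
    fix k assume k: "k \<in> N"
    let ?e = "(par i + par k) * (par k + par j)"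
    have "M2.ev ((-1) ^ ?e * X2 i k * Y2 k j) = M2.ev (scal ((-1) ^ ?e) * (X2 i k * Y2 k j))"
      by (simp only: scal_neg_one_power mult.assoc)
    then show "M2.ev ((-1) ^ ?e * X2 i k * Y2 k j) = ((-1) ^ ?e) \<odot>\<^bsub>T\<^esub> tpure (Uq n) (Uq n) (Lq n i k) (Lq n k j)"
      by (simp only: M2.ev_scal t[OF k])
  qed (use ij in \<open>auto simp: Lq_closed\<close>)
  finally show ?thesis by (simp add: hz_def ij)
qed

lemma hz_part: "g \<in> U_gens n \<Longrightarrow> hz g \<in> part T (gpar g mod 2)"
proof -
  assume g: "g \<in> U_gens n"
  obtain i j where ij: "g = (i, j)" "i \<in> N" "j \<in> N" using g by (auto simp: U_gens_def)
  have L: "Lq n a b \<in> part (Uq n) ((par a + par b) mod 2)" if "a \<in> N" "b \<in> N" for a b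
  proof (cases "a \<le> b")
    case True
    then show ?thesis using pr_gen_part[of "(a, b)"] that by (simp add: Lq_pr Lfree_def U_gens_def gpar_def)
  next
    case False
    have "(par a + par b) mod 2 \<in> {0, 1}" by auto
    then show ?thesis using False TT.A.part_zero[of "(par a + par b) mod 2"]
      by (simp add: Lq_pr Lfree_def U.Q.zero_squot[symmetric])
  qed
  have "tpure (Uq n) (Uq n) (Lq n i k) (Lq n k j) \<in> part (tens_space (Uq n) (Uq n)) (gpar g mod 2)" if "k \<in> N" for k
    by (rule TT.tpure_part[OF _ _ L[OF ij(2) that] L[OF that ij(3)]])
       (auto simp: gpar_def ij mod_simps, presburger)
  then show ?thesis
    unfolding hz_def ij(1) case_prod_conv tens_alg_simps finsum_def
    by (simp add: TT.part_tens_finsum[unfolded finsum_def] TT.part_tens_smult)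
qed

sublocale Z: genmap "U_gens n" gpar "U_rels n" T hz
  rewrites "squot (free_superalg (U_gens n) gpar) (Idl\<^bsub>free_superalg (U_gens n) gpar\<^esub> (U_rels n)) = Uq n"
  by (intro genmap.intro genmap_axioms.intro TT.gralg_tens hz_part U.pres_axioms) (assumption | rule Uq_eq)+

text \<open>Evaluation at the prospective values factors through the two formal copies, which moves
  the check of the relations from the tensor square to the free algebra.\<close>

lemma Z_ev: "Z.ev f = M2.ev (subst zf f)"
proof -
  have op: "Z.opr g v = M2.O.act (zf g) v" if "v \<in> carrier T" for g v
    using that M2.zero_mult[of v] M2.act_ev[OF that, of "zf g"]
    by (cases "g \<in> U_gens n") (simp_all add: Z.opr_def ev_zf, simp add: zf_def)
  show ?thesis
    unfolding Z.ev_def M2.ev_def by (rule M2.O.act_subst[OF M2.B.one_cl Z.O.opspace_axioms op])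
qed

lemma Z_kills: assumes "r \<in> U_rels n" shows "Z.ev r = \<zero>\<^bsub>T\<^esub>"
proof -
  note K = M2.O.two_sided_ker
  have Z: "RLL N M2.O.ker (\<lambda>i j k l. scal (Smat n i j k l)) (mmul N X2 Y2)"
    by (rule RLL_mmul[OF _ K ker_X2(1) ker_Y2(1)]) (auto intro: ker_comm)
  have s: "slot1 (\<lambda>i j. subst zf (Lfree i j)) i j k l = slot1 (mmul N X2 Y2) i j k l"
    "slot2 (\<lambda>i j. subst zf (Lfree i j)) i j k l = slot2 (mmul N X2 Y2) i j k l"
    if "i \<in> N" "j \<in> N" "k \<in> N" "l \<in> N" for i j k l
    using that by (simp_all add: slot1_def slot2_def subst_zf)
  consider i where "i \<in> N" "r = Lfree i i * Lfree (- i) (- i) - 1"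
    | i m k p where "i \<in> N" "m \<in> N" "k \<in> N" "p \<in> N"
      "r = smul N N (smul N N (slot1 Lfree) (slot2 Lfree)) (Sfree n) i m k p
        - smul N N (Sfree n) (smul N N (slot2 Lfree) (slot1 Lfree)) i m k p"
    using assms unfolding U_rels_def by blast
  then have "subst zf r \<in> M2.O.ker"
  proof cases
    case 1
    let ?x = "X2 i i" and ?y = "Y2 i i" and ?x' = "X2 (- i) (- i)" and ?y' = "Y2 (- i) (- i)"
    \<comment> \<open>A telescoping sum: first the two inner factors are exchanged, then the pair of
      \<open>?x\<close> and the pair of \<open>?y\<close> are contracted. Diagonal entries are even,
      so the exchange has no sign.\<close>
    have "subst zf r = ?x * (?y * ?x' - ?x' * ?y) * ?y' + (?x * ?x' - 1) * ?y * ?y' + (?y * ?y' - 1)"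
      unfolding 1(2) using 1(1) by (simp only: subst_diff subst_mult subst_zf idx_uminus mmul_X2_Y2_diag subst_one)
         (simp add: algebra_simps)
    moreover have "?y * ?x' - ?x' * ?y \<in> M2.O.ker"
      using ker_comm[of i i "- i" "- i"] 1(1) by (simp add: mult_2[symmetric])
    ultimately show ?thesis
      using ker_X2(2)[OF 1(1)] ker_Y2(2)[OF 1(1)] by (simp only: two_sidedD[OF K])
  next
    case 2
    have "subst zf r = smul N N (smul N N (slot1 (mmul N X2 Y2)) (slot2 (mmul N X2 Y2))) (\<lambda>i j k l. scal (Smat n i j k l)) i m k p
      - smul N N (\<lambda>i j k l. scal (Smat n i j k l)) (smul N N (slot2 (mmul N X2 Y2)) (slot1 (mmul N X2 Y2))) i m k p"
      unfolding 2(5) subst_rll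
      by (intro arg_cong2[where f = "(-)"] smul_cong refl s 2)
    then show ?thesis using Z 2(1-4) unfolding RLL_def scong_def by simp
  qed
  then show ?thesis by (simp add: Z_ev M2.ker_iff)
qed

text \<open>The definite description behind \<open>comult\<close> is hereby satisfied: a
  homomorphism with the prescribed values exists, and the generators determine it.\<close>

lemma comult_eq: "comult n = Z.hom"
  unfolding comult_def hz_def[symmetric]
proof (rule U.gen_hom_eq[OF TT.uralg_tens_alg])
  show "superalg_hom (Uq n) T Z.hom" by (rule Z.superalg_hom[OF Z_kills])
  show "Z.hom \<in> extensional (carrier (Uq n))" by (rule Z.hom_extensional[OF Z_kills])
  have L: "(case g of (i, j) \<Rightarrow> Lq n i j) = U.Q.pr (gen g)" if "g \<in> U_gens n" for g
    using that by (auto simp: U_gens_def Lq_pr Lfree_def)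
  show "Z.hom (case g of (i, j) \<Rightarrow> Lq n i j) = hz g" if "g \<in> U_gens n" for g
    using that Z.hom_pr[OF Z_kills polys_gen[OF that]] by (simp add: L Z.ev_gen)
  show "\<exists>x\<in>U_gens n. \<exists>c. (case x of (i, j) \<Rightarrow> Lq n i j) \<in> carrier (Uq n) \<and>
      U.Q.pr (gen g) = c \<odot>\<^bsub>Uq n\<^esub> (case x of (i, j) \<Rightarrow> Lq n i j)" if "g \<in> U_gens n" for g
    by (rule bexI[OF _ that], rule exI[of _ 1]) (use that in \<open>simp add: L\<close>)
qed

lemma comult_closed: "u \<in> carrier (Uq n) \<Longrightarrow> comult n u \<in> carrier (tens_space (Uq n) (Uq n))"
  using Z.superalg_hom[OF Z_kills] by (auto simp: comult_eq superalg_hom_def even_linear_def)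

end

section \<open>Relations and embeddings of the coordinate superalgebras\<close>

section \<open>The defining relations of the dual coordinate superalgebra\<close>

text \<open>The entry \<open>i m k p\<close> of the relation between the two products of generator
  matrices with \<open>S\<close>, all sums carried out. Each side has one diagonal term and two xi
  terms; on the left \<open>S\<close> exchanges the columns \<open>m\<close> and \<open>p\<close>,
  on the right the rows \<open>i\<close> and \<open>k\<close>.\<close>

definition arel :: "(int \<Rightarrow> int \<Rightarrow> 'g falg) \<Rightarrow> int \<Rightarrow> int \<Rightarrow> int \<Rightarrow> int \<Rightarrow> 'g falg" where
  "arel T i m k p =
     (-1) ^ ((par i + par m) * (par k + par p)) * scal (qv powi phi m p) * (T i m * T k p)
     + (if m < p then (-1) ^ ((par k + par m) * (par i + par m) + par m) * scal xiv * (T i p * T k m) else 0)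
     + (if - m < p then (-1) ^ ((par k + par m + 1) * (par i + par m) + par m + 1) * scal xiv * (T i (- p) * T k (- m)) else 0)
     - (scal (qv powi phi i k) * (T k p * T i m)
     + (if k < i then (-1) ^ ((par k + par i) * (par k + par m) + par k) * scal xiv * (T i p * T k m) else 0)
     + (if k < - i then (-1) ^ ((par k + par i + 1) * (par k + par m + 1) + par k) * scal xiv * (T (- i) p * T (- k) m) else 0))"

lemma sum_delta2:
  assumes "finite J" "a \<in> J" "finite L" "b \<in> L"
  shows "(\<Sum>j\<in>J. \<Sum>l\<in>L. if j = a \<and> l = b then f j l else 0) = (f a b :: 'a::comm_monoid_add)"
proof -
  have "(\<Sum>j\<in>J. \<Sum>l\<in>L. if j = a \<and> l = b then f j l else 0) = (\<Sum>j\<in>J. \<Sum>l\<in>L. if l = b then if j = a then f a b else 0 else 0)"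
    by (intro sum.cong refl) auto
  then show ?thesis using assms by simp
qed

lemma sum_sc_left:
  assumes "i \<in> idx n" "k \<in> idx n"
  shows "(\<Sum>j\<in>idx n. \<Sum>l\<in>idx n. scal (sc i j k l) * f j l) =
    scal (qv powi phi i k) * f i k + (if k < i then scal (xiv * (-1) ^ par k) * f k i else 0)
    + (if k < - i then scal (xiv * (-1) ^ par k) * f (- k) (- i) else (0 :: 'g falg))"
proof -
  have "(\<Sum>j\<in>idx n. \<Sum>l\<in>idx n. scal (sc i j k l) * f j l) = (\<Sum>j\<in>idx n. \<Sum>l\<in>idx n.
      (if j = i \<and> l = k then scal (qv powi phi i k) * f j l else 0)
      + (if j = k \<and> l = i then (if k < i then scal (xiv * (-1) ^ par k) * f j l else 0) else 0)
      + (if j = - k \<and> l = - i then (if k < - i then scal (xiv * (-1) ^ par k) * f j l else 0) else 0))"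
    unfolding sc_def scal_add distrib_right
    by (intro sum.cong refl arg_cong2[where f = "(+)"]) auto
  also have "\<dots> = scal (qv powi phi i k) * f i k + (if k < i then scal (xiv * (-1) ^ par k) * f k i else 0)
    + (if k < - i then scal (xiv * (-1) ^ par k) * f (- k) (- i) else 0)"
    unfolding sum.distrib using assms by (subst (1 2 3) sum_delta2) simp_all
  finally show ?thesis .
qed

lemma sum_sc_right:
  assumes "m \<in> idx s" "p \<in> idx s"
  shows "(\<Sum>j\<in>idx s. \<Sum>l\<in>idx s. f j l * scal (sc j m l p)) =
    f m p * scal (qv powi phi m p) + (if m < p then f p m * scal (xiv * (-1) ^ par m) else 0)
    + (if - m < p then f (- p) (- m) * scal (xiv * (-1) ^ par (- m)) else (0 :: 'g falg))"
proof -
  have "(\<Sum>j\<in>idx s. \<Sum>l\<in>idx s. f j l * scal (sc j m l p)) = (\<Sum>j\<in>idx s. \<Sum>l\<in>idx s.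
      (if j = m \<and> l = p then f j l * scal (qv powi phi m p) else 0)
      + (if j = p \<and> l = m then (if m < p then f j l * scal (xiv * (-1) ^ par m) else 0) else 0)
      + (if j = - p \<and> l = - m then (if - m < p then f j l * scal (xiv * (-1) ^ par (- m)) else 0) else 0))"
    unfolding sc_def scal_add distrib_left
    by (intro sum.cong refl arg_cong2[where f = "(+)"]) auto
  also have "\<dots> = f m p * scal (qv powi phi m p) + (if m < p then f p m * scal (xiv * (-1) ^ par m) else 0)
    + (if - m < p then f (- p) (- m) * scal (xiv * (-1) ^ par (- m)) else 0)"
    unfolding sum.distrib using assms by (subst (1 2 3) sum_delta2) simp_all
  finally show ?thesis .
qed

lemma scal_xiv_sign: "scal (xiv * (-1) ^ a) = (-1) ^ a * scal xiv"
  by (simp add: scal_times scal_neg_one_power neg_one_power_commute)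

text \<open>For fixed outer indices at most three coefficients of \<open>S\<close> are nonzero, so
  each double sum collapses to three terms. What remains is an identity of sign exponents modulo 2;
  the terms with negated indices use that no index is 0.\<close>

lemma A_rel_eq:
  assumes i: "i \<in> idx n" and k: "k \<in> idx n" and m: "m \<in> idx s" and p: "p \<in> idx s"
  shows "smul (idx s) (idx s) (smul (idx s) (idx n) (slot1 T) (slot2 T)) (Sfree s) i m k p
      - smul (idx n) (idx n) (Sfree n) (smul (idx n) (idx s) (slot2 T) (slot1 T)) i m k p = arel T i m k p"
proof -
  let ?e = "\<lambda>i j k l m p. (par k + par l) * (par j + par m) +
             (par i + par j + par k + par l) * (par j + par m + par l + par p)"
  let ?s = "\<lambda>i j k l m p. (-1) ^ ?e i j k l m p :: 'a falg"
  note nz = idx_nz[OF i] idx_nz[OF k] idx_nz[OF m] idx_nz[OF p]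
  have sgn1: "?s i m k p m p = 1"
    by (rule trans[OF neg_one_power_cong[of _ 0]]) (simp_all only: even_add even_mult_iff dvd_0_right power_0, argo)
  have "smul (idx s) (idx s) (smul (idx s) (idx n) (slot1 T) (slot2 T)) (Sfree s) i m k p
    = (\<Sum>j\<in>idx s. \<Sum>l\<in>idx s. (?s i j k l m p * ((-1) ^ ((par i + par j) * (par k + par l)) * T i j * T k l)) * scal (sc j m l p))"
    unfolding smul_def[of "idx s" "idx s"]
    by (intro sum.cong refl) (simp add: smul_slot1_slot2 k Sfree_def Smat_eq m p)
  also have "\<dots> = (-1) ^ ((par i + par m) * (par k + par p)) * scal (qv powi phi m p) * (T i m * T k p)
     + (if m < p then (-1) ^ ((par k + par m) * (par i + par m) + par m) * scal xiv * (T i p * T k m) else 0)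
     + (if - m < p then (-1) ^ ((par k + par m + 1) * (par i + par m) + par m + 1) * scal xiv * (T i (- p) * T k (- m)) else 0)"
  proof -
    have r: "(x * (y * t * u)) * scal c = (x * y) * scal c * (t * u)" for x y t u :: "'a falg" and c
      by (metis (no_types) mult.assoc scal_commute)
    have r0: "(y * t * u) * scal c = y * scal c * (t * u)" for y t u :: "'a falg" and c
      by (metis (no_types) mult.assoc scal_commute)
    have r': "(x * (y * t * u)) * ((-1) ^ a * scal c) = (x * y) * (-1) ^ a * scal c * (t * u)" for x y t u :: "'a falg" and c a
      using neg_one_power_commute[of a] by (metis (no_types) mult.assoc scal_commute)
    have s2: "?s i p k m m p * (-1) ^ ((par i + par p) * (par k + par m)) * (-1) ^ par m
        = (-1) ^ ((par k + par m) * (par i + par m) + par m)"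
      unfolding power_add[symmetric] by (rule neg_one_power_cong) (simp only: even_add even_mult_iff, argo)
    have s3: "?s i (- p) k (- m) m p * (-1) ^ ((par i + par (- p)) * (par k + par (- m))) * (-1) ^ par (- m)
        = (-1) ^ ((par k + par m + 1) * (par i + par m) + par m + 1)"
      unfolding power_add[symmetric]
      by (rule neg_one_power_cong) (use nz in \<open>auto simp: even_add even_mult_iff par_def\<close>)
    show ?thesis
      by (subst sum_sc_right[OF m p]) (simp only: scal_xiv_sign r r' s2 s3 sgn1 mult_1 r0)
  qed
  finally have 1: "smul (idx s) (idx s) (smul (idx s) (idx n) (slot1 T) (slot2 T)) (Sfree s) i m k p = \<dots>" .
  have "smul (idx n) (idx n) (Sfree n) (smul (idx n) (idx s) (slot2 T) (slot1 T)) i m k p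
    = (\<Sum>j\<in>idx n. \<Sum>l\<in>idx n. scal (sc i j k l) * (?s i j k l m p * (T l p * T j m)))"
    unfolding smul_def[of "idx n" "idx n"]
    by (intro sum.cong refl) (simp add: smul_slot2_slot1 p Sfree_def Smat_eq i k,
        simp only: mult.assoc[symmetric] scal_commute[of _ "(-1) ^ _"])
  also have "\<dots> = scal (qv powi phi i k) * (T k p * T i m)
     + (if k < i then (-1) ^ ((par k + par i) * (par k + par m) + par k) * scal xiv * (T i p * T k m) else 0)
     + (if k < - i then (-1) ^ ((par k + par i + 1) * (par k + par m + 1) + par k) * scal xiv * (T (- i) p * T (- k) m) else 0)"
  proof -
    have r': "(-1) ^ a * scal c * (x * t) = (x * (-1) ^ a) * scal c * t" if "x = (-1) ^ b" for x t :: "'a falg" and c a b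
      unfolding that using neg_one_power_commute[of b "scal c"] neg_one_power_commute[of b "(-1) ^ a"]
      by (metis (no_types) mult.assoc)
    have s1: "?s i i k k m p = 1"
      by (rule trans[OF neg_one_power_cong[of _ 0]]) (simp_all only: even_add even_mult_iff dvd_0_right power_0, argo)
    have s2: "?s i k k i m p * (-1) ^ par k = (-1) ^ ((par k + par i) * (par k + par m) + par k)"
      unfolding power_add[symmetric] by (rule neg_one_power_cong) (simp only: even_add even_mult_iff, argo)
    have s3: "?s i (- k) k (- i) m p * (-1) ^ par k = (-1) ^ ((par k + par i + 1) * (par k + par m + 1) + par k)"
      unfolding power_add[symmetric]
      by (rule neg_one_power_cong) (use nz in \<open>auto simp: even_add even_mult_iff par_def\<close>)
    show ?thesis
      by (subst sum_sc_left[OF i k]) (simp only: scal_xiv_sign r'[OF refl] s1 s2 s3 mult_1)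
  qed
  finally have 2: "smul (idx n) (idx n) (Sfree n) (smul (idx n) (idx s) (slot2 T) (slot1 T)) i m k p = \<dots>" .
  show ?thesis unfolding 1 2 arel_def ..
qed

lemma A_gens_mem [simp]: "(\<alpha>, b) \<in> A_gens s n \<longleftrightarrow> \<alpha> \<in> idx s \<and> b \<in> idx n"
  by (simp add: A_gens_def)

lemma A_rels_eq: "A_rels s n =
   {gen (\<alpha>, b) - (-1) ^ (par \<alpha> + par b) * gen (- \<alpha>, - b) | \<alpha> b. \<alpha> \<in> idx s \<and> b \<in> idx n} \<union>
   {arel Tfree i m k p | i m k p. i \<in> idx n \<and> m \<in> idx s \<and> k \<in> idx n \<and> p \<in> idx s}"
  unfolding A_rels_def
  by (intro arg_cong2[where f = "(\<union>)"] refl Collect_cong ex_cong1) (auto simp: A_rel_eq)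

lemma Tfree_polys: "b \<in> idx n \<Longrightarrow> \<alpha> \<in> idx s \<Longrightarrow> Tfree b \<alpha> \<in> polys (A_gens s n)"
  by (auto simp: Tfree_def A_gens_def intro!: polys_mult polys_gen)

lemma arel_polys:
  assumes "i \<in> idx n" "k \<in> idx n" "m \<in> idx s" "p \<in> idx s"
    and T: "\<And>b \<alpha>. b \<in> idx n \<Longrightarrow> \<alpha> \<in> idx s \<Longrightarrow> T b \<alpha> \<in> polys G"
  shows "arel T i m k p \<in> polys G"
proof -
  have pif: "(if c then f else 0) \<in> polys G" if "f \<in> polys G" for c and f :: "'a falg" using that by simp
  then show ?thesis unfolding arel_def
    using assms by (intro pif polys_diff polys_add polys_mult T polys_neg_one_power polys_scal) simp_all
qed

lemma pres_A: "pres (A_gens s n) (A_rels s n)"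
proof
  show "A_rels s n \<subseteq> polys (A_gens s n)"
  proof
    fix r assume "r \<in> A_rels s n"
    then consider \<alpha> b where "r = gen (\<alpha>, b) - (-1) ^ (par \<alpha> + par b) * gen (- \<alpha>, - b)" "\<alpha> \<in> idx s" "b \<in> idx n"
      | i m k p where "r = arel Tfree i m k p" "i \<in> idx n" "m \<in> idx s" "k \<in> idx n" "p \<in> idx s"
      unfolding A_rels_eq by blast
    then show "r \<in> polys (A_gens s n)"
    proof cases
      case 1
      then show ?thesis by (auto intro!: polys_diff polys_mult polys_gen simp: A_gens_def)
    next
      case 2
      then show ?thesis by (simp add: arel_polys[where n = n and s = s] Tfree_polys)
    qed
  qed
qed

lemma Abar_eq: "squot (free_superalg (A_gens s n) gpar) (Idl\<^bsub>free_superalg (A_gens s n) gpar\<^esub> (A_rels s n)) = Abar s n"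
  by (simp add: Abar_def A_ideal_def A_free_def)

locale abar = fixes s n :: nat

sublocale abar \<subseteq> pres "A_gens s n" gpar "A_rels s n"
  rewrites "squot (free_superalg (A_gens s n) gpar) (Idl\<^bsub>free_superalg (A_gens s n) gpar\<^esub> (A_rels s n)) = Abar s n"
  by (rule pres_A) (rule Abar_eq)

context abar
begin

lemma tbar_pr: "tbar s n \<alpha> b = Q.pr (gen (\<alpha>, b))"
  by (simp add: tbar_def Q.pr_def A_ideal_def A_free_def)

lemma tbar_closed [simp, intro]: "\<alpha> \<in> idx s \<Longrightarrow> b \<in> idx n \<Longrightarrow> tbar s n \<alpha> b \<in> carrier (Abar s n)"
  by (auto simp: tbar_pr)

lemma tbar_neg:
  assumes "\<alpha> \<in> idx s" "b \<in> idx n"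
  shows "tbar s n \<alpha> b = ((-1) ^ (par \<alpha> + par b)) \<odot>\<^bsub>Abar s n\<^esub> tbar s n (- \<alpha>) (- b)"
proof -
  have "gen (\<alpha>, b) - (-1) ^ (par \<alpha> + par b) * gen (- \<alpha>, - b) \<in> I"
    using S_I assms unfolding A_rels_eq by blast
  then show ?thesis
    using assms by (simp add: tbar_pr smult_pr polys_gen Q.pr_eq_iff scal_neg_one_power)
qed

text \<open>A generator with positive first index is, up to sign, the one with both indices
  negated.\<close>

lemma tbar_span:
  assumes "g \<in> A_gens s n"
  shows "\<exists>x\<in>{- int s..-1} \<times> idx n. \<exists>c. (case x of (\<alpha>, a) \<Rightarrow> tbar s n \<alpha> a) \<in> carrier (Abar s n) \<and>
    Q.pr (gen g) = c \<odot>\<^bsub>Abar s n\<^esub> (case x of (\<alpha>, a) \<Rightarrow> tbar s n \<alpha> a)"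
proof -
  interpret V: uralg "Abar s n" by (rule uralg_P)
  obtain \<alpha> b where g: "g = (\<alpha>, b)" "\<alpha> \<in> idx s" "b \<in> idx n" using assms by (auto simp: A_gens_def)
  show ?thesis
  proof (cases "\<alpha> < 0")
    case True
    then have "(\<alpha>, b) \<in> {- int s..-1} \<times> idx n" using g by (auto simp: idx_def)
    moreover have "Q.pr (gen g) = 1 \<odot>\<^bsub>Abar s n\<^esub> tbar s n \<alpha> b" using g by (simp add: tbar_pr)
    ultimately show ?thesis using g by (intro bexI[of _ "(\<alpha>, b)"] exI[of _ 1]) auto
  next
    case False
    then have "(- \<alpha>, - b) \<in> {- int s..-1} \<times> idx n" using g by (auto simp: idx_def)
    then show ?thesis using g tbar_neg[OF g(2,3)]
      by (intro bexI[of _ "(- \<alpha>, - b)"] exI[of _ "(-1) ^ (par \<alpha> + par b)"]) (auto simp: tbar_pr[symmetric])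
  qed
qed

lemma A_induct [consumes 1, case_names one gen add smult]:
  assumes Z: "Z \<in> carrier (Abar s n)" and one: "C \<one>\<^bsub>Abar s n\<^esub>"
    and gen: "\<And>\<alpha> a Z. \<alpha> \<in> {- int s..-1} \<Longrightarrow> a \<in> idx n \<Longrightarrow> Z \<in> carrier (Abar s n) \<Longrightarrow> C Z \<Longrightarrow> C (tbar s n \<alpha> a \<otimes>\<^bsub>Abar s n\<^esub> Z)"
    and add: "\<And>Z W. Z \<in> carrier (Abar s n) \<Longrightarrow> W \<in> carrier (Abar s n) \<Longrightarrow> C Z \<Longrightarrow> C W \<Longrightarrow> C (Z \<oplus>\<^bsub>Abar s n\<^esub> W)"
    and smult: "\<And>Z c. Z \<in> carrier (Abar s n) \<Longrightarrow> C Z \<Longrightarrow> C (c \<odot>\<^bsub>Abar s n\<^esub> Z)"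
  shows "C Z"
  using Z
proof (induct Z rule: P_induct)
  case (gen g Z)
  interpret V: uralg "Abar s n" by (rule uralg_P)
  obtain \<alpha> a c where x: "\<alpha> \<in> {- int s..-1}" "a \<in> idx n" "tbar s n \<alpha> a \<in> carrier (Abar s n)"
    "Q.pr (gen g) = c \<odot>\<^bsub>Abar s n\<^esub> tbar s n \<alpha> a"
    using tbar_span[OF gen(1)] by auto
  have "C (c \<odot>\<^bsub>Abar s n\<^esub> (tbar s n \<alpha> a \<otimes>\<^bsub>Abar s n\<^esub> Z))"
    using x gen by (intro smult assms(3)) auto
  then show ?case unfolding x(4) using x(3) gen(2) by (simp add: V.smult_mult_left)
qed (fact one add smult)+

lemma A_induct_right [consumes 1, case_names one gen add smult]:
  assumes Z: "Z \<in> carrier (Abar s n)" and one: "C \<one>\<^bsub>Abar s n\<^esub>"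
    and gen: "\<And>\<alpha> a Z. \<alpha> \<in> {- int s..-1} \<Longrightarrow> a \<in> idx n \<Longrightarrow> Z \<in> carrier (Abar s n) \<Longrightarrow> C Z \<Longrightarrow> C (Z \<otimes>\<^bsub>Abar s n\<^esub> tbar s n \<alpha> a)"
    and add: "\<And>Z W. Z \<in> carrier (Abar s n) \<Longrightarrow> W \<in> carrier (Abar s n) \<Longrightarrow> C Z \<Longrightarrow> C W \<Longrightarrow> C (Z \<oplus>\<^bsub>Abar s n\<^esub> W)"
    and smult: "\<And>Z c. Z \<in> carrier (Abar s n) \<Longrightarrow> C Z \<Longrightarrow> C (c \<odot>\<^bsub>Abar s n\<^esub> Z)"
  shows "C Z"
  using Z
proof (induct Z rule: P_induct_right)
  case (gen g Z)
  interpret V: uralg "Abar s n" by (rule uralg_P)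
  obtain \<alpha> a c where x: "\<alpha> \<in> {- int s..-1}" "a \<in> idx n" "tbar s n \<alpha> a \<in> carrier (Abar s n)"
    "Q.pr (gen g) = c \<odot>\<^bsub>Abar s n\<^esub> tbar s n \<alpha> a"
    using tbar_span[OF gen(1)] by auto
  have "C (c \<odot>\<^bsub>Abar s n\<^esub> (Z \<otimes>\<^bsub>Abar s n\<^esub> tbar s n \<alpha> a))"
    using x gen by (intro smult assms(3)) auto
  then show ?case unfolding x(4) using x(3) gen(2) by (simp add: V.smult_mult_right)
qed (fact one add smult)+

end

section \<open>The embeddings\<close>

text \<open>Indices move away from 0 on either side. Thus the map commutes with negation, and on
  negative indices it is the shift by \<open>- k\<close> that \<open>iota\<close>
  prescribes.\<close>

definition sh :: "nat \<Rightarrow> int \<Rightarrow> int" where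
  "sh k i = (if i < 0 then i - int k else i + int k)"

definition shift :: "nat \<Rightarrow> (int \<times> int) falg \<Rightarrow> (int \<times> int) falg" where
  "shift k = subst (\<lambda>(\<alpha>, b). gen (sh k \<alpha>, b))"

lemma sh_simps [simp]: "par (sh k i) = par i" "i \<noteq> 0 \<Longrightarrow> sh k (- i) = - sh k i"
  by (auto simp: sh_def par_def)

lemma sh_idx: "i \<in> idx s \<Longrightarrow> k + s \<le> m \<Longrightarrow> sh k i \<in> idx m"
  by (auto simp: idx_def sh_def)

lemma sh_less: "i \<noteq> 0 \<Longrightarrow> j \<noteq> 0 \<Longrightarrow> sh k i < sh k j \<longleftrightarrow> i < j"
  "i \<noteq> 0 \<Longrightarrow> j \<noteq> 0 \<Longrightarrow> - sh k i < sh k j \<longleftrightarrow> - i < j"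
  by (auto simp: sh_def)

lemma phi_sh: "i \<noteq> 0 \<Longrightarrow> j \<noteq> 0 \<Longrightarrow> phi (sh k i) (sh k j) = phi i j"
  by (auto simp: phi_def sh_def par_def)

lemma shift_Tfree: "shift k (Tfree b \<alpha>) = Tfree b (sh k \<alpha>)"
  by (simp add: shift_def Tfree_def subst_mult)

text \<open>A relation depends on its column indices only through their signs, their order and their
  coincidence up to sign, and \<open>sh\<close> preserves all of these.\<close>

lemma shift_arel:
  assumes "m \<noteq> 0" "p \<noteq> 0"
  shows "shift k (arel Tfree i m k' p) = arel Tfree i (sh k m) k' (sh k p)"
proof -
  have T: "subst (\<lambda>(\<alpha>, b). gen (sh k \<alpha>, b)) (Tfree b \<alpha>) = Tfree b (sh k \<alpha>)" for b \<alpha>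
    using shift_Tfree[of k b \<alpha>] by (simp add: shift_def)
  show ?thesis
    using assms
    by (simp add: arel_def shift_def subst_add subst_diff subst_mult T sh_less phi_sh if_distrib[of "subst _"] cong: if_cong)
qed

lemma shift_A_rels:
  assumes "k + s \<le> m" "r \<in> A_rels s n" shows "shift k r \<in> A_rels m n"
  using assms(2) unfolding A_rels_eq[of s]
proof (elim UnE CollectE exE conjE)
  fix \<alpha> b assume *: "r = gen (\<alpha>, b) - (-1) ^ (par \<alpha> + par b) * gen (- \<alpha>, - b)" "\<alpha> \<in> idx s" "b \<in> idx n"
  have "shift k r = gen (sh k \<alpha>, b) - (-1) ^ (par (sh k \<alpha>) + par b) * gen (- sh k \<alpha>, - b)"
    using *(2) idx_nz[OF *(2)] by (simp add: *(1) shift_def subst_diff subst_mult)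
  then show ?thesis unfolding A_rels_eq using sh_idx[OF *(2) assms(1)] *(3) by blast
next
  fix i m' k' p assume *: "r = arel Tfree i m' k' p" "i \<in> idx n" "m' \<in> idx s" "k' \<in> idx n" "p \<in> idx s"
  show ?thesis
    unfolding A_rels_eq *(1) shift_arel[OF idx_nz[OF *(3)] idx_nz[OF *(5)]]
    using * sh_idx[OF _ assms(1)] by blast
qed

lemma shift_polys: "k + s \<le> m \<Longrightarrow> f \<in> polys (A_gens s n) \<Longrightarrow> shift k f \<in> polys (A_gens m n)"
  unfolding shift_def by (rule subst_polys) (auto simp: A_gens_def sh_idx intro!: polys_gen)

text \<open>\<open>iota\<close> is a definite description that fixes values on negative first
  indices only. Shifting all indices maps relations to relations and so induces a homomorphism with
  these values; \<open>gen_hom_eq\<close> identifies the two.\<close>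

lemma iota_shift:
  assumes ks: "k + s \<le> m" and A: "superalgebra (Abar m n)"
  shows "superalg_hom (Abar s n) (Abar m n) (iota k m s n)"
    and "f \<in> polys (A_gens s n) \<Longrightarrow> iota k m s n (quot.pr (A_free s n) (A_ideal s n) f)
      = quot.pr (A_free m n) (A_ideal m n) (shift k f)"
proof -
  interpret S: abar s n .
  interpret M: abar m n .
  interpret A: salg "Abar m n" by (rule salgI[OF A])
  let ?h = "\<lambda>g. M.Q.pr (gen (sh k (fst g), snd g))"
  have h: "?h g \<in> part (Abar m n) (gpar g mod 2)" if g: "g \<in> A_gens s n" for g
  proof -
    have "gen (sh k (fst g), snd g) \<in> part M.F (gpar g mod 2)"
      using g sh_idx[OF _ ks] by (auto simp: free_superalg_def gen_def A_gens_def gpar_def)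
    then show ?thesis using M.Q.part_squot by blast
  qed
  interpret G: genmap "A_gens s n" gpar "A_rels s n" "Abar m n" ?h
    rewrites "squot (free_superalg (A_gens s n) gpar) (Idl\<^bsub>free_superalg (A_gens s n) gpar\<^esub> (A_rels s n)) = Abar s n"
    by (intro genmap.intro genmap_axioms.intro A.gralg h S.pres_axioms) (assumption | rule Abar_eq)+
  have ev: "G.ev f = M.Q.pr (shift k f)" if "f \<in> polys (A_gens s n)" for f
    using that
  proof (induct f rule: polys_induct)
    case one
    then show ?case by (simp add: shift_def M.one_pr)
  next
    case (gen g f)
    then have "gen (sh k (fst g), snd g) \<in> polys (A_gens m n)"
      using sh_idx[OF _ ks] by (auto simp: A_gens_def intro!: polys_gen)
    then show ?case using gen shift_polys[OF ks gen(2)]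
      by (simp add: G.ev_mult G.ev_gen shift_def subst_mult M.mult_pr case_prod_unfold)
  next
    case (add f g)
    then show ?case by (simp add: G.ev_add shift_def subst_add M.Q.add_squot)
  next
    case (scal f c)
    then show ?case using shift_polys[OF ks scal(1)] by (simp add: G.ev_scal shift_def subst_mult M.smult_pr)
  qed
  have kills: "G.ev r = \<zero>\<^bsub>Abar m n\<^esub>" if "r \<in> A_rels s n" for r
  proof -
    have "r \<in> polys (A_gens s n)" "shift k r \<in> M.I"
      using shift_A_rels[OF ks that] that S.S_polys M.S_I by blast+
    then show ?thesis by (simp add: ev M.Q.pr_zero_iff)
  qed
  have io: "iota k m s n = G.hom"
    unfolding iota_def
  proof (rule S.gen_hom_eq[OF A.uralg_axioms])
    show "superalg_hom (Abar s n) (Abar m n) G.hom" by (rule G.superalg_hom[OF kills])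
    show "G.hom \<in> extensional (carrier (Abar s n))" by (rule G.hom_extensional[OF kills])
    show "G.hom (case x of (\<alpha>, a) \<Rightarrow> tbar s n \<alpha> a) = (case x of (\<alpha>, a) \<Rightarrow> tbar m n (\<alpha> - int k) a)"
      if xX: "x \<in> {- int s..-1} \<times> idx n" for x
    proof -
      obtain \<alpha> a where x: "x = (\<alpha>, a)" "\<alpha> \<in> {- int s..-1}" "a \<in> idx n" using xX by auto
      then have g: "(\<alpha>, a) \<in> A_gens s n" by (auto simp: A_gens_def idx_def)
      have "sh k \<alpha> = \<alpha> - int k" using x(2) by (simp add: sh_def)
      then show ?thesis using x(1) G.hom_pr[OF kills polys_gen[OF g]]
        by (simp add: S.tbar_pr M.tbar_pr G.ev_gen[OF g])
    qed
  qed (rule S.tbar_span)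
  show "superalg_hom (Abar s n) (Abar m n) (iota k m s n)"
    unfolding io by (rule G.superalg_hom[OF kills])
  have free: "A_free s n = free_superalg (A_gens s n) gpar" "A_ideal s n = S.I"
    "A_free m n = free_superalg (A_gens m n) gpar" "A_ideal m n = M.I" 
    by (simp_all add: A_free_def A_ideal_def)
  show "f \<in> polys (A_gens s n) \<Longrightarrow> iota k m s n (quot.pr (A_free s n) (A_ideal s n) f)
      = quot.pr (A_free m n) (A_ideal m n) (shift k f)"
    unfolding io free using G.hom_pr[OF kills] ev by simp
qed

section \<open>The relations between the two blocks of generators\<close>

text \<open>The difference of the two sides of the formula for \<open>\<Theta>\<close> on generators, with the tensor product
  read as a product: \<open>x\<close> is a column of the first block and \<open>y\<close> one of the second.\<close>

definition brel :: "(int \<Rightarrow> 'g falg) \<Rightarrow> (int \<Rightarrow> 'g falg) \<Rightarrow> int \<Rightarrow> int \<Rightarrow> 'g falg" where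
  "brel x y a b = y b * x a - ((-1) ^ ((par a + 1) * (par b + 1)) * scal (qv powi phi b a) * (x a * y b)
     - (if a < b then scal xiv * (x b * y a) else 0)
     - (if a < - b then (-1) ^ par b * scal xiv * (x (- b) * y (- a)) else 0))"

text \<open>The coefficients of \<open>arel\<close> and \<open>brel\<close> depend on the rows only
  through their signs and the position of \<open>i\<close> relative to \<open>k\<close> and
  \<open>- k\<close>. A finite case distinction therefore decides each of the identities
  below.\<close>

lemma idx_cases:
  fixes i k :: int
  assumes "i \<noteq> 0" "k \<noteq> 0"
  obtains "i = k" | "i = - k" | "i < k" "i < - k" | "i < k" "- k < i" | "k < i" "i < - k" | "k < i" "- k < i"
  using assms by linarith

lemma qv_nz: "qv \<noteq> 0"
  by (simp add: qv_def Zero_fract_def eq_fract)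

text \<open>For \<alpha> < \<beta> < 0 the left-hand \<open>S\<close> contributes no xi term and its
  diagonal coefficient is 1, so the relation is the braiding formula up to sign.\<close>

lemma arel_brel:
  assumes "\<beta> < 0" "\<alpha> < \<beta>" "i \<noteq> 0" "k \<noteq> 0"
    and T: "\<And>b. T b \<alpha> = x b" "\<And>b. T b \<beta> = y b"
  shows "arel T i \<beta> k \<alpha> = (-1) ^ ((par i + 1) * (par k + 1)) * brel x y k i"
proof -
  have p: "par \<alpha> = 1" "par \<beta> = 1" and ph: "phi \<beta> \<alpha> = 0" using assms by (auto simp: par_def phi_def)
  show ?thesis
    using assms(1-4)
    by (cases "i < 0"; cases "k < 0"; cases rule: idx_cases[OF assms(3,4)])
       (simp_all add: arel_def brel_def T p ph par_def phi_def algebra_simps)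
qed

text \<open>Whenever the column \<open>- \<alpha>\<close> occurs, both xi terms of the left-hand
  \<open>S\<close> are present. They replace the condition \<open>k < i\<close> by its complement,
  and likewise \<open>k < - i\<close>; in the case of equality the surplus xi turns a power of q
  into its inverse, which is the effect of negating the row \<open>k\<close> on
  \<open>phi i k\<close>.\<close>

lemma arel_brel_neg:
  assumes "\<beta> < 0" "\<alpha> < \<beta>" "i \<noteq> 0" "k \<noteq> 0"
    and T: "\<And>b. T b \<alpha> = x b" "\<And>b. T b (- \<alpha>) = x (- b)" "\<And>b. T b \<beta> = y b" "\<And>b. T b (- \<beta>) = y (- b)"
  shows "arel T i \<beta> k (- \<alpha>) = (-1) ^ ((par i + 1) * par k) * brel x y (- k) i"
    and "arel T i (- \<beta>) k \<alpha> = (-1) ^ (par i * (par k + 1)) * brel x y k (- i)"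
    and "arel T i (- \<beta>) k (- \<alpha>) = (-1) ^ (par i * par k) * brel x y (- k) (- i)"
proof -
  have p: "par \<alpha> = 1" "par \<beta> = 1" "par (- \<alpha>) = 0" "par (- \<beta>) = 0"
    and ph: "phi \<beta> (- \<alpha>) = 0" "phi (- \<beta>) \<alpha> = 0" "phi (- \<beta>) (- \<alpha>) = 0"
    using assms by (auto simp: par_def phi_def)
  have x: "scal xiv = scal qv - scal (inverse qv)"
    unfolding xiv_def using scal_add[of qv "- inverse qv"] by simp
  show "arel T i \<beta> k (- \<alpha>) = (-1) ^ ((par i + 1) * par k) * brel x y (- k) i"
    using assms(1-4)
    by (cases "i < 0"; cases "k < 0"; cases rule: idx_cases[OF assms(3,4)])
       (simp_all add: arel_def brel_def T p ph par_def phi_def algebra_simps x power_int_minus)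
  show "arel T i (- \<beta>) k \<alpha> = (-1) ^ (par i * (par k + 1)) * brel x y k (- i)"
    using assms(1-4)
    by (cases "i < 0"; cases "k < 0"; cases rule: idx_cases[OF assms(3,4)])
       (simp_all add: arel_def brel_def T p ph par_def phi_def algebra_simps x power_int_minus)
  show "arel T i (- \<beta>) k (- \<alpha>) = (-1) ^ (par i * par k) * brel x y (- k) (- i)"
    using assms(1-4)
    by (cases "i < 0"; cases "k < 0"; cases rule: idx_cases[OF assms(3,4)])
       (simp_all add: arel_def brel_def T p ph par_def phi_def algebra_simps x power_int_minus)
qed

text \<open>The relations with the columns exchanged are combinations of the \<open>brel\<close>, one for
  each product of a \<open>y\<close> and an \<open>x\<close> in this order.\<close>

lemma arel_brel_exchanged:
  fixes x y :: "int \<Rightarrow> 'g falg"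
  assumes "\<beta> < 0" "\<alpha> < \<beta>" "i \<noteq> 0" "k \<noteq> 0"
    and T: "\<And>b. T b \<alpha> = x b" "\<And>b. T b (- \<alpha>) = x (- b)" "\<And>b. T b \<beta> = y b" "\<And>b. T b (- \<beta>) = y (- b)"
  defines "u \<equiv> \<lambda>a b. if k < i then (-1) ^ ((par k + par i) * (par k + a) + par k) * scal xiv * b else (0 :: 'g falg)"
    and "v \<equiv> \<lambda>a b. if k < - i then (-1) ^ ((par k + par i + 1) * (par k + a + 1) + par k) * scal xiv * b else (0 :: 'g falg)"
  shows "arel T i \<alpha> k \<beta> = (-1) ^ ((par k + 1) * (par i + 1) + 1) * scal xiv * brel x y k i
      - scal (qv powi phi i k) * brel x y i k - u 1 (brel x y k i) - v 1 (brel x y (- k) (- i))"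
    and "arel T i \<alpha> k (- \<beta>) = (-1) ^ ((par k + 1) * (par i + 1) + 1) * scal xiv * brel x y k (- i)
      - scal (qv powi phi i k) * brel x y i (- k) - u 1 (brel x y k (- i)) - v 1 (brel x y (- k) i)"
    and "arel T i (- \<alpha>) k \<beta> = (-1) ^ ((par k + 1) * par i + 1) * scal xiv * brel x y k (- i)
      - scal (qv powi phi i k) * brel x y (- i) k - u 0 (brel x y (- k) i) - v 0 (brel x y k (- i))"
    and "arel T i (- \<alpha>) k (- \<beta>) = (-1) ^ ((par k + 1) * par i + 1) * scal xiv * brel x y k i
      - scal (qv powi phi i k) * brel x y (- i) (- k) - u 0 (brel x y (- k) (- i)) - v 0 (brel x y k i)"
proof -
  have p: "par \<alpha> = 1" "par \<beta> = 1" "par (- \<alpha>) = 0" "par (- \<beta>) = 0"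
    and ph: "phi \<alpha> \<beta> = 0" "phi (- \<alpha>) \<beta> = 0" "phi \<alpha> (- \<beta>) = 0" "phi (- \<alpha>) (- \<beta>) = 0"
    using assms(1,2) by (auto simp: par_def phi_def)
  have xi: "scal xiv = scal qv - scal (inverse qv)"
    unfolding xiv_def using scal_add[of qv "- inverse qv"] by simp
  \<comment> \<open>Inserting one relation into another multiplies two powers of q. These products
    are reduced by xi = q - 1/q together with this cancellation.\<close>
  have q1: "scal qv * (scal (inverse qv) * z) = z" "scal (inverse qv) * (scal qv * z) = z" for z :: "'g falg"
    using qv_nz by (simp_all add: mult.assoc[symmetric] scal_times[symmetric])
  note S = arel_def brel_def T p ph par_def phi_def algebra_simps xi power_int_minus q1 u_def v_def
  show "arel T i \<alpha> k \<beta> = (-1) ^ ((par k + 1) * (par i + 1) + 1) * scal xiv * brel x y k i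
      - scal (qv powi phi i k) * brel x y i k - u 1 (brel x y k i) - v 1 (brel x y (- k) (- i))"
    using assms(1-4)
    by (cases "i < 0"; cases "k < 0"; cases rule: idx_cases[OF assms(3,4)]) (simp_all add: S)
  show "arel T i \<alpha> k (- \<beta>) = (-1) ^ ((par k + 1) * (par i + 1) + 1) * scal xiv * brel x y k (- i)
      - scal (qv powi phi i k) * brel x y i (- k) - u 1 (brel x y k (- i)) - v 1 (brel x y (- k) i)"
    using assms(1-4)
    by (cases "i < 0"; cases "k < 0"; cases rule: idx_cases[OF assms(3,4)]) (simp_all add: S)
  show "arel T i (- \<alpha>) k \<beta> = (-1) ^ ((par k + 1) * par i + 1) * scal xiv * brel x y k (- i)
      - scal (qv powi phi i k) * brel x y (- i) k - u 0 (brel x y (- k) i) - v 0 (brel x y k (- i))"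
    using assms(1-4)
    by (cases "i < 0"; cases "k < 0"; cases rule: idx_cases[OF assms(3,4)]) (simp_all add: S)
  show "arel T i (- \<alpha>) k (- \<beta>) = (-1) ^ ((par k + 1) * par i + 1) * scal xiv * brel x y k i
      - scal (qv powi phi i k) * brel x y (- i) (- k) - u 0 (brel x y (- k) (- i)) - v 0 (brel x y k i)"
    using assms(1-4)
    by (cases "i < 0"; cases "k < 0"; cases rule: idx_cases[OF assms(3,4)]) (simp_all add: S)
qed

text \<open>Needed because the generator matrix has its columns with positive index equal to
  reflected negative ones only modulo the ideal; \<open>arel\<close> is quadratic in its entries, so
  it respects congruence.\<close>

lemma arel_cong:
  assumes K: "two_sided K"
    and T: "\<And>b \<gamma>. b \<in> idx n \<Longrightarrow> \<gamma> \<in> {m, - m, p, - p} \<Longrightarrow> T b \<gamma> - T' b \<gamma> \<in> K"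
    and ik: "i \<in> idx n" "k \<in> idx n"
  shows "arel T i m k p - arel T' i m k p \<in> K"
proof -
  have sum: "(a + b + c - (d + e + f)) - (a' + b' + c' - (d' + e' + f')) \<in> K"
    if "a - a' \<in> K" "b - b' \<in> K" "c - c' \<in> K" "d - d' \<in> K" "e - e' \<in> K" "f - f' \<in> K"
    for a b c d e f a' b' c' d' e' f' :: "'a falg"
  proof -
    have "(a - a') + (b - b') + (c - c') - ((d - d') + (e - e') + (f - f')) \<in> K"
      by (rule two_sided_diff[OF K two_sidedD(2)[OF K two_sidedD(2)[OF K that(1,2)] that(3)]
            two_sidedD(2)[OF K two_sidedD(2)[OF K that(4,5)] that(6)]])
    then show ?thesis by (simp add: algebra_simps)
  qed
  have mult: "c * (a * b) - c * (a' * b') \<in> K" if "a - a' \<in> K" "b - b' \<in> K" for a b a' b' c :: "'a falg"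
  proof -
    have "c * ((a - a') * b + a' * (b - b')) \<in> K" 
      by (rule two_sidedD(3)[OF K two_sidedD(2)[OF K two_sidedD(4)[OF K that(1)] two_sidedD(3)[OF K that(2)]]])
    then show ?thesis by (simp add: algebra_simps)
  qed
  have cond: "(if P then a else 0) - (if P then b else 0) \<in> K" if "a - b \<in> K" for P and a b :: "'a falg"
    using that two_sidedD(1)[OF K] by simp
  show ?thesis unfolding arel_def
    by (intro sum mult cond T) (use ik in simp_all)
qed

text \<open>Two signed columns from each block, in either order, make eight choices of
  \<open>m\<close> and \<open>p\<close>. Each one is a combination of elements \<open>brel\<close>
  with coefficients on the left.\<close>

lemma arel_cross:
  fixes x y :: "int \<Rightarrow> 'g falg"
  assumes K: "two_sided K" and neg: "\<beta> < 0" "\<alpha> < \<beta>" and ik: "i \<in> idx n" "k \<in> idx n"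
    and T: "\<And>b. b \<in> idx n \<Longrightarrow> T b \<alpha> - x b \<in> K" "\<And>b. b \<in> idx n \<Longrightarrow> T b (- \<alpha>) - x (- b) \<in> K"
      "\<And>b. b \<in> idx n \<Longrightarrow> T b \<beta> - y b \<in> K" "\<And>b. b \<in> idx n \<Longrightarrow> T b (- \<beta>) - y (- b) \<in> K"
    and brel: "\<And>a b. a \<in> idx n \<Longrightarrow> b \<in> idx n \<Longrightarrow> brel x y a b \<in> K"
    and mp: "m \<in> {\<alpha>, - \<alpha>} \<and> p \<in> {\<beta>, - \<beta>} \<or> m \<in> {\<beta>, - \<beta>} \<and> p \<in> {\<alpha>, - \<alpha>}"
  shows "arel T i m k p \<in> K"
proof -
  \<comment> \<open>The indices \<alpha>, -\<alpha>, \<beta>, -\<beta> are pairwise distinct, so a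
    matrix satisfying the column identities exactly can be written down, and the polynomial
    identities above apply to it.\<close>
  define T' where "T' b \<gamma> = (if \<gamma> = \<alpha> then x b else if \<gamma> = - \<alpha> then x (- b) else if \<gamma> = \<beta> then y b else y (- b))" for b \<gamma>
  have T': "T' b \<alpha> = x b" "T' b (- \<alpha>) = x (- b)" "T' b \<beta> = y b" "T' b (- \<beta>) = y (- b)" for b
    using neg by (simp_all add: T'_def)
  note nz = idx_nz[OF ik(1)] idx_nz[OF ik(2)]
  have cond: "(if P then a else 0) \<in> K" if "a \<in> K" for P and a :: "'g falg"
    using that two_sidedD(1)[OF K] by simp
  have d: "arel T i m k p - arel T' i m k p \<in> K"
    using mp by (intro arel_cong[OF K _ ik]) (auto simp: T' T)
  have "arel T' i m k p \<in> K"
  proof -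
    consider "m = \<beta>" "p = \<alpha>" | "m = \<beta>" "p = - \<alpha>" | "m = - \<beta>" "p = \<alpha>" | "m = - \<beta>" "p = - \<alpha>"
      | "m = \<alpha>" "p = \<beta>" | "m = \<alpha>" "p = - \<beta>" | "m = - \<alpha>" "p = \<beta>" | "m = - \<alpha>" "p = - \<beta>"
      using mp by blast
    then show ?thesis
    proof cases
      case 1
      show ?thesis unfolding 1 arel_brel[where T = T' and x = x and y = y, OF neg nz T'(1,3)] by (intro two_sidedD(3)[OF K] brel) (use ik in simp_all)
    next
      case 2
      show ?thesis unfolding 2 arel_brel_neg(1)[where T = T' and x = x and y = y, OF neg nz T'] by (intro two_sidedD(3)[OF K] brel) (use ik in simp_all)
    next
      case 3
      show ?thesis unfolding 3 arel_brel_neg(2)[where T = T' and x = x and y = y, OF neg nz T'] by (intro two_sidedD(3)[OF K] brel) (use ik in simp_all)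
    next
      case 4
      show ?thesis unfolding 4 arel_brel_neg(3)[where T = T' and x = x and y = y, OF neg nz T'] by (intro two_sidedD(3)[OF K] brel) (use ik in simp_all)
    next
      case 5
      show ?thesis unfolding 5 arel_brel_exchanged(1)[where T = T' and x = x and y = y, OF neg nz T']
        by (intro two_sided_diff[OF K] cond two_sidedD(3)[OF K] brel) (use ik in simp_all)
    next
      case 6
      show ?thesis unfolding 6 arel_brel_exchanged(2)[where T = T' and x = x and y = y, OF neg nz T']
        by (intro two_sided_diff[OF K] cond two_sidedD(3)[OF K] brel) (use ik in simp_all)
    next
      case 7
      show ?thesis unfolding 7 arel_brel_exchanged(3)[where T = T' and x = x and y = y, OF neg nz T']
        by (intro two_sided_diff[OF K] cond two_sidedD(3)[OF K] brel) (use ik in simp_all)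
    next
      case 8
      show ?thesis unfolding 8 arel_brel_exchanged(4)[where T = T' and x = x and y = y, OF neg nz T']
        by (intro two_sided_diff[OF K] cond two_sidedD(3)[OF K] brel) (use ik in simp_all)
    qed
  qed
  from two_sidedD(2)[OF K d this] show ?thesis by simp
qed

lemma superalg_homD:
  assumes "superalg_hom A B f"
  shows "lin A B f" "x \<in> carrier A \<Longrightarrow> f x \<in> carrier B"
    "x \<in> carrier A \<Longrightarrow> y \<in> carrier A \<Longrightarrow> f (x \<otimes>\<^bsub>A\<^esub> y) = f x \<otimes>\<^bsub>B\<^esub> f y" "f \<one>\<^bsub>A\<^esub> = \<one>\<^bsub>B\<^esub>"
    "p \<in> {0, 1} \<Longrightarrow> x \<in> part A p \<Longrightarrow> f x \<in> part B p"
  using assms ring_hom_memE(2)[of f A B] ring_hom_memE(4)[of f A B]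
  unfolding superalg_hom_def even_linear_def lin_def by blast+

section \<open>Braiding and bijectivity of sigma\<close>

section \<open>The comparison map\<close>

text \<open>That the three algebras are superalgebras is contained in the axioms for their actions;
  the locale keeps only this consequence.\<close>

locale braid =
  fixes s l n :: nat and \<Phi>s \<Phi>l :: "alg \<Rightarrow> alg \<Rightarrow> alg" and \<Theta> :: "(alg, alg) tensor \<Rightarrow> (alg, alg) tensor"
  assumes As: "superalgebra (Abar s n)" and Al: "superalgebra (Abar l n)"
    and Asl: "superalgebra (Abar (s + l) n)"
    and braiding: "is_braiding l s n \<Phi>l \<Phi>s \<Theta>"
begin

sublocale S: abar s n .
sublocale L: abar l n .
sublocale M: abar "s + l" n .
sublocale AS: salg "Abar s n" by (rule salgI[OF As])
sublocale AL: salg "Abar l n" by (rule salgI[OF Al])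
sublocale B: salg "Abar (s + l) n" by (rule salgI[OF Asl])
sublocale W: tensalg "Abar s n" "Abar l n" ..
sublocale V: tensalg "Abar l n" "Abar s n" ..

abbreviation "WW \<equiv> tens_space (Abar s n) (Abar l n)"
abbreviation "VV \<equiv> tens_space (Abar l n) (Abar s n)"
abbreviation "BB \<equiv> Abar (s + l) n"
abbreviation "tp \<equiv> tpure (Abar s n) (Abar l n)"
abbreviation "tv \<equiv> tpure (Abar l n) (Abar s n)"
abbreviation "il \<equiv> iota l (s + l) s n"
abbreviation "i0 \<equiv> iota 0 (s + l) l n"
abbreviation "\<sigma> \<equiv> sigma_bar s l n"

lemma hom_il: "superalg_hom (Abar s n) BB il" and hom_i0: "superalg_hom (Abar l n) BB i0"
  by (rule iota_shift; use Asl in simp)+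

lemma il_pr: "f \<in> polys (A_gens s n) \<Longrightarrow> il (S.Q.pr f) = M.Q.pr (shift l f)"
  and i0_pr: "g \<in> polys (A_gens l n) \<Longrightarrow> i0 (L.Q.pr g) = M.Q.pr (shift 0 g)"
  using iota_shift(2)[of l s "s + l" n f] iota_shift(2)[of 0 l "s + l" n g] Asl
  by (simp_all add: A_free_def A_ideal_def)

lemmas il = superalg_homD[OF hom_il] and i0 = superalg_homD[OF hom_i0]

lemma neg_idx: "\<alpha> \<in> {- int k..-1} \<Longrightarrow> \<alpha> \<in> idx k"
  by (auto simp: idx_def)

lemma il_tbar: "\<alpha> \<in> {- int s..-1} \<Longrightarrow> a \<in> idx n \<Longrightarrow> il (tbar s n \<alpha> a) = tbar (s + l) n (\<alpha> - int l) a"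
  using il_pr[OF polys_gen[of "(\<alpha>, a)"]] neg_idx[of \<alpha> s] by (auto simp: S.tbar_pr M.tbar_pr shift_def sh_def)

lemma i0_tbar: "\<beta> \<in> {- int l..-1} \<Longrightarrow> b \<in> idx n \<Longrightarrow> i0 (tbar l n \<beta> b) = tbar (s + l) n \<beta> b"
  using i0_pr[OF polys_gen[of "(\<beta>, b)"]] neg_idx[of \<beta> l] by (auto simp: L.tbar_pr M.tbar_pr shift_def sh_def)

lemma bilin_il_i0: "bilin (Abar s n) (Abar l n) BB (\<lambda>x y. il x \<otimes>\<^bsub>BB\<^esub> i0 y)"
  by (rule bilinI; rule lin_comp[OF B.lin_mult_left i0(1)] lin_comp[OF B.lin_mult_right il(1)]) (simp_all add: il i0)

lemma sigma_tp [simp]: "x \<in> carrier (Abar s n) \<Longrightarrow> y \<in> carrier (Abar l n) \<Longrightarrow> \<sigma> (tp x y) = il x \<otimes>\<^bsub>BB\<^esub> i0 y"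
  unfolding sigma_bar_def by (rule W.tlift_tpure[OF B.vspace_axioms bilin_il_i0])

lemma lin_sigma: "lin WW BB \<sigma>"
  unfolding sigma_bar_def[abs_def] by (rule W.lin_tlift[OF B.vspace_axioms bilin_il_i0])

lemmas sigma_closed [simp, intro] = lin_closed[OF lin_sigma]

lemma lin_Theta: "lin VV WW \<Theta>"
  using braiding by (auto simp: is_braiding_def Let_def supermodule_hom_def even_linear_def lin_def)

lemmas Theta_closed [simp, intro] = lin_closed[OF lin_Theta]

lemma Theta_one:
  "x \<in> carrier (Abar s n) \<Longrightarrow> \<Theta> (tv \<one>\<^bsub>Abar l n\<^esub> x) = tp x \<one>\<^bsub>Abar l n\<^esub>"
  "y \<in> carrier (Abar l n) \<Longrightarrow> \<Theta> (tv y \<one>\<^bsub>Abar s n\<^esub>) = tp \<one>\<^bsub>Abar s n\<^esub> y"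
  using braiding by (simp_all add: is_braiding_def Let_def)

definition LX :: "alg \<Rightarrow> (alg, alg) tensor \<Rightarrow> (alg, alg) tensor" where
  "LX x = tlift WW (\<lambda>x2 y2. tp (x \<otimes>\<^bsub>Abar s n\<^esub> x2) y2)"

definition RY :: "alg \<Rightarrow> (alg, alg) tensor \<Rightarrow> (alg, alg) tensor" where
  "RY y = tlift WW (\<lambda>x2 y2. tp x2 (y2 \<otimes>\<^bsub>Abar l n\<^esub> y))"

text \<open>Left multiplication by 1 \<otimes> y for the braided product: y is carried past the
  first entry by \<Theta>, and the old second entry is then multiplied from the right.\<close>

definition YY :: "alg \<Rightarrow> (alg, alg) tensor \<Rightarrow> (alg, alg) tensor" where
  "YY y = tlift WW (\<lambda>x' y'. RY y' (\<Theta> (tv y x')))"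

lemma hexagon1:
  assumes "y \<in> carrier (Abar l n)" "x \<in> carrier (Abar s n)" "x' \<in> carrier (Abar s n)"
  shows "\<Theta> (tv y (x \<otimes>\<^bsub>Abar s n\<^esub> x')) = tlift WW (\<lambda>x1 y1. LX x1 (\<Theta> (tv y1 x'))) (\<Theta> (tv y x))"
  using braiding assms by (simp add: is_braiding_def Let_def LX_def)

lemma hexagon2:
  assumes "y \<in> carrier (Abar l n)" "y' \<in> carrier (Abar l n)" "x \<in> carrier (Abar s n)"
  shows "\<Theta> (tv (y \<otimes>\<^bsub>Abar l n\<^esub> y') x) = tlift WW (\<lambda>x1 y1. RY y1 (\<Theta> (tv y x1))) (\<Theta> (tv y' x))"
  using braiding assms by (simp add: is_braiding_def Let_def RY_def)

lemma bilin_LX: "x \<in> carrier (Abar s n) \<Longrightarrow> bilin (Abar s n) (Abar l n) WW (\<lambda>x2 y2. tp (x \<otimes>\<^bsub>Abar s n\<^esub> x2) y2)"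
  by (rule bilinI; rule bilin_right[OF W.bilin_tpure] lin_comp[OF bilin_left[OF W.bilin_tpure] AS.lin_mult_left]) auto

lemma bilin_RY: "y \<in> carrier (Abar l n) \<Longrightarrow> bilin (Abar s n) (Abar l n) WW (\<lambda>x2 y2. tp x2 (y2 \<otimes>\<^bsub>Abar l n\<^esub> y))"
  by (rule bilinI; rule bilin_left[OF W.bilin_tpure] lin_comp[OF bilin_right[OF W.bilin_tpure] AL.lin_mult_right]) auto

lemma lin_LX: "x \<in> carrier (Abar s n) \<Longrightarrow> lin WW WW (LX x)"
  unfolding LX_def by (rule W.lin_tlift[OF W.T.vspace_axioms bilin_LX])

lemma lin_RY: "y \<in> carrier (Abar l n) \<Longrightarrow> lin WW WW (RY y)"
  unfolding RY_def by (rule W.lin_tlift[OF W.T.vspace_axioms bilin_RY])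

lemmas LX_closed [simp, intro] = lin_closed[OF lin_LX]
lemmas RY_closed [simp, intro] = lin_closed[OF lin_RY]

lemma LX_tp: "x \<in> carrier (Abar s n) \<Longrightarrow> a \<in> carrier (Abar s n) \<Longrightarrow> b \<in> carrier (Abar l n) \<Longrightarrow>
    LX x (tp a b) = tp (x \<otimes>\<^bsub>Abar s n\<^esub> a) b"
  unfolding LX_def by (rule W.tlift_tpure[OF W.T.vspace_axioms bilin_LX])

lemma RY_tp: "y \<in> carrier (Abar l n) \<Longrightarrow> a \<in> carrier (Abar s n) \<Longrightarrow> b \<in> carrier (Abar l n) \<Longrightarrow>
    RY y (tp a b) = tp a (b \<otimes>\<^bsub>Abar l n\<^esub> y)"
  unfolding RY_def by (rule W.tlift_tpure[OF W.T.vspace_axioms bilin_RY])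

lemma lin_LX_param: "Z \<in> carrier WW \<Longrightarrow> lin (Abar s n) WW (\<lambda>x. LX x Z)"
  unfolding LX_def
  by (rule W.lin_tlift_param[OF AS.vspace_axioms W.T.vspace_axioms],
      assumption, rule lin_comp[OF bilin_left[OF W.bilin_tpure] AS.lin_mult_right])

lemma lin_RY_param: "Z \<in> carrier WW \<Longrightarrow> lin (Abar l n) WW (\<lambda>y. RY y Z)"
  unfolding RY_def
  by (rule W.lin_tlift_param[OF AL.vspace_axioms W.T.vspace_axioms],
      assumption, rule lin_comp[OF bilin_right[OF W.bilin_tpure] AL.lin_mult_left])

lemma lin_Theta_left: "x \<in> carrier (Abar s n) \<Longrightarrow> lin (Abar l n) WW (\<lambda>y. \<Theta> (tv y x))"
  by (rule lin_comp[OF lin_Theta bilin_left[OF V.bilin_tpure]])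

lemma lin_Theta_right: "y \<in> carrier (Abar l n) \<Longrightarrow> lin (Abar s n) WW (\<lambda>x. \<Theta> (tv y x))"
  by (rule lin_comp[OF lin_Theta bilin_right[OF V.bilin_tpure]])

lemma bilin_YY: "y \<in> carrier (Abar l n) \<Longrightarrow> bilin (Abar s n) (Abar l n) WW (\<lambda>x' y'. RY y' (\<Theta> (tv y x')))"
  by (rule bilinI; rule lin_RY_param lin_comp[OF lin_RY lin_Theta_right]) auto

lemma lin_YY: "y \<in> carrier (Abar l n) \<Longrightarrow> lin WW WW (YY y)"
  unfolding YY_def by (rule W.lin_tlift[OF W.T.vspace_axioms bilin_YY])

lemmas YY_closed [simp, intro] = lin_closed[OF lin_YY]

lemma YY_tp: "y \<in> carrier (Abar l n) \<Longrightarrow> a \<in> carrier (Abar s n) \<Longrightarrow> b \<in> carrier (Abar l n) \<Longrightarrow>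
    YY y (tp a b) = RY b (\<Theta> (tv y a))"
  unfolding YY_def by (rule W.tlift_tpure[OF W.T.vspace_axioms bilin_YY])

lemma lin_YY_param: "Z \<in> carrier WW \<Longrightarrow> lin (Abar l n) WW (\<lambda>y. YY y Z)"
  unfolding YY_def
  by (rule W.lin_tlift_param[OF AL.vspace_axioms W.T.vspace_axioms],
      assumption, rule lin_comp[OF lin_RY lin_Theta_left])

lemma sigma_LX:
  assumes x: "x \<in> carrier (Abar s n)" and Z: "Z \<in> carrier WW" shows "\<sigma> (LX x Z) = il x \<otimes>\<^bsub>BB\<^esub> \<sigma> Z"
  by (rule W.lin_eqI[OF B.vspace_axioms lin_comp[OF lin_sigma lin_LX[OF x]] lin_comp[OF B.lin_mult_left lin_sigma] _ Z])
     (use x in \<open>simp_all add: LX_tp il i0 B.mult_assoc\<close>)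

lemma sigma_RY:
  assumes y: "y \<in> carrier (Abar l n)" and Z: "Z \<in> carrier WW" shows "\<sigma> (RY y Z) = \<sigma> Z \<otimes>\<^bsub>BB\<^esub> i0 y"
  by (rule W.lin_eqI[OF B.vspace_axioms lin_comp[OF lin_sigma lin_RY[OF y]] lin_comp[OF B.lin_mult_right lin_sigma] _ Z])
     (use y in \<open>simp_all add: RY_tp il i0 B.mult_assoc\<close>)

lemma RY_RY:
  assumes y: "y \<in> carrier (Abar l n)" "y' \<in> carrier (Abar l n)" and Z: "Z \<in> carrier WW"
  shows "RY y (RY y' Z) = RY (y' \<otimes>\<^bsub>Abar l n\<^esub> y) Z"
  by (rule W.lin_eqI[OF W.T.vspace_axioms lin_comp[OF lin_RY[OF y(1)] lin_RY[OF y(2)]] lin_RY _ Z])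
     (use y in \<open>simp_all add: RY_tp AL.mult_assoc\<close>)

lemma LX_LX:
  assumes x: "x \<in> carrier (Abar s n)" "x' \<in> carrier (Abar s n)" and Z: "Z \<in> carrier WW"
  shows "LX x (LX x' Z) = LX (x \<otimes>\<^bsub>Abar s n\<^esub> x') Z"
  by (rule W.lin_eqI[OF W.T.vspace_axioms lin_comp[OF lin_LX[OF x(1)] lin_LX[OF x(2)]] lin_LX _ Z])
     (use x in \<open>simp_all add: LX_tp AS.mult_assoc\<close>)

lemma LX_RY:
  assumes x: "x \<in> carrier (Abar s n)" and y: "y \<in> carrier (Abar l n)" and Z: "Z \<in> carrier WW"
  shows "RY y (LX x Z) = LX x (RY y Z)"
  by (rule W.lin_eqI[OF W.T.vspace_axioms lin_comp[OF lin_RY[OF y] lin_LX[OF x]] lin_comp[OF lin_LX[OF x] lin_RY[OF y]] _ Z])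
     (use x y in \<open>simp_all add: LX_tp RY_tp\<close>)

lemma LX_one: assumes Z: "Z \<in> carrier WW" shows "LX \<one>\<^bsub>Abar s n\<^esub> Z = Z"
  by (rule W.lin_eqI[OF W.T.vspace_axioms lin_LX lin_id _ Z]) (simp_all add: LX_tp)

lemma YY_one: assumes Z: "Z \<in> carrier WW" shows "YY \<one>\<^bsub>Abar l n\<^esub> Z = Z"
  by (rule W.lin_eqI[OF W.T.vspace_axioms lin_YY lin_id _ Z]) (simp_all add: YY_tp Theta_one RY_tp)

text \<open>The hexagon identity for products on the left of \<Theta>, in the form that
  \<open>YY\<close> makes the tensor product a module over the second small algebra.\<close>

lemma YY_YY:
  assumes y: "y \<in> carrier (Abar l n)" "y' \<in> carrier (Abar l n)" and Z: "Z \<in> carrier WW"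
  shows "YY (y \<otimes>\<^bsub>Abar l n\<^esub> y') Z = YY y (YY y' Z)"
proof (rule W.lin_eqI[OF W.T.vspace_axioms lin_YY lin_comp[OF lin_YY[OF y(1)] lin_YY[OF y(2)]] _ Z])
  fix a b assume ab: "a \<in> carrier (Abar s n)" "b \<in> carrier (Abar l n)"
  have T: "\<Theta> (tv y' a) \<in> carrier WW" using y ab by auto
  have "YY (y \<otimes>\<^bsub>Abar l n\<^esub> y') (tp a b) = RY b (tlift WW (\<lambda>x1 y1. RY y1 (\<Theta> (tv y x1))) (\<Theta> (tv y' a)))"
    using y ab by (simp add: YY_tp hexagon2)
  also have "\<dots> = tlift WW (\<lambda>x1 y1. RY b (RY y1 (\<Theta> (tv y x1)))) (\<Theta> (tv y' a))"
    by (rule W.lin_comp_tlift[OF W.T.vspace_axioms W.T.vspace_axioms lin_RY[OF ab(2)] T]) (use y in auto)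
  also have "\<dots> = tlift WW (\<lambda>x1 y1. YY y (tp x1 (y1 \<otimes>\<^bsub>Abar l n\<^esub> b))) (\<Theta> (tv y' a))"
    by (rule W.tlift_cong[OF W.T.vspace_axioms T]) (use y ab in \<open>auto simp: RY_RY YY_tp\<close>)
  also have "\<dots> = YY y (tlift WW (\<lambda>x1 y1. tp x1 (y1 \<otimes>\<^bsub>Abar l n\<^esub> b)) (\<Theta> (tv y' a)))"
    by (rule W.lin_comp_tlift[OF W.T.vspace_axioms W.T.vspace_axioms lin_YY[OF y(1)] T, symmetric]) (use ab in auto)
  also have "\<dots> = YY y (YY y' (tp a b))"
    using y ab by (simp add: YY_tp) (simp add: RY_def)
  finally show "YY (y \<otimes>\<^bsub>Abar l n\<^esub> y') (tp a b) = YY y (YY y' (tp a b))" .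
qed (use y in auto)

text \<open>The other hexagon identity as a commutation rule: if \<Theta>(y \<otimes> x) is a sum of
  x1 \<otimes> y1, then y followed by x on the right acts as the sum of the x1 y1. On generators
  this yields the mixed relations.\<close>

lemma YY_LX:
  assumes y: "y \<in> carrier (Abar l n)" and x: "x \<in> carrier (Abar s n)" and Z: "Z \<in> carrier WW"
  shows "YY y (LX x Z) = tlift WW (\<lambda>x1 y1. LX x1 (YY y1 Z)) (\<Theta> (tv y x))"
proof (rule W.lin_eqI[OF W.T.vspace_axioms lin_comp[OF lin_YY[OF y] lin_LX[OF x]] W.lin_tlift_param _ Z])
  show T: "\<Theta> (tv y x) \<in> carrier WW" using y x by auto
  fix a b assume ab: "a \<in> carrier (Abar s n)" "b \<in> carrier (Abar l n)"
  have "YY y (LX x (tp a b)) = RY b (tlift WW (\<lambda>x1 y1. LX x1 (\<Theta> (tv y1 a))) (\<Theta> (tv y x)))"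
    using y x ab by (simp add: LX_tp YY_tp hexagon1)
  also have "\<dots> = tlift WW (\<lambda>x1 y1. RY b (LX x1 (\<Theta> (tv y1 a)))) (\<Theta> (tv y x))"
    by (rule W.lin_comp_tlift[OF W.T.vspace_axioms W.T.vspace_axioms lin_RY[OF ab(2)] T]) (use ab in auto)
  also have "\<dots> = tlift WW (\<lambda>x1 y1. LX x1 (YY y1 (tp a b))) (\<Theta> (tv y x))"
    by (rule W.tlift_cong[OF W.T.vspace_axioms T]) (use ab in \<open>auto simp: LX_RY YY_tp\<close>)
  finally show "YY y (LX x (tp a b)) = tlift WW (\<lambda>x1 y1. LX x1 (YY y1 (tp a b))) (\<Theta> (tv y x))" .
next
  fix x1 y1 assume "x1 \<in> carrier (Abar s n)" "y1 \<in> carrier (Abar l n)"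
  then show "lin WW WW (\<lambda>Z. LX x1 (YY y1 Z))" by (intro lin_comp[OF lin_LX lin_YY])
qed (rule W.T.vspace_axioms)+

section \<open>The braiding computes products in the large algebra\<close>

lemma Theta_gen:
  assumes "\<alpha> \<in> {- int s..-1}" "\<beta> \<in> {- int l..-1}" "a \<in> idx n" "b \<in> idx n"
  shows "\<Theta> (tv (tbar l n \<beta> b) (tbar s n \<alpha> a)) =
          ((-1) ^ ((par a + 1) * (par b + 1)) * qv powi phi b a) \<odot>\<^bsub>WW\<^esub> tp (tbar s n \<alpha> a) (tbar l n \<beta> b)
          \<oplus>\<^bsub>WW\<^esub> (- (of_bool (a < b) * xiv)) \<odot>\<^bsub>WW\<^esub> tp (tbar s n \<alpha> b) (tbar l n \<beta> a)
          \<oplus>\<^bsub>WW\<^esub> (- ((-1) ^ par b * of_bool (a < - b) * xiv)) \<odot>\<^bsub>WW\<^esub> tp (tbar s n \<alpha> (- b)) (tbar l n \<beta> (- a))"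
  using braiding assms by (simp add: is_braiding_def Let_def)

lemma lin_Theta_gen:
  assumes C: "vspace C" and f: "lin WW C f"
    and g: "\<alpha> \<in> {- int s..-1}" "\<beta> \<in> {- int l..-1}" "a \<in> idx n" "b \<in> idx n"
  shows "f (\<Theta> (tv (tbar l n \<beta> b) (tbar s n \<alpha> a))) =
          ((-1) ^ ((par a + 1) * (par b + 1)) * qv powi phi b a) \<odot>\<^bsub>C\<^esub> f (tp (tbar s n \<alpha> a) (tbar l n \<beta> b))
          \<oplus>\<^bsub>C\<^esub> (- (of_bool (a < b) * xiv)) \<odot>\<^bsub>C\<^esub> f (tp (tbar s n \<alpha> b) (tbar l n \<beta> a))
          \<oplus>\<^bsub>C\<^esub> (- ((-1) ^ par b * of_bool (a < - b) * xiv)) \<odot>\<^bsub>C\<^esub> f (tp (tbar s n \<alpha> (- b)) (tbar l n \<beta> (- a)))"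
proof -
  have t: "tp (tbar s n \<alpha> c) (tbar l n \<beta> d) \<in> carrier WW" if "c \<in> idx n" "d \<in> idx n" for c d
    using that neg_idx[OF g(1)] neg_idx[OF g(2)] by auto
  note c = W.T.smult_cl[OF t]
  show ?thesis
    unfolding Theta_gen[OF g]
    using g(3,4) by (simp only: lin_add[OF f] lin_smult[OF f] c t W.T.a_closed idx_uminus)
qed

lemma brel_eq:
  "brel x y a b = y b * x a - (scal ((-1) ^ ((par a + 1) * (par b + 1)) * qv powi phi b a) * (x a * y b)
     + scal (- (of_bool (a < b) * xiv)) * (x b * y a)
     + scal (- ((-1) ^ par b * of_bool (a < - b) * xiv)) * (x (- b) * y (- a)))"
  by (simp add: brel_def scal_times scal_neg_one_power mult.assoc)

lemma idx_neg_range: "\<alpha> \<in> {- int s..-1} \<Longrightarrow> \<alpha> - int l \<in> idx (s + l)" "\<beta> \<in> {- int l..-1} \<Longrightarrow> \<beta> \<in> idx (s + l)"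
  by (auto simp: idx_def)

text \<open>The first block occupies the indices below \<open>- int l\<close>, hence below every
  \<beta> of the second block; in this position \<open>arel\<close> and \<open>brel\<close> differ
  only by a sign.\<close>

lemma brel_I:
  assumes g: "\<alpha> \<in> {- int s..-1}" "\<beta> \<in> {- int l..-1}" "a \<in> idx n" "b \<in> idx n"
  shows "brel (\<lambda>a. gen (\<alpha> - int l, a)) (\<lambda>b. gen (\<beta>, b)) a b \<in> M.I"
proof -
  \<comment> \<open>The sign exponent \<open>par c * (1 + par c)\<close> is even.\<close>
  have T: "Tfree c \<gamma> = gen (\<gamma>, c)" if "\<gamma> < 0" for c \<gamma>
    using that by (simp add: Tfree_def par_def)
  have "arel Tfree b \<beta> a (\<alpha> - int l) \<in> M.I"
    using M.S_I idx_neg_range(1)[of \<alpha>] idx_neg_range(2)[of \<beta>] g unfolding A_rels_eq by blast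
  then have "(-1) ^ ((par b + 1) * (par a + 1)) * arel Tfree b \<beta> a (\<alpha> - int l) \<in> M.I"
    by (rule M.I_mult(1)) simp
  moreover have "arel Tfree b \<beta> a (\<alpha> - int l)
      = (-1) ^ ((par b + 1) * (par a + 1)) * brel (\<lambda>a. gen (\<alpha> - int l, a)) (\<lambda>b. gen (\<beta>, b)) a b"
    using g idx_nz[OF g(3)] idx_nz[OF g(4)] by (intro arel_brel T) auto
  ultimately show ?thesis by (simp add: mult.assoc[symmetric] power_add[symmetric])
qed

lemma product_gen:
  assumes g: "\<alpha> \<in> {- int s..-1}" "\<beta> \<in> {- int l..-1}" "a \<in> idx n" "b \<in> idx n"
  shows "i0 (tbar l n \<beta> b) \<otimes>\<^bsub>BB\<^esub> il (tbar s n \<alpha> a) = \<sigma> (\<Theta> (tv (tbar l n \<beta> b) (tbar s n \<alpha> a)))"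
proof -
  let ?x = "\<lambda>a. gen (\<alpha> - int l, a)" and ?y = "\<lambda>b. gen (\<beta>, b)"
  note neg = neg_idx[OF g(1)] neg_idx[OF g(2)]
  have st: "\<sigma> (tp (tbar s n \<alpha> c) (tbar l n \<beta> d)) = M.Q.pr (?x c * ?y d)" if "c \<in> idx n" "d \<in> idx n" for c d
    using that g(1,2) neg idx_neg_range(1)[of \<alpha>] idx_neg_range(2)[of \<beta>]
    by (simp add: il_tbar i0_tbar M.tbar_pr M.mult_pr polys_gen)
  have xy: "?x c * ?y d \<in> polys (A_gens (s + l) n)" if "c \<in> idx n" "d \<in> idx n" for c d
    using that idx_neg_range(1)[OF g(1)] idx_neg_range(2)[OF g(2)] by (auto intro!: polys_mult polys_gen)
  have "i0 (tbar l n \<beta> b) \<otimes>\<^bsub>BB\<^esub> il (tbar s n \<alpha> a) = M.Q.pr (?y b * ?x a)"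
    using g idx_neg_range(1)[of \<alpha>] idx_neg_range(2)[of \<beta>] by (simp add: il_tbar i0_tbar M.tbar_pr M.mult_pr polys_gen)
  also have "\<dots> = M.Q.pr (?y b * ?x a - brel ?x ?y a b)"
    using brel_I[OF g] by (simp add: M.Q.pr_eq_iff)
  also have "\<dots> = \<sigma> (\<Theta> (tv (tbar l n \<beta> b) (tbar s n \<alpha> a)))"
    unfolding lin_Theta_gen[OF B.vspace_axioms lin_sigma g] brel_eq
    using g(3,4) by (simp add: st M.smult_pr xy M.Q.add_squot)
  finally show ?thesis .
qed

text \<open>The formula for generators spreads to all arguments by the hexagon identities, one for
  each argument. The second argument has to remain a generator while the first one grows.\<close>

lemma product_Theta:
  assumes y: "y \<in> carrier (Abar l n)" and x: "x \<in> carrier (Abar s n)"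
  shows "i0 y \<otimes>\<^bsub>BB\<^esub> il x = \<sigma> (\<Theta> (tv y x))"
proof -
  \<comment> \<open>Right induction: in \<open>y t\<close> the generator \<open>t\<close> meets the
    generator of the first block first. By the explicit formula \<Theta> then gives a combination of
    tensors of generators, to whose first entries the hypothesis for \<open>y\<close>
    applies.\<close>
  have gen_right: "\<forall>\<alpha>\<in>{- int s..-1}. \<forall>a\<in>idx n. i0 y \<otimes>\<^bsub>BB\<^esub> il (tbar s n \<alpha> a) = \<sigma> (\<Theta> (tv y (tbar s n \<alpha> a)))"
    if "y \<in> carrier (Abar l n)" for y
    using that
  proof (induct y rule: L.A_induct_right)
    case one
    show ?case using neg_idx[of _ s] by (simp add: Theta_one i0 il)
  next
    case (gen \<beta> b y)
    note tb = L.tbar_closed[OF neg_idx[OF gen(1)] gen(2)]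
    show ?case
    proof (intro ballI)
      fix \<alpha> a assume \<alpha>: "\<alpha> \<in> {- int s..-1}" "a \<in> idx n"
      have ts: "tbar s n \<alpha> c \<in> carrier (Abar s n)" if "c \<in> idx n" for c using neg_idx[OF \<alpha>(1)] that by simp
      have tl: "tbar l n \<beta> c \<in> carrier (Abar l n)" if "c \<in> idx n" for c using neg_idx[OF gen(1)] that by simp
      let ?b = "\<lambda>x1 y1. \<sigma> (RY y1 (\<Theta> (tv y x1)))"
      have bil: "bilin (Abar s n) (Abar l n) BB ?b"
        by (rule lin_bilin_comp[OF lin_sigma bilin_YY[OF gen(3)]])
      have "\<sigma> (\<Theta> (tv (y \<otimes>\<^bsub>Abar l n\<^esub> tbar l n \<beta> b) (tbar s n \<alpha> a)))
          = tlift BB ?b (\<Theta> (tv (tbar l n \<beta> b) (tbar s n \<alpha> a)))"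
        unfolding hexagon2[OF gen(3) tb ts[OF \<alpha>(2)]]
        by (rule W.lin_comp_tlift[OF W.T.vspace_axioms B.vspace_axioms lin_sigma]) (use gen(3) tb ts[OF \<alpha>(2)] in auto)
      also have "\<dots> = i0 y \<otimes>\<^bsub>BB\<^esub> \<sigma> (\<Theta> (tv (tbar l n \<beta> b) (tbar s n \<alpha> a)))"
      proof -
        have "tlift BB ?b (tp (tbar s n \<alpha> c) (tbar l n \<beta> d)) = i0 y \<otimes>\<^bsub>BB\<^esub> \<sigma> (tp (tbar s n \<alpha> c) (tbar l n \<beta> d))"
          if "c \<in> idx n" "d \<in> idx n" for c d
          using that gen(3) gen(4)[rule_format, OF \<alpha>(1) that(1), symmetric] ts tl
          by (simp add: W.tlift_tpure[OF B.vspace_axioms bil] sigma_RY il i0 B.mult_assoc)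
        then show ?thesis
          unfolding lin_Theta_gen[OF B.vspace_axioms W.lin_tlift[OF B.vspace_axioms bil] \<alpha>(1) gen(1) \<alpha>(2) gen(2)]
            lin_Theta_gen[OF B.vspace_axioms lin_comp[OF B.lin_mult_left[OF i0(2)[OF gen(3)]] lin_sigma] \<alpha>(1) gen(1) \<alpha>(2) gen(2)]
          using \<alpha>(2) gen(2) by simp
      qed
      also have "\<dots> = i0 (y \<otimes>\<^bsub>Abar l n\<^esub> tbar l n \<beta> b) \<otimes>\<^bsub>BB\<^esub> il (tbar s n \<alpha> a)"
        using product_gen[OF \<alpha>(1) gen(1) \<alpha>(2) gen(2)] gen(3) tb ts[OF \<alpha>(2)]
        by (simp add: i0 il B.mult_assoc)
      finally show "i0 (y \<otimes>\<^bsub>Abar l n\<^esub> tbar l n \<beta> b) \<otimes>\<^bsub>BB\<^esub> il (tbar s n \<alpha> a)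
          = \<sigma> (\<Theta> (tv (y \<otimes>\<^bsub>Abar l n\<^esub> tbar l n \<beta> b) (tbar s n \<alpha> a)))" ..
    qed
  next
    case (add y y')
    then show ?case using neg_idx[of _ s]
      by (simp add: lin_add[OF i0(1)] lin_add[OF lin_Theta_left] lin_add[OF lin_sigma] B.add_mult i0 il)
  next
    case (smult y c)
    then show ?case using neg_idx[of _ s]
      by (simp add: lin_smult[OF i0(1)] lin_smult[OF lin_Theta_left] lin_smult[OF lin_sigma] B.smult_mult_left i0 il)
  qed
  \<comment> \<open>All \<open>y\<close> at once, because splitting off a generator \<open>t\<close>
    leaves the second entries of \<Theta>(y \<otimes> t) in front of \<open>x\<close>, and these are
    not under control.\<close>
  have "\<forall>y\<in>carrier (Abar l n). i0 y \<otimes>\<^bsub>BB\<^esub> il x = \<sigma> (\<Theta> (tv y x))"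
    using x
  proof (induct x rule: S.A_induct)
    case one
    show ?case by (simp add: Theta_one i0 il)
  next
    case (gen \<alpha> a x)
    note ta = S.tbar_closed[OF neg_idx[OF gen(1)] gen(2)]
    show ?case
    proof
      fix y assume y: "y \<in> carrier (Abar l n)"
      let ?t = "tbar s n \<alpha> a"
      have T: "\<Theta> (tv y ?t) \<in> carrier WW" using y ta by auto
      have "\<sigma> (\<Theta> (tv y (?t \<otimes>\<^bsub>Abar s n\<^esub> x))) = tlift BB (\<lambda>x1 y1. \<sigma> (LX x1 (\<Theta> (tv y1 x)))) (\<Theta> (tv y ?t))"
        unfolding hexagon1[OF y ta gen(3)]
        by (rule W.lin_comp_tlift[OF W.T.vspace_axioms B.vspace_axioms lin_sigma T]) (use gen(3) in auto)
      also have "\<dots> = tlift BB (\<lambda>x1 y1. (il x1 \<otimes>\<^bsub>BB\<^esub> i0 y1) \<otimes>\<^bsub>BB\<^esub> il x) (\<Theta> (tv y ?t))"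
        by (rule W.tlift_cong[OF B.vspace_axioms T]) (use gen in \<open>auto simp: sigma_LX il i0 B.mult_assoc\<close>)
      also have "\<dots> = \<sigma> (\<Theta> (tv y ?t)) \<otimes>\<^bsub>BB\<^esub> il x"
        unfolding sigma_bar_def
        by (rule W.lin_comp_tlift[OF B.vspace_axioms B.vspace_axioms B.lin_mult_right T, symmetric])
           (use gen(3) in \<open>auto simp: il i0\<close>)
      also have "\<dots> = i0 y \<otimes>\<^bsub>BB\<^esub> il (?t \<otimes>\<^bsub>Abar s n\<^esub> x)"
        using gen_right[OF y, rule_format, OF gen(1,2), symmetric] y ta gen(3)
        by (simp add: il i0 B.mult_assoc)
      finally show "i0 y \<otimes>\<^bsub>BB\<^esub> il (?t \<otimes>\<^bsub>Abar s n\<^esub> x) = \<sigma> (\<Theta> (tv y (?t \<otimes>\<^bsub>Abar s n\<^esub> x)))" ..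
    qed
  next
    case (add x x')
    then show ?case
      by (simp add: lin_add[OF il(1)] lin_add[OF lin_Theta_right] lin_add[OF lin_sigma] B.mult_add i0 il)
  next
    case (smult x c)
    then show ?case
      by (simp add: lin_smult[OF il(1)] lin_smult[OF lin_Theta_right] lin_smult[OF lin_sigma] B.smult_mult_right i0 il)
  qed
  then show ?thesis using y by blast
qed

lemma sigma_YY:
  assumes y: "y \<in> carrier (Abar l n)" and Z: "Z \<in> carrier WW" shows "\<sigma> (YY y Z) = i0 y \<otimes>\<^bsub>BB\<^esub> \<sigma> Z"
  by (rule W.lin_eqI[OF B.vspace_axioms lin_comp[OF lin_sigma lin_YY[OF y]] lin_comp[OF B.lin_mult_left lin_sigma] _ Z])
     (use y in \<open>simp_all add: YY_tp sigma_RY product_Theta[symmetric] il i0 B.mult_assoc\<close>)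

section \<open>Surjectivity\<close>

lemma sigma_surj: "b \<in> carrier BB \<Longrightarrow> \<exists>Z\<in>carrier WW. b = \<sigma> Z"
proof (induct b rule: M.A_induct)
  case one
  show ?case by (rule bexI[of _ "tp \<one>\<^bsub>Abar s n\<^esub> \<one>\<^bsub>Abar l n\<^esub>"]) (simp_all add: il i0)
next
  case (gen \<gamma> c b)
  then obtain Z where Z: "Z \<in> carrier WW" "b = \<sigma> Z" by blast
  show ?case
  proof (cases "\<gamma> < - int l")
    case True
    then have \<alpha>: "\<gamma> + int l \<in> {- int s..-1}" using gen(1) by auto
    have eq: "tbar (s + l) n \<gamma> c \<otimes>\<^bsub>BB\<^esub> b = \<sigma> (LX (tbar s n (\<gamma> + int l) c) Z)"
      using Z il_tbar[OF \<alpha> gen(2)] neg_idx[OF \<alpha>] gen(2) by (simp add: sigma_LX)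
    show ?thesis using eq Z(1) neg_idx[OF \<alpha>] gen(2) by (intro bexI[of _ "LX (tbar s n (\<gamma> + int l) c) Z"]) simp_all
  next
    case False
    then have \<beta>: "\<gamma> \<in> {- int l..-1}" using gen(1) by auto
    have eq: "tbar (s + l) n \<gamma> c \<otimes>\<^bsub>BB\<^esub> b = \<sigma> (YY (tbar l n \<gamma> c) Z)"
      using Z i0_tbar[OF \<beta> gen(2)] neg_idx[OF \<beta>] gen(2) by (simp add: sigma_YY)
    show ?thesis using eq Z(1) neg_idx[OF \<beta>] gen(2) by (intro bexI[of _ "YY (tbar l n \<gamma> c) Z"]) simp_all
  qed
next
  case (add b b')
  then obtain Z Z' where "Z \<in> carrier WW" "b = \<sigma> Z" "Z' \<in> carrier WW" "b' = \<sigma> Z'" by blast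
  then show ?case by (intro bexI[of _ "Z \<oplus>\<^bsub>WW\<^esub> Z'"]) (simp_all add: lin_add[OF lin_sigma])
next
  case (smult b c)
  then obtain Z where "Z \<in> carrier WW" "b = \<sigma> Z" by blast
  then show ?case by (intro bexI[of _ "c \<odot>\<^bsub>WW\<^esub> Z"]) (simp_all add: lin_smult[OF lin_sigma])
qed

section \<open>Injectivity\<close>

text \<open>The block of a generator is read off from the absolute value of its first index, and
  \<open>sh l\<close> is undone for the first block. Letters that are not generators act as
  0.\<close>

definition op :: "int \<times> int \<Rightarrow> (alg, alg) tensor \<Rightarrow> (alg, alg) tensor" where
  "op g Z = (if g \<in> A_gens (s + l) n then
      if int l < \<bar>fst g\<bar> then LX (tbar s n (if fst g < 0 then fst g + int l else fst g - int l) (snd g)) Z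
      else YY (tbar l n (fst g) (snd g)) Z
    else \<zero>\<^bsub>WW\<^esub>)"

lemma op_big: "\<alpha> \<in> idx s \<Longrightarrow> a \<in> idx n \<Longrightarrow> op (sh l \<alpha>, a) Z = LX (tbar s n \<alpha> a) Z"
  using sh_idx[of \<alpha> s l "s + l"] by (auto simp: op_def sh_def idx_def)

lemma op_small: "\<beta> \<in> idx l \<Longrightarrow> b \<in> idx n \<Longrightarrow> op (sh 0 \<beta>, b) Z = YY (tbar l n \<beta> b) Z"
  using sh_idx[of \<beta> l 0 "s + l"] by (auto simp: op_def sh_def idx_def)

lemma idx_split:
  assumes "\<gamma> \<in> idx (s + l)" obtains \<alpha> where "\<alpha> \<in> idx s" "\<gamma> = sh l \<alpha>" | \<beta> where "\<beta> \<in> idx l" "\<gamma> = sh 0 \<beta>"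
proof (cases "int l < \<bar>\<gamma>\<bar>")
  case True
  then show thesis using assms
    by (intro that(1)[of "if \<gamma> < 0 then \<gamma> + int l else \<gamma> - int l"]) (auto simp: idx_def sh_def)
next
  case False
  then show thesis using assms by (intro that(2)[of \<gamma>]) (auto simp: idx_def sh_def)
qed

sublocale R: opspace WW op
proof
  fix g
  show "lin WW WW (op g)"
  proof (cases "g \<in> A_gens (s + l) n")
    case True
    then obtain \<gamma> c where g: "g = (\<gamma>, c)" "\<gamma> \<in> idx (s + l)" "c \<in> idx n" by (auto simp: A_gens_def)
    show ?thesis
    proof (cases rule: idx_split[OF g(2)])
      case (1 \<alpha>)
      have "op g = LX (tbar s n \<alpha> c)" using op_big[of \<alpha> c] 1 g by (intro ext) simp
      then show ?thesis using lin_LX[of "tbar s n \<alpha> c"] 1 g by simp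
    next
      case (2 \<beta>)
      have "op g = YY (tbar l n \<beta> c)" using op_small[of \<beta> c] 2 g by (intro ext) simp
      then show ?thesis using lin_YY[of "tbar l n \<beta> c"] 2 g by simp
    qed
  qed (simp add: op_def[abs_def] lin_const_zero W.T.vspace_axioms)
qed

text \<open>Polynomials in the first block act through their class in the small algebra;
  \<open>LX_LX\<close> is the module law behind it.\<close>

lemma act_shift_l: "f \<in> polys (A_gens s n) \<Longrightarrow> Z \<in> carrier WW \<Longrightarrow> R.act (shift l f) Z = LX (S.Q.pr f) Z"
proof (induct f arbitrary: Z rule: polys_induct)
  case one
  then show ?case by (simp add: shift_def S.one_pr[symmetric] LX_one)
next
  case (gen g f)
  then obtain \<alpha> a where g: "g = (\<alpha>, a)" "\<alpha> \<in> idx s" "a \<in> idx n" by (auto simp: A_gens_def)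
  have t: "tbar s n \<alpha> a \<in> carrier (Abar s n)" using g by simp
  show ?case
    using gen g t by (simp add: shift_def subst_mult R.act_mult op_big S.mult_pr[symmetric] polys_gen S.tbar_pr LX_LX)
next
  case (add f g)
  then show ?case
    by (simp add: shift_def subst_add R.act_add S.Q.add_squot[symmetric] lin_add[OF lin_LX_param])
next
  case (scal f c)
  then show ?case
    by (simp add: shift_def subst_mult R.act_scal S.smult_pr[symmetric] lin_smult[OF lin_LX_param])
qed

lemma act_shift_0: "f \<in> polys (A_gens l n) \<Longrightarrow> Z \<in> carrier WW \<Longrightarrow> R.act (shift 0 f) Z = YY (L.Q.pr f) Z"
proof (induct f arbitrary: Z rule: polys_induct)
  case one
  then show ?case by (simp add: shift_def L.one_pr[symmetric] YY_one)
next
  case (gen g f)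
  then obtain \<beta> b where g: "g = (\<beta>, b)" "\<beta> \<in> idx l" "b \<in> idx n" by (auto simp: A_gens_def)
  have t: "tbar l n \<beta> b \<in> carrier (Abar l n)" using g by simp
  show ?case
    using gen g t by (simp add: shift_def subst_mult R.act_mult op_small L.mult_pr[symmetric] polys_gen L.tbar_pr YY_YY)
next
  case (add f g)
  then show ?case
    by (simp add: shift_def subst_add R.act_add L.Q.add_squot[symmetric] lin_add[OF lin_YY_param])
next
  case (scal f c)
  then show ?case
    by (simp add: shift_def subst_mult R.act_scal L.smult_pr[symmetric] lin_smult[OF lin_YY_param])
qed

lemma zero_op: "Z \<in> carrier WW \<Longrightarrow> LX \<zero>\<^bsub>Abar s n\<^esub> Z = \<zero>\<^bsub>WW\<^esub>" "Z \<in> carrier WW \<Longrightarrow> YY \<zero>\<^bsub>Abar l n\<^esub> Z = \<zero>\<^bsub>WW\<^esub>"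
  using lin_zero[OF AS.vspace_axioms W.T.vspace_axioms lin_LX_param] lin_zero[OF AL.vspace_axioms W.T.vspace_axioms lin_YY_param]
  by auto

text \<open>The class of a relation in its small algebra is 0, so relations inside a block act as 0
  whatever their form.\<close>

lemma shift_rels_ker:
  "r \<in> A_rels s n \<Longrightarrow> shift l r \<in> R.ker" "r \<in> A_rels l n \<Longrightarrow> shift 0 r \<in> R.ker"
proof -
  assume r: "r \<in> A_rels s n"
  have "r \<in> polys (A_gens s n)" by (rule subsetD[OF S.S_polys r])
  moreover have "S.Q.pr r = \<zero>\<^bsub>Abar s n\<^esub>" unfolding S.Q.pr_zero_iff by (rule subsetD[OF S.S_I r])
  ultimately show "shift l r \<in> R.ker" by (simp add: R.ker_def act_shift_l zero_op)
next
  assume r: "r \<in> A_rels l n"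
  have "r \<in> polys (A_gens l n)" by (rule subsetD[OF L.S_polys r])
  moreover have "L.Q.pr r = \<zero>\<^bsub>Abar l n\<^esub>" unfolding L.Q.pr_zero_iff by (rule subsetD[OF L.S_I r])
  ultimately show "shift 0 r \<in> R.ker" by (simp add: R.ker_def act_shift_0 zero_op)
qed

text \<open>\<open>YY_LX\<close> applied to two generators, with \<Theta> given by its explicit
  formula, has the same terms as \<open>brel\<close>.\<close>

lemma brel_ker:
  assumes g: "\<alpha> \<in> {- int s..-1}" "\<beta> \<in> {- int l..-1}" "a \<in> idx n" "b \<in> idx n"
  shows "brel (\<lambda>a. gen (sh l \<alpha>, a)) (\<lambda>b. gen (sh 0 \<beta>, b)) a b \<in> R.ker"
  unfolding R.ker_def
proof (intro CollectI ballI)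
  fix Z assume Z: "Z \<in> carrier WW"
  let ?f = "tlift WW (\<lambda>x1 y1. LX x1 (YY y1 Z))"
  have ts: "tbar s n \<alpha> c \<in> carrier (Abar s n)" if "c \<in> idx n" for c using neg_idx[OF g(1)] that by simp
  have tl: "tbar l n \<beta> c \<in> carrier (Abar l n)" if "c \<in> idx n" for c using neg_idx[OF g(2)] that by simp
  have bil: "bilin (Abar s n) (Abar l n) WW (\<lambda>x1 y1. LX x1 (YY y1 Z))"
    by (rule bilinI; rule lin_LX_param lin_comp[OF lin_LX lin_YY_param]) (use Z in auto)
  have xy: "R.act (gen (sh l \<alpha>, c) * gen (sh 0 \<beta>, d)) Z = LX (tbar s n \<alpha> c) (YY (tbar l n \<beta> d) Z)"
    and f: "?f (tp (tbar s n \<alpha> c) (tbar l n \<beta> d)) = LX (tbar s n \<alpha> c) (YY (tbar l n \<beta> d) Z)"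
    if "c \<in> idx n" "d \<in> idx n" for c d
    using that Z ts tl neg_idx[OF g(1)] neg_idx[OF g(2)]
    by (simp_all add: R.act_mult op_big op_small W.tlift_tpure[OF W.T.vspace_axioms bil])
  have 1: "R.act (gen (sh 0 \<beta>, b) * gen (sh l \<alpha>, a)) Z = ?f (\<Theta> (tv (tbar l n \<beta> b) (tbar s n \<alpha> a)))"
    using g(3,4) Z ts tl neg_idx[OF g(1)] neg_idx[OF g(2)] by (simp add: R.act_mult op_big op_small YY_LX)
  note lf = W.lin_tlift[OF W.T.vspace_axioms bil]
  have T: "\<Theta> (tv (tbar l n \<beta> b) (tbar s n \<alpha> a)) \<in> carrier WW" using ts tl g(3,4) by simp
  have uminus: "- a \<in> idx n" "- b \<in> idx n" using g(3,4) by simp_all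
  have "R.act (brel (\<lambda>a. gen (sh l \<alpha>, a)) (\<lambda>b. gen (sh 0 \<beta>, b)) a b) Z
      = R.act (gen (sh 0 \<beta>, b) * gen (sh l \<alpha>, a)) Z \<ominus>\<^bsub>WW\<^esub> ?f (\<Theta> (tv (tbar l n \<beta> b) (tbar s n \<alpha> a)))"
    unfolding lin_Theta_gen[OF W.T.vspace_axioms lf g] brel_eq
    by (simp only: R.act_diff[OF Z] R.act_add[OF Z] R.act_scal[OF Z] xy f g(3,4) uminus)
  also have "\<dots> = \<zero>\<^bsub>WW\<^esub>"
    unfolding 1 a_minus_def by (rule W.T.r_neg[OF lin_closed[OF lf T]])
  finally show "R.act (brel (\<lambda>a. gen (sh l \<alpha>, a)) (\<lambda>b. gen (sh 0 \<beta>, b)) a b) Z = \<zero>\<^bsub>WW\<^esub>" .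
qed

text \<open>A relation with columns from one block only is the shift of a relation of a small
  algebra. One with columns from both blocks is handled by \<open>arel_cross\<close>, which leaves
  only \<open>brel_ker\<close>.\<close>

lemma rels_ker: "A_rels (s + l) n \<subseteq> R.ker"
proof
  fix r assume r: "r \<in> A_rels (s + l) n"
  note K = R.two_sided_ker
  have sym: "gen (\<gamma>, b) - (-1) ^ (par \<gamma> + par b) * gen (- \<gamma>, - b) \<in> R.ker"
    if h: "\<gamma> \<in> idx (s + l)" "b \<in> idx n" for \<gamma> b
  proof (cases rule: idx_split[OF h(1)])
    case (1 \<alpha>)
    have "gen (\<alpha>, b) - (-1) ^ (par \<alpha> + par b) * gen (- \<alpha>, - b) \<in> A_rels s n"
      unfolding A_rels_eq using 1 h by blast
    from shift_rels_ker(1)[OF this] show ?thesis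
      using 1 idx_nz[OF 1(1)] by (simp add: shift_def subst_diff subst_mult)
  next
    case (2 \<beta>)
    have "gen (\<beta>, b) - (-1) ^ (par \<beta> + par b) * gen (- \<beta>, - b) \<in> A_rels l n"
      unfolding A_rels_eq using 2 h by blast
    from shift_rels_ker(2)[OF this] show ?thesis
      using 2 idx_nz[OF 2(1)] by (simp add: shift_def subst_diff subst_mult)
  qed
  have T_neg: "Tfree b \<gamma> - gen (\<gamma>, b) \<in> R.ker" if "\<gamma> < 0" for b \<gamma>
    using that two_sidedD(1)[OF K] by (simp add: Tfree_def par_def)
  \<comment> \<open>Since \<open>par (- \<gamma>) = 0\<close>, the sign in \<open>Tfree\<close> and
    the sign in the reflection relation are both (-1) to the power \<open>par b\<close>, and they
    cancel.\<close>
  have T_pos: "Tfree b (- \<gamma>) - gen (\<gamma>, - b) \<in> R.ker" if "\<gamma> < 0" "\<gamma> \<in> idx (s + l)" "b \<in> idx n" for b \<gamma>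
  proof -
    have "(-1) ^ par b * (gen (- \<gamma>, b) - (-1) ^ (par (- \<gamma>) + par b) * gen (\<gamma>, - b)) \<in> R.ker"
      using sym[of "- \<gamma>" b] that by (intro two_sidedD(3)[OF K]) simp
    moreover have p: "par (- \<gamma>) = 0" using that by (simp add: par_def)
    moreover have "Tfree b (- \<gamma>) = (-1) ^ par b * gen (- \<gamma>, b)"
      using par_cases[of b] p by (auto simp: Tfree_def)
    ultimately show ?thesis
      by (simp add: right_diff_distrib mult.assoc[symmetric] power_add[symmetric])
  qed
  have cross: "arel Tfree i m k p \<in> R.ker"
    if ik: "i \<in> idx n" "k \<in> idx n" and ab: "\<alpha> \<in> idx s" "\<beta> \<in> idx l"
      and mp: "m = sh l \<alpha> \<and> p = sh 0 \<beta> \<or> m = sh 0 \<beta> \<and> p = sh l \<alpha>" for i k m p \<alpha> \<beta>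
  proof -
    \<comment> \<open>Both columns are replaced by their negative representatives, since
      \<open>arel_cross\<close> starts from negative indices and allows either sign for
      \<open>m\<close> and \<open>p\<close>.\<close>
    define \<alpha>' \<beta>' where "\<alpha>' = - \<bar>\<alpha>\<bar>" and "\<beta>' = - \<bar>\<beta>\<bar>"
    have r: "\<alpha>' \<in> {- int s..-1}" "\<beta>' \<in> {- int l..-1}" using ab by (auto simp: \<alpha>'_def \<beta>'_def idx_def)
    have neg: "sh 0 \<beta>' < 0" "sh l \<alpha>' < sh 0 \<beta>'" using r by (auto simp: sh_def)
    have ix: "sh 0 \<beta>' \<in> idx (s + l)" "sh l \<alpha>' \<in> idx (s + l)" using r by (auto simp: sh_def idx_def)
    have "m \<in> {sh l \<alpha>', - sh l \<alpha>'} \<and> p \<in> {sh 0 \<beta>', - sh 0 \<beta>'} \<or> m \<in> {sh 0 \<beta>', - sh 0 \<beta>'} \<and> p \<in> {sh l \<alpha>', - sh l \<alpha>'}"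
    proof -
      have "sh l \<alpha> = sh l \<alpha>' \<or> sh l \<alpha> = - sh l \<alpha>'" "sh 0 \<beta> = sh 0 \<beta>' \<or> sh 0 \<beta> = - sh 0 \<beta>'"
        using idx_nz[OF ab(1)] idx_nz[OF ab(2)] by (auto simp: \<alpha>'_def \<beta>'_def sh_def abs_if)
      then show ?thesis using mp by auto
    qed
    then show ?thesis
      using neg ix ik
      by (intro arel_cross[OF K neg ik, where x = "\<lambda>a. gen (sh l \<alpha>', a)" and y = "\<lambda>b. gen (sh 0 \<beta>', b)"]
          T_neg T_pos brel_ker r) auto
  qed
  show "r \<in> R.ker"
    using r unfolding A_rels_eq
  proof (elim UnE CollectE exE conjE)
    fix \<gamma> b assume "r = gen (\<gamma>, b) - (-1) ^ (par \<gamma> + par b) * gen (- \<gamma>, - b)" "\<gamma> \<in> idx (s + l)" "b \<in> idx n"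
    then show ?thesis using sym by simp
  next
    fix i m k p
    assume r: "r = arel Tfree i m k p" and ik: "i \<in> idx n" "k \<in> idx n" and mp: "m \<in> idx (s + l)" "p \<in> idx (s + l)"
    show ?thesis
    proof (cases rule: idx_split[OF mp(1)])
      case m: (1 \<alpha>)
      show ?thesis
      proof (cases rule: idx_split[OF mp(2)])
        case p: (1 \<alpha>')
        have "arel Tfree i \<alpha> k \<alpha>' \<in> A_rels s n" unfolding A_rels_eq using ik m p by blast
        from shift_rels_ker(1)[OF this] show ?thesis
          using m p by (simp add: r shift_arel idx_nz)
      next
        case p: (2 \<beta>)
        show ?thesis unfolding r by (rule cross[OF ik m(1) p(1)]) (use m p in simp)
      qed
    next
      case m: (2 \<beta>)
      show ?thesis
      proof (cases rule: idx_split[OF mp(2)])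
        case p: (1 \<alpha>)
        show ?thesis unfolding r by (rule cross[OF ik p(1) m(1)]) (use m p in simp)
      next
        case p: (2 \<beta>')
        have "arel Tfree i \<beta> k \<beta>' \<in> A_rels l n" unfolding A_rels_eq using ik m p by blast
        from shift_rels_ker(2)[OF this] show ?thesis
          using m p by (simp add: r shift_arel idx_nz)
      qed
    qed
  qed
qed

text \<open>One polynomial does two things: its class is the image of Z, and acting on 1 \<otimes> 1
  it gives back Z. Equal images then force a difference in the ideal, which acts as 0. For x
  \<otimes> y the second block acts first and produces 1 \<otimes> y.\<close>

lemma sigma_act:
  assumes "Z \<in> carrier WW"
  shows "\<exists>f\<in>polys (A_gens (s + l) n). \<sigma> Z = M.Q.pr f \<and> R.act f (tp \<one>\<^bsub>Abar s n\<^esub> \<one>\<^bsub>Abar l n\<^esub>) = Z"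
  using assms
proof (induct Z rule: W.tens_induct)
  case (tpure x y)
  obtain f where f: "f \<in> polys (A_gens s n)" "x = S.Q.pr f" using tpure(1) by (rule S.pres_cases)
  obtain g where g: "g \<in> polys (A_gens l n)" "y = L.Q.pr g" using tpure(2) by (rule L.pres_cases)
  have p: "shift l f \<in> polys (A_gens (s + l) n)" "shift 0 g \<in> polys (A_gens (s + l) n)"
    using f g by (auto intro!: shift_polys[of l s] shift_polys[of 0 l])
  have "R.act (shift l f * shift 0 g) (tp \<one>\<^bsub>Abar s n\<^esub> \<one>\<^bsub>Abar l n\<^esub>) = LX x (YY y (tp \<one>\<^bsub>Abar s n\<^esub> \<one>\<^bsub>Abar l n\<^esub>))"
    using f g tpure by (simp add: R.act_mult act_shift_l act_shift_0)
  also have "\<dots> = tp x y" using tpure by (simp add: YY_tp Theta_one RY_tp LX_tp)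
  finally have "R.act (shift l f * shift 0 g) (tp \<one>\<^bsub>Abar s n\<^esub> \<one>\<^bsub>Abar l n\<^esub>) = tp x y" .
  moreover have "\<sigma> (tp x y) = M.Q.pr (shift l f * shift 0 g)"
    using f g p tpure by (simp add: il_pr i0_pr M.mult_pr)
  ultimately show ?case using p polys_mult by blast
next
  case (add Z W)
  then obtain f g where "f \<in> polys (A_gens (s + l) n)" "\<sigma> Z = M.Q.pr f" "R.act f (tp \<one>\<^bsub>Abar s n\<^esub> \<one>\<^bsub>Abar l n\<^esub>) = Z"
    "g \<in> polys (A_gens (s + l) n)" "\<sigma> W = M.Q.pr g" "R.act g (tp \<one>\<^bsub>Abar s n\<^esub> \<one>\<^bsub>Abar l n\<^esub>) = W" by blast
  then show ?case using add(1,2)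
    by (intro bexI[of _ "f + g"]) (simp_all add: lin_add[OF lin_sigma] M.Q.add_squot R.act_add polys_add)
qed

lemma sigma_bij: "bij_betw \<sigma> (carrier WW) (carrier BB)"
proof (rule bij_betwI')
  fix Z Z' assume Z: "Z \<in> carrier WW" "Z' \<in> carrier WW"
  obtain f where f: "\<sigma> Z = M.Q.pr f" "R.act f (tp \<one>\<^bsub>Abar s n\<^esub> \<one>\<^bsub>Abar l n\<^esub>) = Z" using sigma_act[OF Z(1)] by blast
  obtain f' where f': "\<sigma> Z' = M.Q.pr f'" "R.act f' (tp \<one>\<^bsub>Abar s n\<^esub> \<one>\<^bsub>Abar l n\<^esub>) = Z'" using sigma_act[OF Z(2)] by blast
  show "(\<sigma> Z = \<sigma> Z') = (Z = Z')"
  proof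
    assume "\<sigma> Z = \<sigma> Z'"
    then have "f - f' \<in> R.ker" using M.I_least[OF R.two_sided_ker rels_ker] f f' by (auto simp: M.Q.pr_eq_iff)
    then have "R.act f (tp \<one>\<^bsub>Abar s n\<^esub> \<one>\<^bsub>Abar l n\<^esub>) = R.act f' (tp \<one>\<^bsub>Abar s n\<^esub> \<one>\<^bsub>Abar l n\<^esub>)"
      by (rule R.act_cong_ker) simp
    then show "Z = Z'" using f f' by simp
  qed simp
qed (use sigma_surj in auto)

end

section \<open>Equivariance and transport to the braided tensor product\<close>

section \<open>Equivariance\<close>

lemma even_linear_lin: "even_linear V W f \<Longrightarrow> lin V W f"
  by (simp add: even_linear_def lin_def)

lemma even_linear_hcomp:
  assumes V: "superspc V" and W: "superspc W" and f: "even_linear V W f" and p: "p \<in> {0, 1}" and x: "x \<in> carrier V"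
  shows "f (hcomp V p x) = hcomp W p (f x)"
proof -
  interpret V: superspc V by fact
  interpret W: superspc W by fact
  obtain a b where ab: "a \<in> part V 0" "b \<in> part V 1" "x = a \<oplus>\<^bsub>V\<^esub> b" using x by (rule V.decomp)
  have c: "a \<in> carrier V" "b \<in> carrier V" using ab V.part_closed by auto
  have "f a \<in> part W 0" "f b \<in> part W 1" using f ab by (auto simp: even_linear_def)
  moreover have "f x = f a \<oplus>\<^bsub>W\<^esub> f b" using lin_add[OF even_linear_lin[OF f] c] ab by simp
  ultimately show ?thesis using p V.hcomp_eq[OF ab] W.hcomp_eq[of "f a" "f b" "f x"] by auto
qed

locale phi = abar s n + uq n for s n :: nat +
  fixes \<Phi> :: "alg \<Rightarrow> alg \<Rightarrow> alg"
  assumes is_Phi: "is_Phi s n \<Phi>"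
begin

lemma smsa: "supermodule_superalgebra (Uq n) (comult n) (counit n) (Abar s n) \<Phi>"
  using is_Phi by (simp add: is_Phi_def)

lemma superalgebra_A: "superalgebra (Abar s n)"
  using smsa by (simp add: supermodule_superalgebra_def)

sublocale A: salg "Abar s n"
  by (rule salgI[OF superalgebra_A])

lemma supermodule_A: "supermodule (Uq n) (Abar s n) \<Phi>"
  using smsa by (simp add: supermodule_superalgebra_def)

lemma lin_Phi: "u \<in> carrier (Uq n) \<Longrightarrow> lin (Abar s n) (Abar s n) (\<Phi> u)"
  using supermodule_A by (auto simp: supermodule_def lin_def)

lemma lin_Phi_left: "x \<in> carrier (Abar s n) \<Longrightarrow> lin (Uq n) (Abar s n) (\<lambda>u. \<Phi> u x)"
  using supermodule_A by (auto simp: supermodule_def lin_def)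

lemma Phi_closed [simp, intro]: "u \<in> carrier (Uq n) \<Longrightarrow> x \<in> carrier (Abar s n) \<Longrightarrow> \<Phi> u x \<in> carrier (Abar s n)"
  by (rule lin_closed[OF lin_Phi])

lemma Phi_mult: "u \<in> carrier (Uq n) \<Longrightarrow> u' \<in> carrier (Uq n) \<Longrightarrow> x \<in> carrier (Abar s n) \<Longrightarrow>
    \<Phi> (u \<otimes>\<^bsub>Uq n\<^esub> u') x = \<Phi> u (\<Phi> u' x)"
  and Phi_one: "x \<in> carrier (Abar s n) \<Longrightarrow> \<Phi> \<one>\<^bsub>Uq n\<^esub> x = x"
  using supermodule_A by (auto simp: supermodule_def)

lemma Phi_prod: "u \<in> carrier (Uq n) \<Longrightarrow> a \<in> carrier (Abar s n) \<Longrightarrow> b \<in> carrier (Abar s n) \<Longrightarrow>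
   \<Phi> u (a \<otimes>\<^bsub>Abar s n\<^esub> b) = tlift (Abar s n) (\<lambda>u1 u2. koszul_sum (Abar s n) (\<lambda>p r.
          \<Phi> u1 (hcomp (Abar s n) r a) \<otimes>\<^bsub>Abar s n\<^esub> \<Phi> (hcomp (Uq n) p u2) b)) (comult n u)"
  and Phi_unit: "u \<in> carrier (Uq n) \<Longrightarrow> \<Phi> u \<one>\<^bsub>Abar s n\<^esub> = counit n u \<odot>\<^bsub>Abar s n\<^esub> \<one>\<^bsub>Abar s n\<^esub>"
  using smsa by (auto simp: supermodule_superalgebra_def)

text \<open>For negative \<alpha> the sign in \<open>Tbar\<close> is trivial, and the Koszul sign in
  the definition of the action is its own inverse.\<close>

lemma Phi_gen:
  assumes "a \<in> idx n" "b \<in> idx n" "c \<in> idx n" "\<alpha> \<in> {- int s..-1}"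
  shows "\<Phi> (Lq n a b) (tbar s n \<alpha> c) = ((-1) ^ ((par a + par b) * (par c + 1))) \<odot>\<^bsub>Abar s n\<^esub>
    (\<Oplus>\<^bsub>Abar s n\<^esub>j\<in>idx n. Smat_inv n c j a b \<odot>\<^bsub>Abar s n\<^esub> tbar s n \<alpha> j)"
proof -
  have \<alpha>: "\<alpha> \<in> idx s" "par \<alpha> = 1" using assms by (auto simp: idx_def par_def)
  have T: "Tbar s n j \<alpha> = tbar s n \<alpha> j" if "j \<in> idx n" for j
    using \<alpha> that par_cases[of j] by (auto simp: Tbar_def)
  let ?e = "(-1) ^ ((par a + par b) * (par c + 1)) :: cq"
  have cl: "\<Phi> (Lq n a b) (tbar s n \<alpha> c) \<in> carrier (Abar s n)" using assms \<alpha> Lq_closed by simp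
  have "?e \<odot>\<^bsub>Abar s n\<^esub> \<Phi> (Lq n a b) (Tbar s n c \<alpha>) = (\<Oplus>\<^bsub>Abar s n\<^esub>j\<in>idx n. Smat_inv n c j a b \<odot>\<^bsub>Abar s n\<^esub> Tbar s n j \<alpha>)"
    using is_Phi assms(1-3) \<alpha> unfolding is_Phi_def by force
  also have "\<dots> = (\<Oplus>\<^bsub>Abar s n\<^esub>j\<in>idx n. Smat_inv n c j a b \<odot>\<^bsub>Abar s n\<^esub> tbar s n \<alpha> j)"
    by (rule A.finsum_cong') (use \<alpha> in \<open>auto simp: T\<close>)
  finally have "?e \<odot>\<^bsub>Abar s n\<^esub> (?e \<odot>\<^bsub>Abar s n\<^esub> \<Phi> (Lq n a b) (tbar s n \<alpha> c))
      = ?e \<odot>\<^bsub>Abar s n\<^esub> (\<Oplus>\<^bsub>Abar s n\<^esub>j\<in>idx n. Smat_inv n c j a b \<odot>\<^bsub>Abar s n\<^esub> tbar s n \<alpha> j)"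
    by (simp add: T assms(3))
  moreover have "?e * ?e = 1" by (simp add: power_add[symmetric])
  ultimately show ?thesis using cl by simp
qed

end

text \<open>The action on a generator changes only its second index, with coefficients from the
  inverse of \<open>S\<close> for size \<open>n\<close>, whereas \<open>iota\<close> changes only
  the first. Products are then treated by the product formula, which both algebras satisfy with the
  same comultiplication.\<close>

lemma iota_equivariant:
  assumes P: "is_Phi s n \<Phi>" and P': "is_Phi m n \<Phi>'" and ks: "k + s \<le> m"
    and u: "u \<in> carrier (Uq n)" and x: "x \<in> carrier (Abar s n)"
  shows "iota k m s n (\<Phi> u x) = \<Phi>' u (iota k m s n x)"
proof -
  interpret S: phi s n \<Phi> by unfold_locales (rule P)
  interpret M: phi m n \<Phi>' by unfold_locales (rule P')
  let ?i = "iota k m s n"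
  have hom: "superalg_hom (Abar s n) (Abar m n) ?i"
    by (rule iota_shift(1)[OF ks M.superalgebra_A])
  note i = superalg_homD[OF hom]
  have ev: "even_linear (Abar s n) (Abar m n) ?i" using hom by (simp add: superalg_hom_def)
  have it: "?i (tbar s n \<alpha> a) = tbar m n (\<alpha> - int k) a" "\<alpha> \<in> idx s" "\<alpha> - int k \<in> {- int m..-1}" "\<alpha> - int k \<in> idx m"
    if "\<alpha> \<in> {- int s..-1}" "a \<in> idx n" for \<alpha> a
  proof -
    show \<alpha>: "\<alpha> \<in> idx s" "\<alpha> - int k \<in> {- int m..-1}" "\<alpha> - int k \<in> idx m" using that ks by (auto simp: idx_def)
    show "?i (tbar s n \<alpha> a) = tbar m n (\<alpha> - int k) a"
      using iota_shift(2)[OF ks M.superalgebra_A polys_gen[of "(\<alpha>, a)"]] that \<alpha>(1)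
      by (simp add: A_free_def A_ideal_def S.tbar_pr M.tbar_pr shift_def sh_def)
  qed
  \<comment> \<open>Right induction on \<open>u\<close>: the factor \<open>L\<close> acts first and
    keeps the generator in the span of those with the same \<alpha>, where the hypothesis for the
    remaining \<open>u\<close> applies.\<close>
  have gen: "\<forall>\<alpha>\<in>{- int s..-1}. \<forall>c\<in>idx n. ?i (\<Phi> u (tbar s n \<alpha> c)) = \<Phi>' u (?i (tbar s n \<alpha> c))"
    if "u \<in> carrier (Uq n)" for u
    using that
  proof (induct u rule: S.U.P_induct_right)
    case one
    show ?case by (simp add: S.Phi_one M.Phi_one it i)
  next
    case (gen g u)
    show ?case
    proof (intro ballI)
      fix \<alpha> c assume \<alpha>: "\<alpha> \<in> {- int s..-1}" "c \<in> idx n"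
      obtain a b where g: "g = (a, b)" "a \<in> idx n" "b \<in> idx n" "a \<le> b" using gen(1) by (auto simp: U_gens_def)
      have L: "S.U.Q.pr (gen g) = Lq n a b" using g by (simp add: S.Lq_pr Lfree_def)
      let ?e = "(-1) ^ ((par a + par b) * (par c + 1)) :: cq"
      have t: "tbar s n \<alpha> j \<in> carrier (Abar s n)" "tbar m n (\<alpha> - int k) j \<in> carrier (Abar m n)" if "j \<in> idx n" for j
        using it[OF \<alpha>(1) that] that by simp_all
      have l: "lin (Abar s n) (Abar m n) (\<lambda>x. ?i (\<Phi> u x))" by (rule lin_comp[OF i(1) S.lin_Phi[OF gen(2)]])
      have "?i (\<Phi> (u \<otimes>\<^bsub>Uq n\<^esub> Lq n a b) (tbar s n \<alpha> c)) = ?i (\<Phi> u (\<Phi> (Lq n a b) (tbar s n \<alpha> c)))"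
        using gen(2) g \<alpha> t S.Lq_closed by (simp add: S.Phi_mult)
      also have "\<dots> = ?e \<odot>\<^bsub>Abar m n\<^esub> (\<Oplus>\<^bsub>Abar m n\<^esub>j\<in>idx n. Smat_inv n c j a b \<odot>\<^bsub>Abar m n\<^esub> ?i (\<Phi> u (tbar s n \<alpha> j)))"
      proof -
        have "?i (\<Phi> u (\<Phi> (Lq n a b) (tbar s n \<alpha> c)))
          = ?e \<odot>\<^bsub>Abar m n\<^esub> ?i (\<Phi> u (\<Oplus>\<^bsub>Abar s n\<^esub>j\<in>idx n. Smat_inv n c j a b \<odot>\<^bsub>Abar s n\<^esub> tbar s n \<alpha> j))"
          unfolding S.Phi_gen[OF g(2,3) \<alpha>(2,1)]
          by (rule lin_smult[OF l]) (use t in \<open>auto intro!: S.A.finsum_closed\<close>)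
        also have "?i (\<Phi> u (\<Oplus>\<^bsub>Abar s n\<^esub>j\<in>idx n. Smat_inv n c j a b \<odot>\<^bsub>Abar s n\<^esub> tbar s n \<alpha> j))
          = (\<Oplus>\<^bsub>Abar m n\<^esub>j\<in>idx n. ?i (\<Phi> u (Smat_inv n c j a b \<odot>\<^bsub>Abar s n\<^esub> tbar s n \<alpha> j)))"
          by (rule lin_finsum[OF S.A.vspace_axioms M.A.vspace_axioms l]) (use t in auto)
        also have "\<dots> = (\<Oplus>\<^bsub>Abar m n\<^esub>j\<in>idx n. Smat_inv n c j a b \<odot>\<^bsub>Abar m n\<^esub> ?i (\<Phi> u (tbar s n \<alpha> j)))"
          by (rule M.A.finsum_cong') (use t gen(2) i(2) in \<open>auto simp: lin_smult[OF l]\<close>)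
        finally show ?thesis .
      qed
      also have "\<dots> = ?e \<odot>\<^bsub>Abar m n\<^esub> (\<Oplus>\<^bsub>Abar m n\<^esub>j\<in>idx n. Smat_inv n c j a b \<odot>\<^bsub>Abar m n\<^esub> \<Phi>' u (tbar m n (\<alpha> - int k) j))"
      proof (rule arg_cong[where f = "\<lambda>z. ?e \<odot>\<^bsub>Abar m n\<^esub> z"], rule M.A.finsum_cong')
        fix j assume j: "j \<in> idx n"
        show "Smat_inv n c j a b \<odot>\<^bsub>Abar m n\<^esub> ?i (\<Phi> u (tbar s n \<alpha> j))
            = Smat_inv n c j a b \<odot>\<^bsub>Abar m n\<^esub> \<Phi>' u (tbar m n (\<alpha> - int k) j)"
          using gen(3) \<alpha>(1) j it(1)[OF \<alpha>(1) j] by simp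
      qed (use gen(2) t in auto)
      also have "\<dots> = \<Phi>' u (\<Phi>' (Lq n a b) (tbar m n (\<alpha> - int k) c))"
      proof -
        note l' = M.lin_Phi[OF gen(2)]
        have "\<Phi>' u (\<Phi>' (Lq n a b) (tbar m n (\<alpha> - int k) c))
          = ?e \<odot>\<^bsub>Abar m n\<^esub> \<Phi>' u (\<Oplus>\<^bsub>Abar m n\<^esub>j\<in>idx n. Smat_inv n c j a b \<odot>\<^bsub>Abar m n\<^esub> tbar m n (\<alpha> - int k) j)"
          unfolding M.Phi_gen[OF g(2,3) \<alpha>(2) it(3)[OF \<alpha>]]
          by (rule lin_smult[OF l']) (use t in \<open>auto intro!: M.A.finsum_closed\<close>)
        also have "\<Phi>' u (\<Oplus>\<^bsub>Abar m n\<^esub>j\<in>idx n. Smat_inv n c j a b \<odot>\<^bsub>Abar m n\<^esub> tbar m n (\<alpha> - int k) j)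
          = (\<Oplus>\<^bsub>Abar m n\<^esub>j\<in>idx n. \<Phi>' u (Smat_inv n c j a b \<odot>\<^bsub>Abar m n\<^esub> tbar m n (\<alpha> - int k) j))"
          by (rule lin_finsum[OF M.A.vspace_axioms M.A.vspace_axioms l']) (use t in auto)
        also have "\<dots> = (\<Oplus>\<^bsub>Abar m n\<^esub>j\<in>idx n. Smat_inv n c j a b \<odot>\<^bsub>Abar m n\<^esub> \<Phi>' u (tbar m n (\<alpha> - int k) j))"
          by (rule M.A.finsum_cong') (use t gen(2) in \<open>auto simp: lin_smult[OF l']\<close>)
        finally show ?thesis ..
      qed
      also have "\<dots> = \<Phi>' (u \<otimes>\<^bsub>Uq n\<^esub> Lq n a b) (?i (tbar s n \<alpha> c))"
        using gen(2) g \<alpha> t S.Lq_closed by (simp add: M.Phi_mult it)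
      finally show "?i (\<Phi> (u \<otimes>\<^bsub>Uq n\<^esub> S.U.Q.pr (gen g)) (tbar s n \<alpha> c))
          = \<Phi>' (u \<otimes>\<^bsub>Uq n\<^esub> S.U.Q.pr (gen g)) (?i (tbar s n \<alpha> c))" by (simp only: L)
    qed
  next
    case (add u u')
    then show ?case using it
      by (simp add: lin_add[OF S.lin_Phi_left] lin_add[OF M.lin_Phi_left] lin_add[OF i(1)])
  next
    case (smult u c)
    then show ?case using it
      by (simp add: lin_smult[OF S.lin_Phi_left] lin_smult[OF M.lin_Phi_left] lin_smult[OF i(1)])
  qed
  \<comment> \<open>All \<open>u\<close> at once, because the product formula lets components of
    tensor factors of the comultiplication act on the remaining factor.\<close>
  have "\<forall>u\<in>carrier (Uq n). ?i (\<Phi> u x) = \<Phi>' u (?i x)"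
    using x
  proof (induct x rule: S.A_induct)
    case one
    show ?case using lin_smult[OF i(1)] by (simp add: S.Phi_unit M.Phi_unit i)
  next
    case (gen \<alpha> a x)
    let ?t = "tbar s n \<alpha> a"
    have t: "?t \<in> carrier (Abar s n)" using gen it by simp
    have tp: "?t \<in> part (Abar s n) (gpar (\<alpha>, a) mod 2)"
    proof -
      have "gen (\<alpha>, a) \<in> part S.F (gpar (\<alpha>, a) mod 2)"
        using gen(1,2) it(2)[OF gen(1,2)] by (simp add: free_superalg_def gen_def)
      then show ?thesis using S.Q.part_squot by (auto simp: S.tbar_pr)
    qed
    \<comment> \<open>Generators are homogeneous, so a component of \<open>?t\<close> is
      \<open>?t\<close> or 0, and the claim for generators covers it.\<close>
    have h: "?i (\<Phi> u1 (hcomp (Abar s n) r ?t)) = \<Phi>' u1 (hcomp (Abar m n) r (?i ?t))"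
      if r: "r \<in> {0, 1}" and u1: "u1 \<in> carrier (Uq n)" for r u1
    proof -
      have "hcomp (Abar s n) r ?t = (if r = gpar (\<alpha>, a) mod 2 then ?t else \<zero>\<^bsub>Abar s n\<^esub>)"
        by (rule S.A.hcomp_hom[OF r _ tp]) auto
      moreover have "?i (\<Phi> u1 \<zero>\<^bsub>Abar s n\<^esub>) = \<Phi>' u1 (?i \<zero>\<^bsub>Abar s n\<^esub>)"
        using lin_zero[OF S.A.vspace_axioms M.A.vspace_axioms i(1)] lin_zero[OF S.A.vspace_axioms S.A.vspace_axioms S.lin_Phi[OF u1]]
          lin_zero[OF M.A.vspace_axioms M.A.vspace_axioms M.lin_Phi[OF u1]] by simp
      ultimately have "?i (\<Phi> u1 (hcomp (Abar s n) r ?t)) = \<Phi>' u1 (?i (hcomp (Abar s n) r ?t))"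
        using assms(3) gen(1,2) \<open>u1 \<in> carrier (Uq n)\<close> \<open>\<And>u. u \<in> carrier (Uq n) \<Longrightarrow> \<forall>\<alpha>\<in>{- int s..-1}. \<forall>c\<in>idx n. ?i (\<Phi> u (tbar s n \<alpha> c)) = \<Phi>' u (?i (tbar s n \<alpha> c))\<close>
        by auto
      then show ?thesis
        using even_linear_hcomp[OF S.A.superspc_axioms M.A.superspc_axioms ev r t] by simp
    qed
    show ?case
    proof
      fix u assume u: "u \<in> carrier (Uq n)"
      note D = S.comult_closed[OF u]
      have cl: "\<Phi> u1 (hcomp (Abar s n) r ?t) \<otimes>\<^bsub>Abar s n\<^esub> \<Phi> (hcomp (Uq n) p u2) x \<in> carrier (Abar s n)"
        if "u1 \<in> carrier (Uq n)" "u2 \<in> carrier (Uq n)" "p \<in> {0, 1}" "r \<in> {0, 1}" for u1 u2 p r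
        using that t gen(3) S.TT.A.hcomp_closed S.A.hcomp_closed by auto
      have cl': "\<Phi>' u1 (hcomp (Abar m n) r (?i ?t)) \<otimes>\<^bsub>Abar m n\<^esub> \<Phi>' (hcomp (Uq n) p u2) (?i x) \<in> carrier (Abar m n)"
        if "u1 \<in> carrier (Uq n)" "u2 \<in> carrier (Uq n)" "p \<in> {0, 1}" "r \<in> {0, 1}" for u1 u2 p r
        using that t gen(3) i(2) S.TT.A.hcomp_closed M.A.hcomp_closed by auto
      have "?i (\<Phi> u (?t \<otimes>\<^bsub>Abar s n\<^esub> x)) = tlift (Abar m n) (\<lambda>u1 u2. ?i (koszul_sum (Abar s n) (\<lambda>p r.
          \<Phi> u1 (hcomp (Abar s n) r ?t) \<otimes>\<^bsub>Abar s n\<^esub> \<Phi> (hcomp (Uq n) p u2) x))) (comult n u)"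
        unfolding S.Phi_prod[OF u t gen(3)]
        by (rule S.TT.lin_comp_tlift[OF S.A.vspace_axioms M.A.vspace_axioms i(1) D])
           (rule koszul_sum_closed[OF S.A.vspace_axioms], rule cl)
      also have "\<dots> = tlift (Abar m n) (\<lambda>u1 u2. koszul_sum (Abar m n) (\<lambda>p r.
          \<Phi>' u1 (hcomp (Abar m n) r (?i ?t)) \<otimes>\<^bsub>Abar m n\<^esub> \<Phi>' (hcomp (Uq n) p u2) (?i x))) (comult n u)"
      proof (rule S.TT.tlift_cong[OF M.A.vspace_axioms D])
        fix u1 u2 assume uu: "u1 \<in> carrier (Uq n)" "u2 \<in> carrier (Uq n)"
        show "koszul_sum (Abar m n) (\<lambda>p r. \<Phi>' u1 (hcomp (Abar m n) r (?i ?t)) \<otimes>\<^bsub>Abar m n\<^esub> \<Phi>' (hcomp (Uq n) p u2) (?i x)) \<in> carrier (Abar m n)"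
          by (rule koszul_sum_closed[OF M.A.vspace_axioms], rule cl'[OF uu])
        have "?i (koszul_sum (Abar s n) (\<lambda>p r. \<Phi> u1 (hcomp (Abar s n) r ?t) \<otimes>\<^bsub>Abar s n\<^esub> \<Phi> (hcomp (Uq n) p u2) x))
          = koszul_sum (Abar m n) (\<lambda>p r. ?i (\<Phi> u1 (hcomp (Abar s n) r ?t) \<otimes>\<^bsub>Abar s n\<^esub> \<Phi> (hcomp (Uq n) p u2) x))"
          by (rule lin_koszul_sum[OF S.A.vspace_axioms M.A.vspace_axioms i(1)], rule cl[OF uu])
        also have "\<dots> = koszul_sum (Abar m n) (\<lambda>p r. \<Phi>' u1 (hcomp (Abar m n) r (?i ?t)) \<otimes>\<^bsub>Abar m n\<^esub> \<Phi>' (hcomp (Uq n) p u2) (?i x))"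
        proof (rule koszul_sum_cong[OF _ M.A.vspace_axioms])
          fix p r :: nat assume pr: "p \<in> {0, 1}" "r \<in> {0, 1}"
          show "?i (\<Phi> u1 (hcomp (Abar s n) r ?t) \<otimes>\<^bsub>Abar s n\<^esub> \<Phi> (hcomp (Uq n) p u2) x)
            = \<Phi>' u1 (hcomp (Abar m n) r (?i ?t)) \<otimes>\<^bsub>Abar m n\<^esub> \<Phi>' (hcomp (Uq n) p u2) (?i x)"
            using pr uu gen(3,4) t S.TT.A.hcomp_closed S.A.hcomp_closed by (simp add: i(3) h)
        qed (rule cl'[OF uu])
        finally show "?i (koszul_sum (Abar s n) (\<lambda>p r. \<Phi> u1 (hcomp (Abar s n) r ?t) \<otimes>\<^bsub>Abar s n\<^esub> \<Phi> (hcomp (Uq n) p u2) x))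
          = koszul_sum (Abar m n) (\<lambda>p r. \<Phi>' u1 (hcomp (Abar m n) r (?i ?t)) \<otimes>\<^bsub>Abar m n\<^esub> \<Phi>' (hcomp (Uq n) p u2) (?i x))" .
      qed
      also have "\<dots> = \<Phi>' u (?i (?t \<otimes>\<^bsub>Abar s n\<^esub> x))"
        using t gen(3) u by (simp add: i M.Phi_prod)
      finally show "?i (\<Phi> u (?t \<otimes>\<^bsub>Abar s n\<^esub> x)) = \<Phi>' u (?i (?t \<otimes>\<^bsub>Abar s n\<^esub> x))" .
    qed
  next
    case (add x y)
    then show ?case by (simp add: lin_add[OF S.lin_Phi] lin_add[OF M.lin_Phi] lin_add[OF i(1)] i(2))
  next
    case (smult x c)
    then show ?case by (simp add: lin_smult[OF S.lin_Phi] lin_smult[OF M.lin_Phi] lin_smult[OF i(1)] i(2))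
  qed
  then show ?thesis using u by blast
qed

section \<open>Transport of structure\<close>

text \<open>Each axiom is an equation or a membership in a part. Equations are tested after applying
  the injective \<open>f\<close>, and parity is reflected by \<open>f\<close>. Uniqueness of
  components in \<open>V\<close> also comes from \<open>B\<close>, so a mere existence statement is
  assumed for them.\<close>

lemma transport_supermodule_superalgebra:
  assumes U: "salg U" and \<Delta>: "\<And>u. u \<in> carrier U \<Longrightarrow> \<Delta> u \<in> carrier (tens_space U U)"
    and B: "supermodule_superalgebra U \<Delta> \<epsilon> B actB"
    and V: "vspace V" and sub: "\<And>p. p \<in> {0, 1} \<Longrightarrow> submodule (part V p) base_field V"
    and decomp: "\<And>x. x \<in> carrier V \<Longrightarrow> \<exists>a\<in>part V 0. \<exists>b\<in>part V 1. x = a \<oplus>\<^bsub>V\<^esub> b"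
    and mult_cl: "\<And>x y. x \<in> carrier V \<Longrightarrow> y \<in> carrier V \<Longrightarrow> x \<otimes>\<^bsub>V\<^esub> y \<in> carrier V"
    and one_cl: "\<one>\<^bsub>V\<^esub> \<in> carrier V"
    and act_cl: "\<And>u x. u \<in> carrier U \<Longrightarrow> x \<in> carrier V \<Longrightarrow> actV u x \<in> carrier V"
    and bij: "bij_betw f (carrier V) (carrier B)" and ev: "even_linear V B f"
    and f_mult: "\<And>x y. x \<in> carrier V \<Longrightarrow> y \<in> carrier V \<Longrightarrow> f (x \<otimes>\<^bsub>V\<^esub> y) = f x \<otimes>\<^bsub>B\<^esub> f y"
    and f_one: "f \<one>\<^bsub>V\<^esub> = \<one>\<^bsub>B\<^esub>"
    and f_act: "\<And>u x. u \<in> carrier U \<Longrightarrow> x \<in> carrier V \<Longrightarrow> f (actV u x) = actB u (f x)"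
  shows "supermodule_superalgebra_iso U \<Delta> \<epsilon> V actV B actB f"
proof -
  have Bsa: "superalgebra B" and Bsm: "supermodule U B actB" using B by (simp_all add: supermodule_superalgebra_def)
  interpret U: salg U by fact
  interpret V: vspace V by fact
  interpret B: salg B by (rule salgI[OF Bsa])
  interpret UU: tens U U ..
  note lin = even_linear_lin[OF ev]
  note fc [simp] = lin_closed[OF lin] and fa = lin_add[OF lin] and fs = lin_smult[OF lin]
  note fz = lin_zero[OF V.vspace_axioms B.vspace_axioms lin]
  have f_part: "f x \<in> part B p" if "p \<in> {0, 1}" "x \<in> part V p" for p x
    using ev that by (auto simp: even_linear_def)
  have eqI: "x = y" if "f x = f y" "x \<in> carrier V" "y \<in> carrier V" for x y
    using bij that by (auto simp: bij_betw_def inj_on_def)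
  have pc: "x \<in> carrier V" if "p \<in> {0, 1}" "x \<in> part V p" for p x
    using module.submoduleE(1)[OF V.module_base sub[OF that(1)]] that(2) by blast
  have ex1: "\<exists>!yz. yz \<in> part V 0 \<times> part V 1 \<and> x = fst yz \<oplus>\<^bsub>V\<^esub> snd yz" if x: "x \<in> carrier V" for x
  proof (rule ex_ex1I)
    show "\<exists>yz. yz \<in> part V 0 \<times> part V 1 \<and> x = fst yz \<oplus>\<^bsub>V\<^esub> snd yz" using decomp[OF x] by force
  next
    fix yz yz' assume h: "yz \<in> part V 0 \<times> part V 1 \<and> x = fst yz \<oplus>\<^bsub>V\<^esub> snd yz"
      "yz' \<in> part V 0 \<times> part V 1 \<and> x = fst yz' \<oplus>\<^bsub>V\<^esub> snd yz'"
    then have p: "fst yz \<in> part V 0" "snd yz \<in> part V 1" "fst yz' \<in> part V 0" "snd yz' \<in> part V 1" by auto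
    have c: "fst yz \<in> carrier V" "snd yz \<in> carrier V" "fst yz' \<in> carrier V" "snd yz' \<in> carrier V"
      using p pc by auto
    have "f (fst yz) \<oplus>\<^bsub>B\<^esub> f (snd yz) = f (fst yz') \<oplus>\<^bsub>B\<^esub> f (snd yz')"
      using h c by (metis fa)
    then have "f (fst yz) = f (fst yz') \<and> f (snd yz) = f (snd yz')"
      by (intro B.part_unique f_part p) auto
    then show "yz = yz'" using c by (intro prod_eqI eqI) auto
  qed
  have ss: "superspace V"
    unfolding superspace_def by (intro conjI ballI V.module_base sub ex1) simp_all
  interpret V: superspc V by (rule superspcI[OF ss])
  \<comment> \<open>An even map commutes with taking components. Thus \<open>f\<close> sends
    \<open>x\<close> and its component of parity \<open>p\<close> to the same element, and
    injectivity identifies them.\<close>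
  have reflect: "x \<in> part V p" if p: "p \<in> {0, 1}" and x: "x \<in> carrier V" "f x \<in> part B p" for p x
  proof -
    have h: "f (hcomp V r x) = (if r = p then f x else \<zero>\<^bsub>B\<^esub>)" if "r \<in> {0, 1}" for r
      using even_linear_hcomp[OF V.superspc_axioms B.superspc_axioms ev that x(1)] B.hcomp_hom[OF that p x(2)] by simp
    have "hcomp V p x = x" by (rule eqI) (use h[OF p] p x in auto)
    then show ?thesis using V.hcomp_part[OF p x(1)] by simp
  qed
  have Vsa: "superalgebra V"
  proof -
    have "ring V"
      by (intro ringI V.abelian_group_axioms monoidI)
         (auto intro!: eqI simp: mult_cl one_cl f_mult f_one fa B.mult_assoc B.add_mult B.mult_add)
    moreover have "(c \<odot>\<^bsub>V\<^esub> x) \<otimes>\<^bsub>V\<^esub> y = c \<odot>\<^bsub>V\<^esub> (x \<otimes>\<^bsub>V\<^esub> y)" "x \<otimes>\<^bsub>V\<^esub> (c \<odot>\<^bsub>V\<^esub> y) = c \<odot>\<^bsub>V\<^esub> (x \<otimes>\<^bsub>V\<^esub> y)"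
      if "x \<in> carrier V" "y \<in> carrier V" for c x y
      using that by (auto intro!: eqI simp: mult_cl f_mult fs B.smult_mult_left B.smult_mult_right)
    moreover have "\<one>\<^bsub>V\<^esub> \<in> part V 0" by (rule reflect) (simp_all add: one_cl f_one)
    moreover have "x \<otimes>\<^bsub>V\<^esub> y \<in> part V ((p + r) mod 2)"
      if "p \<in> {0, 1}" "r \<in> {0, 1}" "x \<in> part V p" "y \<in> part V r" for p r x y
    proof (rule reflect)
      show "(p + r) mod 2 \<in> {0, 1}" by auto
      show "x \<otimes>\<^bsub>V\<^esub> y \<in> carrier V" using that pc by (auto intro!: mult_cl)
      show "f (x \<otimes>\<^bsub>V\<^esub> y) \<in> part B ((p + r) mod 2)"
        using B.mult_part[OF that(1,2) f_part[OF that(1,3)] f_part[OF that(2,4)]] that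
        by (simp add: f_mult pc[OF that(1,3)] pc[OF that(2,4)])
    qed
    ultimately show ?thesis unfolding superalgebra_def using ss by (intro conjI ballI allI) assumption+
  qed
  note Bm = Bsm[unfolded supermodule_def]
  have aB:
    "\<And>u m m'. u \<in> carrier U \<Longrightarrow> m \<in> carrier B \<Longrightarrow> m' \<in> carrier B \<Longrightarrow> actB u (m \<oplus>\<^bsub>B\<^esub> m') = actB u m \<oplus>\<^bsub>B\<^esub> actB u m'"
    "\<And>u u' m. u \<in> carrier U \<Longrightarrow> u' \<in> carrier U \<Longrightarrow> m \<in> carrier B \<Longrightarrow> actB (u \<oplus>\<^bsub>U\<^esub> u') m = actB u m \<oplus>\<^bsub>B\<^esub> actB u' m"
    "\<And>u c m. u \<in> carrier U \<Longrightarrow> m \<in> carrier B \<Longrightarrow> actB u (c \<odot>\<^bsub>B\<^esub> m) = c \<odot>\<^bsub>B\<^esub> actB u m"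
    "\<And>u c m. u \<in> carrier U \<Longrightarrow> m \<in> carrier B \<Longrightarrow> actB (c \<odot>\<^bsub>U\<^esub> u) m = c \<odot>\<^bsub>B\<^esub> actB u m"
    "\<And>u u' m. u \<in> carrier U \<Longrightarrow> u' \<in> carrier U \<Longrightarrow> m \<in> carrier B \<Longrightarrow> actB (u \<otimes>\<^bsub>U\<^esub> u') m = actB u (actB u' m)"
    "\<And>m. m \<in> carrier B \<Longrightarrow> actB \<one>\<^bsub>U\<^esub> m = m"
    using Bm by simp_all
  have aB_part: "actB u m \<in> part B ((p + r) mod 2)"
    if "p \<in> {0, 1}" "r \<in> {0, 1}" "u \<in> part U p" "m \<in> part B r" for p r u m
    using Bm that by blast
  have Vsm: "supermodule U V actV"
    unfolding supermodule_def
  proof (intro conjI ballI allI)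
    show "superspace V" by (rule ss)
  next
    fix u m m' assume "u \<in> carrier U" "m \<in> carrier V" "m' \<in> carrier V"
    then show "actV u (m \<oplus>\<^bsub>V\<^esub> m') = actV u m \<oplus>\<^bsub>V\<^esub> actV u m'"
      by (intro eqI) (simp_all add: act_cl f_act fa aB)
  next
    fix u u' m assume "u \<in> carrier U" "u' \<in> carrier U" "m \<in> carrier V"
    then show "actV (u \<oplus>\<^bsub>U\<^esub> u') m = actV u m \<oplus>\<^bsub>V\<^esub> actV u' m" "actV (u \<otimes>\<^bsub>U\<^esub> u') m = actV u (actV u' m)"
      by (intro eqI; simp add: act_cl f_act fa aB)+
  next
    fix c u m assume "u \<in> carrier U" "m \<in> carrier V"
    then show "actV u (c \<odot>\<^bsub>V\<^esub> m) = c \<odot>\<^bsub>V\<^esub> actV u m" "actV (c \<odot>\<^bsub>U\<^esub> u) m = c \<odot>\<^bsub>V\<^esub> actV u m"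
      by (intro eqI; simp add: act_cl f_act fs aB)+
  next
    fix m assume "m \<in> carrier V"
    then show "actV \<one>\<^bsub>U\<^esub> m = m" by (intro eqI) (simp_all add: act_cl f_act aB)
  next
    fix p r :: nat and u m
    assume h: "p \<in> {0, 1}" "r \<in> {0, 1}" "u \<in> part U p" "m \<in> part V r"
    have c: "u \<in> carrier U" "m \<in> carrier V" by (rule U.part_closed[OF h(1,3)], rule pc[OF h(2,4)])
    show "actV u m \<in> part V ((p + r) mod 2)"
    proof (rule reflect)
      show "(p + r) mod 2 \<in> {0, 1}" by auto
      show "f (actV u m) \<in> part B ((p + r) mod 2)"
        unfolding f_act[OF c] by (rule aB_part[OF h(1-3) f_part[OF h(2,4)]])
    qed (rule act_cl[OF c])
  qed (rule act_cl)
  have prod: "actV u (a \<otimes>\<^bsub>V\<^esub> b) = tlift V (\<lambda>u1 u2. koszul_sum V (\<lambda>p r.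
        actV u1 (hcomp V r a) \<otimes>\<^bsub>V\<^esub> actV (hcomp U p u2) b)) (\<Delta> u)"
    if u: "u \<in> carrier U" and ab: "a \<in> carrier V" "b \<in> carrier V" for u a b
  proof (rule eqI)
    note D = \<Delta>[OF u]
    have cl: "actV u1 (hcomp V r a) \<otimes>\<^bsub>V\<^esub> actV (hcomp U p u2) b \<in> carrier V"
      if "u1 \<in> carrier U" "u2 \<in> carrier U" "p \<in> {0, 1}" "r \<in> {0, 1}" for u1 u2 p r
      by (intro mult_cl act_cl U.hcomp_closed V.hcomp_closed that ab)
    have k: "koszul_sum V (\<lambda>p r. actV u1 (hcomp V r a) \<otimes>\<^bsub>V\<^esub> actV (hcomp U p u2) b) \<in> carrier V"
      if "u1 \<in> carrier U" "u2 \<in> carrier U" for u1 u2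
      by (rule koszul_sum_closed[OF V.vspace_axioms], rule cl[OF that])
    have f_term: "f (actV u1 (hcomp V r a) \<otimes>\<^bsub>V\<^esub> actV (hcomp U p u2) b)
        = actB u1 (hcomp B r (f a)) \<otimes>\<^bsub>B\<^esub> actB (hcomp U p u2) (f b)"
      if "u1 \<in> carrier U" "u2 \<in> carrier U" "p \<in> {0, 1}" "r \<in> {0, 1}" for u1 u2 p r
      using that U.hcomp_closed[OF that(3,2)] V.hcomp_closed[OF that(4) ab(1)] ab
        even_linear_hcomp[OF V.superspc_axioms B.superspc_axioms ev that(4) ab(1)]
      by (simp add: f_mult act_cl f_act)
    have f_k: "f (koszul_sum V (\<lambda>p r. actV u1 (hcomp V r a) \<otimes>\<^bsub>V\<^esub> actV (hcomp U p u2) b))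
        = koszul_sum B (\<lambda>p r. actB u1 (hcomp B r (f a)) \<otimes>\<^bsub>B\<^esub> actB (hcomp U p u2) (f b))"
      if uu: "u1 \<in> carrier U" "u2 \<in> carrier U" for u1 u2
    proof -
      have "f (koszul_sum V (\<lambda>p r. actV u1 (hcomp V r a) \<otimes>\<^bsub>V\<^esub> actV (hcomp U p u2) b))
        = koszul_sum B (\<lambda>p r. f (actV u1 (hcomp V r a) \<otimes>\<^bsub>V\<^esub> actV (hcomp U p u2) b))"
        by (rule lin_koszul_sum[OF V.vspace_axioms B.vspace_axioms lin], rule cl[OF uu])
      also have "\<dots> = koszul_sum B (\<lambda>p r. actB u1 (hcomp B r (f a)) \<otimes>\<^bsub>B\<^esub> actB (hcomp U p u2) (f b))"
        by (rule koszul_sum_cong[OF f_term[OF uu] B.vspace_axioms])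
           (simp_all only: f_term[OF uu, symmetric] fc cl[OF uu])
      finally show ?thesis .
    qed
    have "f (actV u (a \<otimes>\<^bsub>V\<^esub> b)) = actB u (f a \<otimes>\<^bsub>B\<^esub> f b)"
      using u ab by (simp add: f_act mult_cl f_mult)
    also have "\<dots> = tlift B (\<lambda>u1 u2. koszul_sum B (\<lambda>p r.
        actB u1 (hcomp B r (f a)) \<otimes>\<^bsub>B\<^esub> actB (hcomp U p u2) (f b))) (\<Delta> u)"
      using B u fc[OF ab(1)] fc[OF ab(2)] unfolding supermodule_superalgebra_def by blast
    also have "\<dots> = tlift B (\<lambda>u1 u2. f (koszul_sum V (\<lambda>p r.
        actV u1 (hcomp V r a) \<otimes>\<^bsub>V\<^esub> actV (hcomp U p u2) b))) (\<Delta> u)"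
      by (rule UU.tlift_cong[OF B.vspace_axioms D]) (simp_all only: f_k[symmetric] fc k)
    also have "\<dots> = f (tlift V (\<lambda>u1 u2. koszul_sum V (\<lambda>p r.
        actV u1 (hcomp V r a) \<otimes>\<^bsub>V\<^esub> actV (hcomp U p u2) b)) (\<Delta> u))"
      by (rule UU.lin_comp_tlift[OF V.vspace_axioms B.vspace_axioms lin D k, symmetric])
    finally show "f (actV u (a \<otimes>\<^bsub>V\<^esub> b)) = f (tlift V (\<lambda>u1 u2. koszul_sum V (\<lambda>p r.
        actV u1 (hcomp V r a) \<otimes>\<^bsub>V\<^esub> actV (hcomp U p u2) b)) (\<Delta> u))" .
    show "actV u (a \<otimes>\<^bsub>V\<^esub> b) \<in> carrier V" by (intro act_cl mult_cl u ab)
    show "tlift V (\<lambda>u1 u2. koszul_sum V (\<lambda>p r.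
        actV u1 (hcomp V r a) \<otimes>\<^bsub>V\<^esub> actV (hcomp U p u2) b)) (\<Delta> u) \<in> carrier V"
      by (rule UU.tlift_closed[OF V.vspace_axioms k D])
  qed
  have unit: "actV u \<one>\<^bsub>V\<^esub> = \<epsilon> u \<odot>\<^bsub>V\<^esub> \<one>\<^bsub>V\<^esub>" if u: "u \<in> carrier U" for u
  proof (rule eqI)
    have "actB u \<one>\<^bsub>B\<^esub> = \<epsilon> u \<odot>\<^bsub>B\<^esub> \<one>\<^bsub>B\<^esub>" using B u by (simp add: supermodule_superalgebra_def)
    then show "f (actV u \<one>\<^bsub>V\<^esub>) = f (\<epsilon> u \<odot>\<^bsub>V\<^esub> \<one>\<^bsub>V\<^esub>)" using u by (simp add: f_act one_cl fs f_one)
  qed (use u in \<open>simp_all add: act_cl one_cl\<close>)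
  have "f \<in> ring_hom V B"
    by (rule ring_hom_memI) (simp_all add: f_mult fa f_one)
  then show ?thesis
    unfolding supermodule_superalgebra_iso_def supermodule_superalgebra_def[of U \<Delta> \<epsilon> V] superalg_hom_def supermodule_hom_def
    by (intro conjI ballI Vsa Vsm prod unit B ev bij f_act)
qed

section \<open>The main theorem\<close>

lemma braided_simps [simp]:
  "carrier (braided A B \<Theta>) = carrier (tens_space A B)" "add (braided A B \<Theta>) = add (tens_space A B)"
  "zero (braided A B \<Theta>) = zero (tens_space A B)" "module.smult (braided A B \<Theta>) = module.smult (tens_space A B)"
  "part (braided A B \<Theta>) = part (tens_space A B)" "one (braided A B \<Theta>) = tpure A B \<one>\<^bsub>A\<^esub> \<one>\<^bsub>B\<^esub>"
  by (simp_all add: braided_def)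

context braid
begin

lemma braided_mult:
  "Z \<otimes>\<^bsub>braided (Abar s n) (Abar l n) \<Theta>\<^esub> Z' = tlift WW (\<lambda>x y. tlift WW (\<lambda>x' y'.
     tlift WW (\<lambda>x'' y''. tp (x \<otimes>\<^bsub>Abar s n\<^esub> x'') (y'' \<otimes>\<^bsub>Abar l n\<^esub> y')) (\<Theta> (tv y x'))) Z') Z"
  by (simp add: braided_def)

lemma braided_mult_closed:
  "Z \<in> carrier WW \<Longrightarrow> Z' \<in> carrier WW \<Longrightarrow> Z \<otimes>\<^bsub>braided (Abar s n) (Abar l n) \<Theta>\<^esub> Z' \<in> carrier WW"
  unfolding braided_mult by (intro W.tlift_closed W.T.vspace_axioms) auto

text \<open>The braided product is three nested \<open>tlift\<close>s. Each of them evaluates a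
  fixed representative, so the linear map sigma passes through one after another; at the core
  \<open>product_Theta\<close> replaces the braided middle by the product of \<open>i0 y\<close> and
  \<open>il x'\<close>.\<close>

lemma sigma_mult:
  assumes Z: "Z \<in> carrier WW" "Z' \<in> carrier WW"
  shows "\<sigma> (Z \<otimes>\<^bsub>braided (Abar s n) (Abar l n) \<Theta>\<^esub> Z') = \<sigma> Z \<otimes>\<^bsub>BB\<^esub> \<sigma> Z'"
proof -
  let ?m3 = "\<lambda>x y x' y'. tlift WW (\<lambda>x'' y''. tp (x \<otimes>\<^bsub>Abar s n\<^esub> x'') (y'' \<otimes>\<^bsub>Abar l n\<^esub> y')) (\<Theta> (tv y x'))"
  note WT = W.T.vspace_axioms and BV = B.vspace_axioms
  have c3: "?m3 x y x' y' \<in> carrier WW"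
    if "x \<in> carrier (Abar s n)" "y \<in> carrier (Abar l n)" "x' \<in> carrier (Abar s n)" "y' \<in> carrier (Abar l n)" for x y x' y'
    by (rule W.tlift_closed[OF WT]) (use that in auto)
  have 3: "\<sigma> (?m3 x y x' y') = (il x \<otimes>\<^bsub>BB\<^esub> i0 y) \<otimes>\<^bsub>BB\<^esub> (il x' \<otimes>\<^bsub>BB\<^esub> i0 y')"
    if h: "x \<in> carrier (Abar s n)" "y \<in> carrier (Abar l n)" "x' \<in> carrier (Abar s n)" "y' \<in> carrier (Abar l n)" for x y x' y'
  proof -
    have T: "\<Theta> (tv y x') \<in> carrier WW" using h by auto
    have lr: "lin BB BB (\<lambda>z. il x \<otimes>\<^bsub>BB\<^esub> (z \<otimes>\<^bsub>BB\<^esub> i0 y'))"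
      using h by (intro lin_comp[OF B.lin_mult_left B.lin_mult_right]) (simp_all add: il i0)
    have "\<sigma> (?m3 x y x' y') = tlift BB (\<lambda>x'' y''. \<sigma> (tp (x \<otimes>\<^bsub>Abar s n\<^esub> x'') (y'' \<otimes>\<^bsub>Abar l n\<^esub> y'))) (\<Theta> (tv y x'))"
      by (rule W.lin_comp_tlift[OF WT BV lin_sigma T]) (use h in auto)
    also have "\<dots> = tlift BB (\<lambda>x'' y''. il x \<otimes>\<^bsub>BB\<^esub> ((il x'' \<otimes>\<^bsub>BB\<^esub> i0 y'') \<otimes>\<^bsub>BB\<^esub> i0 y')) (\<Theta> (tv y x'))"
      by (rule W.tlift_cong[OF BV T]) (use h in \<open>simp_all add: il i0 B.mult_assoc\<close>)
    also have "\<dots> = il x \<otimes>\<^bsub>BB\<^esub> (\<sigma> (\<Theta> (tv y x')) \<otimes>\<^bsub>BB\<^esub> i0 y')"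
      unfolding sigma_bar_def
      by (rule W.lin_comp_tlift[OF BV BV lr T, symmetric]) (simp add: il i0)
    finally show ?thesis using h by (simp add: product_Theta[symmetric] il i0 B.mult_assoc)
  qed
  have c2: "tlift WW (?m3 x y) Z' \<in> carrier WW" if "x \<in> carrier (Abar s n)" "y \<in> carrier (Abar l n)" for x y
    by (rule W.tlift_closed[OF WT c3[OF that] Z(2)])
  have 2: "\<sigma> (tlift WW (?m3 x y) Z') = (il x \<otimes>\<^bsub>BB\<^esub> i0 y) \<otimes>\<^bsub>BB\<^esub> \<sigma> Z'"
    if h: "x \<in> carrier (Abar s n)" "y \<in> carrier (Abar l n)" for x y
  proof -
    have "\<sigma> (tlift WW (?m3 x y) Z') = tlift BB (\<lambda>x' y'. \<sigma> (?m3 x y x' y')) Z'"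
      by (rule W.lin_comp_tlift[OF WT BV lin_sigma Z(2) c3[OF h]])
    also have "\<dots> = tlift BB (\<lambda>x' y'. (il x \<otimes>\<^bsub>BB\<^esub> i0 y) \<otimes>\<^bsub>BB\<^esub> (il x' \<otimes>\<^bsub>BB\<^esub> i0 y')) Z'"
      by (rule W.tlift_cong[OF BV Z(2) 3[OF h]]) (use h in \<open>simp_all add: il i0\<close>)
    also have "\<dots> = (il x \<otimes>\<^bsub>BB\<^esub> i0 y) \<otimes>\<^bsub>BB\<^esub> \<sigma> Z'"
      unfolding sigma_bar_def
      by (rule W.lin_comp_tlift[OF BV BV B.lin_mult_left Z(2), symmetric]) (use h in \<open>simp_all add: il i0\<close>)
    finally show ?thesis .
  qed
  have "\<sigma> (Z \<otimes>\<^bsub>braided (Abar s n) (Abar l n) \<Theta>\<^esub> Z') = tlift BB (\<lambda>x y. \<sigma> (tlift WW (?m3 x y) Z')) Z"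
    unfolding braided_mult by (rule W.lin_comp_tlift[OF WT BV lin_sigma Z(1) c2])
  also have "\<dots> = tlift BB (\<lambda>x y. (il x \<otimes>\<^bsub>BB\<^esub> i0 y) \<otimes>\<^bsub>BB\<^esub> \<sigma> Z') Z"
    by (rule W.tlift_cong[OF BV Z(1) 2]) (use Z in \<open>simp_all add: il i0\<close>)
  also have "\<dots> = \<sigma> Z \<otimes>\<^bsub>BB\<^esub> \<sigma> Z'"
    unfolding sigma_bar_def
    by (rule W.lin_comp_tlift[OF BV BV B.lin_mult_right[OF sigma_closed[OF Z(2), unfolded sigma_bar_def]] Z(1), symmetric])
       (simp add: il i0)
  finally show ?thesis .
qed

lemma even_linear_sigma: "even_linear (braided (Abar s n) (Abar l n) \<Theta>) BB \<sigma>"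
proof -
  have "\<sigma> Z \<in> part BB p" if "p \<in> {0, 1}" "Z \<in> part WW p" for p Z
    using that(2)
  proof (induct Z rule: W.part_tens_induct)
    case (tpure x y i j)
    have "il x \<otimes>\<^bsub>BB\<^esub> i0 y \<in> part BB ((i + j) mod 2)"
      by (rule B.mult_part[OF tpure(1,2) il(5)[OF tpure(1,3)] i0(5)[OF tpure(2,4)]])
    then show ?case using tpure AS.part_closed AL.part_closed by simp
  next
    case (add Z W)
    then show ?case using W.part_tens_carrier[of p] B.part_add[OF that(1)]
      by (simp add: lin_add[OF lin_sigma] subset_iff)
  qed (fact that(1))
  then show ?thesis using lin_sigma by (auto simp: even_linear_def lin_def)
qed

end

theorem theorem4p5:
  fixes s l n :: nat
    and \<Phi>\<^sub>s \<Phi>\<^sub>l \<Phi>\<^sub>s\<^sub>l :: "alg \<Rightarrow> alg \<Rightarrow> alg"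
    and \<Theta> :: "(alg, alg) tensor \<Rightarrow> (alg, alg) tensor"
  assumes "s \<ge> 1" and "l \<ge> 1" and "n \<ge> 1"
    and "is_Phi s n \<Phi>\<^sub>s" and "is_Phi l n \<Phi>\<^sub>l" and "is_Phi (s + l) n \<Phi>\<^sub>s\<^sub>l"
    and "is_braiding l s n \<Phi>\<^sub>l \<Phi>\<^sub>s \<Theta>"
  shows "supermodule_superalgebra_iso (Uq n) (comult n) (counit n)
     (braided (Abar s n) (Abar l n) \<Theta>)
     (tens_act (Uq n) (comult n) (Abar s n) \<Phi>\<^sub>s (Abar l n) \<Phi>\<^sub>l)
     (Abar (s + l) n) \<Phi>\<^sub>s\<^sub>l
     (sigma_bar s l n)"
proof -
  interpret PS: phi s n \<Phi>\<^sub>s by unfold_locales (rule assms)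
  interpret PL: phi l n \<Phi>\<^sub>l by unfold_locales (rule assms)
  interpret PM: phi "s + l" n \<Phi>\<^sub>s\<^sub>l by unfold_locales (rule assms)
  interpret braid s l n \<Phi>\<^sub>s \<Phi>\<^sub>l \<Theta>
    by unfold_locales (rule PS.superalgebra_A PL.superalgebra_A PM.superalgebra_A assms)+
  let ?act = "tens_act (Uq n) (comult n) (Abar s n) \<Phi>\<^sub>s (Abar l n) \<Phi>\<^sub>l"
  note WT = W.T.vspace_axioms and BV = PM.A.vspace_axioms
  have act: "?act u Z \<in> carrier WW \<and> \<sigma> (?act u Z) = \<Phi>\<^sub>s\<^sub>l u (\<sigma> Z)"
    if u: "u \<in> carrier (Uq n)" and Z: "Z \<in> carrier WW" for u Z
  proof
    note D = PS.comult_closed[OF u]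
    let ?g = "\<lambda>x y u1 u2 p r. tp (\<Phi>\<^sub>s u1 (hcomp (Abar s n) r x)) (\<Phi>\<^sub>l (hcomp (Uq n) p u2) y)"
    have cl: "?g x y u1 u2 p r \<in> carrier WW"
      if "x \<in> carrier (Abar s n)" "y \<in> carrier (Abar l n)" "u1 \<in> carrier (Uq n)" "u2 \<in> carrier (Uq n)"
        "p \<in> {0, 1}" "r \<in> {0, 1}" for x y u1 u2 p r
      by (intro W.tpure_closed PS.Phi_closed PL.Phi_closed PS.A.hcomp_closed PS.TT.A.hcomp_closed that)
    have k: "koszul_sum WW (?g x y u1 u2) \<in> carrier WW"
      if "x \<in> carrier (Abar s n)" "y \<in> carrier (Abar l n)" "u1 \<in> carrier (Uq n)" "u2 \<in> carrier (Uq n)" for x y u1 u2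
      by (rule koszul_sum_closed[OF WT], rule cl[OF that])
    have t: "tlift WW (\<lambda>u1 u2. koszul_sum WW (?g x y u1 u2)) (comult n u) \<in> carrier WW"
      if "x \<in> carrier (Abar s n)" "y \<in> carrier (Abar l n)" for x y
      by (rule PS.TT.tlift_closed[OF WT k[OF that] D])
    show "?act u Z \<in> carrier WW"
      unfolding tens_act_def by (rule W.tlift_closed[OF WT t Z])
    \<comment> \<open>The tensor product action and the product formula in the large algebra are the
      same Koszul sum over the comultiplication. The summands match one by one, by equivariance of
      the two embeddings and because the first one commutes with taking components.\<close>
    have inner: "\<sigma> (tlift WW (\<lambda>u1 u2. koszul_sum WW (?g x y u1 u2)) (comult n u)) = \<Phi>\<^sub>s\<^sub>l u (il x \<otimes>\<^bsub>BB\<^esub> i0 y)"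
      if xy: "x \<in> carrier (Abar s n)" "y \<in> carrier (Abar l n)" for x y
    proof -
      let ?h = "\<lambda>u1 u2 p r. \<Phi>\<^sub>s\<^sub>l u1 (hcomp BB r (il x)) \<otimes>\<^bsub>BB\<^esub> \<Phi>\<^sub>s\<^sub>l (hcomp (Uq n) p u2) (i0 y)"
      have gh: "\<sigma> (?g x y u1 u2 p r) = ?h u1 u2 p r"
        if uu: "u1 \<in> carrier (Uq n)" "u2 \<in> carrier (Uq n)" and pr: "p \<in> {0, 1}" "r \<in> {0, 1}" for u1 u2 p r
      proof -
        note hx = PS.A.hcomp_closed[OF pr(2) xy(1)] and hu = PS.TT.A.hcomp_closed[OF pr(1) uu(2)]
        have "il (\<Phi>\<^sub>s u1 (hcomp (Abar s n) r x)) = \<Phi>\<^sub>s\<^sub>l u1 (il (hcomp (Abar s n) r x))"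
          by (rule iota_equivariant[OF assms(4,6) _ uu(1) hx]) simp
        moreover have "i0 (\<Phi>\<^sub>l (hcomp (Uq n) p u2) y) = \<Phi>\<^sub>s\<^sub>l (hcomp (Uq n) p u2) (i0 y)"
          by (rule iota_equivariant[OF assms(5,6) _ hu xy(2)]) simp
        moreover have "il (hcomp (Abar s n) r x) = hcomp BB r (il x)"
          using hom_il by (intro even_linear_hcomp[OF PS.A.superspc_axioms PM.A.superspc_axioms _ pr(2) xy(1)])
            (simp add: superalg_hom_def)
        ultimately show ?thesis
          using PS.Phi_closed[OF uu(1) hx] PL.Phi_closed[OF hu xy(2)] by simp
      qed
      have gcl: "?h u1 u2 p r \<in> carrier BB"
        if "u1 \<in> carrier (Uq n)" "u2 \<in> carrier (Uq n)" "p \<in> {0, 1}" "r \<in> {0, 1}" for u1 u2 p r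
        unfolding gh[OF that, symmetric] by (rule sigma_closed[OF cl[OF xy that]])
      have "\<sigma> (tlift WW (\<lambda>u1 u2. koszul_sum WW (?g x y u1 u2)) (comult n u))
          = tlift BB (\<lambda>u1 u2. \<sigma> (koszul_sum WW (?g x y u1 u2))) (comult n u)"
        by (rule PS.TT.lin_comp_tlift[OF WT BV lin_sigma D k[OF xy]])
      also have "\<dots> = tlift BB (\<lambda>u1 u2. koszul_sum BB (?h u1 u2)) (comult n u)"
      proof (rule PS.TT.tlift_cong[OF BV D])
        fix u1 u2 assume uu: "u1 \<in> carrier (Uq n)" "u2 \<in> carrier (Uq n)"
        show "koszul_sum BB (?h u1 u2) \<in> carrier BB" by (rule koszul_sum_closed[OF BV], rule gcl[OF uu])
        have "\<sigma> (koszul_sum WW (?g x y u1 u2)) = koszul_sum BB (\<lambda>p r. \<sigma> (?g x y u1 u2 p r))"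
          by (rule lin_koszul_sum[OF WT BV lin_sigma], rule cl[OF xy uu])
        also have "\<dots> = koszul_sum BB (?h u1 u2)"
          by (rule koszul_sum_cong[OF gh[OF uu] BV gcl[OF uu]])
        finally show "\<sigma> (koszul_sum WW (?g x y u1 u2)) = koszul_sum BB (?h u1 u2)" .
      qed
      also have "\<dots> = \<Phi>\<^sub>s\<^sub>l u (il x \<otimes>\<^bsub>BB\<^esub> i0 y)"
        by (rule PM.Phi_prod[OF u il(2)[OF xy(1)] i0(2)[OF xy(2)], symmetric])
      finally show ?thesis .
    qed
    have "\<sigma> (?act u Z) = tlift BB (\<lambda>x y. \<sigma> (tlift WW (\<lambda>u1 u2. koszul_sum WW (?g x y u1 u2)) (comult n u))) Z"
      unfolding tens_act_def by (rule W.lin_comp_tlift[OF WT BV lin_sigma Z t])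
    also have "\<dots> = tlift BB (\<lambda>x y. \<Phi>\<^sub>s\<^sub>l u (il x \<otimes>\<^bsub>BB\<^esub> i0 y)) Z"
      by (rule W.tlift_cong[OF BV Z inner]) (simp_all add: u il i0)
    also have "\<dots> = \<Phi>\<^sub>s\<^sub>l u (\<sigma> Z)"
      unfolding sigma_bar_def
      by (rule W.lin_comp_tlift[OF BV BV PM.lin_Phi[OF u] Z, symmetric]) (simp add: il i0)
    finally show "\<sigma> (?act u Z) = \<Phi>\<^sub>s\<^sub>l u (\<sigma> Z)" .
  qed
  show ?thesis
  proof (rule transport_supermodule_superalgebra[OF PS.salg_U PS.comult_closed PM.smsa])
    show "vspace (braided (Abar s n) (Abar l n) \<Theta>)" by (rule vspace_cong[OF WT]) simp_all
    show "submodule (part (braided (Abar s n) (Abar l n) \<Theta>) p) base_field (braided (Abar s n) (Abar l n) \<Theta>)" for p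
      using W.submodule_part_tens[of p] by (simp add: submodule_def submodule_axioms_def)
    show "\<exists>a\<in>part (braided (Abar s n) (Abar l n) \<Theta>) 0. \<exists>b\<in>part (braided (Abar s n) (Abar l n) \<Theta>) 1.
        x = a \<oplus>\<^bsub>braided (Abar s n) (Abar l n) \<Theta>\<^esub> b" if "x \<in> carrier (braided (Abar s n) (Abar l n) \<Theta>)" for x
      using W.tens_decomp[of x] that by simp
    show "even_linear (braided (Abar s n) (Abar l n) \<Theta>) BB \<sigma>" by (rule even_linear_sigma)
  qed (use act in \<open>simp_all add: braided_mult_closed sigma_mult sigma_bij il i0\<close>)
qed

end
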